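(* Let $q$ be a prime power and $s>r\ge 1$. There are constants $C=C(q,s)$ and $c=c(q,s)>0$ such that for all sufficiently large $n$ the following holds: if $\theta\ge q^{-cn}$ and $J\in\partial_{s,r}\mathbb{Z}^{\mathrm{Gr}_q(n,s)}$ is $\theta$-bounded, then there is $\Phi\in\mathbb{Z}^{\mathrm{Gr}_q(n,s)}$ with $\partial_{s,r}\Phi=J$ such that $\partial_{s,r}\Phi^+$ and $\partial_{s,r}\Phi^-$ are both $C\theta$-bounded.
   Context: $\mathrm{Gr}_q(n,t)$ is the set of $t$-dimensional subspaces of $\mathbb{F}_q^n$. For $t>u$, $\partial_{t,u}\colon\mathbb{Z}^{\mathrm{Gr}_q(n,t)}\to\mathbb{Z}^{\mathrm{Gr}_q(n,u)}$ is the linear map $e_T\mapsto\sum_{U\leqslant T,\ \dim U=u}e_U$. For a vector $\Phi$, $\Phi^+$ and $\Phi^-$ denote the parts with positive and negative coefficients respectively, so $\Phi=\Phi^++\Phi^-$. A vector $\mathcal{R}\in\mathbb{Z}^{\mathrm{Gr}_q(n,r)}$ is $\theta$-bounded if $\|\partial_{r,r-1}\mathcal{R}^+\|_\infty\le\theta q^n$ and $\|\partial_{r,r-1}\mathcal{R}^-\|_\infty\le\theta q^n$. *)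

theory Defs
  imports
    "HOL-Library.Cardinality"
    "HOL-Library.Function_Algebras"
    "HOL-Number_Theory.Prime_Powers"
    Complex_Main
begin

text \<open>
  The finite field of order \<open>q\<close> is a type \<open>'a\<close> of sort \<open>{field, finite}\<close> with \<open>CARD('a) = q\<close>.
  Since the dimension \<open>n\<close> is quantified inside the theorem, the space of \<open>n\<close>-tuples is the
  subspace of \<open>nat \<Rightarrow> 'a\<close> of those functions that vanish outside \<open>{..<n}\<close>.
\<close>

definition vscale :: "'a::field \<Rightarrow> (nat \<Rightarrow> 'a) \<Rightarrow> nat \<Rightarrow> 'a" where
  "vscale a v = (\<lambda>i. a * v i)"

global_interpretation nv: vector_space "vscale :: 'a::field \<Rightarrow> (nat \<Rightarrow> 'a) \<Rightarrow> nat \<Rightarrow> 'a"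
  by unfold_locales (auto simp: vscale_def fun_eq_iff algebra_simps)

definition nspace :: "nat \<Rightarrow> (nat \<Rightarrow> 'a::field) set" where
  "nspace n = {v. \<forall>i\<ge>n. v i = 0}"

definition Gr :: "nat \<Rightarrow> nat \<Rightarrow> (nat \<Rightarrow> 'a::field) set set" where
  "Gr n t = {T. nv.subspace T \<and> T \<subseteq> nspace n \<and> nv.dim T = t}"

text \<open>
  The integer vectors indexed by \<open>Gr n t\<close> are functions on all sets of vectors
  that are zero off \<open>Gr n t\<close>.
\<close>

definition ZGr :: "nat \<Rightarrow> nat \<Rightarrow> ((nat \<Rightarrow> 'a::field) set \<Rightarrow> int) set" where
  "ZGr n t = {f. \<forall>T. T \<notin> Gr n t \<longrightarrow> f T = 0}"

definition unit_vec :: "'b \<Rightarrow> 'b \<Rightarrow> int" where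
  "unit_vec x = (\<lambda>y. if y = x then 1 else 0)"

definition boundary ::
    "nat \<Rightarrow> nat \<Rightarrow> nat \<Rightarrow> ((nat \<Rightarrow> 'a::field) set \<Rightarrow> int) \<Rightarrow> (nat \<Rightarrow> 'a) set \<Rightarrow> int" where
  "boundary n t u f =
     (\<lambda>V. \<Sum>T\<in>Gr n t. f T * (\<Sum>U\<in>{U \<in> Gr n u. U \<subseteq> T}. unit_vec U V))"

text \<open>The negative part keeps its sign, so that \<open>f = pos_part f + neg_part f\<close>.\<close>

definition pos_part :: "('b \<Rightarrow> int) \<Rightarrow> 'b \<Rightarrow> int" where
  "pos_part f = (\<lambda>x. max (f x) 0)"

definition neg_part :: "('b \<Rightarrow> int) \<Rightarrow> 'b \<Rightarrow> int" where
  "neg_part f = (\<lambda>x. min (f x) 0)"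

text \<open>
  The supremum runs over the whole type; for an element of \<open>ZGr n t\<close> this is the maximum over
  \<open>Gr n t\<close>, since the values elsewhere are zero.
\<close>

definition sup_norm :: "('b \<Rightarrow> int) \<Rightarrow> real" where
  "sup_norm f = (SUP x. \<bar>real_of_int (f x)\<bar>)"

definition bounded_vec ::
    "nat \<Rightarrow> nat \<Rightarrow> real \<Rightarrow> ((nat \<Rightarrow> 'a::{field,finite}) set \<Rightarrow> int) \<Rightarrow> bool" where
  "bounded_vec n r \<theta> R \<longleftrightarrow>
     R \<in> ZGr n r \<and>
     sup_norm (boundary n r (r - 1) (pos_part R)) \<le> \<theta> * real CARD('a) ^ n \<and>
     sup_norm (boundary n r (r - 1) (neg_part R)) \<le> \<theta> * real CARD('a) ^ n"

lemma finite_nspace: "finite (nspace n :: (nat \<Rightarrow> 'a::{field,finite}) set)"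
proof -
  have "nspace n = {f :: nat \<Rightarrow> 'a. \<forall>i. (i \<in> {..<n} \<longrightarrow> f i \<in> UNIV) \<and> (i \<notin> {..<n} \<longrightarrow> f i = 0)}"
    unfolding nspace_def by (intro Collect_cong) (metis UNIV_I lessThan_iff not_less)
  then show ?thesis
    using finite_set_of_finite_funs[of "{..<n}" "UNIV :: 'a set" 0] by simp
qed

lemma finite_Gr: "finite (Gr n t :: (nat \<Rightarrow> 'a::{field,finite}) set set)"
  by (rule finite_subset[of _ "Pow (nspace n)"]) (auto simp: Gr_def finite_nspace)

lemma boundary_apply:
  fixes f :: "(nat \<Rightarrow> 'a::{field,finite}) set \<Rightarrow> int"
  shows "boundary n t u f V = (if V \<in> Gr n u then \<Sum>T\<in>{T \<in> Gr n t. V \<subseteq> T}. f T else 0)"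
proof -
  have *: "(\<Sum>U\<in>{U \<in> Gr n u. U \<subseteq> T}. unit_vec U V) = (if V \<in> Gr n u \<and> V \<subseteq> T then 1 else 0)"
    for T
  proof -
    have "finite {U \<in> Gr n u. U \<subseteq> T}"
      by (rule finite_subset[OF _ finite_Gr[of n u]]) blast
    then show ?thesis
      unfolding unit_vec_def by (subst sum.delta') simp_all
  qed
  show ?thesis
  proof (cases "V \<in> Gr n u")
    case True
    have "boundary n t u f V = (\<Sum>T\<in>Gr n t. if V \<subseteq> T then f T else 0)"
      unfolding boundary_def * by (rule sum.cong) (simp_all add: True)
    also have "\<dots> = (\<Sum>T\<in>{T \<in> Gr n t. V \<subseteq> T}. f T)"
      by (rule sum.inter_filter[symmetric]) (rule finite_Gr)
    finally show ?thesis
      by (simp only: True if_True)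
  next
    case False
    then show ?thesis
      unfolding boundary_def * by (simp only: simp_thms if_False mult_zero_right sum.neutral_const)
  qed
qed

lemma boundary_in_ZGr: "boundary n t u (f :: (nat \<Rightarrow> 'a::{field,finite}) set \<Rightarrow> int) \<in> ZGr n u"
  unfolding ZGr_def by (auto simp only: boundary_apply if_False mem_Collect_eq)

lemma sup_norm_eq_Max:
  fixes f :: "(nat \<Rightarrow> 'a::{field,finite}) set \<Rightarrow> int"
  assumes "f \<in> ZGr n t" and "Gr n t \<noteq> ({} :: (nat \<Rightarrow> 'a) set set)"
  shows "sup_norm f = Max ((\<lambda>T. \<bar>real_of_int (f T)\<bar>) ` Gr n t)"
  unfolding sup_norm_def
proof (rule cSup_eq_maximum)
  have fin: "finite ((\<lambda>T. \<bar>real_of_int (f T)\<bar>) ` Gr n t)"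
    using finite_Gr by blast
  have "Max ((\<lambda>T. \<bar>real_of_int (f T)\<bar>) ` Gr n t) \<in> (\<lambda>T. \<bar>real_of_int (f T)\<bar>) ` Gr n t"
    using fin assms(2) by (intro Max_in) auto
  then show "Max ((\<lambda>T. \<bar>real_of_int (f T)\<bar>) ` Gr n t) \<in> range (\<lambda>T. \<bar>real_of_int (f T)\<bar>)"
    by blast
  fix y assume "y \<in> range (\<lambda>T. \<bar>real_of_int (f T)\<bar>)"
  then obtain T where y: "y = \<bar>real_of_int (f T)\<bar>" by blast
  obtain T0 :: "(nat \<Rightarrow> 'a) set" where T0: "T0 \<in> Gr n t" using assms(2) by blast
  show "y \<le> Max ((\<lambda>T. \<bar>real_of_int (f T)\<bar>) ` Gr n t)"
  proof (cases "T \<in> Gr n t")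
    case True
    then show ?thesis using fin y by (intro Max_ge) auto
  next
    case False
    then have "y \<le> \<bar>real_of_int (f T0)\<bar>" using assms(1) y by (simp add: ZGr_def)
    also have "\<dots> \<le> Max ((\<lambda>T. \<bar>real_of_int (f T)\<bar>) ` Gr n t)"
      using fin T0 by (intro Max_ge) auto
    finally show ?thesis .
  qed
qed

end

(* Proof idea. Fix a multiple m such that m e_R lies in the image of the boundary map for every
   r-space R ("decoding": a bounded combination of s-spaces around R).  First reduce J modulo m and
   cancel the reduced vector by gadgets: each R is put into an s-space S(R) all of whose other r-spaces
   lie in members of a sparse, mutually transversal family of subspaces of codimension k.  What is left
   is supported on that family, and an exactness statement (shearing an s-space by linear functionals
   and taking alternating sums) writes it as the boundary of a vector supported inside the members of
   the family.  Inside each member, a sparse set of s-spaces spans the whole image modulo m, so that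
   this vector may be replaced by one of small degree.  The remainder is divisible by m and is decoded.
   All random choices are derandomised by exponential potential functions; averages over the general
   linear group provide the degree bounds. *)
theory Submission
  imports Defs "HOL-Library.FuncSet"
begin

text \<open>Put w = r - 1 and x = q^u, where u is a small fixed fraction of n and theta >= 1/x. The
  obstacle is scale: one system of gadgets has degree of order q^n, while the answer may only have
  degree of order theta q^n. The gadgets are therefore spread over M = x^2 conjugates under the
  general linear group. Averaging brings the load of a w-space down to a constant times the degree
  of J, plus terms of order q^n / x. The price is a family that is M times as large and must stay
  transversal. The codimension k = 8u pays for it: a w-space lies in about x^4 members for each
  conjugate, a cover inside a member has degree about x q^(n-8u), and in total this is x^7 q^(n-8u)
  = q^(n-u) <= theta q^n. The exactness statement gives no control on coefficients. This is
  harmless, since its output is used only modulo m and only inside the members, where a vector with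
  coefficients in [0,m] on a sparse set replaces it. Sizes of subspaces are mostly handled as
  cardinalities q^d, which turns dimension arguments into counting.\<close>

type_synonym 'a vec = "nat => 'a"

type_synonym 'a vs = "(nat => 'a) set"

abbreviation "nsub == nv.subspace"

abbreviation "rint == real_of_int"

abbreviation lin_map :: "((nat => 'a::field) => 'a vec) => bool" where
 "lin_map \<equiv> Vector_Spaces.linear vscale vscale"

interpretation nn: vector_space_pair "vscale :: 'a::field => 'a vec => _" vscale by unfold_locales

interpretation nf: vector_space_pair "vscale :: 'a::field => 'a vec => _" "(*)" by unfold_locales (auto simp: algebra_simps)

lemma lin_map_add: "lin_map g ==> g (x + y) = g x + g y"
 and lin_map_scale: "lin_map g ==> g (vscale c x) = vscale c (g x)" by (auto simp: Vector_Spaces.linear_iff)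

lemma lin_mapI:
 "(!!x y. g (x + y) = g x + g y) ==> (!!c x. g (vscale c x) = vscale c (g x)) ==> lin_map g" using nv.vector_space_axioms by (auto simp: Vector_Spaces.linear_iff)

lemma card_field_ge2: "CARD('a::{field,finite}) >= 2"
proof -
 have "card {0, 1 :: 'a} <= CARD('a)" by (intro card_mono) auto
 then show ?thesis by simp
qed

section \<open>Linear algebra over a finite field by counting\<close>

lemma subspace_nspace: "nsub (nspace n)" by (auto simp: nv.subspace_def nspace_def vscale_def)

lemma nspace_mono: "m <= n ==> nspace m <= nspace n" by (auto simp: nspace_def)

lemma finite_sub_nspace: "T <= nspace n ==> finite (T :: 'a::{field,finite} vs)" using finite_nspace finite_subset by blast

lemma card_span_insert:
 fixes a :: "nat => 'a::{field,finite}"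
 assumes "a ~: nv.span B"
 shows "card (nv.span (insert a B)) = CARD('a) * card (nv.span B)"
proof -
 let ?f = "%(k, x). x + vscale k a"
 have inj: "inj_on ?f (UNIV \<times> nv.span B)"
 proof (rule inj_onI, clarify)
  fix k x k' x' assume x: "x : nv.span B" "x' : nv.span B" and eq: "x + vscale k a = x' + vscale k' a"
  have "vscale (k - k') a = x' - x" using eq by (simp add: nv.scale_left_diff_distrib algebra_simps)
  then have in_s: "vscale (k - k') a : nv.span B" using x nv.span_diff by metis
  have "k = k'"
  proof (rule ccontr)
  assume "k ~= k'"
  then have "a = vscale (inverse (k - k')) (vscale (k - k') a)" by simp
  then show False using in_s assms nv.span_scale by metis
  qed
  then show "k = k' & x = x'" using eq by simp
 qed
 have "nv.span (insert a B) = ?f ` (UNIV \<times> nv.span B)"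
 proof (intro set_eqI iffI)
  fix x assume "x : nv.span (insert a B)"
  then obtain k where "x - vscale k a : nv.span B" by (auto simp: nv.span_insert)
  then show "x : ?f ` (UNIV \<times> nv.span B)" by (intro image_eqI[of _ _ "(k, x - vscale k a)"]) auto
 next
  fix x assume "x : ?f ` (UNIV \<times> nv.span B)"
  then obtain k y where "y : nv.span B" "x = y + vscale k a" by auto
  then show "x : nv.span (insert a B)" by (auto simp: nv.span_insert intro!: exI[of _ k])
 qed
 then show ?thesis using inj by (simp add: card_image card_cartesian_product)
qed

lemma card_span_independent:
 fixes B :: "'a::{field,finite} vs"
 assumes "finite B" "nv.independent B"
 shows "card (nv.span B) = CARD('a) ^ card B" using assms
proof (induction B)
 case (insert b B)
 then have "b ~: nv.span B" "nv.independent B" using nv.independent_insert[of b B] by auto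
 then show ?case using insert by (simp add: card_span_insert)
qed simp

lemma basis_of:
 fixes T :: "'a::{field,finite} vs"
 assumes "nsub T" "T <= nspace n" "S <= T" "nv.independent S"
 obtains B where "S <= B" "B <= T" "finite B" "nv.independent B" "nv.span B = T"
  "card T = CARD('a) ^ card B" "nv.dim T = card B"
proof -
 obtain B where B: "S <= B" "B <= T" "nv.independent B" "T <= nv.span B" using nv.maximal_independent_subset_extend[OF assms(3,4)] by blast
 have fin: "finite B" using B(2) assms(2) finite_sub_nspace by blast
 have sp: "nv.span B = T" using B assms(1) by (simp add: nv.span_minimal subset_antisym)
 have "nv.dim T = card B" using B by (metis nv.basis_card_eq_dim)
 then show ?thesis using that B fin sp card_span_independent[OF fin B(3)] by auto
qed

lemma card_subspace:
 fixes T :: "'a::{field,finite} vs"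
 assumes "nsub T" "T <= nspace n"
 shows "card T = CARD('a) ^ nv.dim T" by (metis basis_of[OF assms, of "{}"] empty_subsetI nv.independent_empty)

lemma power_card_inj: "CARD('a::{field,finite}) ^ i = CARD('a) ^ j \<longleftrightarrow> i = j" using card_field_ge2[where 'a='a] by (simp add: power_inject_exp)

lemma nspace_Suc:
 "nspace (Suc n) = nv.span (insert (%i. if i = n then 1 else 0) (nspace n :: (nat => 'a::field) set))"
proof (intro set_eqI iffI)
 fix x :: "nat => 'a" assume "x : nspace (Suc n)"
 then have "x - vscale (x n) (%i. if i = n then 1 else 0) : nspace n" by (auto simp: nspace_def vscale_def)
 then show "x : nv.span (insert (%i. if i = n then 1 else 0) (nspace n))" unfolding nv.span_insert using nv.span_base by blast
next
 fix x :: "nat => 'a" assume x: "x : nv.span (insert (%i. if i = n then 1 else 0) (nspace n))"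
 have "nv.span (insert (%i. if i = n then 1 else 0) (nspace n)) <= (nspace (Suc n) :: 'a vs)" by (rule nv.span_minimal[OF _ subspace_nspace]) (auto simp: nspace_def)
 then show "x : nspace (Suc n)" using x by blast
qed

lemma card_nspace: "card (nspace n :: 'a::{field,finite} vs) = CARD('a) ^ n"
proof (induction n)
 case 0
 have "(nspace 0 :: 'a vs) = {%_. 0}" by (auto simp: nspace_def)
 then show ?case by simp
next
 case (Suc n)
 have sp: "nv.span (nspace n) = (nspace n :: 'a vs)" by (simp add: subspace_nspace)
 have "(%i. if i = n then 1 else 0) ~: nv.span (nspace n :: 'a vs)" unfolding sp by (auto simp: nspace_def)
 from card_span_insert[OF this] show ?case using Suc by (simp add: nspace_Suc sp)
qed

text \<open>Over a finite field the cardinality determines the dimension. Membership in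
  \<open>Gr\<close> is usually checked in this form below.\<close>

lemma Gr_iff:
 "T : Gr n t \<longleftrightarrow> nsub T & T <= nspace n & card T = CARD('a) ^ t"
 for T :: "'a::{field,finite} vs"
proof (cases "nsub T & T <= nspace n")
 case True
 then have "card T = CARD('a) ^ nv.dim T" using card_subspace by blast
 then show ?thesis using True unfolding Gr_def mem_Collect_eq by (simp only: power_card_inj)
qed (auto simp: Gr_def)

lemma GrD:
 assumes "T : Gr n t"
 shows "nsub T" "T <= nspace n" "nv.dim T = t"
  "finite (T :: 'a::{field,finite} vs)" "card T = CARD('a) ^ t"
proof -
 show "nsub T" "T <= nspace n" "nv.dim T = t" using assms by (simp_all add: Gr_def)
 show "finite T" "card T = CARD('a) ^ t" using assms finite_sub_nspace[of T n] by (simp_all add: Gr_iff)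
qed

lemma subspace_inGr:
 fixes T :: "'a::{field,finite} vs"
 shows "nsub T ==> T <= nspace n ==> T : Gr n (nv.dim T)" by (simp add: Gr_def)

lemma dim_le_of_subset:
 fixes A B :: "'a::{field,finite} vs"
 assumes "nsub A" "nsub B" "A <= B" "B <= nspace n"
 shows "nv.dim A <= nv.dim B" "nv.dim A = nv.dim B ==> A = B"
proof -
 have fin: "finite B" using assms finite_sub_nspace by blast
 have c: "card A = CARD('a) ^ nv.dim A" "card B = CARD('a) ^ nv.dim B" using card_subspace assms by (metis order_trans)+
 show "nv.dim A <= nv.dim B" using card_mono[OF fin assms(3)] card_field_ge2[where 'a='a] unfolding c by (simp add: power_le_imp_le_exp)
 show "nv.dim A = nv.dim B ==> A = B" using c card_subset_eq[OF fin assms(3)] by simp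
qed

lemma dim_nspace: "nv.dim (nspace n :: 'a::{field,finite} vs) = n" using card_subspace[OF subspace_nspace order_refl, where 'a='a, of n] power_card_inj[where 'a='a]
 by (simp add: card_nspace)

lemma dim_le_n: "nsub T ==> T <= nspace n ==> nv.dim T <= n"
 for T :: "'a::{field,finite} vs" using dim_le_of_subset(1)[OF _ subspace_nspace _ order_refl, of T n] by (simp add: dim_nspace)

definition ssum :: "(nat => 'a::field) set => 'a vs => 'a vs" where
 "ssum A B = {x + y | x y. x : A & y : B}"

lemma subspace_ssum: "nsub A ==> nsub B ==> nsub (ssum A B)" unfolding ssum_def by (rule nv.subspace_sums)

lemma ssum_upper: "nsub A ==> nsub B ==> A <= ssum A B & B <= ssum A B" unfolding ssum_def by auto (metis add.right_neutral nv.subspace_0, metis add.left_neutral nv.subspace_0)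

lemma ssum_least: "nsub C ==> A <= C ==> B <= C ==> ssum A B <= C" unfolding ssum_def using nv.subspace_add by blast

text \<open>The fibres of addition on pairs from \<open>A\<close> and \<open>B\<close> are copies of
  \<open>A Int B\<close>. This is the dimension formula in a form without subtraction.\<close>

lemma card_ssum:
 fixes A B :: "'a::{field,finite} vs"
 assumes "nsub A" "nsub B" "finite A" "finite B"
 shows "card (ssum A B) * card (A Int B) = card A * card B"
proof -
 let ?f = "%(x, y). x + y"
 have im: "ssum A B = ?f ` (A \<times> B)" by (auto simp: ssum_def)
 have fib: "card {p : A \<times> B. ?f p = z} = card (A Int B)" if z: "z : ssum A B" for z
 proof -
  obtain a b where ab: "a : A" "b : B" "z = a + b" using z by (auto simp: ssum_def)
  have "bij_betw (%t. (a + t, b - t)) (A Int B) {p : A \<times> B. ?f p = z}"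
  proof (rule bij_betw_imageI)
  show "inj_on (%t. (a + t, b - t)) (A Int B)" by (auto intro: inj_onI)
  show "(%t. (a + t, b - t)) ` (A Int B) = {p : A \<times> B. ?f p = z}"
  proof (intro set_eqI iffI)
  fix p assume "p : (%t. (a + t, b - t)) ` (A Int B)"
  then show "p : {p : A \<times> B. ?f p = z}" using assms ab nv.subspace_add nv.subspace_diff by fastforce
  next
  fix p assume "p : {p : A \<times> B. ?f p = z}"
  then obtain x y where p: "p = (x, y)" "x : A" "y : B" "x + y = a + b" using ab by auto
  then have e: "x - a = b - y" by (simp add: algebra_simps)
  have "x - a : A" "b - y : B" using p ab assms nv.subspace_diff by auto
  then have "x - a : A Int B" using e by simp
  moreover have "p = (a + (x - a), b - (x - a))" using p e by (simp add: algebra_simps)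
  ultimately show "p : (%t. (a + t, b - t)) ` (A Int B)" by blast
  qed
  qed
  then show ?thesis by (simp add: bij_betw_same_card)
 qed
 have "card A * card B = card (A \<times> B)" by (simp add: card_cartesian_product)
 also have "... = (SUM z:ssum A B. card {p : A \<times> B. ?f p = z})" unfolding im using sum_fun_comp[of "A \<times> B" "?f ` (A \<times> B)" ?f "%_. 1 :: nat"] assms by simp
 also have "... = card (ssum A B) * card (A Int B)" by (simp add: fib)
 finally show ?thesis by simp
qed

lemma independent_if_card_span:
 fixes X :: "'a::{field,finite} vs"
 assumes "finite X" "card (nv.span X) >= CARD('a) ^ card X"
 shows "nv.independent X"
proof (rule ccontr)
 assume "\<not> nv.independent X"
 then obtain a where a: "a : X" "a : nv.span (X - {a})" by (auto simp: nv.dependent_def)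
 have sp: "nv.span X = nv.span (X - {a})" using nv.span_redundant[OF a(2)] a(1) by (simp add: insert_absorb)
 obtain B where B: "B <= X - {a}" "nv.independent B" "X - {a} <= nv.span B" using nv.maximal_independent_subset by blast
 have fB: "finite B" using B(1) assms(1) finite_subset by blast
 have "nv.span X = nv.span B" using B sp by (metis nv.span_mono nv.span_span subset_antisym)
 then have "card (nv.span X) = CARD('a) ^ card B" using card_span_independent[OF fB B(2)] by simp
 moreover have "card B < card X" using B(1) a(1) assms(1) by (intro psubset_card_mono) auto
 ultimately show False using assms(2) card_field_ge2[where 'a='a] by (simp add: power_increasing_iff not_le)
qed

text \<open>One basis of the intersection is extended separately inside \<open>R\<close> and inside
  \<open>W\<close>. The union spans \<open>ssum R W\<close>, whose cardinality is known from
  \<open>card_ssum\<close>, and so it is independent. Such bases are what a linear map needs in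
  order to carry one pair of subspaces to another.\<close>

lemma adapted_bases:
 fixes R W :: "'a::{field,finite} vs"
 assumes "nsub R" "R <= nspace n" "nsub W" "W <= nspace n"
 obtains B0 BR BW where "nv.span B0 = R Int W" "B0 Un BR <= R" "B0 Un BW <= W"
  "nv.span (B0 Un BR) = R" "nv.span (B0 Un BW) = W" "B0 Int BR = {}" "B0 Int BW = {}" "BR Int BW = {}"
  "nv.independent (B0 Un BR Un BW)" "finite B0" "finite BR" "finite BW"
  "card (R Int W) = CARD('a) ^ card B0" "card R = CARD('a) ^ (card B0 + card BR)"
  "card W = CARD('a) ^ (card B0 + card BW)"
proof -
 have sI: "nsub (R Int W)" using assms nv.subspace_inter by blast
 have fin: "finite R" "finite W" using assms finite_sub_nspace by blast+
 obtain B0 where B0: "B0 <= R Int W" "finite B0" "nv.independent B0" "nv.span B0 = R Int W"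
  "card (R Int W) = CARD('a) ^ card B0" using basis_of[OF sI, of n "{}"] assms nv.independent_empty by (metis empty_subsetI le_infI1)
 obtain CR where CR: "B0 <= CR" "CR <= R" "finite CR" "nv.independent CR" "nv.span CR = R"
  "card R = CARD('a) ^ card CR" using basis_of[OF assms(1,2), of B0] B0 by (metis le_inf_iff)
 obtain CW where CW: "B0 <= CW" "CW <= W" "finite CW" "nv.independent CW" "nv.span CW = W"
  "card W = CARD('a) ^ card CW" using basis_of[OF assms(3,4), of B0] B0 by (metis le_inf_iff)
 define BR BW where "BR = CR - B0" and "BW = CW - B0"
 have eR: "B0 Un BR = CR" and eW: "B0 Un BW = CW" using CR CW by (auto simp: BR_def BW_def)
 have d: "BR Int BW = {}"
 proof (rule ccontr)
  assume "BR Int BW ~= {}"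
  then obtain b where "b : BR Int BW" by blast
  then have b: "b : CR" "b ~: B0" "b : R Int W" using CR(2) CW(2) by (auto simp: BR_def BW_def)
  then have "b : nv.span (CR - {b})" using B0(4) CR(1) nv.span_mono[of B0 "CR - {b}"] by blast
  then show False using b CR(4) nv.dependent_def by blast
 qed
 have cR: "card CR = card B0 + card BR" and cW: "card CW = card B0 + card BW" using CR CW B0 by (auto simp: BR_def BW_def card_Diff_subset card_mono)
 have cX: "card (B0 Un BR Un BW) = card B0 + card BR + card BW"
 proof -
  have "card (B0 Un BR) = card B0 + card BR" using eR cR by simp
  moreover have "card (B0 Un BR Un BW) = card (B0 Un BR) + card BW" by (rule card_Un_disjoint) (use d B0(2) CR(3) CW(3) in \<open>auto simp: BR_def BW_def\<close>)
  ultimately show ?thesis by simp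
 qed
 have ss: "ssum R W <= nv.span (B0 Un BR Un BW)" using CR(5) CW(5) nv.span_mono[of CR "B0 Un BR Un BW"] nv.span_mono[of CW "B0 Un BR Un BW"]
  by (intro ssum_least) (auto simp: BR_def BW_def)
 have sub: "nv.span (B0 Un BR Un BW) <= nspace n" using CR CW assms B0 by (intro nv.span_minimal subspace_nspace) (auto simp: BR_def BW_def)
 have "card (ssum R W) * CARD('a) ^ card B0 = CARD('a) ^ card CR * CARD('a) ^ card CW" using card_ssum[OF assms(1,3) fin] B0 CR CW by simp
 also have "... = CARD('a) ^ (card B0 + card BR + card BW) * CARD('a) ^ card B0" by (simp add: cR cW power_add)
 finally have "card (ssum R W) = CARD('a) ^ card (B0 Un BR Un BW)" by (simp add: cX)
 then have "nv.independent (B0 Un BR Un BW)" using card_mono[OF finite_sub_nspace[OF sub] ss] B0 CR CW by (intro independent_if_card_span) (auto simp: BR_def BW_def)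
 then show ?thesis
 proof (intro that[of B0 BR BW])
  show "BR Int BW = {}" by (rule d)
  show "card R = CARD('a) ^ (card B0 + card BR)" "card W = CARD('a) ^ (card B0 + card BW)" using CR(6) CW(6) cR cW by simp_all
  show "B0 Int BR = {}" "B0 Int BW = {}" by (auto simp: BR_def BW_def)
  show "finite BR" "finite BW" using CR(3) CW(3) by (auto simp: BR_def BW_def)
  show "nv.span (B0 Un BR) = R" "nv.span (B0 Un BW) = W" using eR eW CR(5) CW(5) by simp_all
  show "B0 Un BR <= R" "B0 Un BW <= W" using eR eW CR(2) CW(2) by simp_all
 qed (use B0 in auto)
qed

section \<open>The general linear group of \<open>nspace n\<close>\<close>

lemma nspace_basis_extend:
 fixes B :: "'a::{field,finite} vs"
 assumes "B <= nspace n" "nv.independent B"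
 obtains B' where "B <= B'" "B' <= nspace n" "finite B'" "nv.independent B'" "nv.span B' = nspace n"
  "card B' = n"
proof (rule basis_of[OF subspace_nspace order_refl assms])
 fix B' assume "B <= B'" "B' <= nspace n" "finite B'" "nv.independent B'" "nv.span B' = nspace n"
  and d: "nv.dim (nspace n :: 'a vs) = card B'"
 then show thesis by (intro that) (assumption | rule trans[OF d[symmetric] dim_nspace])+
qed

text \<open>Elements are bijections of the whole type, so \<open>inv\<close> can be used without
  domain conditions. The last clause fixes all vectors supported beyond the first \<open>n\<close>
  coordinates; an element is then determined by its restriction to \<open>nspace n\<close>, and
  \<open>GL n\<close> is finite.\<close>

definition GL :: "nat => ((nat => 'a::field) => 'a vec) set" where
 "GL n = {g. lin_map g & bij g & g ` nspace n = nspace n & (ALL x. (ALL i<n. x i = 0) --> g x = x)}"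

definition head_part :: "nat => (nat => 'a::field) => nat => 'a" where
 "head_part n x = (%i. if i < n then x i else 0)"

definition tail_part :: "nat => (nat => 'a::field) => nat => 'a" where
 "tail_part n x = (%i. if i < n then 0 else x i)"

lemma head_tail: "head_part n x + tail_part n x = x" by (rule ext) (simp add: head_part_def tail_part_def)

lemma head_part_in: "head_part n x : nspace n" by (auto simp: head_part_def nspace_def)

lemma head_part_id: "x : nspace n ==> head_part n x = x"
 and tail_part_0: "x : nspace n ==> tail_part n x = 0" by (rule ext, simp add: head_part_def tail_part_def nspace_def)+

text \<open>Both independent sets are completed to bases of \<open>nspace n\<close>, and a bijection
  of these bases extends linearly.\<close>

lemma GL_extend:
 fixes B :: "'a::{field,finite} vs"
 assumes B: "B <= nspace n" "nv.independent B" and f: "inj_on f B" "f ` B <= nspace n" "nv.independent (f ` B)"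
 obtains g where "g : GL n" "!!b. b : B ==> g b = f b"
proof -
 obtain B' where B': "B <= B'" "B' <= nspace n" "finite B'" "nv.independent B'" "nv.span B' = nspace n" "card B' = n" using nspace_basis_extend[OF B] by metis
 obtain C' where C': "f ` B <= C'" "C' <= nspace n" "finite C'" "nv.independent C'" "nv.span C' = nspace n" "card C' = n" using nspace_basis_extend[OF f(2,3)] by metis
 have "card (B' - B) = card (C' - f ` B)" using B' C' f(1) by (simp add: card_Diff_subset finite_subset card_image)
 then obtain h0 where h0: "bij_betw h0 (B' - B) (C' - f ` B)" using B'(3) C'(3) by (meson finite_Diff finite_same_card_bij)
 define F where "F x = (if x : B then f x else h0 x)" for x
 have FB: "F ` B' = C'"
 proof -
  have "F ` B' = F ` B Un F ` (B' - B)" using B' by auto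
  also have "F ` B = f ` B" by (rule image_cong) (simp_all add: F_def)
  also have "F ` (B' - B) = h0 ` (B' - B)" by (rule image_cong) (simp_all add: F_def)
  also have "... = C' - f ` B" using h0 by (simp add: bij_betw_def)
  also have "f ` B Un (C' - f ` B) = C'" using C'(1) by blast
  finally show ?thesis .
 qed
 obtain h where h: "lin_map h" "!!x. x : B' ==> h x = F x" using nn.linear_independent_extend[OF B'(4), of F] by blast
 have him: "h ` nspace n = nspace n"
 proof -
  have "h ` nspace n = nv.span (h ` B')" using nn.linear_span_image[OF h(1), of B'] B'(5) by simp
  also have "h ` B' = C'" using h(2) FB by (metis image_cong)
  finally show ?thesis using C' by simp
 qed
 have hinj: "inj_on h (nspace n)" by (rule eq_card_imp_inj_on) (auto simp: finite_nspace him)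
 \<comment> \<open>\<open>h\<close> is controlled on \<open>nspace n\<close> only; the tail is left
   alone, as the last clause of \<open>GL\<close> demands.\<close>
 define g where "g x = h (head_part n x) + tail_part n x" for x
 have g_in: "g x = h x" if "x : nspace n" for x using that by (simp add: g_def head_part_id tail_part_0)
 have glin: "lin_map g"
 proof (rule lin_mapI)
  fix x y :: "nat => 'a" and c
  have *: "head_part n (x + y) = head_part n x + head_part n y" "tail_part n (x + y) = tail_part n x + tail_part n y"
  "head_part n (vscale c x) = vscale c (head_part n x)" "tail_part n (vscale c x) = vscale c (tail_part n x)" by (rule ext, simp add: head_part_def tail_part_def vscale_def)+
  show "g (x + y) = g x + g y" by (simp only: g_def * lin_map_add[OF h(1)] ac_simps)
  show "g (vscale c x) = vscale c (g x)" by (simp only: g_def * lin_map_scale[OF h(1)] nv.scale_right_distrib)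
 qed
 have hn: "h (head_part n x) : nspace n" for x using him head_part_in by blast
 have h0': "h 0 = 0" using h(1) by (metis lin_map_scale nv.scale_zero_left)
 have "inj g"
 proof (rule injI)
  fix x y assume "g x = g y"
  then have "h (head_part n x) + tail_part n x = h (head_part n y) + tail_part n y" by (simp add: g_def)
  then have e: "!!i. h (head_part n x) i + tail_part n x i = h (head_part n y) i + tail_part n y i" by (simp add: fun_eq_iff)
  have t: "tail_part n x = tail_part n y"
  proof
  fix i show "tail_part n x i = tail_part n y i" using e[of i] hn[of x] hn[of y] by (cases "i < n") (auto simp: tail_part_def nspace_def)
  qed
  then have "h (head_part n x) = h (head_part n y)" using e by (simp add: fun_eq_iff)
  then have "head_part n x = head_part n y" using hinj head_part_in by (metis inj_onD)
  then show "x = y" using t head_tail by metis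
 qed
 moreover have "surj g"
 proof (rule surjI)
  fix y
  let ?p = "inv_into (nspace n) h (head_part n y)"
  have p: "?p : nspace n" "h ?p = head_part n y" using him head_part_in[of n y] inv_into_into[of _ h "nspace n"] f_inv_into_f[of _ h "nspace n"] by simp_all
  have "g (?p + tail_part n y) = g ?p + g (tail_part n y)" using glin by (rule lin_map_add)
  moreover have "g (tail_part n y) = tail_part n y"
  proof -
  have "head_part n (tail_part n y) = 0" "tail_part n (tail_part n y) = tail_part n y" by (rule ext, simp add: head_part_def tail_part_def)+
  then show ?thesis by (simp add: g_def h0')
  qed
  ultimately show "g (?p + tail_part n y) = y" using p g_in[OF p(1)] head_tail by metis
 qed
 moreover have "g ` nspace n = nspace n" using g_in him by (metis image_cong)
 moreover have "g x = x" if "ALL i<n. x i = 0" for x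
 proof -
  have "head_part n x = 0" "tail_part n x = x" using that by (intro ext; simp add: head_part_def tail_part_def)+
  then show ?thesis by (simp add: g_def h0')
 qed
 ultimately have "g : GL n" using glin by (auto simp: GL_def bij_def)
 moreover have "g b = f b" if "b : B" for b
 proof -
  have "b : nspace n" "b : B'" using that B B' by auto
  then show ?thesis using g_in h(2) that by (simp add: F_def)
 qed
 ultimately show ?thesis using that by blast
qed

lemma GL_lin: "g : GL n ==> lin_map g"
 and GL_bij: "g : GL n ==> bij g"
 and GL_nspace: "g : GL n ==> g ` nspace n = nspace n" by (auto simp: GL_def)

lemma GL_id: "id : GL n" by (auto simp: GL_def intro!: lin_mapI)

lemma GL_comp: "g : GL n ==> h : GL n ==> g \<circ> h : GL n"
proof -
 assume gh: "g : GL n" "h : GL n"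
 then have "lin_map (g \<circ> h)" by (auto simp: GL_def Vector_Spaces.linear_iff)
 moreover have "(g \<circ> h) ` nspace n = nspace n" using gh by (simp only: GL_def image_comp[symmetric] mem_Collect_eq)
 ultimately show ?thesis using gh by (auto simp: GL_def bij_comp)
qed

lemma GL_inv:
 assumes "g : GL n" shows "inv (g :: (nat => 'a::field) => _) : GL n"
proof -
 have b: "bij g" and l: "lin_map g" using assms by (auto simp: GL_def)
 have gi: "g (inv g x) = x" for x using b by (simp add: bij_is_surj surj_f_inv_f)
 have ig: "inv g (g x) = x" for x using b by (simp add: bij_is_inj)
 have "lin_map (inv g)"
 proof (rule lin_mapI)
  fix x y :: "nat => 'a" and c
  have "inv g (g (inv g x) + g (inv g y)) = inv g x + inv g y" using ig lin_map_add[OF l] by metis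
  then show "inv g (x + y) = inv g x + inv g y" by (simp only: gi)
  have "inv g (vscale c (g (inv g x))) = vscale c (inv g x)" using ig lin_map_scale[OF l] by metis
  then show "inv g (vscale c x) = vscale c (inv g x)" by (simp only: gi)
 qed
 moreover have "inv g ` nspace n = nspace n"
 proof -
  have "inv g ` nspace n = inv g ` (g ` nspace n)" using assms by (simp add: GL_def)
  also have "... = nspace n" using ig by (simp add: image_image)
  finally show ?thesis .
 qed
 moreover have "ALL x. (ALL i<n. x i = 0) --> inv g x = x"
 proof (intro allI impI)
  fix x :: "nat => 'a" assume "ALL i<n. x i = 0"
  then have "g x = x" using assms by (simp add: GL_def)
  then show "inv g x = x" using ig[of x] by simp
 qed
 ultimately show ?thesis using b by (simp add: GL_def bij_imp_bij_inv)
qed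

lemma GL_eqI:
 assumes "g : GL n" "h : GL n" "!!x. x : nspace n ==> g x = h x"
 shows "g = h"
proof (rule ext)
 fix x
 have "g (tail_part n x) = tail_part n x" "h (tail_part n x) = tail_part n x" using assms(1,2) by (auto simp: GL_def tail_part_def)
 then have "g (head_part n x + tail_part n x) = h (head_part n x + tail_part n x)"
  using assms(3)[OF head_part_in] GL_lin[OF assms(1)] GL_lin[OF assms(2)] by (simp add: lin_map_add)
 then show "g x = h x" by (simp add: head_tail)
qed

lemma finite_GL: "finite (GL n :: ('a::{field,finite} vec => _) set)"
proof (rule inj_on_finite)
 show "inj_on (%g. restrict g (nspace n)) (GL n :: ('a vec => _) set)"
 proof (rule inj_onI)
  fix g h :: "'a vec => nat => 'a" assume a: "g : GL n" "h : GL n" and e: "restrict g (nspace n) = restrict h (nspace n)"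
  show "g = h"
  proof (rule GL_eqI[OF a])
  fix x :: "nat => 'a" assume "x : nspace n"
  then show "g x = h x" using fun_cong[OF e, of x] by simp
  qed
 qed
 show "(%g :: 'a vec => _. restrict g (nspace n)) ` GL n <= Pi\<^sub>E (nspace n) (%_. nspace n)" by (auto simp: GL_def)
 show "finite (Pi\<^sub>E (nspace n) (%_. nspace n) :: ('a vec => 'a vec) set)" by (rule finite_PiE[OF finite_nspace]) (rule finite_nspace)
qed

lemma GL_pos: "card (GL n :: ('a::{field,finite} vec => _) set) > 0" using GL_id finite_GL card_gt_0_iff by blast

lemma GL_image_subspace: "g : GL n ==> nsub T ==> nsub (g ` T)" using nn.linear_subspace_image GL_lin by blast

lemma GL_card: "g : GL n ==> card (g ` T) = card T" using GL_bij[of g n] by (auto intro!: card_image simp: bij_def inj_on_def)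

lemma GL_image_subset: "g : GL n ==> T <= nspace n ==> g ` T <= nspace n" using GL_nspace by blast

lemma GL_Gr: "g : GL n ==> T : Gr n t ==> g ` T : Gr n t"
 for T :: "'a::{field,finite} vs" unfolding Gr_iff using GL_image_subspace[of g n T] GL_card[of g n T] GL_image_subset[of g n T] by simp

lemma GL_subset_iff: "g : GL n ==> g ` A <= g ` B \<longleftrightarrow> A <= B" using inj_image_subset_iff[OF bij_is_inj[OF GL_bij]] .

lemma GL_eq_iff: "g : GL n ==> g ` A = g ` B \<longleftrightarrow> A = B" using inj_image_eq_iff[OF bij_is_inj[OF GL_bij]] .

lemma GL_Int: "g : GL n ==> g ` (A Int B) = g ` A Int g ` B" using image_Int[OF bij_is_inj[OF GL_bij]] .

lemma GL_inv_image: "g : GL n ==> inv g ` (g ` A) = A" "g : GL n ==> g ` (inv g ` A) = A" using GL_bij[of g n] by (metis bij_def image_inv_f_f, metis bij_def image_f_inv_f)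

lemma GL_Gr_iff: "g : GL n ==> g ` T : Gr n t \<longleftrightarrow> T : Gr n t"
 for T :: "'a::{field,finite} vs" using GL_Gr GL_inv GL_inv_image(1) by metis

lemma GL_bij_Gr: "g : GL n ==> bij_betw ((`) g) (Gr n t) (Gr n t :: 'a::{field,finite} vs set)" by (rule bij_betwI[of _ _ _ "(`) (inv g)"]) (auto simp: GL_Gr GL_inv GL_inv_image)

text \<open>A bijection of adapted bases that respects the three blocks extends to
  \<open>GL n\<close>. So the orbit of a pair of subspaces is given by the two dimensions and that
  of the intersection, which makes averages over \<open>GL n\<close> computable.\<close>

lemma GL_pair_transitive:
 fixes R1 R2 W1 W2 :: "'a::{field,finite} vs"
 assumes "nsub R1" "R1 <= nspace n" "nsub W1" "W1 <= nspace n"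
  and "nsub R2" "R2 <= nspace n" "nsub W2" "W2 <= nspace n"
  and "card R1 = card R2" "card W1 = card W2" "card (R1 Int W1) = card (R2 Int W2)"
 obtains g where "g : GL n" "g ` R1 = R2" "g ` W1 = W2"
proof -
 obtain B0 BR BW where B: "nv.span B0 = R1 Int W1" "B0 Un BR <= R1" "B0 Un BW <= W1"
  "nv.span (B0 Un BR) = R1" "nv.span (B0 Un BW) = W1" "B0 Int BR = {}" "B0 Int BW = {}" "BR Int BW = {}"
  "nv.independent (B0 Un BR Un BW)" "finite B0" "finite BR" "finite BW"
  "card (R1 Int W1) = CARD('a) ^ card B0" "card R1 = CARD('a) ^ (card B0 + card BR)"
  "card W1 = CARD('a) ^ (card B0 + card BW)" by (rule adapted_bases[OF assms(1-4)])
 obtain C0 CR CW where C: "nv.span C0 = R2 Int W2" "C0 Un CR <= R2" "C0 Un CW <= W2"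
  "nv.span (C0 Un CR) = R2" "nv.span (C0 Un CW) = W2" "C0 Int CR = {}" "C0 Int CW = {}" "CR Int CW = {}"
  "nv.independent (C0 Un CR Un CW)" "finite C0" "finite CR" "finite CW"
  "card (R2 Int W2) = CARD('a) ^ card C0" "card R2 = CARD('a) ^ (card C0 + card CR)"
  "card W2 = CARD('a) ^ (card C0 + card CW)" by (rule adapted_bases[OF assms(5-8)])
 have "card B0 = card C0" "card BR = card CR" "card BW = card CW" using assms(9-11) unfolding B(13-15) C(13-15) power_card_inj by simp_all
 then obtain f0 fR fW where f: "bij_betw f0 B0 C0" "bij_betw fR BR CR" "bij_betw fW BW CW" using B(10-12) C(10-12) by (meson finite_same_card_bij)
 define f where "f x = (if x : B0 then f0 x else if x : BR then fR x else fW x)" for x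
 have f0: "f ` B0 = C0" and fR: "f ` BR = CR" and fW: "f ` BW = CW"
 proof -
  have "f ` B0 = f0 ` B0" "f ` BR = fR ` BR" "f ` BW = fW ` BW"
  proof -
  have "f x = f0 x" if "x : B0" for x using that by (simp add: f_def)
  moreover have "f x = fR x" if "x : BR" for x using that B(6) by (auto simp: f_def)
  moreover have "f x = fW x" if "x : BW" for x using that B(7,8) by (auto simp: f_def)
  ultimately show "f ` B0 = f0 ` B0" "f ` BR = fR ` BR" "f ` BW = fW ` BW" by (simp_all cong: image_cong)
  qed
  then show "f ` B0 = C0" "f ` BR = CR" "f ` BW = CW" using f by (simp_all add: bij_betw_def)
 qed
 have inj: "inj_on f (B0 Un BR Un BW)"
 proof (rule eq_card_imp_inj_on)
  show "finite (B0 Un BR Un BW)" using B by simp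
  have "f ` (B0 Un BR Un BW) = C0 Un CR Un CW" using f0 fR fW by auto
  moreover have "card (C0 Un CR Un CW) = card C0 + card CR + card CW"
  proof -
  have "card (C0 Un CR) = card C0 + card CR" by (rule card_Un_disjoint) (use C in simp_all)
  moreover have "card (C0 Un CR Un CW) = card (C0 Un CR) + card CW" by (rule card_Un_disjoint) (use C(6-8,10-12) in auto)
  ultimately show ?thesis by simp
  qed
  moreover have "card (B0 Un BR Un BW) = card B0 + card BR + card BW"
  proof -
  have "card (B0 Un BR) = card B0 + card BR" by (rule card_Un_disjoint) (use B in simp_all)
  moreover have "card (B0 Un BR Un BW) = card (B0 Un BR) + card BW" by (rule card_Un_disjoint) (use B(6-8,10-12) in auto)
  ultimately show ?thesis by simp
  qed
  ultimately show "card (f ` (B0 Un BR Un BW)) = card (B0 Un BR Un BW)"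
  using \<open>card B0 = card C0\<close> \<open>card BR = card CR\<close> \<open>card BW = card CW\<close> by simp
 qed
 have im: "f ` (B0 Un BR Un BW) = C0 Un CR Un CW" using f0 fR fW by auto
 obtain g where g: "g : GL n" "!!b. b : B0 Un BR Un BW ==> g b = f b"
 proof (rule GL_extend[of "B0 Un BR Un BW" n f])
  show "B0 Un BR Un BW <= nspace n" using B assms by auto
  show "f ` (B0 Un BR Un BW) <= nspace n" unfolding im using C assms by auto
  show "nv.independent (B0 Un BR Un BW)" by (rule B(9))
  show "nv.independent (f ` (B0 Un BR Un BW))" unfolding im by (rule C(9))
  show "inj_on f (B0 Un BR Un BW)" by (rule inj)
 qed (rule that)  have "g ` R1 = nv.span (g ` (B0 Un BR))" "g ` W1 = nv.span (g ` (B0 Un BW))" using nn.linear_span_image[OF GL_lin[OF g(1)], of "B0 Un BR"]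
  nn.linear_span_image[OF GL_lin[OF g(1)], of "B0 Un BW"] B(4,5) by simp_all
 moreover have "g ` B0 = C0" "g ` BR = CR" "g ` BW = CW"
 proof -
  have "g ` B0 = f ` B0" "g ` BR = f ` BR" "g ` BW = f ` BW" by (rule image_cong; simp add: g(2))+
  then show "g ` B0 = C0" "g ` BR = CR" "g ` BW = CW" using f0 fR fW by simp_all
 qed
 ultimately have "g ` R1 = R2" "g ` W1 = W2" using C(4,5) by (simp_all add: image_Un)
 then show ?thesis using that g(1) by blast
qed

section \<open>Counting subspaces above or transversal to given ones\<close>

lemma card_fibers:
 assumes "finite A" "finite B" "!!a. a : A ==> f a : B"
 shows "card A = (SUM b:B. card {a : A. f a = b})"
proof -
 have "f ` A <= B" using assms(3) by blast
 from sum.group[OF assms(1,2) this, of "%_. 1 :: nat"] show ?thesis by simp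
qed

lemma span_subspace_id: "nsub W ==> nv.span W = W" by (rule nv.span_eq_iff[THEN iffD2])

lemma span_insert_Gr:
 fixes W :: "'a::{field,finite} vs"
 assumes "W : Gr n w" "v : nspace n" "v ~: W"
 shows "nv.span (insert v W) : Gr n (Suc w)"
proof -
 have sp: "nv.span W = W" using GrD(1)[OF assms(1)] by (rule span_subspace_id)
 have "card (nv.span (insert v W)) = CARD('a) * card W" using card_span_insert[of v W] assms(3) unfolding sp by simp
 moreover have "nv.span (insert v W) <= nspace n" using GrD(2)[OF assms(1)] assms(2) by (intro nv.span_minimal subspace_nspace) simp
 ultimately show ?thesis using GrD(5)[OF assms(1)] by (simp add: Gr_iff)
qed

lemma hyperplane_between:
 fixes W0 W' :: "'a::{field,finite} vs"
 assumes "nsub W0" "W0 <= W'" "W' : Gr n (Suc w)" "nv.dim W0 <= w"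
 obtains W v where "W : Gr n w" "W0 <= W" "v : W'" "v ~: W" "W' = nv.span (insert v W)"
proof -
 have W': "nsub W'" "W' <= nspace n" using GrD[OF assms(3)] by auto
 have W0n: "W0 <= nspace n" using assms(2) W' by blast
 obtain B0 where B0: "B0 <= W0" "finite B0" "nv.independent B0" "nv.span B0 = W0" "nv.dim W0 = card B0" by (rule basis_of[OF assms(1) W0n empty_subsetI nv.independent_empty])
 have "B0 <= W'" using B0 assms(2) by blast
 obtain B where B: "B0 <= B" "B <= W'" "finite B" "nv.independent B" "nv.span B = W'" "nv.dim W' = card B" by (rule basis_of[OF W' \<open>B0 <= W'\<close> B0(3)])
 have cB: "card B = Suc w" using B(6) GrD(3)[OF assms(3)] by simp
 have "B0 ~= B" using cB B0(5) assms(4) by auto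
 then obtain v where v: "v : B" "v ~: B0" using B(1) by blast
 let ?W = "nv.span (B - {v})"
 have i: "nv.independent (B - {v})" using B(4) nv.independent_mono by blast
 have sub: "?W <= W'" using B(5) nv.span_mono[of "B - {v}" B] by auto
 have "card ?W = CARD('a) ^ w" using card_span_independent[OF _ i] B(3) cB v(1) by simp
 then have "?W : Gr n w" using sub W'(2) by (auto simp: Gr_iff)
 moreover have "W0 <= ?W" using B0(4) nv.span_mono[of B0 "B - {v}"] B(1) v by auto
 moreover have "v : W'" using v B(2) by blast
 moreover have "v ~: ?W" using B(4) v(1) nv.dependent_def by blast
 moreover have "W' = nv.span (insert v ?W)"
 proof
  show "W' <= nv.span (insert v ?W)" unfolding B(5)[symmetric]
  proof (rule nv.span_minimal)
  have "B - {v} <= ?W" by (rule nv.span_superset)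
  then have "B <= insert v ?W" by blast
  then show "B <= nv.span (insert v ?W)" using nv.span_superset by (rule order_trans)
  qed simp
  show "nv.span (insert v ?W) <= W'" by (rule nv.span_minimal) (use \<open>v : W'\<close> sub W' in blast)+
 qed
 ultimately show ?thesis by (rule that)
qed

text \<open>Each space is a hyperplane of it together with one of the q^n vectors, which gives a
  factor q^n per dimension. The order of magnitude is right, up to the constants collected in
  \<open>kap\<close>.\<close>

lemma card_Gr_above_le:
 fixes W0 :: "'a::{field,finite} vs"
 assumes "W0 : Gr n j" "j <= w"
 shows "card {W : Gr n w. W0 <= W} <= CARD('a) ^ (n * (w - j))" using assms(2)
proof (induction w rule: dec_induct)
 case base
 have "{W : Gr n j. W0 <= W} <= {W0}"
 proof (rule subsetI)
  fix W assume "W : {W : Gr n j. W0 <= W}"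
  then show "W : {W0}" using GrD[OF assms(1)] GrD[of W n j] card_subset_eq[of W W0] by simp
 qed
 then have "card {W : Gr n j. W0 <= W} <= card {W0}" by (rule card_mono[rotated]) simp
 then show ?case by simp
next
 case (step w)
 let ?f = "%(W, v). nv.span (insert v W)"
 have "{W : Gr n (Suc w). W0 <= W} <= ?f ` ({W : Gr n w. W0 <= W} \<times> nspace n)"
 proof (rule subsetI)
  fix W' assume "W' : {W : Gr n (Suc w). W0 <= W}"
  then have W': "W' : Gr n (Suc w)" "W0 <= W'" by auto
  obtain W v where "W : Gr n w" "W0 <= W" "v : W'" "W' = nv.span (insert v W)" using hyperplane_between[OF GrD(1)[OF assms(1)] W'(2,1)] GrD(3)[OF assms(1)] step.hyps by metis
  then show "W' : ?f ` ({W : Gr n w. W0 <= W} \<times> nspace n)" using GrD(2)[OF W'(1)] by (intro image_eqI[of _ _ "(W, v)"]) auto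
 qed
 then have "card {W : Gr n (Suc w). W0 <= W} <= card ({W : Gr n w. W0 <= W} \<times> (nspace n :: 'a vs))" by (rule surj_card_le[rotated]) (simp add: finite_Gr finite_nspace)
 also have "... <= CARD('a) ^ (n * (w - j)) * CARD('a) ^ n" using step.IH by (simp add: card_cartesian_product card_nspace)
 also have "... = CARD('a) ^ (n * (Suc w - j))" using step.hyps by (simp add: Suc_diff_le power_add[symmetric] add.commute)
 finally show ?case .
qed

lemma zero_Gr: "{0} : (Gr n 0 :: 'a::{field,finite} vs set)" by (simp add: Gr_iff nv.subspace_single_0 subspace_nspace nv.subspace_0)

lemma card_Gr_le: "card (Gr n w :: 'a::{field,finite} vs set) <= CARD('a) ^ (n * w)"
proof -
 have "{W : Gr n w. {0} <= W} = (Gr n w :: 'a vs set)" using GrD(1) nv.subspace_0 by blast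
 then show ?thesis using card_Gr_above_le[OF zero_Gr, of w n, where 'a='a] by simp
qed

text \<open>The loss per dimension in \<open>card_Gr_meet_ge\<close>. The 2 is there because at
  least half of all vectors avoid \<open>ssum W R\<close>; the other factor bounds the pairs of a
  subset and a vector of one space of dimension at most \<open>s\<close>, hence the number of pairs
  (\<open>W\<close>, \<open>v\<close>) that generate the same space.\<close>

definition kap :: "nat => nat => real" where
 "kap q s = 2 * (2 ^ (q ^ s) * q ^ s)"

lemma kap_ge1: "q >= 1 ==> kap q s >= 1"
proof -
 assume "q >= 1"
 then have "(1::nat) <= 2 ^ (q ^ s) * q ^ s" by simp
 then have "(1::real) <= real (2 ^ (q ^ s) * q ^ s)" by linarith
 then show ?thesis by (simp add: kap_def)
qed

text \<open>A vector outside \<open>ssum W R\<close> enlarges \<open>W\<close> without enlarging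
  \<open>W Int R\<close>. The pairs of such a \<open>W\<close> and such a vector are counted twice,
  by \<open>W\<close> and by the space they generate.\<close>

lemma card_Gr_meet_ge:
 fixes W0 R :: "'a::{field,finite} vs"
 assumes "W0 : Gr n j" "R : Gr n r" "W0 <= R" "j <= w" "w <= s" "r <= s" "2 * s < n"
 shows "(real CARD('a) ^ n / kap CARD('a) s) ^ (w - j) <= card {W : Gr n w. W Int R = W0}" using assms(4,5)
proof (induction w rule: dec_induct)
 case base
 have "{W0} <= {W : Gr n j. W Int R = W0}" using assms by auto
 then have "card {W0} <= card {W : Gr n j. W Int R = W0}" by (rule card_mono[rotated]) (simp add: finite_Gr)
 then show ?case by simp
next
 case (step w)
 let ?q = "CARD('a)"
 let ?A = "{W : Gr n w. W Int R = W0}" and ?B = "{W : Gr n (Suc w). W Int R = W0}"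
 let ?P = "Sigma ?A (%W. nspace n - ssum W R)"
 let ?f = "%(W, v). nv.span (insert v W)"
 note R = GrD[OF assms(2)]
 have finA: "finite ?A" "finite ?B" by (simp_all add: finite_Gr)
 have img: "?f p : ?B" if p: "p : ?P" for p
 proof -
  obtain W v where pv: "p = (W, v)" "W : Gr n w" "W Int R = W0" "v : nspace n" "v ~: ssum W R" using p by auto
  note W = GrD[OF pv(2)]
  have "v ~: W" using pv(5) ssum_upper[OF W(1) R(1)] by blast
  have "nv.span (insert v W) Int R <= W"
  proof (rule subsetI)
  fix x assume "x : nv.span (insert v W) Int R"
  then have x: "x : nv.span (insert v W)" "x : R" by auto
  then obtain k where k: "x - vscale k v : W" by (auto simp: nv.span_insert span_subspace_id[OF W(1)])
  show "x : W"
  proof (cases "k = 0")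
  case False
  have "vscale k v = (vscale k v - x) + x" by simp
  moreover have "vscale k v - x : W" using nv.subspace_neg[OF W(1) k] by simp
  ultimately have "vscale k v : ssum W R" using x(2) unfolding ssum_def by blast
  then have "vscale (inverse k) (vscale k v) : ssum W R" using nv.subspace_scale[OF subspace_ssum[OF W(1) R(1)]] by blast
  then show ?thesis using False pv(5) by simp
  qed (use k in simp)
  qed
  moreover have "W <= nv.span (insert v W)" using nv.span_superset[of "insert v W"] by blast
  ultimately have "nv.span (insert v W) Int R = W0" using pv(3) by blast
  then show ?thesis using span_insert_Gr[OF pv(2,4) \<open>v ~: W\<close>] pv(1) by simp
 qed
 have fib: "card {p : ?P. ?f p = W'} <= 2 ^ (?q ^ s) * ?q ^ s" if W': "W' : ?B" for W'
 proof -
  have W'G: "W' : Gr n (Suc w)" using W' by simp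
  note W'' = GrD[OF W'G]
  have "{p : ?P. ?f p = W'} <= Pow W' \<times> W'"
  proof (rule subsetI)
  fix p assume p: "p : {p : ?P. ?f p = W'}"
  obtain W v where pv: "p = (W, v)" by (cases p)
  have "nv.span (insert v W) = W'" using p pv by simp
  then show "p : Pow W' \<times> W'" using nv.span_superset[of "insert v W"] pv by blast
  qed
  then have "card {p : ?P. ?f p = W'} <= card (Pow W' \<times> W')" by (rule card_mono[rotated]) (simp add: W''(4))
  also have "... = 2 ^ (?q ^ Suc w) * ?q ^ Suc w" using W'' by (simp add: card_cartesian_product card_Pow)
  also have "... <= 2 ^ (?q ^ s) * ?q ^ s" using step.prems card_field_ge2[where 'a='a] by (intro mult_mono power_increasing) auto
  finally show ?thesis .
 qed
 have cP: "card ?A * (?q ^ n) <= 2 * card ?P"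
 proof -
  have "?q ^ n <= 2 * card (nspace n - ssum W R)" if "W : ?A" for W
  proof -
  have WG: "W : Gr n w" using that by simp
  note W = GrD[OF WG]
  have sub: "ssum W R <= nspace n" using ssum_least[OF subspace_nspace W(2) R(2)] .
  have "card (ssum W R) * 1 <= card (ssum W R) * card (W Int R)" using nv.subspace_0[OF W(1)] nv.subspace_0[OF R(1)] W(4)
  by (intro mult_le_mono le_refl) (auto simp: Suc_le_eq card_gt_0_iff)
  also have "... = ?q ^ (w + r)" using card_ssum[OF W(1) R(1) W(4) R(4)] W(5) R(5) by (simp add: power_add)
  also have "... <= ?q ^ (n - 1)" using step.prems assms(6,7) card_field_ge2[where 'a='a] by (intro power_increasing) auto
  finally have a: "card (ssum W R) <= ?q ^ (n - 1)" by simp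
  have "2 * ?q ^ (n - 1) <= ?q * ?q ^ (n - 1)" using card_field_ge2[where 'a='a] by simp
  also have "... = ?q ^ n" using assms(7) by (simp add: power_eq_if)
  finally have b: "2 * card (ssum W R) <= ?q ^ n" using a by linarith
  have "card (nspace n - ssum W R) = ?q ^ n - card (ssum W R)" using sub finite_sub_nspace[OF sub] by (simp add: card_Diff_subset card_nspace)
  then show ?thesis using b by linarith
  qed
  then have "(SUM W:?A. ?q ^ n) <= (SUM W:?A. 2 * card (nspace n - ssum W R))" by (rule sum_mono)
  also have "... = 2 * card ?P" using finA by (subst card_SigmaI) (auto simp: finite_nspace sum_distrib_left)
  finally show ?thesis by simp
 qed
 have finP: "finite ?P" using finA by (intro finite_SigmaI) (auto simp: finite_nspace)
 have "card ?P = (SUM W':?B. card {p : ?P. ?f p = W'})" by (rule card_fibers[OF finP finA(2)]) (rule img)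
 also have "... <= (SUM W':?B. 2 ^ (?q ^ s) * ?q ^ s)" by (rule sum_mono) (rule fib)
 finally have "card ?A * ?q ^ n <= 2 * (card ?B * (2 ^ (?q ^ s) * ?q ^ s))" using cP by simp
 then have "real (card ?A * ?q ^ n) <= real (2 * (card ?B * (2 ^ (?q ^ s) * ?q ^ s)))" by (simp only: of_nat_le_iff)
 then have main: "real (card ?A) * real ?q ^ n <= real (card ?B) * kap ?q s" by (simp only: kap_def of_nat_mult of_nat_power of_nat_numeral ac_simps)
 have kp: "kap ?q s > 0" using kap_ge1[of ?q s] card_field_ge2[where 'a='a] by auto
 have "(real ?q ^ n / kap ?q s) ^ (Suc w - j) = (real ?q ^ n / kap ?q s) ^ (w - j) * (real ?q ^ n / kap ?q s)" using step.hyps by (simp add: Suc_diff_le)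
 also have "... <= real (card ?A) * (real ?q ^ n / kap ?q s)" using step kp by (intro mult_right_mono) auto
 also have "... <= real (card ?B)" using main kp by (simp add: field_simps)
 finally show ?case .
qed

lemma subspace_of_dim:
 fixes T :: "'a::{field,finite} vs"
 assumes "T : Gr n t" "j <= t"
 obtains U where "U : Gr n j" "U <= T"
proof -
 note T = GrD[OF assms(1)]
 obtain B where B: "B <= T" "finite B" "nv.independent B" "nv.span B = T" "nv.dim T = card B" by (rule basis_of[OF T(1,2) empty_subsetI nv.independent_empty])
 obtain C where C: "C <= B" "card C = j" "finite C" using obtain_subset_with_card_n[of j B] B(5) T(3) assms(2) by metis
 have i: "nv.independent C" using B(3) C(1) nv.independent_mono by blast
 have "nv.span C <= T" using nv.span_mono[OF C(1)] B(4) by simp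
 then have "nv.span C : Gr n j" using card_span_independent[OF C(3) i] C(2) T(2) by (auto simp: Gr_iff)
 then show ?thesis using that \<open>nv.span C <= T\<close> by blast
qed

lemma card_Gr_ge:
 assumes "w <= s" "2 * s < n"
 shows "(real CARD('a) ^ n / kap CARD('a) s) ^ w <= card (Gr n w :: 'a::{field,finite} vs set)"
proof -
 have "(real CARD('a) ^ n / kap CARD('a) s) ^ (w - 0) <= card {W : Gr n w. W Int {0} = ({0} :: 'a vs)}" by (rule card_Gr_meet_ge[OF zero_Gr zero_Gr]) (use assms in auto)
 also have "... <= card (Gr n w :: 'a vs set)" by (rule of_nat_mono) (rule card_mono, auto simp: finite_Gr)
 finally show ?thesis by simp
qed

section \<open>Averages over the general linear group\<close>

lemma orbit_count:
 fixes act :: "('a::{field,finite} vec => 'a vec) => 'b => 'b"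
 assumes fin: "finite \<Omega>"
  and cl: "!!g x. g : GL n ==> x : \<Omega> ==> act g x : \<Omega>"
  and comp: "!!g h x. g : GL n ==> h : GL n ==> x : \<Omega> ==> act (g \<circ> h) x = act g (act h x)"
  and trans: "!!x y. x : \<Omega> ==> y : \<Omega> ==> EX g : GL n. act g x = y"
  and xy: "x : \<Omega>" "y : \<Omega>"
 shows "card {g : GL n. act g x = y} * card \<Omega> = card (GL n :: ('a vec => _) set)"
proof -
 let ?S = "%y. {g : GL n. act g x = y}"
 have finS: "finite (?S z)" for z by (rule finite_subset[OF _ finite_GL]) blast
 have le: "card (?S z) <= card (?S z')" if z: "z : \<Omega>" "z' : \<Omega>" for z z'
 proof -
  obtain h where h: "h : GL n" "act h z = z'" using trans[OF z] by blast
  have "(%g. h \<circ> g) ` ?S z <= ?S z'" using h comp xy by (auto intro: GL_comp)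
  moreover have "inj_on (%g. h \<circ> g) (?S z)" using bij_is_inj[OF GL_bij[OF h(1)]] by (auto intro!: inj_onI simp: fun_eq_iff inj_def)
  ultimately show ?thesis using finS[of z'] card_inj_on_le by blast
 qed
 have "card (GL n :: ('a vec => _) set) = (SUM z:\<Omega>. card (?S z))" by (rule card_fibers[OF finite_GL fin]) (rule cl[OF _ xy(1)])
 also have "... = (SUM z:\<Omega>. card (?S y))" using le xy by (intro sum.cong refl) (simp add: order_antisym)
 finally show ?thesis by simp
qed

lemma real_card_pos: "real CARD('a::{field,finite}) > 0" using card_field_ge2[where 'a='a] by linarith

lemma kap_pos: "kap CARD('a::{field,finite}) s > 0" using kap_ge1[of "CARD('a)" s] card_field_ge2[where 'a='a] by linarith

text \<open>For uniform \<open>g\<close> the pair of \<open>g\<close> R\<open>and\<close>g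
  \<open>W\<close> is uniform on its orbit. By \<open>card_Gr_meet_ge\<close> the orbit contains
  many partners for every first component, whereas \<open>F\<close> has total mass at most
  \<open>c\<close> for each; the quotient bounds the average. The larger the intersection of
  \<open>R\<close> and \<open>W\<close>, the weaker the bound.\<close>

lemma sum_GL_pair:
 fixes F :: "'a::{field,finite} vs => 'a vs => real"
 assumes R: "R : Gr n r" and W: "W : Gr n w" and j: "card (R Int W) = CARD('a) ^ j" "j <= w" "j <= r"
  and n: "w <= s" "r <= s" "2 * s < n"
  and F: "!!R1 W1. F R1 W1 >= 0" "!!R1. R1 : Gr n r ==> (SUM W1:Gr n w. F R1 W1) <= c"
 shows "(SUM g:GL n. F (g ` R) (g ` W)) * (real CARD('a) ^ n / kap CARD('a) s) ^ (w - j)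
  <= c * card (GL n :: ('a vec => _) set)"
proof -
 define P where "P = {p : (Gr n r :: 'a vs set) \<times> Gr n w. card (fst p Int snd p) = CARD('a) ^ j}"
 define act where "act g p = (g ` fst p, g ` snd p)" for g :: "'a vec => nat => 'a" and p :: "'a vs \<times> 'a vs"
 let ?F = "%p. F (fst p) (snd p)"
 let ?L = "(real CARD('a) ^ n / kap CARD('a) s) ^ (w - j)"
 let ?G = "GL n :: ('a vec => nat => 'a) set"
 have finP: "finite P" unfolding P_def by (rule finite_subset[of _ "Gr n r \<times> Gr n w"]) (blast, intro finite_cartesian_product finite_Gr)
 have cl: "act g p : P" if "g : GL n" "p : P" for g p using that by (auto simp: P_def act_def GL_Gr GL_Int[symmetric] GL_card)
 have comp: "act (g \<circ> h) p = act g (act h p)" for g h p by (simp add: act_def image_comp)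
 have trans: "EX g:GL n. act g p = p'" if p: "p : P" "p' : P" for p p'
 proof -
  have 1: "fst p : Gr n r" "snd p : Gr n w" "fst p' : Gr n r" "snd p' : Gr n w"
  "card (fst p Int snd p) = card (fst p' Int snd p')" using p unfolding P_def by fastforce+
  obtain g where "g : GL n" "g ` fst p = fst p'" "g ` snd p = snd p'" by (rule GL_pair_transitive[OF GrD(1,2)[OF 1(1)] GrD(1,2)[OF 1(2)] GrD(1,2)[OF 1(3)] GrD(1,2)[OF 1(4)]])
  (use GrD(5)[OF 1(1)] GrD(5)[OF 1(2)] GrD(5)[OF 1(3)] GrD(5)[OF 1(4)] 1(5) in simp_all)
  then show ?thesis by (intro bexI[of _ g]) (simp_all add: act_def)
 qed
 have p0: "(R, W) : P" using R W j by (simp add: P_def)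
 have orb: "real (card {g : ?G. act g (R, W) = p}) * card P = card ?G" if "p : P" for p
 proof -
  have "card {g : ?G. act g (R, W) = p} * card P = card ?G" by (rule orbit_count[OF finP cl comp trans p0 that])
  then show ?thesis by (simp only: of_nat_mult[symmetric])
 qed
 have "(SUM g:?G. F (g ` R) (g ` W)) = (SUM g:?G. ?F (act g (R, W)))" by (simp add: act_def)
 also have "... = (SUM p:P. SUM g:{g : ?G. act g (R, W) = p}. ?F (act g (R, W)))" by (rule sum.group[symmetric]) (use finite_GL finP cl[OF _ p0] in auto)
 also have "... = (SUM p:P. card {g : ?G. act g (R, W) = p} * ?F p)" by (rule sum.cong) auto
 finally have e0: "(SUM g:?G. F (g ` R) (g ` W)) = (SUM p:P. card {g : ?G. act g (R, W) = p} * ?F p)" .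
 have "(SUM g:?G. F (g ` R) (g ` W)) * card P
  = (SUM p:P. card {g : ?G. act g (R, W) = p} * ?F p * card P)" unfolding e0 by (rule sum_distrib_right)
 also have "... = (SUM p:P. card ?G * ?F p)"
 proof (rule sum.cong[OF refl])
  fix p assume p: "p : P"
  have "card {g : ?G. act g (R, W) = p} * ?F p * card P
  = (real (card {g : ?G. act g (R, W) = p}) * card P) * ?F p" by (simp only: mult_ac)
  then show "card {g : ?G. act g (R, W) = p} * ?F p * card P = card ?G * ?F p" by (simp only: orb[OF p])
 qed
 also have "... = card ?G * (SUM p:P. ?F p)" by (rule sum_distrib_left[symmetric])
 finally have e1: "(SUM g:?G. F (g ` R) (g ` W)) * card P = card ?G * (SUM p:P. ?F p)" .
 have "(SUM p:P. ?F p) <= (SUM p:Gr n r \<times> Gr n w. ?F p)" using F(1) by (intro sum_mono2) (auto simp: P_def finite_Gr)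
 also have "... = (SUM R1:Gr n r. SUM W1:Gr n w. F R1 W1)" by (simp add: sum.cartesian_product split_def)
 also have "... <= (SUM R1:(Gr n r :: 'a vs set). c)" using F(2) by (intro sum_mono) auto
 finally have e2: "(SUM p:P. ?F p) <= card (Gr n r :: 'a vs set) * c" by simp
 have Pe: "card P = (SUM R1:Gr n r. card {p : P. fst p = R1})" by (rule card_fibers) (auto simp: finP finite_Gr P_def)
 have "?L <= real (card {p : P. fst p = R1})" if R1: "R1 : Gr n r" for R1
 proof -
  obtain U where U: "U : Gr n j" "U <= R1" using subspace_of_dim[OF R1 j(3)] .
  have "?L <= real (card {W1 : Gr n w. W1 Int R1 = U})" by (rule card_Gr_meet_ge[OF U(1) R1 U(2) j(2) n])
  also have "... <= real (card {p : P. fst p = R1})"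
  proof (rule of_nat_mono, rule card_inj_on_le[of "Pair R1"])
  show "Pair R1 ` {W1 : Gr n w. W1 Int R1 = U} <= {p : P. fst p = R1}" using R1 GrD(5)[OF U(1)] by (auto simp: P_def Int_commute)
  show "inj_on (Pair R1) {W1 : Gr n w. W1 Int R1 = U}" by (rule inj_onI) simp
  qed (simp add: finP)
  finally show ?thesis .
 qed
 then have "(SUM R1:(Gr n r :: 'a vs set). ?L) <= (SUM R1:Gr n r. real (card {p : P. fst p = R1}))" by (rule sum_mono)
 then have e3: "card (Gr n r :: 'a vs set) * ?L <= card P" by (simp add: Pe)
 have S0: "(SUM g:?G. F (g ` R) (g ` W)) >= 0" using F(1) by (simp add: sum_nonneg)
 have gp: "real (card (Gr n r :: 'a vs set)) > 0" using R finite_Gr[of n r, where 'a='a] by (auto simp: card_gt_0_iff)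
 have "(SUM g:?G. F (g ` R) (g ` W)) * ?L * card (Gr n r :: 'a vs set)
  <= (SUM g:?G. F (g ` R) (g ` W)) * card P" using mult_left_mono[OF e3 S0] by (simp only: mult_ac)
 also have "... <= card ?G * (card (Gr n r :: 'a vs set) * c)" unfolding e1 by (rule mult_left_mono[OF e2]) simp
 also have "... = c * card ?G * card (Gr n r :: 'a vs set)" by (simp only: mult_ac)
 finally show ?thesis using gp by (rule mult_right_le_imp_le)
qed

lemma hyperplane_above:
 fixes U R :: "'a::{field,finite} vs"
 assumes "U : Gr n j" "R : Gr n (Suc w)" "U <= R" "j <= w"
 obtains W where "W : Gr n w" "U <= W" "W <= R"
proof -
 obtain W v where "W : Gr n w" "U <= W" "R = nv.span (insert v W)" using hyperplane_between[OF GrD(1)[OF assms(1)] assms(3,2)] GrD(3)[OF assms(1)] assms(4) by metis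
 then show ?thesis using that nv.span_superset[of "insert v W"] by blast
qed

text \<open>Every \<open>R\<close> above \<open>U\<close> contains a w-space above \<open>U\<close>,
  and there are at most q^(n(w-j)) of these.\<close>

lemma sum_above_le:
 fixes A :: "'a::{field,finite} vs => real"
 assumes A: "!!R. A R >= 0"
  and D: "!!W. W : Gr n w ==> (SUM R:{R : Gr n (Suc w). W <= R}. A R) <= D" "D >= 0"
  and U: "U : Gr n j" "j <= w"
 shows "(SUM R:{R : Gr n (Suc w). U <= R}. A R) <= real CARD('a) ^ (n * (w - j)) * D"
proof -
 let ?Ws = "{W : Gr n w. U <= W}"
 have "(SUM R:{R : Gr n (Suc w). U <= R}. A R)
  <= (SUM R:{R : Gr n (Suc w). U <= R}. SUM W:?Ws. if W <= R then A R else 0)"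
 proof (rule sum_mono)
  fix R assume "R : {R : Gr n (Suc w). U <= R}"
  then obtain W where W: "W : Gr n w" "U <= W" "W <= R" using hyperplane_above[OF U(1) _ _ U(2)] by blast
  then have "A R = (if W <= R then A R else 0)" by simp
  also have "... <= (SUM W:?Ws. if W <= R then A R else 0)" by (rule member_le_sum) (use W A in \<open>auto simp: finite_Gr\<close>)
  finally show "A R <= (SUM W:?Ws. if W <= R then A R else 0)" .
 qed
 also have "... <= (SUM R:Gr n (Suc w). SUM W:?Ws. if W <= R then A R else 0)"
 proof (rule sum_mono2)
  fix R show "0 <= (SUM W:?Ws. if W <= R then A R else 0)" by (rule sum_nonneg) (simp add: A)
 qed (auto simp: finite_Gr)
 also have "... = (SUM W:?Ws. SUM R:{R : Gr n (Suc w). W <= R}. A R)" by (subst sum.swap) (simp add: sum.inter_filter finite_Gr)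
 also have "... <= (SUM W:?Ws. D)" using D by (intro sum_mono) auto
 also have "... = real (card ?Ws) * D" by simp
 also have "... <= real (CARD('a) ^ (n * (w - j))) * D" using card_Gr_above_le[OF U] D(2) by (intro mult_right_mono) (simp_all only: of_nat_le_iff)
 finally show ?thesis by simp
qed

text \<open>The first factor bounds the number of possible intersections \<open>R Int W\<close>, the
  second the loss in \<open>sum_GL_pair\<close> for one of them.\<close>

definition csym :: "nat => nat => real" where
 "csym q s = 2 ^ (q ^ s) * kap q s ^ s"

text \<open>Group the \<open>R\<close> by U = \<open>R Int W\<close>. The weight above U is at most
  q^(n(w - dim U)) times \<open>D\<close>, and each such \<open>R\<close> has average about q^(-n(w
  - dim U)) times \<open>c\<close>, so the powers cancel. In this way a degree bound for
  \<open>A\<close> passes to randomly rotated decoders or gadgets of which only the total mass per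
  space is bounded.\<close>

lemma sum_GL_weighted:
 fixes F :: "'a::{field,finite} vs => 'a vs => real"
 assumes W: "W : Gr n w" and n: "Suc w <= s" "2 * s < n"
  and F: "!!R1 W1. F R1 W1 >= 0" "!!R1. R1 : Gr n (Suc w) ==> (SUM W1:Gr n w. F R1 W1) <= c" "c >= 0"
  and A: "!!R. A R >= 0"
  and D: "!!W. W : Gr n w ==> (SUM R:{R : Gr n (Suc w). W <= R}. A R) <= D" "D >= 0"
 shows "(SUM R:Gr n (Suc w). A R * (SUM g:GL n. F (g ` R) (g ` W)))
  <= card (GL n :: ('a vec => _) set) * (csym CARD('a) s * c * D)"
proof -
 let ?q = "real CARD('a)" and ?k = "kap CARD('a) s"
 let ?G = "GL n :: ('a vec => nat => 'a) set"
 define \<U> where "\<U> = {U. nsub U & U <= W}"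
 note W' = GrD[OF W]
 have k1: "?k >= 1" using kap_ge1[of "CARD('a)" s] card_field_ge2[where 'a='a] by linarith
 have q0: "?q > 0" by (rule real_card_pos)
 have finU: "finite \<U>" unfolding \<U>_def by (rule finite_subset[of _ "Pow W"]) (auto simp: W'(4))
 have cU: "real (card \<U>) <= 2 ^ (CARD('a) ^ s)"
 proof -
  have "card \<U> <= card (Pow W)" unfolding \<U>_def by (rule card_mono) (auto simp: W'(4))
  also have "... = 2 ^ (CARD('a) ^ w)" by (simp add: card_Pow W')
  also have "... <= 2 ^ (CARD('a) ^ s)" using n(1) card_field_ge2[where 'a='a] by (intro power_increasing) auto
  finally show ?thesis by (metis of_nat_le_iff of_nat_numeral of_nat_power)
 qed
 have Ud: "U : Gr n (nv.dim U)" "nv.dim U <= w" if "U : \<U>" for U using that W' dim_le_of_subset(1)[of U W n] by (auto simp: \<U>_def intro!: subspace_inGr)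
 have each: "A R * (SUM g:?G. F (g ` R) (g ` W))
  <= card ?G * c * ?k ^ s * (SUM U:\<U>. (if U <= R then A R / ?q ^ (n * (w - nv.dim U)) else 0))"
  if R: "R : Gr n (Suc w)" for R
 proof -
  let ?U = "R Int W"
  have U: "?U : \<U>" using GrD(1)[OF R] W' nv.subspace_inter by (auto simp: \<U>_def)
  let ?j = "nv.dim ?U"
  have cj: "card ?U = CARD('a) ^ ?j" using GrD(5)[OF Ud(1)[OF U]] .
  have L: "(?q ^ n / ?k) ^ (w - ?j) = ?q ^ (n * (w - ?j)) / ?k ^ (w - ?j)" by (simp add: power_divide power_mult)
  have "(SUM g:?G. F (g ` R) (g ` W)) * (?q ^ n / ?k) ^ (w - ?j) <= c * card ?G" by (rule sum_GL_pair[OF R W cj]) (use Ud(2)[OF U] n F in auto)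
  then have "(SUM g:?G. F (g ` R) (g ` W)) <= c * card ?G * ?k ^ (w - ?j) / ?q ^ (n * (w - ?j))"
  proof -
  have arith: "a * (b / d) <= e ==> b > 0 ==> d > 0 ==> a <= e * d / b" for a b d e :: real by (simp add: field_simps)
  assume "(SUM g:?G. F (g ` R) (g ` W)) * (?q ^ n / ?k) ^ (w - ?j) <= c * card ?G"
  then show ?thesis unfolding L by (rule arith) (use q0 k1 in auto)
  qed
  also have "... <= c * card ?G * ?k ^ s / ?q ^ (n * (w - ?j))" using k1 n(1) F(3) q0 by (intro divide_right_mono mult_left_mono power_increasing) auto
  finally have "A R * (SUM g:?G. F (g ` R) (g ` W)) <= A R * (c * card ?G * ?k ^ s / ?q ^ (n * (w - ?j)))" using A by (rule mult_left_mono)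
  also have "... = card ?G * c * ?k ^ s * (if ?U <= R then A R / ?q ^ (n * (w - ?j)) else 0)" by (simp only: Int_lower1 if_True times_divide_eq_right mult_ac)
  also have "... <= card ?G * c * ?k ^ s * (SUM U:\<U>. (if U <= R then A R / ?q ^ (n * (w - nv.dim U)) else 0))"
  using A q0 F(3) k1 by (intro mult_left_mono member_le_sum[OF U]) (auto simp: finU)
  finally show ?thesis .
 qed
 have "(SUM R:Gr n (Suc w). A R * (SUM g:?G. F (g ` R) (g ` W)))
  <= (SUM R:Gr n (Suc w). card ?G * c * ?k ^ s * (SUM U:\<U>. (if U <= R then A R / ?q ^ (n * (w - nv.dim U)) else 0)))" by (rule sum_mono) (rule each)
 also have "... = card ?G * c * ?k ^ s * (SUM U:\<U>. SUM R:Gr n (Suc w). (if U <= R then A R / ?q ^ (n * (w - nv.dim U)) else 0))"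
  by (subst sum.swap) (simp add: sum_distrib_left)
 also have "... <= card ?G * c * ?k ^ s * (SUM U:\<U>. D)"
 proof (intro mult_left_mono sum_mono)
  fix U assume U: "U : \<U>"
  have "(SUM R:Gr n (Suc w). (if U <= R then A R / ?q ^ (n * (w - nv.dim U)) else 0))
  = (SUM R:{R : Gr n (Suc w). U <= R}. A R) / ?q ^ (n * (w - nv.dim U))" by (simp add: sum.inter_filter[symmetric] finite_Gr sum_divide_distrib)
  also have "... <= D" using sum_above_le[of A n w D, OF A D Ud[OF U]] q0 by (simp add: divide_le_eq mult.commute)
  finally show "(SUM R:Gr n (Suc w). (if U <= R then A R / ?q ^ (n * (w - nv.dim U)) else 0)) <= D" .
 qed (use F(3) k1 in auto)
 also have "... = card ?G * c * ?k ^ s * (card \<U> * D)" by simp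
 also have "... <= card ?G * c * ?k ^ s * (2 ^ (CARD('a) ^ s) * D)" using cU F(3) k1 D(2) by (intro mult_left_mono mult_right_mono) auto
 finally show ?thesis by (simp only: csym_def mult_ac)
qed

section \<open>Selection by exponential potentials\<close>

lemma exists_le_average:
 fixes f :: "'o => real" and c :: real
 assumes "finite S" "S ~= {}" "(SUM x:S. f x) <= card S * c"
 obtains x where "x : S" "f x <= c"
proof -
 have "EX x:S. f x <= c"
 proof (rule ccontr)
  assume "\<not> (EX x:S. f x <= c)"
  then have "(SUM x:S. c) < (SUM x:S. f x)" by (intro sum_strict_mono assms(1,2)) auto
  then show False using assms(3) by simp
 qed
 then show ?thesis using that by blast
qed

lemma exp_le_linear: "0 <= t ==> t <= 1 ==> exp t <= 1 + 2 * (t :: real)"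
proof -
 assume t: "0 <= t" "t <= 1"
 have "exp t <= 1 + t + t\<^sup>2" using exp_bound[OF t] .
 moreover have "t\<^sup>2 <= t" using t by (simp add: power2_eq_square mult_left_le)
 ultimately show ?thesis by linarith
qed

text \<open>The method of conditional expectations. For t in [0,1] one has exp t <= 1 + 2t <= exp
  (2t), so normalising by twice the mean keeps the average over \<open>Op x\<close> from raising the
  potential. \<open>K\<close> carries the factors of choices already made through the
  induction.\<close>

lemma select_potential:
 fixes w :: "'x => 'o => 'z => real"
 assumes X: "finite X" and Z: "finite Z" and B: "B > 0"
  and Op: "!!x. x : X ==> finite (Op x) & Op x ~= {}"
  and w: "!!x p z. x : X ==> p : Op x ==> z : Z ==> 0 <= w x p z & w x p z <= B"
  and K: "!!z. z : Z ==> K z >= 0"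
 shows "EX f. (ALL x:X. f x : Op x) &
  (SUM z:Z. K z * exp (SUM x:X. w x (f x) z / B - 2 * ((SUM p:Op x. w x p z) / card (Op x)) / B)) <= (SUM z:Z. K z)" using X Op w K
proof (induction X arbitrary: K)
 case empty
 then show ?case by simp
next
 case (insert x X)
 define a where "a z = (SUM p:Op x. w x p z) / card (Op x)" for z
 define e where "e p z = w x p z / B - 2 * a z / B" for p z
 have Ox: "finite (Op x)" "Op x ~= {}" using insert.prems(1)[of x] by auto
 have c: "real (card (Op x)) > 0" using Ox by (simp add: card_gt_0_iff)
 have avg: "(SUM p:Op x. exp (e p z)) <= card (Op x)" if z: "z : Z" for z
 proof -
  have "exp (w x p z / B) <= 1 + 2 * (w x p z / B)" if "p : Op x" for p using insert.prems(2)[of x p z] that z B by (intro exp_le_linear) auto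
  then have "(SUM p:Op x. exp (w x p z / B)) <= (SUM p:Op x. 1 + 2 * (w x p z / B))" by (rule sum_mono)
  also have "... = card (Op x) + 2 * ((SUM p:Op x. w x p z) / B)" by (simp add: sum.distrib sum_distrib_left sum_divide_distrib)
  also have "... = card (Op x) * (1 + 2 * a z / B)"
  proof -
  have A: "(SUM p:Op x. w x p z) = card (Op x) * a z" using c by (simp add: a_def)
  show ?thesis unfolding A by (simp only: distrib_left mult_1_right times_divide_eq_right mult_ac)
  qed
  also have "... <= card (Op x) * exp (2 * a z / B)" by (intro mult_left_mono exp_ge_add_one_self) simp
  finally have m: "(SUM p:Op x. exp (w x p z / B)) <= card (Op x) * exp (2 * a z / B)" .
  have "(SUM p:Op x. exp (e p z)) = (SUM p:Op x. exp (w x p z / B)) / exp (2 * a z / B)" by (simp add: e_def exp_diff sum_divide_distrib)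
  also have "... <= card (Op x)" using m by (simp add: divide_le_eq)
  finally show ?thesis .
 qed
 have "(SUM p:Op x. SUM z:Z. K z * exp (e p z)) = (SUM z:Z. K z * (SUM p:Op x. exp (e p z)))" by (subst sum.swap) (simp add: sum_distrib_left)
 also have "... <= (SUM z:Z. K z * card (Op x))" using avg insert.prems(3) by (intro sum_mono mult_left_mono) auto
 also have "... = card (Op x) * (SUM z:Z. K z)" by (simp only: sum_distrib_right[symmetric] mult.commute)
 finally obtain p where p: "p : Op x" "(SUM z:Z. K z * exp (e p z)) <= (SUM z:Z. K z)" using exists_le_average[OF Ox] by blast
 obtain f where f: "ALL x:X. f x : Op x"
  "(SUM z:Z. (K z * exp (e p z)) * exp (SUM x:X. w x (f x) z / B - 2 * ((SUM p:Op x. w x p z) / card (Op x)) / B))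
  <= (SUM z:Z. K z * exp (e p z))" using insert.IH[of "%z. K z * exp (e p z)"] insert.prems by auto
 let ?f = "f(x := p)"
 have ff: "?f y = f y" if "y : X" for y using that insert.hyps(2) by auto
 have "(SUM z:Z. K z * exp (SUM y:insert x X. w y (?f y) z / B - 2 * ((SUM p:Op y. w y p z) / card (Op y)) / B))
  = (SUM z:Z. (K z * exp (e p z)) * exp (SUM x:X. w x (f x) z / B - 2 * ((SUM p:Op x. w x p z) / card (Op x)) / B))"
 proof (rule sum.cong[OF refl])
  fix z
  have "(SUM y:X. w y (?f y) z / B - 2 * ((SUM p:Op y. w y p z) / card (Op y)) / B)
  = (SUM y:X. w y (f y) z / B - 2 * ((SUM p:Op y. w y p z) / card (Op y)) / B)" by (rule sum.cong[OF refl]) (simp only: ff)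
  then show "K z * exp (SUM y:insert x X. w y (?f y) z / B - 2 * ((SUM p:Op y. w y p z) / card (Op y)) / B)
  = (K z * exp (e p z)) * exp (SUM x:X. w x (f x) z / B - 2 * ((SUM p:Op x. w x p z) / card (Op x)) / B)" using insert.hyps by (simp add: exp_add e_def a_def)
 qed
 also have "... <= (SUM z:Z. K z)" using f(2) p(2) by linarith
 finally show ?case using f(1) p(1) ff by (intro exI[of _ ?f]) auto
qed

text \<open>With all weights 1 the final potential is at most \<open>card Z\<close>, hence every
  single exponent is at most \<open>ln (card Z)\<close>. This is a Chernoff bound together with a
  union bound over \<open>Z\<close>.\<close>

lemma select:
 fixes w :: "'x => 'o => 'z => real"
 assumes X: "finite X" and Z: "finite Z" and B: "B > 0"
  and Op: "!!x. x : X ==> finite (Op x) & Op x ~= {}"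
  and w: "!!x p z. x : X ==> p : Op x ==> z : Z ==> 0 <= w x p z & w x p z <= B"
 obtains f where "!!x. x : X ==> f x : Op x"
  "!!z. z : Z ==> (SUM x:X. w x (f x) z) <= 2 * (SUM x:X. (SUM p:Op x. w x p z) / card (Op x)) + B * ln (card Z)"
proof -
 define E where "E f z = (SUM x:X. w x (f x) z / B - 2 * ((SUM p:Op x. w x p z) / card (Op x)) / B)" for f z
 have "EX f. (ALL x:X. f x : Op x) & (SUM z:Z. 1 * exp (E f z)) <= (SUM z:Z. 1)" unfolding E_def by (rule select_potential[where K = "%_. 1", OF X Z B Op w]) simp_all
 then obtain f where f: "ALL x:X. f x : Op x" "(SUM z:Z. 1 * exp (E f z)) <= (SUM z:Z. 1)" by blast
 have "(SUM x:X. w x (f x) z) <= 2 * (SUM x:X. (SUM p:Op x. w x p z) / card (Op x)) + B * ln (card Z)" if z: "z : Z" for z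
 proof -
  have "exp (E f z) <= (SUM z:Z. exp (E f z))" by (rule member_le_sum[OF z _ Z]) simp
  also have "... <= card Z" using f(2) by simp
  finally have "E f z <= ln (card Z)" using z Z by (subst ln_ge_iff) (auto simp: card_gt_0_iff)
  then have "B * E f z <= B * ln (card Z)" using B by simp
  moreover have "B * E f z = (SUM x:X. w x (f x) z) - 2 * (SUM x:X. (SUM p:Op x. w x p z) / card (Op x))"
  proof -
  have "B * (w x (f x) z / B - 2 * ((SUM p:Op x. w x p z) / card (Op x)) / B)
  = w x (f x) z - 2 * ((SUM p:Op x. w x p z) / card (Op x))" for x using B by (simp only: right_diff_distrib) simp
  then have "B * E f z = (SUM x:X. w x (f x) z - 2 * ((SUM p:Op x. w x p z) / card (Op x)))" unfolding E_def sum_distrib_left by (intro sum.cong refl)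
  then show ?thesis by (simp only: sum_subtractf sum_distrib_left)
  qed
  ultimately show ?thesis by linarith
 qed
 then show ?thesis using that f(1) by blast
qed

section \<open>The boundary map and degrees\<close>

lemma boundary_lincomb:
 fixes f :: "'i => 'a::{field,finite} vs => int"
 shows "boundary n t u (%T. SUM i:I. c i * f i T) = (%V. SUM i:I. c i * boundary n t u (f i) V)"
proof
 fix V :: "'a vs"
 show "boundary n t u (%T. SUM i:I. c i * f i T) V = (SUM i:I. c i * boundary n t u (f i) V)" unfolding boundary_apply by (subst sum.swap) (simp add: sum_distrib_left)
qed

lemma boundary_add:
 fixes f g :: "'a::{field,finite} vs => int"
 shows "boundary n t u (%T. f T + g T) = (%V. boundary n t u f V + boundary n t u g V)" by (rule ext) (simp add: boundary_apply sum.distrib)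

lemma boundary_diff:
 fixes f g :: "'a::{field,finite} vs => int"
 shows "boundary n t u (%T. f T - g T) = (%V. boundary n t u f V - boundary n t u g V)" by (rule ext) (simp add: boundary_apply sum_subtractf)

lemma boundary_cmul:
 fixes f :: "'a::{field,finite} vs => int"
 shows "boundary n t u (%T. c * f T) = (%V. c * boundary n t u f V)" by (rule ext) (simp add: boundary_apply sum_distrib_left)

lemma boundary_sum:
 fixes f :: "'i => 'a::{field,finite} vs => int"
 shows "boundary n t u (%T. SUM i:I. f i T) = (%V. SUM i:I. boundary n t u (f i) V)" using boundary_lincomb[of n t u "%_. 1" f I] by simp

lemma boundary_unit:
 assumes "S : Gr n t"
 shows "boundary n t u (unit_vec S) V = (if V : Gr n u & V <= (S :: 'a::{field,finite} vs) then 1 else 0)"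
proof -
 have "finite {T : Gr n t. V <= T}" by (rule finite_subset[OF _ finite_Gr[of n t]]) blast
 then have "(SUM T:{T : Gr n t. V <= T}. unit_vec S T) = (if V <= S then 1 else 0)" using assms unfolding unit_vec_def by (subst sum.delta) auto
 then show ?thesis by (simp only: boundary_apply) simp
qed



lemma ZGr_expand:
 fixes f :: "'a::{field,finite} vs => int"
 assumes "f : ZGr n t" shows "f = (%T. SUM S:Gr n t. f S * unit_vec S T)"
proof
 fix T
 have "(SUM S:Gr n t. f S * unit_vec S T) = (SUM S:Gr n t. if T = S then f S else 0)" by (rule sum.cong) (auto simp: unit_vec_def)
 also have "... = f T" using assms finite_Gr[of n t, where 'a='a] by (simp add: ZGr_def)
 finally show "f T = (SUM S:Gr n t. f S * unit_vec S T)" by simp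
qed

lemma unit_vec_ZGr: "S : Gr n t ==> unit_vec S : ZGr n t" by (auto simp: ZGr_def unit_vec_def)

lemma boundary_push:
 fixes f :: "'a::{field,finite} vs => int"
 assumes g: "g : GL n"
 shows "boundary n t u (%T. f (g ` T)) V = boundary n t u f (g ` V)"
proof -
 have "(SUM T:{T : Gr n t. V <= T}. f (g ` T)) = (SUM T:{T : Gr n t. g ` V <= T}. f T)"
 proof (rule sum.reindex_bij_witness[of _ "(`) (inv g)" "(`) g"])
  fix T assume "T : {T : Gr n t. V <= T}"
  then show "inv g ` g ` T = T" "g ` T : {T : Gr n t. g ` V <= T}" "f (g ` T) = f (g ` T)" using GL_inv_image(1)[OF g] GL_Gr[OF g] by auto
 next
  fix T assume T: "T : {T : Gr n t. g ` V <= T}"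
  then show "g ` inv g ` T = T" using GL_inv_image(2)[OF g] by auto
  have "inv g ` g ` V <= inv g ` T" using T by blast
  then show "inv g ` T : {T : Gr n t. V <= T}" using GL_inv_image(1)[OF g] GL_Gr[OF GL_inv[OF g]] T by auto
 qed
 then show ?thesis by (simp only: boundary_apply GL_Gr_iff[OF g])
qed

lemma push_ZGr:
 fixes f :: "'a::{field,finite} vs => int"
 assumes "g : GL n" "f : ZGr n t" shows "(%T. f (g ` T)) : ZGr n t" using assms(2) by (simp add: ZGr_def GL_Gr_iff[OF assms(1)])

text \<open>The working measure of size, taken at spaces of dimension r - 1. It ignores signs and so
  controls positive and negative parts together, and it is subadditive;
  \<open>bounded_vec_deg\<close> and \<open>bounded_vec_of_deg\<close> translate from and to
  boundedness.\<close>

definition deg :: "nat => nat => ((nat => 'a::field) set => int) => 'a vs => real" where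
 "deg n s f W = (SUM S:{S : Gr n s. W <= S}. \<bar>rint (f S)\<bar>)"

lemma deg_nonneg: "deg n s f W >= 0" unfolding deg_def by (rule sum_nonneg) simp

lemma deg_add: "deg n s (%S. f S + g S) W <= deg n s f W + deg n s g W" unfolding deg_def sum.distrib[symmetric] by (rule sum_mono) simp

lemma deg_sum_le: "finite I ==> deg n s (%S. SUM i:I. f i S) W <= (SUM i:I. deg n s (f i) W)" unfolding deg_def by (subst sum.swap) (intro sum_mono, simp add: sum_abs)

lemma sup_norm_ge:
 fixes f :: "'a::{field,finite} vs => int"
 assumes "f : ZGr n t" shows "\<bar>rint (f T)\<bar> <= sup_norm f" unfolding sup_norm_def
proof (rule cSUP_upper)
 have "range (%T. \<bar>rint (f T)\<bar>) <= insert 0 ((%T. \<bar>rint (f T)\<bar>) ` Gr n t)" using assms by (auto simp: ZGr_def)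
 then have "finite (range (%T. \<bar>rint (f T)\<bar>))" by (rule finite_subset) (simp add: finite_Gr)
 then show "bdd_above (range (%T. \<bar>rint (f T)\<bar>))" by (rule bdd_above_finite)
qed simp

text \<open>The degree at \<open>W\<close> is the difference of the boundaries of the two parts,
  which have opposite signs; hence the 2.\<close>

lemma bounded_vec_deg:
 fixes J :: "'a::{field,finite} vs => int"
 assumes "bounded_vec n r tht J" "W : Gr n (r - 1)"
 shows "deg n r J W <= 2 * (tht * real CARD('a) ^ n)"
proof -
 have b: "\<bar>rint (boundary n r (r - 1) (pos_part J) W)\<bar> <= tht * real CARD('a) ^ n"
  "\<bar>rint (boundary n r (r - 1) (neg_part J) W)\<bar> <= tht * real CARD('a) ^ n"
  using assms(1) sup_norm_ge[OF boundary_in_ZGr] unfolding bounded_vec_def by (meson order_trans)+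
 have p: "rint (boundary n r (r - 1) (pos_part J) W) = (SUM S:{S : Gr n r. W <= S}. rint (pos_part J S))"
  and m: "rint (boundary n r (r - 1) (neg_part J) W) = (SUM S:{S : Gr n r. W <= S}. rint (neg_part J S))" using assms(2) by (simp_all only: boundary_apply if_True of_int_sum)
 have "deg n r J W = rint (boundary n r (r - 1) (pos_part J) W) - rint (boundary n r (r - 1) (neg_part J) W)"
  unfolding deg_def p m sum_subtractf[symmetric] by (rule sum.cong) (auto simp: pos_part_def neg_part_def)
 then show ?thesis using b by linarith
qed

lemma card_subsets_le:
 assumes "S : Gr n s" shows "card {R. R : Gr n r & P R & R <= (S :: 'a::{field,finite} vs)} <= 2 ^ (CARD('a) ^ s)"
proof -
 have "card {R. R : Gr n r & P R & R <= S} <= card (Pow S)" by (rule card_mono) (use GrD(4)[OF assms] in auto)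
 also have "... = 2 ^ (CARD('a) ^ s)" using GrD[OF assms] by (simp add: card_Pow)
 finally show ?thesis .
qed

lemma deg_boundary_le:
 fixes f :: "'a::{field,finite} vs => int"
 shows "deg n r (boundary n s r f) W <= 2 ^ (CARD('a) ^ s) * deg n s f W"
proof -
 let ?c = "%S. {R. R : Gr n r & W <= R & R <= S}"
 have "deg n r (boundary n s r f) W <= (SUM R:{R : Gr n r. W <= R}. SUM S:{S : Gr n s. R <= S}. \<bar>rint (f S)\<bar>)" unfolding deg_def
 proof (rule sum_mono)
  fix R :: "'a vs" assume "R : {R : Gr n r. W <= R}"
  then have "boundary n s r f R = (SUM S:{S : Gr n s. R <= S}. f S)" by (simp only: boundary_apply mem_Collect_eq if_True)
  then show "\<bar>rint (boundary n s r f R)\<bar> <= (SUM S:{S : Gr n s. R <= S}. \<bar>rint (f S)\<bar>)" by (simp add: sum_abs)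
 qed
 also have "... = (SUM R:{R : Gr n r. W <= R}. SUM S:Gr n s. if R <= S then \<bar>rint (f S)\<bar> else 0)" by (simp add: sum.inter_filter finite_Gr)
 also have "... = (SUM S:Gr n s. SUM R:{R : Gr n r. W <= R}. if R <= S then \<bar>rint (f S)\<bar> else 0)" by (rule sum.swap)
 also have "... <= (SUM S:Gr n s. if W <= S then 2 ^ (CARD('a) ^ s) * \<bar>rint (f S)\<bar> else 0)"
 proof (rule sum_mono)
  fix S :: "'a vs" assume S: "S : Gr n s"
  have fin: "finite {R : Gr n r. W <= R}" by (rule finite_subset[OF _ finite_Gr[of n r]]) blast
  have "(SUM R:{R : Gr n r. W <= R}. if R <= S then \<bar>rint (f S)\<bar> else 0)
  = (SUM R:?c S. \<bar>rint (f S)\<bar>)" using fin by (simp add: sum.inter_filter[symmetric] conj_assoc)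
  also have "... = card (?c S) * \<bar>rint (f S)\<bar>" by simp
  also have "... <= (if W <= S then 2 ^ (CARD('a) ^ s) * \<bar>rint (f S)\<bar> else 0)"
  proof (cases "W <= S")
  case True
  have "real (card (?c S)) <= real (2 ^ (CARD('a) ^ s))" by (rule of_nat_mono) (rule card_subsets_le[OF S])
  then show ?thesis using True by (simp add: mult_right_mono)
  next
  case False
  then have "?c S = {}" by blast
  then have "card (?c S) = 0" by (simp only: card.empty)
  then show ?thesis using False by (simp only: if_False of_nat_0 mult_zero_left order_refl)
  qed
  finally show "(SUM R:{R : Gr n r. W <= R}. if R <= S then \<bar>rint (f S)\<bar> else 0)
  <= (if W <= S then 2 ^ (CARD('a) ^ s) * \<bar>rint (f S)\<bar> else 0)" .
 qed
 also have "... = 2 ^ (CARD('a) ^ s) * deg n s f W" unfolding deg_def by (simp add: sum.inter_filter[symmetric] finite_Gr sum_distrib_left)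
 finally show ?thesis .
qed

text \<open>Stated for any \<open>g\<close> dominated by \<open>f\<close>, so that it serves for the
  positive and the negative part of \<open>f\<close>. The factor \<open>2 ^ (CARD('a) ^ s)\<close>
  bounds the number of r-spaces in one s-space.\<close>

lemma bounded_vec_of_deg:
 fixes f g :: "'a::{field,finite} vs => int"
 assumes g: "!!S. \<bar>g S\<bar> <= \<bar>f S\<bar>" and D: "!!W. W : Gr n (r - 1) ==> deg n s f W <= D" "D >= 0"
  and tht: "2 ^ (CARD('a) ^ s) * D <= tht * real CARD('a) ^ n"
 shows "bounded_vec n r tht (boundary n s r g)"
proof -
 have b0: "2 ^ (CARD('a) ^ s) * D >= 0" using D(2) by simp
 have dg: "deg n r (boundary n s r g) W <= 2 ^ (CARD('a) ^ s) * D" if W: "W : Gr n (r - 1)" for W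
 proof -
  have "deg n s g W <= deg n s f W" unfolding deg_def by (rule sum_mono) (metis g of_int_abs of_int_le_iff)
  then have "deg n s g W <= D" using D(1)[OF W] by linarith
  then show ?thesis using deg_boundary_le[of n r s g W] by (smt (verit) mult_left_mono zero_le_power)
 qed
 have "sup_norm (boundary n r (r - 1) h) <= tht * real CARD('a) ^ n"
  if h: "!!R. \<bar>h R\<bar> <= \<bar>boundary n s r g R\<bar>" for h :: "'a vs => int" unfolding sup_norm_def
 proof (rule cSUP_least)
  fix W :: "'a vs"
  show "\<bar>rint (boundary n r (r - 1) h W)\<bar> <= tht * real CARD('a) ^ n"
  proof (cases "W : Gr n (r - 1)")
  case True
  then have "\<bar>rint (boundary n r (r - 1) h W)\<bar> = \<bar>SUM R:{R : Gr n r. W <= R}. rint (h R)\<bar>" by (simp only: boundary_apply if_True of_int_sum)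
  also have "... <= (SUM R:{R : Gr n r. W <= R}. \<bar>rint (h R)\<bar>)" by (rule sum_abs)
  also have "... <= deg n r (boundary n s r g) W" unfolding deg_def by (rule sum_mono) (metis h of_int_abs of_int_le_iff)
  finally show ?thesis using dg[OF True] tht by linarith
  next
  case False
  then have "boundary n r (r - 1) h W = 0" by (simp only: boundary_apply if_False)
  then show ?thesis using b0 tht by simp
  qed
 qed simp
 then show ?thesis unfolding bounded_vec_def using boundary_in_ZGr[of n s r g] by (simp add: pos_part_def neg_part_def)
qed

section \<open>Decoding: multiples of unit vectors as boundaries\<close>

definition coord :: "nat set => (nat => 'a::field) set" where
 "coord I = {v. ALL i. i ~: I --> v i = 0}"

lemma subspace_coord: "nsub (coord I)" by (auto simp: nv.subspace_def coord_def vscale_def)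

lemma coord_insert:
 "coord (insert j I) = nv.span (insert (%i. if i = j then 1 else 0) (coord I :: (nat => 'a::field) set))"
proof (intro set_eqI iffI)
 fix x :: "nat => 'a" assume "x : coord (insert j I)"
 then have "x - vscale (x j) (%i. if i = j then 1 else 0) : coord I" by (auto simp: coord_def vscale_def)
 then show "x : nv.span (insert (%i. if i = j then 1 else 0) (coord I))" unfolding nv.span_insert using nv.span_base by blast
next
 fix x :: "nat => 'a" assume x: "x : nv.span (insert (%i. if i = j then 1 else 0) (coord I))"
 have "nv.span (insert (%i. if i = j then 1 else 0) (coord I)) <= (coord (insert j I) :: 'a vs)" by (rule nv.span_minimal[OF _ subspace_coord]) (auto simp: coord_def)
 then show "x : coord (insert j I)" using x by blast
qed

lemma card_coord: "finite I ==> card (coord I :: 'a::{field,finite} vs) = CARD('a) ^ card I"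
proof (induction I rule: finite_induct)
 case empty
 have "(coord {} :: 'a vs) = {%_. 0}" by (auto simp: coord_def)
 then show ?case by simp
next
 case (insert j I)
 have sp: "nv.span (coord I) = (coord I :: 'a vs)" by (rule span_subspace_id[OF subspace_coord])
 have "(%i. if i = j then 1 else 0) ~: nv.span (coord I :: 'a vs)" unfolding sp using insert.hyps by (auto simp: coord_def)
 from card_span_insert[OF this] show ?case using insert by (simp add: coord_insert sp)
qed

lemma coord_Int: "coord I Int coord I' = coord (I Int I')" by (auto simp: coord_def)

lemma coord_mono: "I <= I' ==> coord I <= coord I'" by (auto simp: coord_def)

lemma nspace_coord: "nspace n = coord {..<n}" by (auto simp: nspace_def coord_def)

lemma coord_Gr: "I <= {..<n} ==> coord I : (Gr n (card I) :: 'a::{field,finite} vs set)" using card_coord[of I, where 'a='a] finite_subset[of I "{..<n}"]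
 by (simp add: Gr_iff subspace_coord nspace_coord coord_mono)

lemma nspace_Gr: "k <= n ==> nspace k : (Gr n k :: 'a::{field,finite} vs set)" using coord_Gr[of "{..<k}" n, where 'a='a] by (simp add: nspace_coord)

text \<open>Sum the images of an s-space that meets \<open>R0\<close> in dimension \<open>j\<close>
  over the stabiliser of \<open>R0\<close>. The boundary at \<open>V\<close> depends only on dim
  (\<open>V Int R0\<close>), is zero if this exceeds \<open>j\<close> and positive if it equals
  \<open>j\<close>. This is a triangular system with nonzero diagonal, solved by removing the
  smaller classes inductively. For \<open>j = r\<close> the class consists of \<open>R0\<close>
  alone.\<close>

lemma decode_triangular:
 fixes R0 :: "'a::{field,finite} vs"
 assumes R0: "R0 = nspace r" and rs: "r <= s" and j: "j <= r"
 shows "EX m>0. EX Ph : ZGr (r + s) s.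
  boundary (r + s) s r Ph = (%V. if V : Gr (r + s) r & card (V Int R0) = CARD('a) ^ j then m else 0)" using j
proof (induction j rule: less_induct)
 case (less j)
 let ?d = "r + s"
 \<comment> \<open>The first \<open>j\<close> coordinates lie in \<open>R0\<close>, the other
   \<open>s - j\<close> beyond it; the dimension \<open>r + s\<close> leaves room for them even when
   \<open>j = 0\<close>.\<close>
 define Sj where "Sj = (coord ({..<j} Un {r..<r + s - j}) :: 'a vs)"
 define Rj where "Rj i = (coord ({..<i} Un {r..<r + (r - i)}) :: 'a vs)" for i
 define St where "St = {g : GL ?d. g ` R0 = R0}"
 define c where "c V = card {g : St. V <= g ` Sj}" for V
 have fSt: "finite St" unfolding St_def by (rule finite_subset[OF _ finite_GL[of ?d]]) blast
 have c1: "card ({..<j} Un {r..<r + s - j}) = s" using less.prems rs by (subst card_Un_disjoint) auto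
 have SjG: "Sj : Gr ?d s"
 proof -
  have "{..<j} Un {r..<r + s - j} <= {..<r + s}"
  proof (rule subsetI)
  fix x assume "x : {..<j} Un {r..<r + s - j}"
  then have "x < j \<or> x < r + s - j" by auto
  then show "x : {..<r + s}" using less.prems rs by auto
  qed
  from coord_Gr[OF this, where 'a='a] show ?thesis unfolding Sj_def c1 .
 qed
 have R0G: "R0 : Gr ?d r" unfolding R0 by (rule nspace_Gr) simp
 have SjR0: "Sj Int R0 = nspace j"
 proof -
  have "({..<j} Un {r..<r + s - j}) Int {..<r} = {..<j}" using less.prems by auto
  then show ?thesis by (simp add: Sj_def R0 nspace_coord coord_Int)
 qed
 have RjG: "Rj i : Gr ?d r" "Rj i Int R0 = nspace i" if "i <= r" for i
 proof -
  have c2: "card ({..<i} Un {r..<r + (r - i)}) = r" using that by (subst card_Un_disjoint) auto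
  have "{..<i} Un {r..<r + (r - i)} <= {..<r + s}"
  proof (rule subsetI)
  fix x assume "x : {..<i} Un {r..<r + (r - i)}"
  then have "x < i \<or> x < r + (r - i)" by auto
  then show "x : {..<r + s}" using that rs by auto
  qed
  from coord_Gr[OF this, where 'a='a] show "Rj i : Gr ?d r" unfolding Rj_def c2 .
  have "({..<i} Un {r..<r + (r - i)}) Int {..<r} = {..<i}" using that by auto
  then show "Rj i Int R0 = nspace i" by (simp add: Rj_def R0 nspace_coord coord_Int)
 qed
 have cle: "c V <= c V'" if V: "V : Gr ?d r" "V' : Gr ?d r" "card (V Int R0) = card (V' Int R0)" for V V'
 proof -
  obtain h where h: "h : GL ?d" "h ` V = V'" "h ` R0 = R0" by (rule GL_pair_transitive[OF GrD(1,2)[OF V(1)] GrD(1,2)[OF R0G] GrD(1,2)[OF V(2)] GrD(1,2)[OF R0G]])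
  (use V(3) GrD(5)[OF V(1)] GrD(5)[OF V(2)] in simp_all)
  have "(%g. h \<circ> g) ` {g : St. V <= g ` Sj} <= {g : St. V' <= g ` Sj}"
  proof (rule image_subsetI)
  fix g assume "g : {g : St. V <= g ` Sj}"
  then have g: "g : GL ?d" "g ` R0 = R0" "V <= g ` Sj" by (auto simp: St_def)
  have "(h \<circ> g) ` R0 = R0" using g h by (simp only: image_comp[symmetric])
  moreover have "V' <= (h \<circ> g) ` Sj" using g(3) h(2) by (metis image_comp image_mono)
  ultimately show "h \<circ> g : {g : St. V' <= g ` Sj}" using GL_comp[OF h(1) g(1)] by (simp add: St_def)
  qed
  moreover have "inj_on (%g. h \<circ> g) {g : St. V <= g ` Sj}" using bij_is_inj[OF GL_bij[OF h(1)]] by (auto intro!: inj_onI simp: fun_eq_iff inj_def)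
  ultimately show ?thesis unfolding c_def using fSt by (intro card_inj_on_le[of "%g. h \<circ> g"]) auto
 qed
 have ceq: "c V = c (Rj i)" if "V : Gr ?d r" "card (V Int R0) = CARD('a) ^ i" "i <= r" for V i
  using cle[OF that(1) RjG(1)[OF that(3)]] cle[OF RjG(1)[OF that(3)] that(1)] RjG(2)[OF that(3)] that(2) by (simp add: card_nspace)
 have czero: "c V = 0" if "card (V Int R0) > CARD('a) ^ j" for V
 proof -
  have "{g : St. V <= g ` Sj} = {}"
  proof (rule ccontr)
  assume "{g : St. V <= g ` Sj} ~= {}"
  then obtain g where g: "g : GL ?d" "g ` R0 = R0" "V <= g ` Sj" by (auto simp: St_def)
  have "V Int R0 <= g ` (Sj Int R0)" unfolding GL_Int[OF g(1)] g(2) using g(3) by blast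
  then have "card (V Int R0) <= card (g ` (Sj Int R0))" by (rule card_mono[rotated]) (simp add: SjR0 finite_nspace)
  also have "... = CARD('a) ^ j" by (simp add: GL_card[OF g(1)] SjR0 card_nspace)
  finally show False using that by simp
  qed
  then show ?thesis unfolding c_def by (simp only: card.empty)
 qed
 have cpos: "c (Rj j) > 0"
 proof -
  have "{..<j} Un {r..<r + (r - j)} <= {..<j} Un {r..<r + s - j}" using less.prems rs by (intro Un_mono) auto
  then have "Rj j <= Sj" unfolding Rj_def Sj_def by (rule coord_mono)
  then have "id : {g : St. Rj j <= g ` Sj}" using GL_id[of ?d] by (simp add: St_def)
  moreover have "finite {g : St. Rj j <= g ` Sj}" by (rule finite_subset[OF _ fSt]) blast
  ultimately show ?thesis unfolding c_def card_gt_0_iff by blast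
 qed
 have "ALL i:{..<j}. EX p. fst p > 0 & snd p : ZGr ?d s & boundary ?d s r (snd p)
  = (%V. if V : Gr ?d r & card (V Int R0) = CARD('a) ^ i then fst p else 0)"
 proof
  fix i assume "i : {..<j}"
  then have i: "i < j" "i <= r" using less.prems by auto
  obtain m Ph where "m > 0" "Ph : ZGr ?d s" "boundary ?d s r Ph
  = (%V. if V : Gr ?d r & card (V Int R0) = CARD('a) ^ i then m else 0)" using less.IH[OF i] by blast
  then show "EX p. fst p > 0 & snd p : ZGr ?d s & boundary ?d s r (snd p)
  = (%V. if V : Gr ?d r & card (V Int R0) = CARD('a) ^ i then fst p else 0)" by (intro exI[of _ "(m, Ph)"], unfold fst_conv snd_conv) blast
 qed
 from bchoice[OF this] obtain p where p0: "ALL i:{..<j}. fst (p i) > 0 & snd (p i) : ZGr ?d s & boundary ?d s r (snd (p i))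
  = (%V. if V : Gr ?d r & card (V Int R0) = CARD('a) ^ i then fst (p i) else 0)" ..
 have p: "!!i. i < j ==> fst (p i) > 0" "!!i. i < j ==> snd (p i) : ZGr ?d s"
  "!!i. i < j ==> boundary ?d s r (snd (p i))
  = (%V. if V : Gr ?d r & card (V Int R0) = CARD('a) ^ i then fst (p i) else 0)" using p0 by blast+
 define mm where "mm i = fst (p i)" for i
 \<comment> \<open>A common multiple of the multipliers of the smaller classes, so that the
   elimination stays integral.\<close>
 define M where "M = (PROD i<j. mm i)"
 have Mpos: "M > 0" unfolding M_def mm_def using p(1) by (intro prod_pos) auto
 have Mdvd: "mm i * (M div mm i) = M" if "i < j" for i unfolding M_def using that by (intro dvd_mult_div_cancel dvd_prodI) auto
 define Ph where "Ph = (%T. M * (SUM g:St. unit_vec (g ` Sj) T)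
  - (SUM i<j. ((M div mm i) * int (c (Rj i))) * snd (p i) T))"
 have stG: "g ` Sj : Gr ?d s" if "g : St" for g using that GL_Gr[OF _ SjG] by (auto simp: St_def)
 have bS: "boundary ?d s r (%T. SUM g:St. unit_vec (g ` Sj) T) V = int (c V)" if V: "V : Gr ?d r" for V
 proof -
  have "boundary ?d s r (%T. SUM g:St. unit_vec (g ` Sj) T) V = (SUM g:St. if V <= g ` Sj then 1 else 0)"
  unfolding boundary_sum using stG V by (intro sum.cong) (auto simp: boundary_unit)
  also have "... = int (c V)" unfolding c_def using fSt by (simp add: sum.inter_filter[symmetric])
  finally show ?thesis .
 qed
 have "Ph : ZGr ?d s" using p(2) stG by (auto simp: Ph_def ZGr_def unit_vec_def intro!: sum.neutral)
 moreover have "boundary ?d s r Ph V = (if V : Gr ?d r & card (V Int R0) = CARD('a) ^ j then M * int (c (Rj j)) else 0)" for V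
 proof (cases "V : Gr ?d r")
  case True
  have sI: "nsub (V Int R0)" "V Int R0 <= nspace ?d" using GrD(1,2)[OF True] GrD(1)[OF R0G] nv.subspace_inter by auto
  define i where "i = nv.dim (V Int R0)"
  have ci: "card (V Int R0) = CARD('a) ^ i" unfolding i_def by (rule card_subspace[OF sI])
  have ir: "i <= r" unfolding i_def using dim_le_of_subset(1)[OF sI(1) GrD(1)[OF R0G] Int_lower2 GrD(2)[OF R0G]] GrD(3)[OF R0G] by simp
  have "boundary ?d s r Ph V = M * int (c V) - (SUM k<j. ((M div mm k) * int (c (Rj k))) * boundary ?d s r (snd (p k)) V)"
  unfolding Ph_def boundary_diff boundary_cmul boundary_lincomb bS[OF True] ..
  also have "(SUM k<j. ((M div mm k) * int (c (Rj k))) * boundary ?d s r (snd (p k)) V)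
  = (SUM k<j. if k = i then M * int (c (Rj i)) else 0)"
  proof (rule sum.cong[OF refl])
  fix k assume "k : {..<j}"
  then have k: "k < j" by simp
  have "boundary ?d s r (snd (p k)) V = (if k = i then mm k else 0)" unfolding p(3)[OF k] mm_def using True ci power_card_inj[where 'a='a] by auto
  then show "((M div mm k) * int (c (Rj k))) * boundary ?d s r (snd (p k)) V
  = (if k = i then M * int (c (Rj i)) else 0)"
  proof (cases "k = i")
  case True
  have "((M div mm i) * int (c (Rj i))) * mm i = (mm i * (M div mm i)) * int (c (Rj i))" by (simp only: mult_ac)
  then show ?thesis using Mdvd[OF k] mult.commute[of "mm i"] True \<open>boundary ?d s r (snd (p k)) V = (if k = i then mm k else 0)\<close> by simp
  qed (use \<open>boundary ?d s r (snd (p k)) V = (if k = i then mm k else 0)\<close> in simp)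
  qed
  also have "... = (if i < j then M * int (c (Rj i)) else 0)" by simp
  finally have e: "boundary ?d s r Ph V = M * int (c V) - (if i < j then M * int (c (Rj i)) else 0)" .
  consider "i < j" | "i = j" | "i > j" by linarith
  then show ?thesis
  proof cases
  case 1
  then show ?thesis using e ceq[OF True ci ir] ci power_card_inj[where 'a='a] by simp
  next
  case 2
  then show ?thesis using e ceq[OF True ci ir] ci True by simp
  next
  case 3
  have "card (V Int R0) > CARD('a) ^ j" unfolding ci using 3 card_field_ge2[where 'a='a] by (intro power_strict_increasing) auto
  then have "c V = 0" by (rule czero)
  then show ?thesis using e 3 ci power_card_inj[where 'a='a] by simp
  qed
 next
  case False
  then show ?thesis by (simp only: boundary_apply if_False simp_thms)
 qed
 ultimately show ?case using Mpos cpos by (intro exI[of _ "M * int (c (Rj j))"] conjI bexI[of _ Ph]) auto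
qed

lemma ZGr_mono: "d <= n ==> f : ZGr d t ==> f : ZGr n t" using nspace_mono[of d n] unfolding ZGr_def Gr_def by blast

text \<open>A subspace of \<open>nspace d\<close> contains only subspaces of
  \<open>nspace d\<close>, so for vectors supported there the ambient dimension is irrelevant.
  Decoders and covers are moved between dimensions in this way.\<close>

lemma boundary_restrict:
 fixes f :: "'a::{field,finite} vs => int"
 assumes "d <= n" "f : ZGr d t"
 shows "boundary n t u f = boundary d t u f"
proof
 fix V :: "'a vs"
 have sub: "Gr d t <= (Gr n t :: 'a vs set)" "Gr d u <= (Gr n u :: 'a vs set)" using nspace_mono[OF assms(1), where 'a='a] unfolding Gr_def by blast+
 have e: "(SUM T:{T : Gr n t. V <= T}. f T) = (SUM T:{T : Gr d t. V <= T}. f T)" using sub(1) assms(2) by (intro sum.mono_neutral_right) (auto simp: finite_Gr ZGr_def)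
 show "boundary n t u f V = boundary d t u f V"
 proof (cases "V : Gr d u")
  case True
  then show ?thesis using sub(2) e by (simp only: boundary_apply if_True subsetD)
 next
  case False
  have "{T : Gr d t. V <= T} = {}" if "V : Gr n u" using False that unfolding Gr_def by blast
  then have "V : Gr n u ==> (SUM T:{T : Gr d t. V <= T}. f T) = 0" by (simp only: sum.empty)
  then show ?thesis using False e by (simp only: boundary_apply if_False split: if_split) simp
 qed
qed

text \<open>The decoder is built once in dimension \<open>r + s\<close> and carried to an arbitrary
  \<open>R\<close> by the group; this is why \<open>m\<close> and \<open>c0\<close> do not depend on
  \<open>n\<close>.\<close>

lemma decode:
 assumes "r <= s"
 obtains m :: int and c0 :: real where "m >= 1" "c0 > 0"
  "!!n (R :: 'a::{field,finite} vs). r + s <= n ==> R : Gr n r ==>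
  EX D : ZGr n s. boundary n s r D = (%V. m * unit_vec R V) & (SUM S:Gr n s. \<bar>rint (D S)\<bar>) <= c0"
proof -
 let ?d = "r + s" and ?R0 = "nspace r :: 'a vs"
 obtain m D0 where m: "m > 0" and D0: "D0 : ZGr ?d s"
  and b: "boundary ?d s r D0 = (%V. if V : Gr ?d r & card (V Int ?R0) = CARD('a) ^ r then m else 0)" using decode_triangular[OF refl assms order_refl, where 'a='a] by blast
 have R0G: "?R0 : Gr ?d r" by (rule nspace_Gr) simp
 have "V : Gr ?d r & card (V Int ?R0) = CARD('a) ^ r \<longleftrightarrow> V = ?R0" for V
 proof
  assume V: "V : Gr ?d r & card (V Int ?R0) = CARD('a) ^ r"
  have "V Int ?R0 = V" by (rule card_subset_eq) (use V GrD[of V ?d r] in auto)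
  moreover have "V Int ?R0 = ?R0" by (rule card_subset_eq) (use V GrD[OF R0G] in auto)
  ultimately show "V = ?R0" by simp
 next
  assume "V = ?R0"
  then show "V : Gr ?d r & card (V Int ?R0) = CARD('a) ^ r" using R0G by (simp add: card_nspace)
 qed
 then have b': "boundary ?d s r D0 = (%V. m * unit_vec ?R0 V)" unfolding b by (auto simp: unit_vec_def)
 define c0 where "c0 = (SUM S:Gr ?d s. \<bar>rint (D0 S)\<bar>) + 1"
 have "c0 > 0" unfolding c0_def by (smt (verit) sum_nonneg abs_ge_zero)
 show ?thesis
 proof (rule that[of m c0])
  fix n and R :: "'a vs" assume n: "?d <= n" and R: "R : Gr n r"
  have R0n: "?R0 : Gr n r" by (rule nspace_Gr) (use n in simp)
  obtain g where g: "g : GL n" "g ` R = ?R0" by (rule GL_pair_transitive[OF GrD(1,2)[OF R] GrD(1,2)[OF R] GrD(1,2)[OF R0n] GrD(1,2)[OF R0n]])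
  (use GrD(5)[OF R] GrD(5)[OF R0n] in simp_all)
  let ?D = "%T. D0 (g ` T)"
  have D0n: "D0 : ZGr n s" using ZGr_mono[OF n D0] .
  have "boundary n s r ?D V = m * unit_vec R V" for V
  proof -
  have "boundary n s r ?D V = m * unit_vec ?R0 (g ` V)" unfolding boundary_push[OF g(1)] boundary_restrict[OF n D0] b' ..
  also have "unit_vec ?R0 (g ` V) = unit_vec R V" unfolding unit_vec_def g(2)[symmetric] GL_eq_iff[OF g(1)] ..
  finally show ?thesis .
  qed
  moreover have "(SUM S:Gr n s. \<bar>rint (?D S)\<bar>) <= c0"
  proof -
  have "(SUM S:Gr n s. \<bar>rint (?D S)\<bar>) = (SUM S:Gr n s. \<bar>rint (D0 S)\<bar>)" by (rule sum.reindex_bij_betw[OF GL_bij_Gr[OF g(1)]])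
  also have "... = (SUM S:Gr ?d s. \<bar>rint (D0 S)\<bar>)"
  proof (rule sum.mono_neutral_right[OF finite_Gr])
  show "Gr ?d s <= (Gr n s :: 'a vs set)" using nspace_mono[OF n, where 'a='a] unfolding Gr_def by blast
  qed (use D0 in \<open>auto simp: ZGr_def\<close>)
  finally show ?thesis by (simp add: c0_def)
  qed
  ultimately show "EX D : ZGr n s. boundary n s r D = (%V. m * unit_vec R V) & (SUM S:Gr n s. \<bar>rint (D S)\<bar>) <= c0"
  using push_ZGr[OF g(1) D0n] by (intro bexI[of _ ?D]) auto
 qed (use m \<open>c0 > 0\<close> in auto)
qed

lemma deg_push:
 assumes g: "g : GL n"
 shows "deg n s (%T. f (g ` T)) W = deg n s f (g ` (W :: 'a::{field,finite} vs))" unfolding deg_def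
proof (rule sum.reindex_bij_witness[of _ "(`) (inv g)" "(`) g"])
 fix T assume "T : {T : Gr n s. W <= T}"
 then show "inv g ` g ` T = T" "g ` T : {T : Gr n s. g ` W <= T}" "\<bar>rint (f (g ` T))\<bar> = \<bar>rint (f (g ` T))\<bar>" using GL_inv_image(1)[OF g] GL_Gr[OF g] by auto
next
 fix T assume T: "T : {T : Gr n s. g ` W <= T}"
 then show "g ` inv g ` T = T" using GL_inv_image(2)[OF g] by auto
 have "inv g ` g ` W <= inv g ` T" using T by blast
 then show "inv g ` T : {T : Gr n s. W <= T}" using GL_inv_image(1)[OF g] GL_Gr[OF GL_inv[OF g]] T by auto
qed

lemma deg_total:
 fixes f :: "'a::{field,finite} vs => int"
 shows "(SUM W:Gr n w. deg n s f W) <= 2 ^ (CARD('a) ^ s) * (SUM S:Gr n s. \<bar>rint (f S)\<bar>)"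
proof -
 have "(SUM W:Gr n w. deg n s f W) = (SUM W:Gr n w. SUM S:Gr n s. if W <= S then \<bar>rint (f S)\<bar> else 0)" unfolding deg_def by (simp add: sum.inter_filter finite_Gr)
 also have "... = (SUM S:Gr n s. SUM W:Gr n w. if W <= S then \<bar>rint (f S)\<bar> else 0)" by (rule sum.swap)
 also have "... <= (SUM S:Gr n s. 2 ^ (CARD('a) ^ s) * \<bar>rint (f S)\<bar>)"
 proof (rule sum_mono)
  fix S :: "'a vs" assume S: "S : Gr n s"
  have "(SUM W:Gr n w. if W <= S then \<bar>rint (f S)\<bar> else 0) = (SUM W:{W : Gr n w. W <= S}. \<bar>rint (f S)\<bar>)" by (simp only: sum.inter_filter finite_Gr)
  also have "... = card {W. W : Gr n w & True & W <= S} * \<bar>rint (f S)\<bar>" by simp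
  also have "... <= real (2 ^ (CARD('a) ^ s)) * \<bar>rint (f S)\<bar>" by (intro mult_right_mono of_nat_mono card_subsets_le[OF S]) simp
  finally show "(SUM W:Gr n w. if W <= S then \<bar>rint (f S)\<bar> else 0) <= 2 ^ (CARD('a) ^ s) * \<bar>rint (f S)\<bar>" by simp
 qed
 finally show ?thesis by (simp add: sum_distrib_left)
qed

lemma ln_card_Gr:
 assumes "w <= s"
 shows "ln (real (card (Gr n w :: 'a::{field,finite} vs set))) <= real n * real s * ln (real CARD('a))"
proof (cases "card (Gr n w :: 'a vs set) = 0")
 case True
 have "ln (real CARD('a)) >= 0" using card_field_ge2[where 'a='a] by simp
 then show ?thesis unfolding True by simp
next
 case False
 have q: "real CARD('a) >= 1" using card_field_ge2[where 'a='a] by simp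
 have "real (card (Gr n w :: 'a vs set)) <= real (CARD('a) ^ (n * w))" by (rule of_nat_mono[OF card_Gr_le])
 also have "... <= real CARD('a) ^ (n * s)" unfolding of_nat_power using q assms by (intro power_increasing) auto
 finally have "ln (real (card (Gr n w :: 'a vs set))) <= ln (real CARD('a) ^ (n * s))" using False q by (subst ln_le_cancel_iff) auto
 also have "... = real (n * s) * ln (real CARD('a))" using q by (subst ln_realpow) auto
 finally show ?thesis by simp
qed

text \<open>A fixed decoder may pile up on few spaces. Each unit of a coefficient is decoded after a
  rotation of its own, by pulling back the decoder of the rotated space;
  \<open>sum_GL_weighted\<close> bounds the mean degree, and \<open>select\<close> fixes the
  rotations.\<close>

lemma decode_bounded:
 fixes J :: "'a::{field,finite} vs => int"
 assumes dec: "!!R :: 'a vs. R : Gr n (Suc w) ==> EX D : ZGr n s. boundary n s (Suc w) D = (%V. m * unit_vec R V) & (SUM S:Gr n s. \<bar>rint (D S)\<bar>) <= c0"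
  and c0: "c0 > 0" and n: "Suc w <= s" "2 * s < n"
  and J: "J : ZGr n (Suc w)" "!!W. W : Gr n w ==> deg n (Suc w) J W <= D" "D >= 0"
 obtains Ph where "Ph : ZGr n s" "boundary n s (Suc w) Ph = (%V. m * J V)"
  "!!W. W : Gr n w ==> deg n s Ph W <= 2 * (csym CARD('a) s * (2 ^ (CARD('a) ^ s) * c0) * D) + c0 * (real n * real s * ln (real CARD('a)))"
proof -
 let ?G = "GL n :: ('a vec => nat => 'a) set"
 have "ALL R:(Gr n (Suc w) :: 'a vs set). EX D. D : ZGr n s & boundary n s (Suc w) D = (%V. m * unit_vec R V)
  & (SUM S:Gr n s. \<bar>rint (D S)\<bar>) <= c0"
 proof
  fix R :: "'a vs" assume "R : Gr n (Suc w)"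
  from dec[OF this] show "EX D. D : ZGr n s & boundary n s (Suc w) D = (%V. m * unit_vec R V)
  & (SUM S:Gr n s. \<bar>rint (D S)\<bar>) <= c0" unfolding Bex_def .
 qed
 from bchoice[OF this] obtain \<D> :: "'a vs => 'a vs => int" where
  \<D>0: "ALL R:Gr n (Suc w). \<D> R : ZGr n s & boundary n s (Suc w) (\<D> R) = (%V. m * unit_vec R V)
  & (SUM S:Gr n s. \<bar>rint (\<D> R S)\<bar>) <= c0" ..
 have \<D>: "!!R. R : Gr n (Suc w) ==> \<D> R : ZGr n s"
  "!!R. R : Gr n (Suc w) ==> boundary n s (Suc w) (\<D> R) = (%V. m * unit_vec R V)"
  "!!R. R : Gr n (Suc w) ==> (SUM S:Gr n s. \<bar>rint (\<D> R S)\<bar>) <= c0" using \<D>0 by blast+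
 \<comment> \<open>One item per unit of coefficient: a single choice then weighs at most
   \<open>c0\<close>, however large the coefficients of \<open>J\<close> are.\<close>
 define X where "X = Sigma (Gr n (Suc w)) (%R. {..<nat \<bar>J R\<bar>})"
 define wt where "wt x g W = deg n s (\<D> (g ` fst x)) (g ` W)" for x :: "'a vs \<times> nat" and g :: "'a vec => 'a vec" and W
 have finX: "finite X" unfolding X_def by (intro finite_SigmaI finite_Gr) simp
 have fstX: "fst x : Gr n (Suc w)" if "x : X" for x using that by (auto simp: X_def)
 have Gne: "?G ~= {}" using GL_id by blast
 have wt01: "0 <= wt x g W & wt x g W <= c0" if "x : X" "g : ?G" "W : Gr n w" for x g W
 proof -
  have R: "g ` fst x : Gr n (Suc w)" using GL_Gr[OF that(2) fstX[OF that(1)]] .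
  have "wt x g W <= (SUM S:Gr n s. \<bar>rint (\<D> (g ` fst x) S)\<bar>)" unfolding wt_def deg_def by (rule sum_mono2) (auto simp: finite_Gr)
  then show ?thesis using \<D>(3)[OF R] deg_nonneg unfolding wt_def by (metis order_trans)
 qed
 obtain f where f: "!!x. x : X ==> f x : ?G"
  "!!W. W : Gr n w ==> (SUM x:X. wt x (f x) W) <= 2 * (SUM x:X. (SUM g:?G. wt x g W) / card ?G)
  + c0 * ln (card (Gr n w :: 'a vs set))" by (rule select[OF finX finite_Gr[of n w, where 'a='a] c0, of "%_. ?G" wt])
  (use finite_GL Gne wt01 in auto)
 define Ph where "Ph T = (SUM x:X. sgn (J (fst x)) * \<D> (f x ` fst x) (f x ` T))" for T
 have "Ph : ZGr n s" unfolding Ph_def ZGr_def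
 proof (intro CollectI allI impI sum.neutral ballI)
  fix T :: "'a vs" and x assume "T ~: Gr n s" "x : X"
  then have "\<D> (f x ` fst x) (f x ` T) = 0" using \<D>(1)[OF GL_Gr[OF f(1) fstX]] GL_Gr_iff[OF f(1)] by (auto simp: ZGr_def)
  then show "sgn (J (fst x)) * \<D> (f x ` fst x) (f x ` T) = 0" by simp
 qed
 moreover have "boundary n s (Suc w) Ph V = m * J V" for V
 proof -
  have "boundary n s (Suc w) Ph V = (SUM x:X. sgn (J (fst x)) * boundary n s (Suc w) (%T. \<D> (f x ` fst x) (f x ` T)) V)" unfolding Ph_def boundary_lincomb ..
  also have "... = (SUM x:X. sgn (J (fst x)) * (m * unit_vec (fst x) V))"
  proof (intro sum.cong refl)
  fix x assume x: "x : X"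
  show "sgn (J (fst x)) * boundary n s (Suc w) (%T. \<D> (f x ` fst x) (f x ` T)) V = sgn (J (fst x)) * (m * unit_vec (fst x) V)"
  unfolding boundary_push[OF f(1)[OF x]] \<D>(2)[OF GL_Gr[OF f(1)[OF x] fstX[OF x]]] by (simp add: unit_vec_def GL_eq_iff[OF f(1)[OF x]])
  qed
  also have "... = (SUM R:Gr n (Suc w). SUM u<nat \<bar>J R\<bar>. sgn (J R) * (m * unit_vec R V))" unfolding X_def by (subst sum.Sigma) (auto simp: finite_Gr split_def)
  also have "... = (SUM R:Gr n (Suc w). m * (J R * unit_vec R V))"
  proof (rule sum.cong[OF refl])
  fix R
  have e: "int (nat \<bar>J R\<bar>) * sgn (J R) = J R" by (simp add: abs_mult_sgn)
  have "(SUM u<nat \<bar>J R\<bar>. sgn (J R) * (m * unit_vec R V)) = (int (nat \<bar>J R\<bar>) * sgn (J R)) * (m * unit_vec R V)"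
  by (simp only: sum_constant card_lessThan mult.assoc)
  then show "(SUM u<nat \<bar>J R\<bar>. sgn (J R) * (m * unit_vec R V)) = m * (J R * unit_vec R V)" unfolding e by (simp only: mult_ac)
  qed
  also have "... = m * J V" unfolding sum_distrib_left[symmetric] using fun_cong[OF ZGr_expand[OF J(1)], of V] by simp
  finally show ?thesis .
 qed
 moreover have "deg n s Ph W <= 2 * (csym CARD('a) s * (2 ^ (CARD('a) ^ s) * c0) * D) + c0 * (real n * real s * ln (real CARD('a)))"
  if W: "W : Gr n w" for W
 proof -
  have "deg n s Ph W <= (SUM x:X. deg n s (%T. sgn (J (fst x)) * \<D> (f x ` fst x) (f x ` T)) W)" unfolding Ph_def by (rule deg_sum_le[OF finX])
  also have "... <= (SUM x:X. wt x (f x) W)"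
  proof (rule sum_mono)
  fix x assume x: "x : X"
  have "deg n s (%T. sgn (J (fst x)) * \<D> (f x ` fst x) (f x ` T)) W <= deg n s (%T. \<D> (f x ` fst x) (f x ` T)) W"
  unfolding deg_def by (rule sum_mono) (auto simp: abs_mult sgn_if)
  then show "deg n s (%T. sgn (J (fst x)) * \<D> (f x ` fst x) (f x ` T)) W <= wt x (f x) W" unfolding wt_def deg_push[OF f(1)[OF x]] .
  qed
  also have "... <= 2 * (SUM x:X. (SUM g:?G. wt x g W) / card ?G) + c0 * ln (card (Gr n w :: 'a vs set))" by (rule f(2)[OF W])
  also have "(SUM x:X. (SUM g:?G. wt x g W) / card ?G) <= csym CARD('a) s * (2 ^ (CARD('a) ^ s) * c0) * D"
  proof -
  have "(SUM x:X. (SUM g:?G. wt x g W) / card ?G)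
  = (SUM R:Gr n (Suc w). \<bar>rint (J R)\<bar> * (SUM g:?G. deg n s (\<D> (g ` R)) (g ` W))) / card ?G"
  proof -
  define h where "h R = (SUM g:?G. deg n s (\<D> (g ` R)) (g ` W)) / card ?G" for R
  have "(SUM x:X. h (fst x)) = (SUM R:Gr n (Suc w). SUM u<nat \<bar>J R\<bar>. h R)" unfolding X_def by (subst sum.Sigma) (auto simp: finite_Gr split_def)
  also have "... = (SUM R:Gr n (Suc w). \<bar>rint (J R)\<bar> * h R)" by (rule sum.cong[OF refl]) simp
  finally show ?thesis by (simp only: h_def wt_def sum_divide_distrib[where A = "Gr n (Suc w)"] times_divide_eq_right)
  qed
  also have "... <= card ?G * (csym CARD('a) s * (2 ^ (CARD('a) ^ s) * c0) * D) / card ?G"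
  proof (intro divide_right_mono)
  show "(SUM R:Gr n (Suc w). \<bar>rint (J R)\<bar> * (SUM g:?G. deg n s (\<D> (g ` R)) (g ` W)))
  <= card ?G * (csym CARD('a) s * (2 ^ (CARD('a) ^ s) * c0) * D)"
  proof (rule sum_GL_weighted[OF W n, of "%R1 W1. deg n s (\<D> R1) W1"])
  fix R1 :: "'a vs" assume R1: "R1 : Gr n (Suc w)"
  have "(SUM W1:Gr n w. deg n s (\<D> R1) W1) <= 2 ^ (CARD('a) ^ s) * (SUM S:Gr n s. \<bar>rint (\<D> R1 S)\<bar>)" by (rule deg_total)
  also have "... <= 2 ^ (CARD('a) ^ s) * c0" using \<D>(3)[OF R1] by (intro mult_left_mono) auto
  finally show "(SUM W1:Gr n w. deg n s (\<D> R1) W1) <= 2 ^ (CARD('a) ^ s) * c0" .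
  next
  fix W1 :: "'a vs" assume "W1 : Gr n w"
  then have "deg n (Suc w) J W1 <= D" by (rule J(2))
  then show "(SUM R:{R : Gr n (Suc w). W1 <= R}. \<bar>rint (J R)\<bar>) <= D" unfolding deg_def .
  qed (use deg_nonneg c0 J(3) in auto)
  qed simp
  also have "... = csym CARD('a) s * (2 ^ (CARD('a) ^ s) * c0) * D" using GL_pos[of n, where 'a='a] by simp
  finally show ?thesis .
  qed
  also have "ln (card (Gr n w :: 'a vs set)) <= real n * real s * ln (real CARD('a))" by (rule ln_card_Gr) (use n in simp)
  finally show ?thesis using c0 by simp
 qed
 ultimately show ?thesis using that by blast
qed

section \<open>Transversal families, congruences and shears\<close>

abbreviation lin_fun :: "((nat => 'a::field) => 'a) => bool" where
 "lin_fun \<equiv> Vector_Spaces.linear vscale (*)"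

lemma lin_fun_add: "lin_fun l ==> l (x + y) = l x + l y"
 and lin_fun_scale: "lin_fun l ==> l (vscale c x) = c * l x" by (auto simp: Vector_Spaces.linear_iff)

lemma lin_fun_0: "lin_fun l ==> l 0 = 0" using lin_fun_scale[of l 0 0] by (simp only: nv.scale_zero_left mult_zero_left)

lemma lin_fun_sum:
 assumes "lin_fun l"
 shows "l (SUM i:I. vscale (c i) (x i)) = (SUM i:I. c i * l (x i))"
proof (induction I rule: infinite_finite_induct)
 case (infinite I)
 then show ?case by (simp only: sum.infinite lin_fun_0[OF assms] if_False simp_thms)
next
 case empty
 then show ?case by (simp only: sum.empty lin_fun_0[OF assms])
next
 case (insert i I)
 show ?case unfolding sum.insert[OF insert.hyps] lin_fun_add[OF assms] lin_fun_scale[OF assms] insert.IH ..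
qed

lemma functional_exists:
 fixes R :: "'a::{field,finite} vs"
 assumes "nsub R" "R <= nspace n" "y ~: R"
 obtains l where "lin_fun l" "!!x. x : R ==> l x = 0" "l y = 1"
proof -
 obtain B where B: "B <= R" "finite B" "nv.independent B" "nv.span B = R" by (rule basis_of[OF assms(1,2) empty_subsetI nv.independent_empty])
 have "nv.independent (insert y B)" using B assms(3) by (intro nv.independent_insertI) auto
 from nf.linear_independent_extend[OF this, of "%x. if x = y then 1 else 0"]
 obtain l where l: "lin_fun l" "ALL x:insert y B. l x = (if x = y then 1 else 0)" by blast
 have "l x = 0" if "x : R" for x
 proof (rule nf.linear_eq_0_on_span[OF l(1), of B])
  fix b assume "b : B"
  then show "l b = 0" using l(2) B(1) assms(3) by auto
 qed (use that B(4) in simp)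
 then show ?thesis using that l by auto
qed

text \<open>Any at most \<open>m0\<close> members are in general position, each of codimension
  \<open>k\<close>. One-element sets \<open>C\<close> are included, so for \<open>m0 >= 1\<close>
  the codimension of the members is part of the condition.\<close>

definition tfam :: "nat => nat => nat => 'a::{field,finite} vs set => bool" where
 "tfam n k m0 H \<longleftrightarrow> (ALL X:H. nsub X & X <= nspace n) &
  (ALL C. C <= H --> finite C --> card C <= m0 --> card (nspace n Int \<Inter>C) * CARD('a) ^ (k * card C) = CARD('a) ^ n)"

lemma tfamD:
 assumes "tfam n k m0 (H :: 'a::{field,finite} vs set)"
 shows "X : H ==> nsub X" "X : H ==> X <= nspace n"
  "C <= H ==> finite C ==> card C <= m0 ==> card (nspace n Int \<Inter>C) * CARD('a) ^ (k * card C) = CARD('a) ^ n" using assms unfolding tfam_def by auto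

lemma tfam_finite: "tfam n k m0 (H :: 'a::{field,finite} vs set) ==> finite H" by (rule finite_subset[of _ "Pow (nspace n)"]) (auto simp: tfam_def finite_nspace)

lemma subspace_common:
 "tfam n k m0 H ==> C <= H ==> nsub (nspace n Int \<Inter>C)" by (intro nv.subspace_inter subspace_nspace nv.subspace_Inter) (auto simp: tfam_def)

text \<open>A Chinese remainder theorem. By transversality the intersection of the members treated
  so far and the next member together span \<open>nspace n\<close>, so the next congruence can be
  corrected by a vector that leaves the earlier ones intact.\<close>

lemma crt:
 fixes H :: "'a::{field,finite} vs set"
 assumes H: "tfam n k m0 H" and C: "finite C" "C <= H" "card C <= m0"
  and w: "!!X. X : C ==> w X : nspace n"
 shows "EX v:nspace n. ALL X:C. v - w X : X" using C w
proof (induction C rule: finite_induct)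
 case empty
 then show ?case using nv.subspace_0[OF subspace_nspace[of n]] by auto
next
 case (insert X C)
 let ?q = "CARD('a)"
 let ?U = "nspace n Int \<Inter>C"
 have XH: "X : H" and CH: "C <= H" and cC: "card C <= m0" "Suc (card C) <= m0" using insert by auto
 obtain v where v: "v : nspace n" "ALL X:C. v - w X : X" using insert.IH[OF CH cC(1)] insert.prems(3) by blast
 note sX = tfamD(1,2)[OF H XH]
 have sU: "nsub ?U" by (rule subspace_common[OF H CH])
 have fin: "finite ?U" "finite X" using finite_nspace sX finite_sub_nspace by auto
 have cU: "card ?U * ?q ^ (k * card C) = ?q ^ n" by (rule tfamD(3)[OF H CH insert.hyps(1) cC(1)])
 have cX: "card X * ?q ^ k = ?q ^ n" using tfamD(3)[OF H, of "{X}"] XH cC(2) sX(2) by (simp add: Int_absorb1)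
 have cUX: "card (?U Int X) * ?q ^ (k * Suc (card C)) = ?q ^ n"
 proof -
  have "?U Int X = nspace n Int \<Inter>(insert X C)" by blast
  then show ?thesis using tfamD(3)[OF H, of "insert X C"] insert by simp
 qed
 have sub: "ssum ?U X <= nspace n" by (rule ssum_least[OF subspace_nspace]) (use sX in auto)
 have "card (ssum ?U X) * ?q ^ n = card (ssum ?U X) * card (?U Int X) * ?q ^ (k * Suc (card C))" unfolding cUX[symmetric] by (simp only: mult.assoc)
 also have "... = card ?U * card X * (?q ^ (k * card C) * ?q ^ k)" unfolding card_ssum[OF sU sX(1) fin] by (simp only: mult_Suc_right power_add mult.commute)
 also have "... = (card ?U * ?q ^ (k * card C)) * (card X * ?q ^ k)" by (simp only: mult_ac)
 also have "... = ?q ^ n * ?q ^ n" unfolding cU cX ..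
 finally have "card (ssum ?U X) = ?q ^ n" by simp
 then have "ssum ?U X = nspace n" using card_subset_eq[OF finite_nspace sub] by (simp add: card_nspace)
 moreover have "w X - v : nspace n" using nv.subspace_diff[OF subspace_nspace insert.prems(3)[of X] v(1)] by simp
 ultimately obtain u h where u: "u : ?U" "h : X" "w X - v = u + h" unfolding ssum_def by blast
 have "v + u : nspace n" using nv.subspace_add[OF subspace_nspace v(1)] u(1) by blast
 moreover have "v + u - w Y : Y" if "Y : C" for Y
 proof -
  have "(v - w Y) + u : Y" using v(2) that u(1) CH tfamD(1)[OF H] by (intro nv.subspace_add) auto
  then show ?thesis by (simp add: algebra_simps)
 qed
 moreover have "v + u - w X : X"
 proof -
  have "v + u - w X = - h" using u(3) by (simp add: algebra_simps)
  then show ?thesis using nv.subspace_neg[OF sX(1) u(2)] by simp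
 qed
 ultimately show ?case by (intro bexI[of _ "v + u"] ballI) blast+
qed

text \<open>The solutions form a coset of the common intersection, which is larger than
  \<open>T\<close>.\<close>

lemma crt_avoid:
 fixes H :: "'a::{field,finite} vs set"
 assumes H: "tfam n k m0 H" and C: "finite C" "C <= H" "card C <= m0"
  and w: "!!X. X : C ==> w X : nspace n"
  and T: "nsub T" "T <= nspace n" "card T * CARD('a) ^ (k * card C) < CARD('a) ^ n"
 shows "EX v:nspace n. v ~: T & (ALL X:C. v - w X : X)"
proof -
 have "EX v:nspace n. ALL X:C. v - w X : X" by (rule crt[OF H C]) (rule w)
 then obtain v where v: "v : nspace n" "ALL X:C. v - w X : X" by blast
 show ?thesis
 proof (cases "v : T")
  case True
  let ?U = "nspace n Int \<Inter>C"
  have "card T * CARD('a) ^ (k * card C) < card ?U * CARD('a) ^ (k * card C)" using T(3) tfamD(3)[OF H C(2,1,3)] by simp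
  then have "card T < card ?U" by simp
  then have "\<not> ?U <= T" using card_mono[OF finite_sub_nspace[OF T(2)]] by (meson not_less)
  then obtain u where u: "u : ?U" "u ~: T" by blast
  have "v + u ~: T"
  proof
  assume "v + u : T"
  then have "(v + u) - v : T" using True nv.subspace_diff[OF T(1)] by blast
  then show False using u(2) by simp
  qed
  moreover have "v + u - w Y : Y" if "Y : C" for Y
  proof -
  have "(v - w Y) + u : Y" using v(2) that u(1) C(2) tfamD(1)[OF H] by (intro nv.subspace_add) auto
  then show ?thesis by (simp add: algebra_simps)
  qed
  moreover have "v + u : nspace n" using nv.subspace_add[OF subspace_nspace v(1)] u(1) by blast
  ultimately show ?thesis by blast
 qed (use v in blast)
qed

text \<open>One vector at a time by \<open>crt_avoid\<close>, always outside the span of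
  \<open>T\<close> and the vectors already placed.\<close>

lemma place_vectors:
 fixes H :: "'a::{field,finite} vs set" and w :: "'i => 'a vs => 'a vec"
 assumes H: "tfam n k m0 H" and C: "finite C" "C <= H" "card C <= m0"
  and w: "!!i X. i : I ==> X : C ==> w i X : nspace n" and I: "finite I"
  and T: "nsub T" "T <= nspace n" "card T * CARD('a) ^ card I * CARD('a) ^ (k * card C) < CARD('a) ^ n"
 shows "EX v T'. nsub T' & T <= T' & T' <= nspace n & card T' <= card T * CARD('a) ^ card I
  & (ALL i:I. v i : T') & (ALL i:I. ALL X:C. v i - w i X : X)
  & (ALL c. (SUM i:I. vscale (c i) (v i)) : T --> (ALL i:I. c i = 0))" using I w T(3)
proof (induction I rule: finite_induct)
 case empty
 then show ?case using T by (intro exI[of _ undefined] exI[of _ T]) auto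
next
 case (insert j I)
 let ?q = "CARD('a)"
 have q: "?q >= 2" by (rule card_field_ge2)
 have lt: "card T * ?q ^ card I * ?q ^ (k * card C) < ?q ^ n"
 proof -
  have "card T * ?q ^ card I * ?q ^ (k * card C) <= card T * ?q ^ card (insert j I) * ?q ^ (k * card C)" using insert.hyps q by (intro mult_le_mono power_increasing) auto
  then show ?thesis using insert.prems(2) by linarith
 qed
 obtain v T' where v: "nsub T'" "T <= T'" "T' <= nspace n" "card T' <= card T * ?q ^ card I"
  "ALL i:I. v i : T'" "ALL i:I. ALL X:C. v i - w i X : X"
  "ALL c. (SUM i:I. vscale (c i) (v i)) : T --> (ALL i:I. c i = 0)"
 proof -
  have "EX v T'. nsub T' & T <= T' & T' <= nspace n & card T' <= card T * ?q ^ card I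
  & (ALL i:I. v i : T') & (ALL i:I. ALL X:C. v i - w i X : X)
  & (ALL c. (SUM i:I. vscale (c i) (v i)) : T --> (ALL i:I. c i = 0))"
  proof (rule insert.IH)
  show "w i X : nspace n" if "i : I" "X : C" for i X by (rule insert.prems(1)[OF insertI2[OF that(1)] that(2)])
  qed (rule lt)
  then show thesis by (elim exE conjE) (rule that)
 qed
 have "card T' * ?q ^ (k * card C) <= card T * ?q ^ card I * ?q ^ (k * card C)" using v(4) by simp
 then have "card T' * ?q ^ (k * card C) < ?q ^ n" using lt by linarith
 then obtain y where y: "y : nspace n" "y ~: T'" "ALL X:C. y - w j X : X" using crt_avoid[OF H C _ v(1,3), of "w j"] insert.prems(1) by blast
 let ?v = "v(j := y)" and ?T = "nv.span (insert y T')"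
 have vI: "?v i = v i" if "i : I" for i using that insert.hyps(2) by auto
 have sup: "insert y T' <= ?T" by (rule nv.span_superset)
 have cT: "card ?T <= card T * ?q ^ card (insert j I)"
 proof -
  have "card ?T = ?q * card T'" using card_span_insert[of y T'] y(2) span_subspace_id[OF v(1)] by simp
  also have "... <= ?q * (card T * ?q ^ card I)" using v(4) by simp
  also have "... = card T * ?q ^ card (insert j I)" using insert.hyps by simp
  finally show ?thesis .
 qed
 have ind: "ALL i:insert j I. c i = 0" if c: "(SUM i:insert j I. vscale (c i) (?v i)) : T" for c
 proof -
  have s: "(SUM i:insert j I. vscale (c i) (?v i)) = vscale (c j) y + (SUM i:I. vscale (c i) (v i))" using insert.hyps vI by simp
  have sT: "(SUM i:I. vscale (c i) (v i)) : T'" using v(1,5) by (intro nv.subspace_sum nv.subspace_scale) auto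
  have "vscale (c j) y + (SUM i:I. vscale (c i) (v i)) : T'" using c v(2) unfolding s by blast
  then have "(vscale (c j) y + (SUM i:I. vscale (c i) (v i))) - (SUM i:I. vscale (c i) (v i)) : T'" using sT nv.subspace_diff[OF v(1)] by blast
  then have cy: "vscale (c j) y : T'" by simp
  have cj: "c j = 0"
  proof (rule ccontr)
  assume "c j ~= 0"
  then have "y = vscale (inverse (c j)) (vscale (c j) y)" by simp
  then show False using cy y(2) nv.subspace_scale[OF v(1)] by metis
  qed
  then have "(SUM i:I. vscale (c i) (v i)) : T" using c unfolding s by simp
  then show ?thesis using v(7) cj by blast
 qed
 have 1: "nsub ?T" by simp
 have 2: "T <= ?T" using v(2) sup by blast
 have 3: "?T <= nspace n" by (rule nv.span_minimal[OF _ subspace_nspace]) (use y(1) v(3) in blast)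
 have 4: "ALL i:insert j I. ?v i : ?T" using sup v(5) vI by auto
 have 5: "ALL i:insert j I. ALL X:C. ?v i - w i X : X" using v(6) vI y(3) by auto
 show ?case using 1 2 3 cT 4 5 ind by (intro exI[of _ ?v] exI[of _ ?T] conjI) blast+
qed

text \<open>A projection of \<open>Q\<close> onto the common kernel, written in the form of a shear.
  If vectors \<open>v i\<close> are congruent to these \<open>w i\<close> modulo a subspace that
  contains the kernel, then the shear by the \<open>v i\<close> carries \<open>Q\<close> into that
  subspace.\<close>

lemma factor_functionals:
 fixes Q :: "'a::{field,finite} vs"
 assumes "finite E" "nsub Q" "!!i. i : E ==> lin_fun (l i)"
 shows "EX w. (ALL i:E. w i : Q) &
  (ALL x:Q. x + (SUM i:E. vscale (l i x) (w i)) : {x : Q. ALL i:E. l i x = 0})" using assms(1,3)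
proof (induction E rule: finite_induct)
 case empty
 then show ?case by simp
next
 case (insert j E)
 have lj: "lin_fun (l j)" using insert.prems by simp
 obtain w where w: "ALL i:E. w i : Q"
  "ALL x:Q. x + (SUM i:E. vscale (l i x) (w i)) : {x : Q. ALL i:E. l i x = 0}" using insert.IH insert.prems by blast
 define p where "p x = x + (SUM i:E. vscale (l i x) (w i))" for x
 have p: "p x : Q" "ALL i:E. l i (p x) = 0" if "x : Q" for x using w(2) that by (auto simp: p_def)
 show ?case
 \<comment> \<open>If \<open>l j\<close> is nonzero somewhere on the earlier kernel, a vector
   \<open>z\<close> there with value 1 corrects the projection. Otherwise the old projection already
   works, with 0 as the vector for \<open>j\<close>.\<close>
 proof (cases "EX z:Q. (ALL i:E. l i z = 0) & l j z ~= 0")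
  case True
  then obtain z0 where z0: "z0 : Q" "ALL i:E. l i z0 = 0" "l j z0 ~= 0" by blast
  define z where "z = vscale (inverse (l j z0)) z0"
  have z: "z : Q" "ALL i:E. l i z = 0" "l j z = 1" using z0 nv.subspace_scale[OF assms(2)] insert.prems by (auto simp: z_def lin_fun_scale)
  define w' where "w' i = (if i = j then - z else w i - vscale (l j (w i)) z)" for i
  have "w' i : Q" if "i : insert j E" for i using that w(1) z(1) nv.subspace_neg[OF assms(2)] nv.subspace_diff[OF assms(2)] nv.subspace_scale[OF assms(2)] by (auto simp: w'_def)
  moreover have "x + (SUM i:insert j E. vscale (l i x) (w' i)) : {x : Q. ALL i:insert j E. l i x = 0}"
  if x: "x : Q" for x
  proof -
  have "(SUM i:E. vscale (l i x) (w' i)) = (SUM i:E. vscale (l i x) (w i) - vscale (l i x * l j (w i)) z)"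
  using insert.hyps(2) by (intro sum.cong refl) (auto simp: w'_def nv.scale_right_diff_distrib)
  also have "... = (SUM i:E. vscale (l i x) (w i)) - vscale (SUM i:E. l i x * l j (w i)) z" by (simp only: sum_subtractf nv.scale_sum_left)
  finally have e1: "(SUM i:E. vscale (l i x) (w' i)) = (SUM i:E. vscale (l i x) (w i)) - vscale (SUM i:E. l i x * l j (w i)) z" .
  have lp: "l j (p x) = l j x + (SUM i:E. l i x * l j (w i))" unfolding p_def lin_fun_add[OF lj] lin_fun_sum[OF lj] ..
  have e2: "x + (SUM i:insert j E. vscale (l i x) (w' i)) = p x - vscale (l j (p x)) z"
  proof -
  have wj: "w' j = - z" by (simp add: w'_def)
  have "(SUM i:insert j E. vscale (l i x) (w' i)) = vscale (l j x) (- z) + ((SUM i:E. vscale (l i x) (w i)) - vscale (SUM i:E. l i x * l j (w i)) z)"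
  unfolding sum.insert[OF insert.hyps] e1 wj ..
  then show ?thesis unfolding lp nv.scale_left_distrib nv.scale_minus_right unfolding p_def by simp
  qed
  have "l j (p x - vscale (l j (p x)) z) = 0"
  proof -
  have "l j ((p x - vscale (l j (p x)) z) + vscale (l j (p x)) z) = l j (p x - vscale (l j (p x)) z) + l j (p x) * l j z" by (simp only: lin_fun_add[OF lj] lin_fun_scale[OF lj])
  then show ?thesis using z(3) by simp
  qed
  moreover have "l i (p x - vscale (l j (p x)) z) = 0" if i: "i : E" for i
  proof -
  have li: "lin_fun (l i)" using insert.prems i by simp
  have "l i ((p x - vscale (l j (p x)) z) + vscale (l j (p x)) z) = l i (p x - vscale (l j (p x)) z) + l j (p x) * l i z" by (simp only: lin_fun_add[OF li] lin_fun_scale[OF li])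
  then show ?thesis using z(2) p(2)[OF x] i by simp
  qed
  moreover have "p x - vscale (l j (p x)) z : Q" using p(1)[OF x] z(1) nv.subspace_diff[OF assms(2)] nv.subspace_scale[OF assms(2)] by blast
  ultimately show ?thesis unfolding e2 by auto
  qed
  ultimately show ?thesis by (intro exI[of _ w']) blast
 next
  case False
  define w' where "w' i = (if i = j then 0 else w i)" for i
  have s: "(SUM i:insert j E. vscale (l i x) (w' i)) = (SUM i:E. vscale (l i x) (w i))" for x
  proof -
  have "(SUM i:E. vscale (l i x) (w' i)) = (SUM i:E. vscale (l i x) (w i))" using insert.hyps(2) by (intro sum.cong refl) (auto simp: w'_def)
  then show ?thesis using insert.hyps by (simp add: w'_def)
  qed
  have px: "p x : {x : Q. ALL i:insert j E. l i x = 0}" if "x : Q" for x using False p[OF that] by auto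
  have "x + (SUM i:insert j E. vscale (l i x) (w' i)) : {x : Q. ALL i:insert j E. l i x = 0}" if "x : Q" for x using px[OF that] unfolding s p_def .
  moreover have "w' i : Q" if "i : insert j E" for i using that w(1) nv.subspace_0[OF assms(2)] by (auto simp: w'_def)
  ultimately show ?thesis by (intro exI[of _ w'] conjI ballI) blast+
 qed
qed

lemma choose_disjoint:
 assumes "finite \<J>" "finite F" "!!c. c : \<J> ==> finite (A c)"
  "!!c. c : \<J> ==> card F + card \<J> * m <= card (A c)"
 shows "EX B. (ALL c:\<J>. B c <= A c & B c Int F = {} & card (B c) = m) & (ALL c:\<J>. ALL d:\<J>. c ~= d --> B c Int B d = {})" using assms
proof (induction \<J> arbitrary: F rule: finite_induct)
 case empty
 then show ?case by simp
next
 case (insert c \<J>)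
 have "card (A c) - card F <= card (A c - F)" by (rule diff_card_le_card_Diff) (rule insert.prems(1))
 then have "m <= card (A c - F)" using insert.prems(3)[of c] insert.hyps by simp
 then obtain Bc where Bc: "Bc <= A c - F" "card Bc = m" "finite Bc" using obtain_subset_with_card_n by metis
 have F': "finite (F Un Bc)" "card (F Un Bc) <= card F + m" using insert.prems(1) Bc card_Un_le[of F Bc] by auto
 have "card (F Un Bc) + card \<J> * m <= card (A d)" if "d : \<J>" for d using insert.prems(3)[of d] that insert.hyps F'(2) by simp
 then obtain B where B: "ALL d:\<J>. B d <= A d & B d Int (F Un Bc) = {} & card (B d) = m"
  "ALL d:\<J>. ALL e:\<J>. d ~= e --> B d Int B e = {}" using insert.IH[OF F'(1)] insert.prems(2) by auto
 have e: "(B(c := Bc)) d = B d" if "d : \<J>" for d using that insert.hyps(2) by auto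
 show ?case
 proof (intro exI[of _ "B(c := Bc)"] conjI ballI impI)
  fix d assume d: "d : insert c \<J>"
  show "(B(c := Bc)) d <= A d" "(B(c := Bc)) d Int F = {}" "card ((B(c := Bc)) d) = m" using d B(1) Bc e by (cases "d = c"; auto)+
  fix e' assume e': "e' : insert c \<J>" "d ~= e'"
  show "(B(c := Bc)) d Int (B(c := Bc)) e' = {}" using d e' B Bc insert.hyps(2) by (cases "d = c"; cases "e' = c") auto
 qed
qed

text \<open>The functionals decide what is moved, the vectors where to. The alternating sum over all
  \<open>E <= I\<close> of the images of one space is the basic relation of the exactness
  argument.\<close>

definition shear :: "('i => (nat => 'a::field) => 'a) => ('i => nat => 'a) => 'i set => 'a vec => nat => 'a" where
 "shear l v E x = x + (SUM i:E. vscale (l i x) (v i))"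

definition indep_mod :: "'i set => ('i => nat => 'a::field) => 'a vs => bool" where
 "indep_mod I v T \<longleftrightarrow> (ALL c. (SUM i:I. vscale (c i) (v i)) : T --> (ALL i:I. c i = 0))"

lemma shear_lin: "(!!i. i : E ==> lin_fun (l i)) ==> lin_map (shear l v E)"
proof (rule lin_mapI)
 fix x y c assume l: "!!i. i : E ==> lin_fun (l i)"
 have "(SUM i:E. vscale (l i (x + y)) (v i)) = (SUM i:E. vscale (l i x) (v i) + vscale (l i y) (v i))"
  using l by (intro sum.cong refl) (simp add: lin_fun_add nv.scale_left_distrib)
 then show "shear l v E (x + y) = shear l v E x + shear l v E y" by (simp add: shear_def sum.distrib)
 have "(SUM i:E. vscale (l i (vscale c x)) (v i)) = (SUM i:E. vscale c (vscale (l i x) (v i)))" using l by (intro sum.cong refl) (simp add: lin_fun_scale)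
 then show "shear l v E (vscale c x) = vscale c (shear l v E x)" by (simp add: shear_def nv.scale_sum_right nv.scale_right_distrib)
qed

text \<open>The displacement lies in the span of the \<open>v i\<close>; independence modulo
  \<open>T\<close> makes its coefficients vanish. Injectivity on \<open>T\<close> follows.\<close>

lemma shear_in_T:
 assumes "nsub T" "indep_mod I v T" "finite I" "E <= I" "x : T" "shear l v E x : T"
 shows "ALL i:E. l i x = 0" "shear l v E x = x"
proof -
 have "shear l v E x - x : T" using nv.subspace_diff[OF assms(1,6,5)] .
 then have "(SUM i:E. vscale (l i x) (v i)) : T" by (simp add: shear_def)
 moreover have "(SUM i:E. vscale (l i x) (v i)) = (SUM i:I. vscale (if i : E then l i x else 0) (v i))"
 proof -
  have "(SUM i:I. vscale (if i : E then l i x else 0) (v i)) = (SUM i:I. if i : E then vscale (l i x) (v i) else 0)" by (intro sum.cong refl) simp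
  also have "... = (SUM i:I Int E. vscale (l i x) (v i))" using assms(3) by (simp add: sum.inter_restrict)
  finally show ?thesis using assms(4) by (simp add: Int_absorb1)
 qed
 ultimately have "(SUM i:I. vscale (if i : E then l i x else 0) (v i)) : T" by (simp only:)
 then have "ALL i:I. (if i : E then l i x else 0) = 0" using spec[OF assms(2)[unfolded indep_mod_def], of "%i. if i : E then l i x else 0"] by blast
 then show a: "ALL i:E. l i x = 0" using assms(4) by (metis subsetD)
 then show "shear l v E x = x" by (simp add: shear_def)
qed

lemma shear_inj:
 assumes "nsub T" "indep_mod I v T" "finite I" "E <= I" "!!i. i : E ==> lin_fun (l i)"
 shows "inj_on (shear l v E) T"
proof (rule inj_onI)
 fix x y assume xy: "x : T" "y : T" "shear l v E x = shear l v E y"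
 have lin: "lin_map (shear l v E)" by (rule shear_lin) (rule assms(5))
 have "shear l v E (x - y) + shear l v E y = shear l v E x" using lin_map_add[OF lin, of "x - y" y] by simp
 then have z: "shear l v E (x - y) = 0" using xy(3) by simp
 have "x - y : T" using nv.subspace_diff[OF assms(1) xy(1,2)] .
 moreover have "shear l v E (x - y) : T" unfolding z by (rule nv.subspace_0[OF assms(1)])
 ultimately have "shear l v E (x - y) = x - y" by (rule shear_in_T(2)[OF assms(1-4)])
 then show "x = y" using z by simp
qed

text \<open>Each task \<open>c\<close> asks for \<open>m\<close> members containing the sheared
  \<open>Qf c\<close>. It receives \<open>m\<close> private members among those that already contain
  the kernel of its functionals on \<open>Qf c\<close>. Thus every member prescribes a single
  residue for each \<open>v i\<close>, the one from \<open>factor_functionals\<close>, and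
  \<open>place_vectors\<close> satisfies all of them. The members in \<open>F\<close> are reserved
  for the one task (\<open>E0\<close>, \<open>Q0\<close>), which must be met for all of
  them.\<close>

lemma shear_exists:
 fixes H :: "'a::{field,finite} vs set" and l :: "'i => 'a vec => 'a"
 assumes H: "tfam n k m0 H" and T: "nsub T" "T <= nspace n" and I: "finite I" "!!i. i : I ==> lin_fun (l i)"
  and J: "finite \<J>" "!!c. c : \<J> ==> Ef c <= I" "!!c. c : \<J> ==> nsub (Qf c)" "!!c. c : \<J> ==> Qf c <= T"
  and A: "!!c. c : \<J> ==> card F + card \<J> * m <= card {X : H. {x : Qf c. ALL i:Ef c. l i x = 0} <= X}"
  and F: "F <= H" "E0 <= I" "nsub Q0" "Q0 <= T" "!!X. X : F ==> {x : Q0. ALL i:E0. l i x = 0} <= X"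
  and b: "card F + card \<J> * m <= m0" "card T * CARD('a) ^ card I * CARD('a) ^ (k * (card F + card \<J> * m)) < CARD('a) ^ n"
 obtains v where "!!i. i : I ==> v i : nspace n" "indep_mod I v T"
  "!!c. c : \<J> ==> m <= card {X : H. shear l v (Ef c) ` Qf c <= X}"
  "!!X. X : F ==> shear l v E0 ` Q0 <= X"
proof -
 have finH: "finite H" by (rule tfam_finite[OF H])
 have finF: "finite F" using F(1) finH finite_subset by blast
 obtain B where B: "ALL c:\<J>. B c <= {X : H. {x : Qf c. ALL i:Ef c. l i x = 0} <= X} & B c Int F = {} & card (B c) = m"
  "ALL c:\<J>. ALL d:\<J>. c ~= d --> B c Int B d = {}" using choose_disjoint[OF J(1) finF, of "%c. {X : H. {x : Qf c. ALL i:Ef c. l i x = 0} <= X}" m] A finH by auto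
 define C where "C = F Un (UN c:\<J>. B c)"
 have CH: "C <= H" using F(1) B(1) by (auto simp: C_def)
 have finC: "finite C" using CH finH finite_subset by blast
 have cC: "card C <= card F + card \<J> * m"
 proof -
  have "card (UN c:\<J>. B c) <= (SUM c:\<J>. card (B c))" by (rule card_UN_le[OF J(1)])
  also have "... = card \<J> * m" using B(1) by simp
  finally show ?thesis unfolding C_def using card_Un_le[of F "UN c:\<J>. B c"] by linarith
 qed
 define cX where "cX X = (SOME c. c : \<J> & X : B c)" for X
 have cX: "cX X = c" if "c : \<J>" "X : B c" for X c
 proof -
  have "cX X : \<J> & X : B (cX X)" unfolding cX_def by (rule someI[of _ c]) (use that in simp)
  then show ?thesis using B(2) that by blast
 qed
 define Ei where "Ei X = (if X : F then E0 else Ef (cX X))" for X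
 define Qi where "Qi X = (if X : F then Q0 else Qf (cX X))" for X
 have EQ: "Ei X <= I" "nsub (Qi X)" "Qi X <= T" "{x : Qi X. ALL i:Ei X. l i x = 0} <= X" if X: "X : C" for X
 proof -
  have "Ei X <= I & nsub (Qi X) & Qi X <= T & {x : Qi X. ALL i:Ei X. l i x = 0} <= X"
  proof (cases "X : F")
  case True
  then show ?thesis using F by (simp add: Ei_def Qi_def)
  next
  case False
  then obtain c where c: "c : \<J>" "X : B c" using X by (auto simp: C_def)
  then have "Ei X = Ef c" "Qi X = Qf c" using False cX by (auto simp: Ei_def Qi_def)
  moreover have "X : {X : H. {x : Qf c. ALL i:Ef c. l i x = 0} <= X}" using B(1) c by blast
  ultimately show ?thesis using J c by simp
  qed
  then show "Ei X <= I" "nsub (Qi X)" "Qi X <= T" "{x : Qi X. ALL i:Ei X. l i x = 0} <= X" by auto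
 qed
 have "ALL X:C. EX w. (ALL i:Ei X. w i : Qi X) &
  (ALL x:Qi X. x + (SUM i:Ei X. vscale (l i x) (w i)) : {x : Qi X. ALL i:Ei X. l i x = 0})"
 proof
  fix X assume X: "X : C"
  have "finite (Ei X)" using EQ(1)[OF X] I(1) finite_subset by blast
  then show "EX w. (ALL i:Ei X. w i : Qi X) &
  (ALL x:Qi X. x + (SUM i:Ei X. vscale (l i x) (w i)) : {x : Qi X. ALL i:Ei X. l i x = 0})" by (rule factor_functionals[OF _ EQ(2)[OF X]]) (use I(2) EQ(1)[OF X] in auto)
 qed
 from bchoice[OF this] obtain W where W: "ALL X:C. (ALL i:Ei X. W X i : Qi X) &
  (ALL x:Qi X. x + (SUM i:Ei X. vscale (l i x) (W X i)) : {x : Qi X. ALL i:Ei X. l i x = 0})" ..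
 \<comment> \<open>Functionals outside \<open>Ei X\<close> do not enter the shear used for
   \<open>X\<close>, so any residue would do for them.\<close>
 define w where "w i X = (if i : Ei X then W X i else 0)" for i X
 have wn: "w i X : nspace n" if "i : I" "X : C" for i X
 proof (cases "i : Ei X")
  case True
  then have "W X i : Qi X" using bspec[OF W that(2)] by blast
  then show ?thesis using EQ(3)[OF that(2)] T(2) True unfolding w_def by auto
 next
  case False
  then show ?thesis using nv.subspace_0[OF subspace_nspace] unfolding w_def by simp
 qed
 have "card T * CARD('a) ^ card I * CARD('a) ^ (k * card C) <= card T * CARD('a) ^ card I * CARD('a) ^ (k * (card F + card \<J> * m))"
  using cC card_field_ge2[where 'a='a] by (intro mult_le_mono2 power_increasing) auto
 then have bb: "card T * CARD('a) ^ card I * CARD('a) ^ (k * card C) < CARD('a) ^ n" using b(2) by linarith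
 have cm: "card C <= m0" using cC b(1) by linarith
 obtain v T' where v: "T' <= nspace n" "ALL i:I. v i : T'" "ALL i:I. ALL X:C. v i - w i X : X"
  "ALL c. (SUM i:I. vscale (c i) (v i)) : T --> (ALL i:I. c i = 0)"
 proof -
  have "EX v T'. nsub T' & T <= T' & T' <= nspace n & card T' <= card T * CARD('a) ^ card I
  & (ALL i:I. v i : T') & (ALL i:I. ALL X:C. v i - w i X : X)
  & (ALL c. (SUM i:I. vscale (c i) (v i)) : T --> (ALL i:I. c i = 0))" by (rule place_vectors[OF H finC CH cm _ I(1) T bb]) (rule wn)
  then show thesis by (elim exE conjE) (rule that)
 qed
 have main: "shear l v (Ei X) x : X" if X: "X : C" and x: "x : Qi X" for X x
 proof -
  have sX: "nsub X" using tfamD(1)[OF H] CH X by blast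
  have "shear l v (Ei X) x = (x + (SUM i:Ei X. vscale (l i x) (W X i))) + (SUM i:Ei X. vscale (l i x) (v i - W X i))"
  by (simp add: shear_def nv.scale_right_diff_distrib sum_subtractf)
  moreover have "x + (SUM i:Ei X. vscale (l i x) (W X i)) : X" using W X x EQ(4)[OF X] by blast
  moreover have "(SUM i:Ei X. vscale (l i x) (v i - W X i)) : X"
  proof (intro nv.subspace_sum[OF sX] nv.subspace_scale[OF sX])
  fix i assume i: "i : Ei X"
  then have "v i - w i X : X" using v(3) EQ(1)[OF X] X by blast
  then show "v i - W X i : X" using i by (simp add: w_def)
  qed
  ultimately show ?thesis using nv.subspace_add[OF sX] by simp
 qed
 show ?thesis
 proof (rule that[of v])
  show "v i : nspace n" if "i : I" for i using v(1,2) that by blast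
  show "indep_mod I v T" unfolding indep_mod_def by (rule v(4))
  show "m <= card {X : H. shear l v (Ef c) ` Qf c <= X}" if c: "c : \<J>" for c
  proof -
  have "B c <= {X : H. shear l v (Ef c) ` Qf c <= X}"
  proof (rule subsetI)
  fix X assume X: "X : B c"
  have "X ~: F" using B(1) c X by blast
  then have "Ei X = Ef c" "Qi X = Qf c" using cX[OF c X] by (auto simp: Ei_def Qi_def)
  moreover have "X : C" using c X by (auto simp: C_def)
  ultimately show "X : {X : H. shear l v (Ef c) ` Qf c <= X}" using main[of X] CH by auto
  qed
  then have "card (B c) <= card {X : H. shear l v (Ef c) ` Qf c <= X}" by (rule card_mono[rotated]) (simp add: finH)
  then show ?thesis using B(1) c by simp
  qed
  show "shear l v E0 ` Q0 <= X" if X: "X : F" for X using main[of X] X by (auto simp: Ei_def Qi_def C_def)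
 qed
qed

section \<open>Alternating sums of shears and exactness\<close>

lemma alternating_toggle:
 fixes f :: "'i set => int"
 assumes I: "finite I" "i : I" and f: "!!E. E <= I - {i} ==> f (insert i E) = f E"
 shows "(SUM E:Pow I. (- 1) ^ card E * f E) = 0"
proof -
 let ?I = "I - {i}"
 have P: "Pow I = Pow ?I Un insert i ` Pow ?I" using Pow_insert[of i ?I] I(2) by (simp add: insert_absorb)
 have inj: "inj_on (insert i) (Pow ?I)" by (rule inj_onI) blast
 have "(SUM E:Pow I. (- 1) ^ card E * f E) = (SUM E:Pow ?I. (- 1) ^ card E * f E) + (SUM E:insert i ` Pow ?I. (- 1) ^ card E * f E)"
  unfolding P by (rule sum.union_disjoint) (use I in auto)
 also have "(SUM E:insert i ` Pow ?I. (- 1) ^ card E * f E) = (SUM E:Pow ?I. - ((- 1) ^ card E * f E))"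
 proof (subst sum.reindex[OF inj], rule sum.cong)
  fix E assume E: "E : Pow ?I"
  then have "finite E" "i ~: E" using I finite_subset by auto
  then show "((%E. (- 1) ^ card E * f E) \<circ> insert i) E = - ((- 1) ^ card E * f E)" using f[of E] E by simp
 qed simp
 finally show ?thesis by (simp add: sum_negf)
qed

lemma shear_id: "(!!i. i : E ==> l i x = 0) ==> shear l v E x = x" by (simp add: shear_def)

lemma shear_empty: "shear l v {} = id" by (auto simp: shear_def)

lemma shear_Gr:
 fixes S :: "'a::{field,finite} vs"
 assumes T: "nsub T" and I: "finite I" "!!i. i : I ==> lin_fun (l i)"
  and v: "!!i. i : I ==> v i : nspace n" "indep_mod I v T"
  and S: "S : Gr n s" "S <= T" and E: "E <= I"
 shows "shear l v E ` S : Gr n s"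
proof -
 have lin: "lin_map (shear l v E)" by (rule shear_lin) (use I(2) E in blast)
 have inj: "inj_on (shear l v E) T" by (rule shear_inj[OF T v(2) I(1) E]) (use I(2) E in blast)
 have "shear l v E x : nspace n" if "x : S" for x unfolding shear_def using that GrD(2)[OF S(1)] v(1) E
  by (intro nv.subspace_add nv.subspace_sum nv.subspace_scale subspace_nspace) auto
 moreover have "card (shear l v E ` S) = card S" by (rule card_image) (rule inj_on_subset[OF inj S(2)])
 moreover have "nsub (shear l v E ` S)" by (rule nn.linear_subspace_image[OF lin GrD(1)[OF S(1)]])
 ultimately show ?thesis using GrD(5)[OF S(1)] by (auto simp: Gr_iff)
qed

lemma shear_pullback:
 fixes S :: "'a::{field,finite} vs"
 assumes lin: "!!i. i : E ==> lin_fun (l i)" and S: "nsub S" and Z: "nsub Z" "Z <= shear l v E ` S"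
 shows "nsub {x : S. shear l v E x : Z}" "shear l v E ` {x : S. shear l v E x : Z} = Z"
proof -
 have l: "lin_map (shear l v E)" by (rule shear_lin) (rule lin)
 show "nsub {x : S. shear l v E x : Z}" using nv.subspace_inter[OF S nn.linear_subspace_vimage[OF l Z(1)]] by (simp add: vimage_def Int_def)
 show "shear l v E ` {x : S. shear l v E x : Z} = Z" using Z(2) by blast
qed

text \<open>If some \<open>l i\<close> vanishes on an r-space of \<open>S\<close>, then adding
  \<open>i\<close> to \<open>E\<close> does not change its image and its terms cancel in pairs. The
  choice of functionals thus decides which r-spaces survive.\<close>

lemma shear_boundary:
 fixes S :: "'a::{field,finite} vs"
 assumes T: "nsub T" and I: "finite I" "!!i. i : I ==> lin_fun (l i)"
  and v: "!!i. i : I ==> v i : nspace n" "indep_mod I v T"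
  and S: "S : Gr n s" "S <= T" and V: "V : Gr n r"
 shows "(SUM E:Pow I. (- 1) ^ card E * boundary n s r (unit_vec (shear l v E ` S)) V) =
  (SUM R:{R : Gr n r. R <= S & (ALL i:I. EX x:R. l i x ~= 0)}. SUM E:Pow I. (- 1) ^ card E * unit_vec (shear l v E ` R) V)"
proof -
 let ?R = "{R : Gr n r. R <= S}"
 have fR: "finite ?R" by (rule finite_subset[OF _ finite_Gr[of n r]]) blast
 have b: "boundary n s r (unit_vec (shear l v E ` S)) V = (SUM R:?R. unit_vec (shear l v E ` R) V)" if E: "E : Pow I" for E
 proof -
  have EI: "E <= I" using E by simp
  have lE: "!!i. i : E ==> lin_fun (l i)" using I(2) EI by blast
  have inj: "inj_on (shear l v E) S" using shear_inj[OF T v(2) I(1) EI lE] S(2) by (rule inj_on_subset)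
  have SG: "shear l v E ` S : Gr n s" by (rule shear_Gr[where l = l, OF T I v S EI])
  show ?thesis
  proof (cases "V <= shear l v E ` S")
  case True
  note pb = shear_pullback[where l = l, OF lE GrD(1)[OF S(1)] GrD(1)[OF V] True]
  define R0 where "R0 = {x : S. shear l v E x : V}"
  have cR0: "card R0 = card V"
  proof -
  have "card (shear l v E ` R0) = card R0" by (rule card_image, rule inj_on_subset[OF inj]) (auto simp: R0_def)
  then show ?thesis using pb(2) by (simp add: R0_def)
  qed
  have R0: "R0 : ?R" using pb(1) GrD(2)[OF S(1)] GrD(5)[OF V] cR0 by (auto simp: Gr_iff R0_def)
  have im: "shear l v E ` R0 = V" using pb(2) by (simp add: R0_def)
  have "unit_vec (shear l v E ` R) V = (if R = R0 then 1 else 0)" if "R : ?R" for R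
  proof -
  have "shear l v E ` R = V \<longleftrightarrow> R = R0" unfolding im[symmetric] by (rule inj_on_image_eq_iff[OF inj]) (use that in \<open>auto simp: R0_def\<close>)
  then show ?thesis by (auto simp: unit_vec_def)
  qed
  then have "(SUM R:?R. unit_vec (shear l v E ` R) V) = (SUM R:?R. if R = R0 then 1 else 0)" by (rule sum.cong[OF refl])
  also have "... = 1" using R0 fR by (subst sum.delta) simp_all
  finally show ?thesis unfolding boundary_unit[OF SG] using True V by simp
  next
  case False
  have "(SUM R:?R. unit_vec (shear l v E ` R) V) = 0" by (rule sum.neutral) (use False in \<open>auto simp: unit_vec_def\<close>)
  then show ?thesis unfolding boundary_unit[OF SG] using False by simp
  qed
 qed
 have "(SUM E:Pow I. (- 1) ^ card E * boundary n s r (unit_vec (shear l v E ` S)) V) =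
  (SUM E:Pow I. SUM R:?R. (- 1) ^ card E * unit_vec (shear l v E ` R) V)" by (rule sum.cong[OF refl]) (simp only: b sum_distrib_left)
 also have "... = (SUM R:?R. SUM E:Pow I. (- 1) ^ card E * unit_vec (shear l v E ` R) V)" by (rule sum.swap)
 also have "... = (SUM R:{R : Gr n r. R <= S & (ALL i:I. EX x:R. l i x ~= 0)}. SUM E:Pow I. (- 1) ^ card E * unit_vec (shear l v E ` R) V)"
 proof (rule sum.mono_neutral_right[OF fR])
  show "{R : Gr n r. R <= S & (ALL i:I. EX x:R. l i x ~= 0)} <= ?R" by blast
  show "ALL R:?R - {R : Gr n r. R <= S & (ALL i:I. EX x:R. l i x ~= 0)}. (SUM E:Pow I. (- 1) ^ card E * unit_vec (shear l v E ` R) V) = 0"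
  proof
  fix R assume "R : ?R - {R : Gr n r. R <= S & (ALL i:I. EX x:R. l i x ~= 0)}"
  then obtain i where i: "i : I" "ALL x:R. l i x = 0" by auto
  show "(SUM E:Pow I. (- 1) ^ card E * unit_vec (shear l v E ` R) V) = 0"
  proof (rule alternating_toggle[OF I(1) i(1)])
  fix E assume E: "E <= I - {i}"
  then have fE: "finite E" "i ~: E" using I(1) finite_subset by auto
  have "shear l v (insert i E) x = shear l v E x" if "x : R" for x using i(2) that fE by (simp add: shear_def)
  then have "shear l v (insert i E) ` R = shear l v E ` R" by (rule image_cong[OF refl])
  then show "unit_vec (shear l v (insert i E) ` R) V = unit_vec (shear l v E ` R) V" by simp
  qed
  qed
 qed
 finally show ?thesis .
qed

text \<open>Congruence modulo the kernel of the boundary map, with only the support recorded.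
  Reductions then compose freely (\<open>redto_trans\<close>), while the coefficients may grow
  without control.\<close>

definition redto :: "nat => nat => nat => (nat => 'a::field) set set => ('a vs => int) => bool" where
 "redto n s r A f \<longleftrightarrow> (EX Ph:ZGr n s. (ALL S. Ph S ~= 0 --> S : A) & boundary n s r Ph = boundary n s r f)"

lemma redtoE:
 assumes "redto n s r A f"
 obtains Ph where "Ph : ZGr n s" "!!S. Ph S ~= 0 ==> S : A" "boundary n s r Ph = boundary n s r f" using assms unfolding redto_def by blast

lemma redto_comb:
 fixes f :: "'i => 'a::{field,finite} vs => int"
 assumes "!!i. i : I ==> redto n s r A (f i)"
 shows "redto n s r A (%T. SUM i:I. c i * f i T)"
proof -
 have "ALL i:I. EX Ph. Ph : ZGr n s & (ALL S. Ph S ~= 0 --> S : A) & boundary n s r Ph = boundary n s r (f i)" using assms unfolding redto_def by blast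
 from bchoice[OF this] obtain Ph where P: "ALL i:I. Ph i : ZGr n s & (ALL S. Ph i S ~= 0 --> S : A) & boundary n s r (Ph i) = boundary n s r (f i)" ..
 let ?P = "%T. SUM i:I. c i * Ph i T"
 have "?P : ZGr n s" unfolding ZGr_def using P by (auto simp: ZGr_def intro!: sum.neutral)
 moreover have "S : A" if S: "?P S ~= 0" for S
 proof (rule ccontr)
  assume "S ~: A"
  then have "?P S = 0" using P by (intro sum.neutral) auto
  then show False using S by simp
 qed
 moreover have "boundary n s r ?P = boundary n s r (%T. SUM i:I. c i * f i T)" unfolding boundary_lincomb using P by (intro ext sum.cong) auto
 ultimately show ?thesis unfolding redto_def by (intro bexI[of _ ?P] conjI allI impI)
qed

lemma redto_unit: "S : Gr n s ==> S : A ==> redto n s r A (unit_vec S)" unfolding redto_def by (rule bexI[OF _ unit_vec_ZGr]) (auto simp: unit_vec_def split: if_splits)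

lemma redto_mono: "redto n s r A f ==> A <= B ==> redto n s r B f" unfolding redto_def by blast

lemma redto_cong: "redto n s r A f ==> boundary n s r f = boundary n s r g ==> redto n s r A g" unfolding redto_def by simp

lemma redto_trans:
 fixes f :: "'a::{field,finite} vs => int"
 assumes f: "redto n s r A f" and A: "!!S. S : A ==> S : Gr n s ==> redto n s r B (unit_vec S)"
 shows "redto n s r B f"
proof -
 obtain Ph where P: "Ph : ZGr n s" "!!S. Ph S ~= 0 ==> S : A" "boundary n s r Ph = boundary n s r f" using redtoE[OF f] by blast
 let ?I = "{S : Gr n s. Ph S ~= 0}"
 have "redto n s r B (%T. SUM S:?I. Ph S * unit_vec S T)" by (rule redto_comb) (use A P(2) in blast)
 moreover have "(%T. SUM S:?I. Ph S * unit_vec S T) = Ph"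
 proof -
  have "(SUM S:?I. Ph S * unit_vec S T) = (SUM S:Gr n s. Ph S * unit_vec S T)" for T by (rule sum.mono_neutral_left) (auto simp: finite_Gr)
  then show ?thesis using ZGr_expand[OF P(1)] by simp
 qed
 ultimately show ?thesis using P(3) redto_cong by simp
qed

text \<open>Removing the term \<open>E = {}\<close> from a vanishing alternating sum.\<close>

lemma redto_of_alternating:
 fixes g :: "'i set => 'a::{field,finite} vs => int"
 assumes I: "finite I" and z: "!!V. V : Gr n r ==> (SUM E:Pow I. (- 1) ^ card E * boundary n s r (g E) V) = 0"
  and A: "!!E. E <= I ==> E ~= {} ==> redto n s r A (g E)"
 shows "redto n s r A (g {})"
proof (rule redto_cong)
 show "redto n s r A (%T. SUM E:Pow I - {{}}. - ((- 1) ^ card E) * g E T)" by (rule redto_comb) (use A in blast)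
 show "boundary n s r (%T. SUM E:Pow I - {{}}. - ((- 1) ^ card E) * g E T) = boundary n s r (g {})" unfolding boundary_lincomb
 proof
  fix V
  show "(SUM E:Pow I - {{}}. - ((- 1) ^ card E) * boundary n s r (g E) V) = boundary n s r (g {}) V"
  proof (cases "V : Gr n r")
  case True
  have "(SUM E:Pow I. (- 1) ^ card E * boundary n s r (g E) V) = boundary n s r (g {}) V + (SUM E:Pow I - {{}}. (- 1) ^ card E * boundary n s r (g E) V)"
  using I by (subst sum.remove[of _ "{}"]) auto
  then show ?thesis using z[OF True] by (simp add: sum_negf)
  next
  case False
  then show ?thesis by (simp add: boundary_apply)
  qed
 qed
qed

definition inK :: "'a vs set => 'a vs => bool" where
 "inK H S \<longleftrightarrow> (EX X:H. S <= X)"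

text \<open>\<open>Y\<close> is a core of \<open>S\<close>: parts of \<open>S\<close> that meet it
  in dimension below \<open>r\<close> lie in \<open>m\<close> members, and nothing is asked of the
  others. Reductions shrink the core from \<open>S\<close> itself to dimension \<open>r\<close>;
  \<open>m\<close> is the supply of members that later shears draw on.\<close>

definition good :: "'a::{field,finite} vs set => nat => nat => 'a vs => 'a vs => bool" where
 "good H m r S Y \<longleftrightarrow> (ALL Z. nsub Z & Z <= S & card (Z Int Y) < CARD('a) ^ r --> m <= card {X : H. Z <= X})"

lemma goodD: "good H m r S Y ==> nsub Z ==> Z <= S ==> card (Z Int Y) < CARD('a) ^ r ==> m <= card {X : H. Z <= X}"
 for S :: "'a::{field,finite} vs" unfolding good_def by blast

lemma good_mono: "good H m r S Y ==> m' <= m ==> good H m' r S Y" unfolding good_def by (meson le_trans)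

lemma inK_of_card: "1 <= card {X : H. Z <= X} ==> inK H Z" unfolding inK_def by (metis (mono_tags, lifting) card.empty empty_Collect_eq not_one_le_zero)

lemma subspace_kernel:
 assumes "nsub Q" "!!i. i : E ==> lin_fun (l i)"
 shows "nsub {x : Q. ALL i:E. l i x = 0}" unfolding nv.subspace_def using nv.subspace_0[OF assms(1)] nv.subspace_add[OF assms(1)] nv.subspace_scale[OF assms(1)] assms(2)
 by (auto simp: lin_fun_0 lin_fun_add lin_fun_scale)

lemma redto_diff:
 fixes f g :: "'a::{field,finite} vs => int"
 assumes "redto n s r A f" "redto n s r A g"
 shows "redto n s r A (%T. f T - g T)"
proof -
 have "redto n s r A (%T. SUM i:{True, False}. (if i then 1 else - 1) * (if i then f else g) T)" by (rule redto_comb) (use assms in auto)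
 then show ?thesis by simp
qed

lemma card_field_power_iff:
 "CARD('a::{field,finite}) ^ i < CARD('a) ^ j \<longleftrightarrow> i < j" "CARD('a) ^ i <= CARD('a) ^ j \<longleftrightarrow> i <= j"
 using card_field_ge2[where 'a='a] by (auto intro!: power_strict_increasing_iff power_increasing_iff)

text \<open>As dim \<open>Y\<close> exceeds \<open>r\<close>, each r-space of \<open>S\<close>
  admits a functional that vanishes on it but not on \<open>Y\<close>. Every r-space is then
  cancelled, so \<open>S\<close> reduces to its proper shears. For nonempty \<open>E\<close> the
  shear fixes the part \<open>P E\<close> of \<open>Y\<close> pointwise, and this part is a properly
  smaller core; if its dimension is below \<open>r\<close>, the sheared space lies in a
  member.\<close>

lemma good_reduce:
 fixes S Y :: "'a::{field,finite} vs" and H :: "'a vs set"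
 assumes bdef: "b = 2 ^ (CARD('a) ^ s)" and H: "tfam n k m0 H" and S: "S : Gr n s" and Y: "nsub Y" "Y <= S" "card Y = CARD('a) ^ t" "r < t"
  and g: "good H (2 ^ b * b * m') r S Y" and m': "1 <= m'" "2 ^ b * b * m' <= m0"
  and sz: "CARD('a) ^ s * CARD('a) ^ b * CARD('a) ^ (k * m0) < CARD('a) ^ n"
 shows "redto n s r ({S. inK H S} Un {S'. EX Y' t'. nsub Y' & Y' <= S' & card Y' = CARD('a) ^ t' & r <= t' & t' < t & good H m' r S' Y'})
  (unit_vec S)"
proof -
 let ?q = "CARD('a)"
 define I where "I = {R : Gr n r. R <= S}"
 have finI: "finite I" unfolding I_def by (rule finite_subset[OF _ finite_Gr[of n r]]) blast
 have cI: "card I <= b" using card_subsets_le[OF S, of r "%_. True"] by (simp add: I_def bdef)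
 have "ALL R:I. EX l. lin_fun l & (ALL x:R. l x = 0) & (EX y:Y. l y ~= 0)"
 proof
  fix R assume "R : I"
  then have R: "R : Gr n r" by (simp add: I_def)
  have "\<not> Y <= R"
  proof
  assume "Y <= R"
  then have "card Y <= card R" by (rule card_mono[OF GrD(4)[OF R]])
  then show False using Y(3,4) GrD(5)[OF R] card_field_power_iff(1)[of r t, where 'a='a] by simp
  qed
  then obtain y where y: "y : Y" "y ~: R" by blast
  obtain l where "lin_fun l" "!!x. x : R ==> l x = 0" "l y = 1" using functional_exists[OF GrD(1,2)[OF R] y(2)] by blast
  then show "EX l. lin_fun l & (ALL x:R. l x = 0) & (EX y:Y. l y ~= 0)" using y(1) by (intro exI[of _ l] conjI bexI[of _ y]) auto
 qed
 from bchoice[OF this] obtain l where l: "ALL R:I. lin_fun (l R) & (ALL x:R. l R x = 0) & (EX y:Y. l R y ~= 0)" ..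
 have lin: "lin_fun (l i)" if "i : I" for i using l that by blast
 define P where "P E = {x : Y. ALL i:E. l i x = 0}" for E
 \<comment> \<open>All demands that goodness of the sheared spaces will make. There are at most 2^b
   sets \<open>E\<close> and \<open>b\<close> subsets \<open>Q\<close>, whence the factor
   \<open>2 ^ b * b\<close> by which the supply drops in one step.\<close>
 define JJ where "JJ = {(E, Q). E <= I & nsub Q & Q <= S & card (Q Int P E) < ?q ^ r}"
 have sub: "JJ <= Pow I \<times> Pow S" by (auto simp: JJ_def)
 have fS: "finite S" by (rule GrD(4)[OF S])
 have finPP: "finite (Pow I \<times> Pow S)" using finI fS by blast
 have finJ: "finite JJ" by (rule finite_subset[OF sub finPP])
 have cJ: "card JJ <= 2 ^ b * b"
 proof -
  have "card JJ <= card (Pow I \<times> Pow S)" by (rule card_mono[OF finPP sub])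
  also have "... = 2 ^ card I * 2 ^ card S" using finI fS by (simp add: card_cartesian_product card_Pow)
  also have "... <= 2 ^ b * b" unfolding bdef[symmetric] GrD(5)[OF S] using cI by (intro mult_le_mono power_increasing) (simp_all add: bdef)
  finally show ?thesis .
 qed
 have cJm: "card JJ * m' <= 2 ^ b * b * m'" using cJ by (rule mult_le_mono1)
 have Pfin: "finite (P E)" for E using finite_subset[OF _ finite_subset[OF Y(2) fS], of "P E"] by (auto simp: P_def)
 obtain v where v: "!!i. i : I ==> v i : nspace n" "indep_mod I v S"
  "!!c. c : JJ ==> m' <= card {X : H. shear l v (fst c) ` snd c <= X}"
 proof (rule shear_exists[of n k m0 H S I l JJ fst snd "{}" m' "{}" S])
  show "tfam n k m0 H" by (rule H)
  show "nsub S" "S <= nspace n" "nsub S" using GrD[OF S] by auto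
  show "finite I" by (rule finI)
  show "lin_fun (l i)" if "i : I" for i by (rule lin[OF that])
  show "finite JJ" by (rule finJ)
  show "fst c <= I" "nsub (snd c)" "snd c <= S" if "c : JJ" for c using that by (auto simp: JJ_def)
  show "card {} + card JJ * m' <= card {X : H. {x : snd c. ALL i:fst c. l i x = 0} <= X}" if c: "c : JJ" for c
  proof -
  obtain E Q where EQ: "c = (E, Q)" "E <= I" "nsub Q" "Q <= S" "card (Q Int P E) < ?q ^ r" using c by (auto simp: JJ_def)
  have "2 ^ b * b * m' <= card {X : H. {x : Q. ALL i:E. l i x = 0} <= X}"
  proof (rule goodD[OF g])
  show "nsub {x : Q. ALL i:E. l i x = 0}" by (rule subspace_kernel[OF EQ(3)]) (use lin EQ(2) in blast)
  show "{x : Q. ALL i:E. l i x = 0} <= S" using EQ(4) by blast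
  have "{x : Q. ALL i:E. l i x = 0} Int Y = Q Int P E" by (auto simp: P_def)
  then show "card ({x : Q. ALL i:E. l i x = 0} Int Y) < ?q ^ r" using EQ(5) by simp
  qed
  then have "card {} + card JJ * m' <= card {X : H. {x : Q. ALL i:E. l i x = 0} <= X}" using cJm unfolding card.empty by linarith
  then show ?thesis using EQ(1) by (simp only: fst_conv snd_conv)
  qed
  show "card {} + card JJ * m' <= m0" using cJm m'(2) unfolding card.empty by linarith
  have "card {} + card JJ * m' <= m0" using cJm m'(2) unfolding card.empty by linarith
  then have "?q ^ s * ?q ^ card I * ?q ^ (k * (card {} + card JJ * m')) <= ?q ^ s * ?q ^ b * ?q ^ (k * m0)"
  using cI card_field_ge2[where 'a='a] by (intro mult_le_mono power_increasing order_refl; (linarith | simp))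
  then show "card S * ?q ^ card I * ?q ^ (k * (card {} + card JJ * m')) < ?q ^ n" using sz unfolding GrD(5)[OF S] by (rule le_less_trans)
  fix v assume "!!i. i : I ==> v i : nspace n" "indep_mod I v S"
  "!!c. c : JJ ==> m' <= card {X : H. shear l v (fst c) ` snd c <= X}"
  then show thesis by (rule that)
 qed auto
 let ?A = "{S. inK H S} Un {S'. EX Y' t'. nsub Y' & Y' <= S' & card Y' = CARD('a) ^ t' & r <= t' & t' < t & good H m' r S' Y'}"
 have "redto n s r ?A (unit_vec (shear l v {} ` S))"
 proof (rule redto_of_alternating[OF finI, of n r s "%E. unit_vec (shear l v E ` S)"])
  fix V :: "'a vs" assume V: "V : Gr n r"
  have e: "{R : Gr n r. R <= S & (ALL i:I. EX x:R. l i x ~= 0)} = {}" using l by (auto simp: I_def)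
  show "(SUM E:Pow I. (- 1) ^ card E * boundary n s r (unit_vec (shear l v E ` S)) V) = 0"
  using shear_boundary[where l = l, OF GrD(1)[OF S] finI lin v(1,2) S subset_refl V] unfolding e by simp
 next
  fix E assume E: "E <= I" "E ~= {}"
  have SG: "shear l v E ` S : Gr n s" by (rule shear_Gr[where l = l, OF GrD(1)[OF S] finI lin v(1,2) S subset_refl E(1)])
  have linE: "!!i. i : E ==> lin_fun (l i)" using lin E(1) by blast
  have PY: "P E <= Y" by (auto simp: P_def)
  have Psub: "nsub (P E)" unfolding P_def by (rule subspace_kernel[OF Y(1)]) (rule linE)
  have Pid: "shear l v E x = x" if "x : P E" for x by (rule shear_id) (use that in \<open>auto simp: P_def\<close>)
  show "redto n s r ?A (unit_vec (shear l v E ` S))"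
  proof (rule redto_unit[OF SG])
  show "shear l v E ` S : ?A"
  proof (cases "card (P E) < ?q ^ r")
  case True
  have "S Int P E = P E" using PY Y(2) by blast
  then have "(E, S) : JJ" using True E(1) GrD(1)[OF S] by (simp add: JJ_def)
  then have "1 <= card {X : H. shear l v E ` S <= X}" using v(3)[of "(E, S)"] m'(1) by simp
  then show ?thesis using inK_of_card by blast
  next
  case False
  have Pn: "P E <= nspace n" using PY Y(2) GrD(2)[OF S] by blast
  have cP: "card (P E) = ?q ^ nv.dim (P E)" by (rule card_subspace[OF Psub Pn])
  have "r <= nv.dim (P E)" using False cP card_field_power_iff(2)[of r "nv.dim (P E)", where 'a='a] by simp
  moreover have "nv.dim (P E) < t"
  proof -
  obtain i where i: "i : E" using E(2) by blast
  then obtain y where "y : Y" "l i y ~= 0" using l E(1) by blast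
  then have "P E \<subset> Y" using PY i by (auto simp: P_def)
  then have "card (P E) < card Y" by (rule psubset_card_mono[OF finite_subset[OF Y(2) fS]])
  then show ?thesis using cP Y(3) card_field_power_iff(1)[of "nv.dim (P E)" t, where 'a='a] by simp
  qed
  moreover have "P E <= shear l v E ` S"
  proof
  fix x assume x: "x : P E"
  then have "shear l v E x : shear l v E ` S" using PY Y(2) by blast
  then show "x : shear l v E ` S" using Pid[OF x] by simp
  qed
  moreover have "good H m' r (shear l v E ` S) (P E)" unfolding good_def
  proof (intro allI impI, elim conjE)
  fix Z :: "'a vs" assume Z: "nsub Z" "Z <= shear l v E ` S" "card (Z Int P E) < ?q ^ r"
  define Q where "Q = {x : S. shear l v E x : Z}"
  have Q: "nsub Q" "shear l v E ` Q = Z" unfolding Q_def by (rule shear_pullback[where l = l, OF linE GrD(1)[OF S] Z(1,2)], assumption)+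
  have "Q Int P E <= Z Int P E" using Pid by (auto simp: Q_def)
  then have "card (Q Int P E) <= card (Z Int P E)" using Pfin by (intro card_mono) auto
  then have "(E, Q) : JJ" using Z(3) E(1) Q(1) by (auto simp: JJ_def Q_def)
  then show "m' <= card {X : H. Z <= X}" using v(3)[of "(E, Q)"] Q(2) by simp
  qed
  ultimately show ?thesis using Psub cP by blast
  qed
  qed
 qed
 then show ?thesis by (simp add: shear_empty)
qed


text \<open>Here the functionals vanish on the r-spaces other than \<open>R\<close>, but not on
  \<open>R\<close>. In both alternating sums only the images of \<open>R\<close> survive, with equal
  contributions that cancel in the difference; every proper shear of \<open>S1\<close> or
  \<open>S2\<close> cuts the core and lies in a member.\<close>

lemma good_pair:
 fixes S1 S2 R :: "'a::{field,finite} vs" and H :: "'a vs set"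
 assumes bdef: "b = 2 ^ (CARD('a) ^ s)" and H: "tfam n k m0 H"
  and S: "S1 : Gr n s" "S2 : Gr n s" and R: "R : Gr n r" "R <= S1" "R <= S2"
  and g: "good H (2 ^ (2 * b) * 2) r S1 R" "good H (2 ^ (2 * b) * 2) r S2 R" and m0: "2 ^ (2 * b) * 2 <= m0"
  and sz: "CARD('a) ^ (2 * s) * CARD('a) ^ (2 * b) * CARD('a) ^ (k * m0) < CARD('a) ^ n"
 shows "redto n s r {S. inK H S} (%T. unit_vec S1 T - unit_vec S2 T)"
proof -
 let ?q = "CARD('a)"
 define T where "T = ssum S1 S2"
 have sT: "nsub T" unfolding T_def by (rule subspace_ssum[OF GrD(1)[OF S(1)] GrD(1)[OF S(2)]])
 have ST: "S1 <= T" "S2 <= T" using ssum_upper[OF GrD(1)[OF S(1)] GrD(1)[OF S(2)]] by (auto simp: T_def)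
 have Tn: "T <= nspace n" unfolding T_def by (rule ssum_least[OF subspace_nspace GrD(2)[OF S(1)] GrD(2)[OF S(2)]])
 have cT: "card T <= ?q ^ (2 * s)"
 proof -
  have "card (S1 Int S2) >= 1"
  proof -
  have "0 : S1 Int S2" using nv.subspace_0[OF GrD(1)[OF S(1)]] nv.subspace_0[OF GrD(1)[OF S(2)]] by simp
  then have "card (S1 Int S2) > 0" using GrD(4)[OF S(1)] by (auto simp: card_gt_0_iff)
  then show ?thesis by simp
  qed
  then have "card T <= card T * card (S1 Int S2)" by simp
  also have "... = ?q ^ s * ?q ^ s" unfolding T_def using card_ssum[OF GrD(1)[OF S(1)] GrD(1)[OF S(2)] GrD(4)[OF S(1)] GrD(4)[OF S(2)]] GrD(5)[OF S(1)] GrD(5)[OF S(2)] by simp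
  finally show ?thesis by (simp only: mult_2 power_add)
 qed
 define I where "I = {R' : Gr n r. R' ~= R & R' <= S1} Un {R' : Gr n r. R' ~= R & R' <= S2}"
 have finI: "finite I" unfolding I_def by (rule finite_subset[OF _ finite_Gr[of n r]]) blast
 have cI: "card I <= 2 * b" using card_Un_le[of "{R' : Gr n r. R' ~= R & R' <= S1}" "{R' : Gr n r. R' ~= R & R' <= S2}"]
  card_subsets_le[OF S(1), of r "%R'. R' ~= R"] card_subsets_le[OF S(2), of r "%R'. R' ~= R"] unfolding I_def[symmetric] bdef[symmetric] by linarith
 have "ALL R':I. EX l. lin_fun l & (ALL x:R'. l x = 0) & (EX y:R. l y ~= 0)"
 proof
  fix R' assume "R' : I"
  then have R': "R' : Gr n r" "R' ~= R" by (auto simp: I_def)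
  have "\<not> R <= R'"
  proof
  assume "R <= R'"
  then have "R = R'" using card_subset_eq[OF GrD(4)[OF R'(1)]] GrD(5)[OF R(1)] GrD(5)[OF R'(1)] by simp
  then show False using R'(2) by simp
  qed
  then obtain y where y: "y : R" "y ~: R'" by blast
  obtain l where "lin_fun l" "!!x. x : R' ==> l x = 0" "l y = 1" using functional_exists[OF GrD(1,2)[OF R'(1)] y(2)] by blast
  then show "EX l. lin_fun l & (ALL x:R'. l x = 0) & (EX y:R. l y ~= 0)" using y(1) by (intro exI[of _ l] conjI bexI[of _ y]) auto
 qed
 from bchoice[OF this] obtain l where l: "ALL R':I. lin_fun (l R') & (ALL x:R'. l R' x = 0) & (EX y:R. l R' y ~= 0)" ..
 have lin: "lin_fun (l i)" if "i : I" for i using l that by blast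
 define JJ where "JJ = (Pow I - {{}}) \<times> {S1, S2}"
 have finJ: "finite JJ" unfolding JJ_def using finI by blast
 have cJ: "card JJ <= 2 ^ (2 * b) * 2"
 proof -
  have "card (Pow I - {{}}) <= 2 ^ card I" using card_mono[of "Pow I" "Pow I - {{}}"] finI by (auto simp: card_Pow)
  also have "... <= 2 ^ (2 * b)" using cI by (intro power_increasing) auto
  finally have "card (Pow I - {{}}) * card {S1, S2} <= 2 ^ (2 * b) * 2" by (intro mult_le_mono) (simp_all add: card_insert_if)
  then show ?thesis unfolding JJ_def card_cartesian_product .
 qed
 have S12: "S' : Gr n s" "R <= S'" "S' <= T" "good H (2 ^ (2 * b) * 2) r S' R" if "S' : {S1, S2}" for S' using that S R g ST by auto
 obtain v where v: "!!i. i : I ==> v i : nspace n" "indep_mod I v T"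
  "!!c. c : JJ ==> 1 <= card {X : H. shear l v (fst c) ` snd c <= X}"
 proof (rule shear_exists[of n k m0 H T I l JJ fst snd "{}" 1 "{}" T])
  show "tfam n k m0 H" by (rule H)
  show "nsub T" "T <= nspace n" "nsub T" by (rule sT, rule Tn, rule sT)
  show "finite I" by (rule finI)
  show "lin_fun (l i)" if "i : I" for i by (rule lin[OF that])
  show "finite JJ" by (rule finJ)
  show "fst c <= I" "nsub (snd c)" "snd c <= T" if "c : JJ" for c using that S12(3)[of "snd c"] GrD(1)[OF S12(1)[of "snd c"]] by (auto simp: JJ_def)
  show "card {} + card JJ * 1 <= card {X : H. {x : snd c. ALL i:fst c. l i x = 0} <= X}" if c: "c : JJ" for c
  proof -
  obtain E S' where EQ: "c = (E, S')" "E <= I" "E ~= {}" "S' : {S1, S2}" using c by (auto simp: JJ_def)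
  have "2 ^ (2 * b) * 2 <= card {X : H. {x : S'. ALL i:E. l i x = 0} <= X}"
  proof (rule goodD[OF S12(4)[OF EQ(4)]])
  show "nsub {x : S'. ALL i:E. l i x = 0}" by (rule subspace_kernel[OF GrD(1)[OF S12(1)[OF EQ(4)]]]) (use lin EQ(2) in blast)
  show "{x : S'. ALL i:E. l i x = 0} <= S'" by blast
  obtain i where i: "i : E" using EQ(3) by blast
  then obtain y where "y : R" "l i y ~= 0" using l EQ(2) by blast
  then have "{x : S'. ALL i:E. l i x = 0} Int R \<subset> R" using i by auto
  from psubset_card_mono[OF GrD(4)[OF R(1)] this]
  show "card ({x : S'. ALL i:E. l i x = 0} Int R) < ?q ^ r" unfolding GrD(5)[OF R(1)] .
  qed
  then show ?thesis using cJ EQ(1) by simp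
  qed
  show "card {} + card JJ * 1 <= m0" using cJ m0 by simp
  have "card {} + card JJ * 1 <= m0" using cJ m0 by simp
  then have "card T * ?q ^ card I * ?q ^ (k * (card {} + card JJ * 1)) <= ?q ^ (2 * s) * ?q ^ (2 * b) * ?q ^ (k * m0)"
  using cT cI card_field_ge2[where 'a='a] by (intro mult_le_mono power_increasing order_refl; (linarith | simp))
  then show "card T * ?q ^ card I * ?q ^ (k * (card {} + card JJ * 1)) < ?q ^ n" using sz by (rule le_less_trans)
  fix v assume "!!i. i : I ==> v i : nspace n" "indep_mod I v T"
  "!!c. c : JJ ==> 1 <= card {X : H. shear l v (fst c) ` snd c <= X}"
  then show thesis by (rule that)
 qed auto
 let ?g = "%E T. unit_vec (shear l v E ` S1) T - unit_vec (shear l v E ` S2) T"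
 have "redto n s r {S. inK H S} (?g {})"
 proof (rule redto_of_alternating[OF finI, of n r s ?g])
  fix V :: "'a vs" assume V: "V : Gr n r"
  have e: "(SUM E:Pow I. (- 1) ^ card E * boundary n s r (unit_vec (shear l v E ` S')) V) = (SUM E:Pow I. (- 1) ^ card E * unit_vec (shear l v E ` R) V)"
  if S': "S' : {S1, S2}" for S'
  proof -
  have "{R' : Gr n r. R' <= S' & (ALL i:I. EX x:R'. l i x ~= 0)} = {R}"
  proof (rule set_eqI, rule iffI)
  fix R' assume R': "R' : {R' : Gr n r. R' <= S' & (ALL i:I. EX x:R'. l i x ~= 0)}"
  have "R' ~: I" using R' l by blast
  then show "R' : {R}" using R' S' by (auto simp: I_def)
  qed (use l R S12(2)[OF S'] in blast)
  then show ?thesis using shear_boundary[where l = l, OF sT finI lin v(1,2) S12(1)[OF S'] S12(3)[OF S'] V] by simp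
  qed
  show "(SUM E:Pow I. (- 1) ^ card E * boundary n s r (?g E) V) = 0" unfolding boundary_diff right_diff_distrib sum_subtractf using e[of S1] e[of S2] by simp
 next
  fix E assume E: "E <= I" "E ~= {}"
  have "redto n s r {S. inK H S} (unit_vec (shear l v E ` S'))" if S': "S' : {S1, S2}" for S'
  proof (rule redto_unit)
  show "shear l v E ` S' : Gr n s" by (rule shear_Gr[where l = l, OF sT finI lin v(1,2) S12(1)[OF S'] S12(3)[OF S'] E(1)])
  have "(E, S') : JJ" using E S' by (auto simp: JJ_def)
  then show "shear l v E ` S' : {S. inK H S}" using v(3)[of "(E, S')"] inK_of_card by simp
  qed
  then show "redto n s r {S. inK H S} (?g E)" by (intro redto_diff) blast+
 qed
 then show ?thesis by (simp add: shear_empty)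
qed

text \<open>Functionals that vanish on \<open>R\<close>, one nonzero at each other vector of
  \<open>S0\<close>, have common kernel \<open>R\<close> in \<open>S0\<close>. A subspace that meets
  \<open>R\<close> in dimension below \<open>r\<close> therefore has a kernel part that
  \<open>P\<close> puts into many members. Reserving \<open>X0\<close> as the set \<open>F\<close>
  keeps the sheared space inside \<open>X0\<close>.\<close>

lemma good_extension:
 fixes S0 R :: "'a::{field,finite} vs" and H :: "'a vs set"
 assumes bdef: "b = 2 ^ (CARD('a) ^ s)" and H: "tfam n k m0 H"
  and S: "S0 : Gr n s" and R: "R : Gr n r" "R <= S0" and X: "X0 : H" "R <= X0" "S0 <= X0"
  and P: "!!Z :: 'a vs. nsub Z ==> Z <= nspace n ==> card Z < CARD('a) ^ r ==> 1 + b * m <= card {X : H. Z <= X}"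
  and m0: "1 + b * m <= m0"
  and sz: "CARD('a) ^ s * CARD('a) ^ b * CARD('a) ^ (k * m0) < CARD('a) ^ n"
 shows "EX S:Gr n s. R <= S & S <= X0 & good H m r S R"
proof -
 let ?q = "CARD('a)"
 define I where "I = S0 - R"
 have fS: "finite S0" by (rule GrD(4)[OF S])
 have finI: "finite I" using fS by (simp add: I_def)
 have cI: "card I <= b"
 proof -
  have "card I <= card S0" unfolding I_def by (rule card_mono[OF fS]) blast
  also have "... <= b" unfolding bdef GrD(5)[OF S] by (rule less_imp_le[OF less_exp])
  finally show ?thesis .
 qed
 have "ALL y:I. EX l. lin_fun l & (ALL x:R. l x = 0) & l y = 1"
 proof
  fix y assume "y : I"
  then have y: "y ~: R" by (simp add: I_def)
  obtain l where "lin_fun l" "!!x. x : R ==> l x = 0" "l y = 1" using functional_exists[OF GrD(1,2)[OF R(1)] y] by blast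
  then show "EX l. lin_fun l & (ALL x:R. l x = 0) & l y = 1" by blast
 qed
 from bchoice[OF this] obtain l where l: "ALL y:I. lin_fun (l y) & (ALL x:R. l y x = 0) & l y y = 1" ..
 have lin: "lin_fun (l i)" if "i : I" for i using l that by blast
 have ker: "{x : S0. ALL i:I. l i x = 0} = R"
 proof (rule set_eqI, rule iffI)
  fix x assume x: "x : {x : S0. ALL i:I. l i x = 0}"
  show "x : R"
  proof (rule ccontr)
  assume "x ~: R"
  then have "x : I" using x by (simp add: I_def)
  then have "l x x = 1" "l x x = 0" using l x by auto
  then show False by simp
  qed
 qed (use l R(2) in auto)
 define JJ where "JJ = {Q. nsub Q & Q <= S0 & card (Q Int R) < ?q ^ r}"
 have sub: "JJ <= Pow S0" by (auto simp: JJ_def)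
 have finJ: "finite JJ" using finite_subset[OF sub] fS by blast
 have cJ: "card JJ <= b" using card_mono[OF _ sub] fS GrD(5)[OF S] by (simp add: card_Pow bdef)
 have cJm: "card JJ * m <= b * m" using cJ by (rule mult_le_mono1)
 obtain v where v: "!!i. i : I ==> v i : nspace n" "indep_mod I v S0"
  "!!c. c : JJ ==> m <= card {X : H. shear l v I ` c <= X}"
  "!!X. X : {X0} ==> shear l v I ` S0 <= X"
 proof (rule shear_exists[of n k m0 H S0 I l JJ "%_. I" "%Q. Q" "{X0}" m I S0])
  show "tfam n k m0 H" by (rule H)
  show "nsub S0" "S0 <= nspace n" "nsub S0" using GrD[OF S] by auto
  show "finite I" by (rule finI)
  show "lin_fun (l i)" if "i : I" for i by (rule lin[OF that])
  show "finite JJ" by (rule finJ)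
  show "nsub c" "c <= S0" if "c : JJ" for c using that by (auto simp: JJ_def)
  show "card {X0} + card JJ * m <= card {X : H. {x : Q. ALL i:I. l i x = 0} <= X}" if c: "Q : JJ" for Q
  proof -
  have Q: "nsub Q" "Q <= S0" "card (Q Int R) < ?q ^ r" using c by (auto simp: JJ_def)
  have e1: "{x : Q. ALL i:I. l i x = 0} = Q Int R" using ker Q(2) by blast
  have e2: "1 + b * m <= card {X : H. Q Int R <= X}" using Q(3) GrD(2)[OF R(1)] by (intro P nv.subspace_inter[OF Q(1) GrD(1)[OF R(1)]]) auto
  have e3: "card {X0} = 1" by simp
  show ?thesis unfolding e1 e3 by (rule order_trans[OF add_left_mono[OF cJm] e2])
  qed
  have cx: "card {X0} = 1" by simp
  show c0: "card {X0} + card JJ * m <= m0" using cJm m0 unfolding cx by linarith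
  have "?q ^ s * ?q ^ card I * ?q ^ (k * (card {X0} + card JJ * m)) <= ?q ^ s * ?q ^ b * ?q ^ (k * m0)"
  using cI c0 card_field_ge2[where 'a='a] by (intro mult_le_mono power_increasing order_refl; (linarith | simp))
  then show "card S0 * ?q ^ card I * ?q ^ (k * (card {X0} + card JJ * m)) < ?q ^ n" using sz unfolding GrD(5)[OF S] by (rule le_less_trans)
  show "{x : S0. ALL i:I. l i x = 0} <= X" if "X : {X0}" for X using that ker X(2) by simp
  fix v assume "!!i. i : I ==> v i : nspace n" "indep_mod I v S0"
  "!!c. c : JJ ==> m <= card {X : H. shear l v I ` c <= X}" "!!X. X : {X0} ==> shear l v I ` S0 <= X"
  then show thesis by (rule that)
 qed (use X(1) in auto)
 define S where "S = shear l v I ` S0"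
 have SG: "S : Gr n s" unfolding S_def by (rule shear_Gr[where l = l, OF GrD(1)[OF S] finI lin v(1,2) S subset_refl subset_refl])
 have Rid: "shear l v I x = x" if "x : R" for x by (rule shear_id) (use l that in blast)
 have RS: "R <= S"
 proof
  fix x assume x: "x : R"
  then have "shear l v I x : S" using R(2) by (auto simp: S_def)
  then show "x : S" using Rid[OF x] by simp
 qed
 have "good H m r S R" unfolding good_def
 proof (intro allI impI, elim conjE)
  fix Z :: "'a vs" assume Z: "nsub Z" "Z <= S" "card (Z Int R) < ?q ^ r"
  define Q where "Q = {x : S0. shear l v I x : Z}"
  have Q: "nsub Q" "shear l v I ` Q = Z" unfolding Q_def by (rule shear_pullback[where l = l, OF lin GrD(1)[OF S] Z(1) Z(2)[unfolded S_def]], assumption)+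
  have "Q Int R <= Z Int R" using Rid by (auto simp: Q_def)
  then have "card (Q Int R) <= card (Z Int R)" using GrD(4)[OF R(1)] by (intro card_mono) auto
  then have "Q : JJ" using Z(3) Q(1) by (auto simp: JJ_def Q_def)
  then show "m <= card {X : H. Z <= X}" using v(3)[of Q] Q(2) by simp
 qed
 then show ?thesis using SG RS v(4)[of X0] by (auto simp: S_def)
qed

lemma subspace_between:
 fixes R X :: "'a::{field,finite} vs"
 assumes R: "R : Gr n r" "R <= X" and X: "nsub X" "X <= nspace n" "CARD('a) ^ s <= card X" and rs: "r <= s"
 shows "EX S:Gr n s. R <= S & S <= X"
proof -
 obtain B0 where B0: "{} <= B0" "B0 <= R" "finite B0" "nv.independent B0" "nv.span B0 = R" "card R = CARD('a) ^ card B0"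
  by (rule basis_of[OF GrD(1,2)[OF R(1)] empty_subsetI nv.independent_empty])
 have B0X: "B0 <= X" using B0(2) R(2) by blast
 obtain B where B: "B0 <= B" "B <= X" "finite B" "nv.independent B" "nv.span B = X" "card X = CARD('a) ^ card B" by (rule basis_of[OF X(1,2) B0X B0(4)])
 have "card B0 = r" using B0(6) unfolding GrD(5)[OF R(1)] power_card_inj by simp
 moreover have "s <= card B" using X(3) B(6) card_field_power_iff(2)[of s "card B", where 'a='a] by simp
 ultimately obtain D where D: "B0 <= D" "D <= B" "card D = s" using exists_subset_between[of B0 s B] rs B(1,3) by auto
 have iD: "nv.independent D" using nv.independent_mono[OF B(4) D(2)] .
 have fD: "finite D" using D(2) B(3) finite_subset by blast
 have DX: "nv.span D <= X" using nv.span_mono[OF D(2)] B(5) by simp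
 have "nv.span D : Gr n s" using card_span_independent[OF fD iD] D(3) DX X(2) by (auto simp: Gr_iff)
 moreover have "R <= nv.span D" using nv.span_mono[OF D(1)] B0(5) by simp
 ultimately show ?thesis using DX by blast
qed


text \<open>Every s-space reduces to spaces with a core of dimension \<open>r\<close>. By
  \<open>good_pair\<close> only the core matters: if it lies in a member, the space can be exchanged
  for one inside that member (\<open>good_extension\<close>), and otherwise for a fixed
  representative. The coefficient of the representative of \<open>R\<close> is the boundary at
  \<open>R\<close>, which is zero outside the family. \<open>L b\<close> is the supply spent per
  dimension of the core, \<open>M0 b\<close> what \<open>good_pair\<close> needs at the end.\<close>

lemma exactness:
 fixes H :: "'a::{field,finite} vs set" and Ph :: "'a vs => int"
 defines "L \<equiv> %b. 2 ^ b * b" and "M0 \<equiv> %b. 2 ^ (2 * b) * (2 :: nat)"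
 assumes bdef: "b = 2 ^ (CARD('a) ^ s)" and H: "tfam n k m0 H" and rs: "r <= s"
  and P: "!!Z :: 'a vs. nsub Z ==> Z <= nspace n ==> card Z < CARD('a) ^ r ==> m1 <= card {X : H. Z <= X}"
  and m1: "L b ^ s * M0 b <= m1" "1 + b * M0 b <= m1" "m1 <= m0"
  and sz: "CARD('a) ^ (2 * s) * CARD('a) ^ (2 * b) * CARD('a) ^ (k * m0) < CARD('a) ^ n"
  and Phi: "Ph : ZGr n s" "!!R. boundary n s r Ph R ~= 0 ==> inK H R"
 shows "EX Ps:ZGr n s. (ALL S. Ps S ~= 0 --> inK H S) & boundary n s r Ps = boundary n s r Ph"
proof -
 let ?q = "CARD('a)"
 have b1: "1 <= b" unfolding bdef by simp
 have L1: "1 <= L b" using b1 by (simp add: L_def)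
 have M1: "1 <= M0 b" by (simp add: M0_def)
 have sz1: "?q ^ s * ?q ^ b * ?q ^ (k * m0) < ?q ^ n"
 proof -
  have "?q ^ s * ?q ^ b * ?q ^ (k * m0) <= ?q ^ (2 * s) * ?q ^ (2 * b) * ?q ^ (k * m0)"
  using card_field_ge2[where 'a='a] by (intro mult_le_mono power_increasing order_refl; (linarith | simp))
  then show ?thesis using sz by (rule le_less_trans)
 qed
 define G where "G = {S. inK H S} Un {S. EX R:Gr n r. R <= S & good H (M0 b) r S R}"
 have step1: "redto n s r G (unit_vec S)"
  if "S : Gr n s" "nsub Y" "Y <= S" "card Y = ?q ^ t" "r <= t" "good H (L b ^ (t - r) * M0 b) r S Y" for S Y t using that
 proof (induction t arbitrary: S Y rule: less_induct)
  case (less t)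
  show ?case
  proof (cases "t = r")
  case True
  have "Y : Gr n r" using less.prems True GrD(2)[OF less.prems(1)] by (auto simp: Gr_iff)
  then have "S : G" using less.prems True by (auto simp: G_def)
  then show ?thesis by (rule redto_unit[OF less.prems(1)])
  next
  case False
  then have rt: "r < t" using less.prems(5) by simp
  define m' where "m' = L b ^ (t - Suc r) * M0 b"
  have tr: "t - r = Suc (t - Suc r)" using rt by simp
  have lev: "L b ^ (t - r) * M0 b = 2 ^ b * b * m'" unfolding tr m'_def L_def power_Suc by (simp only: mult.assoc)
  have ts: "t <= s"
  proof -
  have "card Y <= card S" by (rule card_mono[OF GrD(4)[OF less.prems(1)] less.prems(3)])
  then show ?thesis using less.prems(4) GrD(5)[OF less.prems(1)] card_field_power_iff(2)[of t s, where 'a='a] by simp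
  qed
  have m'1: "1 <= m'" using mult_le_mono[OF one_le_power[OF L1, of "t - Suc r"] M1] unfolding m'_def by simp
  have "L b ^ (t - r) * M0 b <= L b ^ s * M0 b" using L1 ts by (intro mult_le_mono1 power_increasing) auto
  then have m'0: "2 ^ b * b * m' <= m0" using m1 unfolding lev by linarith
  have g: "good H (2 ^ b * b * m') r S Y" using less.prems(6) unfolding lev .
  note gr = good_reduce[OF bdef H less.prems(1,2,3,4) rt g m'1 m'0 sz1]
  show ?thesis
  proof (rule redto_trans[OF gr])
  fix S' assume S': "S' : {S. inK H S} Un {S'. EX Y' t'. nsub Y' & Y' <= S' & card Y' = CARD('a) ^ t' & r <= t' & t' < t & good H m' r S' Y'}" "S' : Gr n s"
  show "redto n s r G (unit_vec S')"
  proof (cases "inK H S'")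
  case True
  then show ?thesis by (intro redto_unit[OF S'(2)]) (simp add: G_def)
  next
  case False
  then obtain Y' t' where Y': "nsub Y'" "Y' <= S'" "card Y' = ?q ^ t'" "r <= t'" "t' < t" "good H m' r S' Y'" using S'(1) by blast
  have "L b ^ (t' - r) * M0 b <= m'" unfolding m'_def using L1 Y'(5) by (intro mult_le_mono1 power_increasing) auto
  then show ?thesis by (intro less.IH[OF Y'(5) S'(2) Y'(1,2,3,4)] good_mono[OF Y'(6)])
  qed
  qed
  qed
 qed
 \<comment> \<open>At the start the whole space is its own core, and \<open>P\<close> supplies the
   members for its small subspaces.\<close>
 have all_G: "redto n s r G (unit_vec S)" if S: "S : Gr n s" for S
 proof (rule step1[OF S GrD(1)[OF S] subset_refl GrD(5)[OF S] rs])
  show "good H (L b ^ (s - r) * M0 b) r S S" unfolding good_def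
  proof (intro allI impI, elim conjE)
  fix Z :: "'a vs" assume Z: "nsub Z" "Z <= S" "card (Z Int S) < ?q ^ r"
  have "Z Int S = Z" using Z(2) by blast
  then have "m1 <= card {X : H. Z <= X}" using Z GrD(2)[OF S] by (intro P) auto
  moreover have "L b ^ (s - r) * M0 b <= L b ^ s * M0 b" using L1 by (intro mult_le_mono1 power_increasing) auto
  ultimately show "L b ^ (s - r) * M0 b <= card {X : H. Z <= X}" using m1 by linarith
  qed
 qed
 have szC: "1 + b * M0 b <= m0" "2 ^ (2 * b) * 2 <= m0"
 proof -
  show a: "1 + b * M0 b <= m0" using m1 by linarith
  have "1 * M0 b <= b * M0 b" using b1 by (rule mult_le_mono1)
  then show "2 ^ (2 * b) * 2 <= m0" using a unfolding M0_def by linarith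
 qed
 define ok where "ok R S \<longleftrightarrow> S : Gr n s & R <= S & good H (M0 b) r S R" for R S
 \<comment> \<open>A single representative for each \<open>R\<close>, so that the boundary at
   \<open>R\<close> sees one coefficient only.\<close>
 define st where "st R = (SOME S. ok R S)" for R
 define A where "A = {S. inK H S} Un {S. EX R:Gr n r. \<not> inK H R & ok R S & S = st R}"
 have pair: "redto n s r {S. inK H S} (%T. unit_vec S1 T - unit_vec S2 T)"
  if "R : Gr n r" "ok R S1" "ok R S2" for R S1 S2 using that good_pair[OF bdef H _ _ that(1) _ _ _ _ szC(2) sz, of S1 S2] unfolding ok_def M0_def by blast
 have all_A: "redto n s r A (unit_vec S)" if S: "S : Gr n s" "S : G" for S
 proof (cases "inK H S")
  case True
  then show ?thesis by (intro redto_unit[OF S(1)]) (simp add: A_def)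
 next
  case False
  then obtain R where R: "R : Gr n r" "R <= S" "good H (M0 b) r S R" using S(2) by (auto simp: G_def)
  have okS: "ok R S" using R S(1) by (simp add: ok_def)
  obtain S2 where S2: "ok R S2" "S2 : A"
  proof (cases "inK H R")
  case True
  then obtain X0 where X0: "X0 : H" "R <= X0" by (auto simp: inK_def)
  have eX: "card X0 * ?q ^ k = ?q ^ n" using tfamD(3)[OF H, of "{X0}"] X0(1) szC(1) tfamD(2)[OF H X0(1)] by (simp add: Int_absorb1)
  have le: "?q ^ s * ?q ^ k <= ?q ^ s * ?q ^ b * ?q ^ (k * m0)"
  proof -
  have "?q ^ s * ?q ^ k <= (?q ^ s * ?q ^ b) * ?q ^ (k * m0)" using szC(1) card_field_ge2[where 'a='a] by (intro mult_le_mono power_increasing) auto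
  then show ?thesis .
  qed
  have "?q ^ s * ?q ^ k <= card X0 * ?q ^ k" unfolding eX by (rule less_imp_le[OF le_less_trans[OF le sz1]])
  then have "?q ^ s <= card X0" using card_field_ge2[where 'a='a] by simp
  then obtain S0 where S0: "S0 : Gr n s" "R <= S0" "S0 <= X0" using subspace_between[OF R(1) X0(2) tfamD(1,2)[OF H X0(1)] _ rs] by blast
  have PP: "1 + b * M0 b <= card {X : H. Z <= X}" if "nsub Z" "Z <= nspace n" "card Z < ?q ^ r" for Z :: "'a vs" using P[OF that] m1 by linarith
  obtain S2 where "S2 : Gr n s" "R <= S2" "S2 <= X0" "good H (M0 b) r S2 R" using good_extension[OF bdef H S0(1) R(1) S0(2) X0 S0(3) PP szC(1) sz1] by blast
  then show thesis using X0(1) that[of S2] by (auto simp: ok_def A_def inK_def)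
  next
  case False
  have "ok R (st R)" unfolding st_def by (rule someI[of _ S]) (rule okS)
  then show thesis using that[of "st R"] False R(1) by (auto simp: A_def)
  qed
  have S2G: "S2 : Gr n s" using S2(1) by (simp add: ok_def)
  have "redto n s r A (%T. unit_vec S T - unit_vec S2 T)" by (rule redto_mono[OF pair[OF R(1) okS S2(1)]]) (auto simp: A_def)
  moreover have "redto n s r A (%T. 0 - unit_vec S2 T)" using redto_comb[of "{()}" n s r A "%_. unit_vec S2" "%_. - 1"] redto_unit[OF S2G S2(2), of r] by simp
  ultimately have "redto n s r A (%T. (unit_vec S T - unit_vec S2 T) - (0 - unit_vec S2 T))" by (rule redto_diff)
  then show ?thesis by simp
 qed
 have "redto n s r G Ph"
 proof -
  have "redto n s r (Gr n s) Ph" unfolding redto_def using Phi(1) by (intro bexI[of _ Ph]) (auto simp: ZGr_def)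
  then show ?thesis by (rule redto_trans) (rule all_G)
 qed
 then have "redto n s r A Ph" by (rule redto_trans) (rule all_A)
 then obtain Ps where Psi: "Ps : ZGr n s" "!!S. Ps S ~= 0 ==> S : A" "boundary n s r Ps = boundary n s r Ph" using redtoE by blast
 have "inK H S" if S: "Ps S ~= 0" for S
 proof (rule ccontr)
  assume nK: "\<not> inK H S"
  then obtain R where R: "R : Gr n r" "\<not> inK H R" "ok R S" "S = st R" using Psi(2)[OF S] by (auto simp: A_def)
  have SG: "S : Gr n s" "R <= S" using R(3) by (auto simp: ok_def)
  \<comment> \<open>Another space of the support above \<open>R\<close> would represent some
    \<open>R2\<close> different from \<open>R\<close>. As \<open>R\<close> meets the core
    \<open>R2\<close> in dimension below \<open>r\<close>, goodness would put \<open>R\<close> into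
    a member.\<close>
  have "T = S" if T: "T : Gr n s" "R <= T" "Ps T ~= 0" for T
  proof -
  have "\<not> inK H T" using R(2) T(2) unfolding inK_def by blast
  then obtain R2 where R2: "R2 : Gr n r" "ok R2 T" "T = st R2" using Psi(2)[OF T(3)] by (auto simp: A_def)
  have "R = R2"
  proof (rule ccontr)
  assume "R ~= R2"
  then have "R Int R2 \<subset> R" using card_subset_eq[OF GrD(4)[OF R2(1)], of R] GrD(5)[OF R(1)] GrD(5)[OF R2(1)] by auto
  from psubset_card_mono[OF GrD(4)[OF R(1)] this]
  have "card (R Int R2) < ?q ^ r" unfolding GrD(5)[OF R(1)] .
  then have "M0 b <= card {X : H. R <= X}" using R2(2) T(2) GrD(1)[OF R(1)] unfolding ok_def good_def by blast
  then show False using R(2) inK_of_card[of H R] M1 by linarith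
  qed
  then show ?thesis using R(4) R2(3) by simp
  qed
  then have z: "ALL T:{T : Gr n s. R <= T} - {S}. Ps T = 0" by blast
  have "(SUM T:{T : Gr n s. R <= T}. Ps T) = (SUM T:{S}. Ps T)"
  proof (rule sum.mono_neutral_right[OF _ _ z])
  show "finite {T : Gr n s. R <= T}" by (rule finite_subset[OF _ finite_Gr[of n s]]) blast
  show "{S} <= {T : Gr n s. R <= T}" using SG by blast
  qed
  then have "boundary n s r Ps R = Ps S" unfolding boundary_apply using R(1) by simp
  then have "boundary n s r Ph R ~= 0" using S unfolding Psi(3) by simp
  then have "inK H R" by (rule Phi(2))
  then show False using R(2) by simp
 qed
 then show ?thesis using Psi(1,3) by (intro bexI[of _ Ps] conjI allI impI)
qed

section \<open>Sparse spanning sets modulo \<open>m\<close>\<close>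

lemma greedy_list:
 fixes P :: "'o list => real"
 assumes A: "!!h. length h < T ==> (!!i. i < length h ==> h ! i : A (take i h)) ==> P h <= P [] ==> finite (A h) & A h ~= {}
  & (SUM x:A h. P (h @ [x])) <= card (A h) * P h"
 shows "EX h. length h = T & (ALL i<T. h ! i : A (take i h)) & P h <= P []" using A
proof (induction T)
 case 0
 show ?case by (rule exI[of _ "[]"]) simp
next
 case (Suc T)
 have "EX h. length h = T & (ALL i<T. h ! i : A (take i h)) & P h <= P []" by (rule Suc.IH) (rule Suc.prems; simp)
 then obtain h where h: "length h = T" "ALL i<T. h ! i : A (take i h)" "P h <= P []" by blast
 have "finite (A h) & A h ~= {} & (SUM x:A h. P (h @ [x])) <= card (A h) * P h" by (rule Suc.prems) (use h in auto)
 then obtain x where x: "x : A h" "P (h @ [x]) <= P h" using exists_le_average[of "A h" "%x. P (h @ [x])" "P h"] by blast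
 have "(h @ [x]) ! i : A (take i (h @ [x]))" if "i < Suc T" for i using that h(1,2) x(1) by (cases "i = T") (auto simp: nth_append)
 then show ?case using h x by (intro exI[of _ "h @ [x]"]) auto
qed

text \<open>The submodule of functions modulo \<open>m\<close> generated by the rows
  \<open>a i\<close>. For \<open>m > 0\<close> classes are represented by residues in [0,m), so it
  is a set of integer functions whose cardinality takes the place of a dimension.\<close>

definition spanmod :: "int => ('i => 'x => int) => 'i set => ('x => int) set" where
 "spanmod m a A = range (%c x. (SUM i:A. c i * a i x) mod m)"

abbreviation inspan :: "int => ('i => 'x => int) => 'i set => 'i => bool" where
 "inspan m a A i \<equiv> (%x. a i x mod m) : spanmod m a A"

lemma spanmodI: "(%x. (SUM i:A. c i * a i x) mod m) : spanmod m a A" unfolding spanmod_def by blast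

lemma spanmodE:
 assumes "f : spanmod m a A"
 obtains c where "f = (%x. (SUM i:A. c i * a i x) mod m)" using assms unfolding spanmod_def by blast

lemma mod_lin:
 fixes u v a b m :: int
 shows "(u * (a mod m) + v * (b mod m)) mod m = (u * a + v * b) mod m"
proof -
 have "(u * (a mod m) + v * (b mod m)) mod m = ((u * (a mod m)) mod m + (v * (b mod m)) mod m) mod m" by (rule mod_add_eq[symmetric])
 also have "... = ((u * a) mod m + (v * b) mod m) mod m" by (simp only: mod_mult_right_eq)
 finally show ?thesis by (simp only: mod_add_eq)
qed

lemma spanmod_lincomb:
 assumes "f : spanmod m a A" "g : spanmod m a A"
 shows "(%x. (u * f x + v * g x) mod m) : spanmod m a A"
proof -
 obtain c where c1: "f = (%x. (SUM i:A. c i * a i x) mod m)" by (rule spanmodE[OF assms(1)])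
 obtain d where c2: "g = (%x. (SUM i:A. d i * a i x) mod m)" by (rule spanmodE[OF assms(2)])
 have "(%x. (u * f x + v * g x) mod m) = (%x. (SUM i:A. (u * c i + v * d i) * a i x) mod m)"
 proof
  fix x
  have "(u * f x + v * g x) mod m = (u * (SUM i:A. c i * a i x) + v * (SUM i:A. d i * a i x)) mod m" unfolding c1 c2 by (rule mod_lin)
  also have "u * (SUM i:A. c i * a i x) + v * (SUM i:A. d i * a i x) = (SUM i:A. (u * c i + v * d i) * a i x)"
  by (simp add: sum_distrib_left sum.distrib[symmetric] distrib_right mult.assoc)
  finally show "(u * f x + v * g x) mod m = (SUM i:A. (u * c i + v * d i) * a i x) mod m" .
 qed
 then show ?thesis by (simp only: spanmodI)
qed

lemma spanmod_mono:
 assumes "finite B" "A <= B"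
 shows "spanmod m a A <= spanmod m a B"
proof
 fix f assume "f : spanmod m a A"
 then obtain c where c: "f = (%x. (SUM i:A. c i * a i x) mod m)" by (rule spanmodE)
 have "(SUM i:A. c i * a i x) = (SUM i:B. (if i : A then c i else 0) * a i x)" for x using assms by (intro sum.mono_neutral_cong_left) auto
 then show "f : spanmod m a B" unfolding c using spanmodI[where A=B] by simp
qed

lemma inspan_self:
 assumes "finite A" "i : A"
 shows "inspan m a A i"
proof -
 have "(%x. (SUM j:A. (if j = i then 1 else 0) * a j x) mod m) : spanmod m a A" by (rule spanmodI)
 moreover have "(SUM j:A. (if j = i then 1 else 0) * a j x) = a i x" for x
 proof -
  have "(SUM j:A. (if j = i then 1 else 0) * a j x) = (SUM j:A. if j = i then a j x else 0)" by (rule sum.cong) auto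
  then show ?thesis using assms by simp
 qed
 ultimately show ?thesis by simp
qed

lemma spanmod_range:
 assumes "m > 0" "f : spanmod m a A"
 shows "f x : {0..<m}" "f x mod m = f x" using assms by (auto elim!: spanmodE)

lemma spanmod_card_le:
 assumes m: "m > 0" and X: "finite X" "!!i x. x ~: X ==> a i x = 0"
 shows "finite (spanmod m a A)" "card (spanmod m a A) <= nat m ^ card X"
proof -
 let ?r = "%f. restrict f X"
 have inj: "inj_on ?r (spanmod m a A)"
 proof (rule inj_onI)
  fix f g assume fg: "f : spanmod m a A" "g : spanmod m a A" "?r f = ?r g"
  show "f = g"
  proof
  fix x
  show "f x = g x"
  proof (cases "x : X")
  case True
  then show ?thesis using fun_cong[OF fg(3), of x] by simp
  next
  case False
  then show ?thesis using fg(1,2) X(2) by (auto elim!: spanmodE)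
  qed
  qed
 qed
 have im: "?r ` spanmod m a A <= X \<rightarrow>\<^sub>E {0..<m}" using spanmod_range(1)[OF m, where a = a and A = A] by (fastforce simp: PiE_iff)
 have fin: "finite (X \<rightarrow>\<^sub>E {0..<m})" using X(1) by (intro finite_PiE) auto
 show "finite (spanmod m a A)" using finite_imageD[OF finite_subset[OF im fin] inj] .
 have "card (spanmod m a A) = card (?r ` spanmod m a A)" by (rule card_image[OF inj, symmetric])
 also have "... <= card (X \<rightarrow>\<^sub>E {0..<m})" by (rule card_mono[OF fin im])
 also have "... = nat m ^ card X" using X(1) by (simp add: card_funcsetE)
 finally show "card (spanmod m a A) <= nat m ^ card X" .
qed

lemma spanmod_insert_absorb:
 assumes "finite A" "inspan m a A i"
 shows "spanmod m a (insert i A) = spanmod m a A"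
proof (cases "i : A")
 case False
 show ?thesis
 proof
  show "spanmod m a (insert i A) <= spanmod m a A"
  proof
  fix f assume "f : spanmod m a (insert i A)"
  then obtain c where c: "f = (%x. (SUM j:insert i A. c j * a j x) mod m)" by (rule spanmodE)
  have "f = (%x. (c i * (a i x mod m) + 1 * ((SUM j:A. c j * a j x) mod m)) mod m)" unfolding c mod_lin using assms(1) False by simp
  then show "f : spanmod m a A" by (simp only: spanmod_lincomb[OF assms(2) spanmodI])
  qed
  show "spanmod m a A <= spanmod m a (insert i A)" by (rule spanmod_mono) (use assms in auto)
 qed
qed (simp add: insert_absorb)

lemma spanmod_union_absorb:
 assumes "finite B" "finite A" "!!i. i : B ==> inspan m a A i"
 shows "spanmod m a (A Un B) = spanmod m a A" using assms
proof (induction B rule: finite_induct)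
 case (insert i B)
 have e: "spanmod m a (A Un B) = spanmod m a A" using insert by simp
 have "spanmod m a (insert i (A Un B)) = spanmod m a (A Un B)" by (rule spanmod_insert_absorb) (use insert e in auto)
 then show ?case using e by simp
qed simp

lemma card_spanmod_insert_le:
 assumes m: "m > 0" and X: "finite X" "!!i x. x ~: X ==> a i x = 0" and A: "finite A"
 shows "card (spanmod m a (insert i A)) <= nat m * card (spanmod m a A)"
proof (cases "i : A")
 case True
 have "1 * card (spanmod m a A) <= nat m * card (spanmod m a A)" using m by (intro mult_le_mono1) simp
 then show ?thesis using True by (simp add: insert_absorb)
next
 case False
 let ?F = "%(j, f) x. (j * a i x + f x) mod m"
 note fin = spanmod_card_le(1)[where a = a, OF m X, where A = A]
 have "spanmod m a (insert i A) <= ?F ` ({0..<m} \<times> spanmod m a A)"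
 proof
  fix f assume "f : spanmod m a (insert i A)"
  then obtain c where c: "f = (%x. (SUM j:insert i A. c j * a j x) mod m)" by (rule spanmodE)
  have "f = ?F (c i mod m, %x. (SUM j:A. c j * a j x) mod m)"
  proof -
  have "(c i mod m * a i x + (SUM j:A. c j * a j x) mod m) mod m = (c i * a i x + (SUM j:A. c j * a j x)) mod m" for x
  using mod_lin[of "a i x" "c i" m 1 "SUM j:A. c j * a j x"] by (simp only: mult.commute[of "a i x"] mult_1)
  then show ?thesis unfolding c using A False by simp
  qed
  moreover have "(c i mod m, %x. (SUM j:A. c j * a j x) mod m) : {0..<m} \<times> spanmod m a A" using m spanmodI by auto
  ultimately show "f : ?F ` ({0..<m} \<times> spanmod m a A)" by (rule image_eqI)
 qed
 then have "card (spanmod m a (insert i A)) <= card (?F ` ({0..<m} \<times> spanmod m a A))" using fin by (intro card_mono) auto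
 also have "... <= card ({0..<m} \<times> spanmod m a A)" using fin by (intro card_image_le) auto
 finally show ?thesis by (simp add: card_cartesian_product)
qed

lemma card_spanmod_union_le:
 assumes m: "m > 0" and X: "finite X" "!!i x. x ~: X ==> a i x = 0" and A: "finite A" and B: "finite B"
 shows "card (spanmod m a (A Un B)) <= nat m ^ card B * card (spanmod m a A)" using B
proof (induction B rule: finite_induct)
 case (insert i B)
 have "card (spanmod m a (insert i (A Un B))) <= nat m * card (spanmod m a (A Un B))" by (rule card_spanmod_insert_le[where a = a, OF m X]) (use A insert in auto)
 also have "... <= nat m * (nat m ^ card B * card (spanmod m a A))" by (rule mult_le_mono2[OF insert.IH])
 finally show ?case using insert.hyps by (simp add: mult.assoc)
qed simp

text \<open>The old span and its translate by the new row are disjoint, and both lie in the new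
  span. For composite \<open>m\<close> no more than index 2 can be expected.\<close>

lemma card_spanmod_insert_ge:
 assumes m: "m > 0" and X: "finite X" "!!i x. x ~: X ==> a i x = 0" and A: "finite A" and i: "\<not> inspan m a A i"
 shows "2 * card (spanmod m a A) <= card (spanmod m a (insert i A))"
proof -
 let ?t = "%f x. (1 * (a i x mod m) + 1 * f x) mod m"
 let ?B = "insert i A"
 note fin = spanmod_card_le(1)[where a = a, OF m X]
 have AB: "spanmod m a A <= spanmod m a ?B" by (rule spanmod_mono) (use A in auto)
 have im: "?t ` spanmod m a A <= spanmod m a ?B"
 proof (rule image_subsetI)
  fix f assume "f : spanmod m a A"
  then have "f : spanmod m a ?B" using AB by blast
  moreover have "inspan m a ?B i" by (rule inspan_self) (use A in auto)
  ultimately show "?t f : spanmod m a ?B" by (intro spanmod_lincomb)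
 qed
 have bk: "f x = (1 * ?t f x + (- 1) * (a i x mod m)) mod m" if "f : spanmod m a A" for f x
 proof -
  have "(1 * ?t f x + (- 1) * (a i x mod m)) mod m = (1 * (1 * (a i x mod m) + 1 * f x) + (- 1) * a i x) mod m" by (rule mod_lin)
  also have "... = (1 * (a i x mod m) + (f x - a i x)) mod m" by (simp add: algebra_simps)
  also have "... = (f x - a i x + 1 * (a i x mod m)) mod m" by (simp only: add.commute)
  also have "... = f x mod m" by (simp add: mod_add_right_eq)
  finally show ?thesis using spanmod_range(2)[OF m that, of x] by simp
 qed
 have inj: "inj_on ?t (spanmod m a A)"
 proof (rule inj_onI)
  fix f g assume fg: "f : spanmod m a A" "g : spanmod m a A" "?t f = ?t g"
  show "f = g"
  proof
  fix x
  have "f x = (1 * ?t f x + (- 1) * (a i x mod m)) mod m" by (rule bk[OF fg(1)])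
  also have "?t f x = ?t g x" by (rule fun_cong[OF fg(3)])
  also have "(1 * ?t g x + (- 1) * (a i x mod m)) mod m = g x" by (rule bk[OF fg(2), symmetric])
  finally show "f x = g x" .
  qed
 qed
 have disj: "spanmod m a A Int ?t ` spanmod m a A = {}"
 proof (rule ccontr)
  assume "spanmod m a A Int ?t ` spanmod m a A ~= {}"
  then obtain f where f: "f : spanmod m a A" "?t f : spanmod m a A" by blast
  have "(%x. (1 * ?t f x + (- 1) * f x) mod m) : spanmod m a A" by (rule spanmod_lincomb[OF f(2,1)])
  moreover have "(1 * ?t f x + (- 1) * f x) mod m = a i x mod m" for x using mod_lin[of 1 "1 * (a i x mod m) + 1 * f x" m "- 1" "f x"] spanmod_range(2)[OF m f(1), of x] by simp
  ultimately show False using i by simp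
 qed
 have "card (spanmod m a A) + card (?t ` spanmod m a A) <= card (spanmod m a ?B)"
  using card_Un_disjoint[OF fin finite_imageI[OF fin] disj] card_mono[OF fin[of ?B], of "spanmod m a A Un ?t ` spanmod m a A"] AB im X by auto
 then show ?thesis using card_image[OF inj] by simp
qed

text \<open>Take \<open>K\<close> of maximal size with
  \<open>2 ^ card K <= card (spanmod m a K)\<close>; a row outside its span could be added, since it
  doubles the span.\<close>

lemma small_spanning_set:
 assumes m: "m > 0" and X: "finite X" "!!i x. x ~: X ==> a i x = 0" and G: "finite G"
 obtains K where "K <= G" "!!i. i : G ==> inspan m a K i" "2 ^ card K <= card (spanmod m a K)"
proof -
 let ?P = "%K. K <= G & 2 ^ card K <= card (spanmod m a K)"
 have p0: "?P {}" using spanmod_card_le(1)[where a = a, OF m X, where A = "{}"] spanmodI[where A="{}" and a=a and m=m] by (auto simp: Suc_le_eq card_gt_0_iff)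
 have bd: "ALL K. ?P K --> card K < Suc (card G)" using card_mono[OF G] by (simp add: less_Suc_eq_le)
 obtain K where K0: "?P K & (ALL K'. ?P K' --> card K' <= card K)" using ex_has_greatest_nat[of ?P "{}" card "Suc (card G)", OF p0 bd] ..
 have K: "?P K" "!!K'. ?P K' ==> card K' <= card K" using K0 by simp_all
 have fK: "finite K" using K(1) G finite_subset by blast
 have "inspan m a K i" if i: "i : G" for i
 proof (rule ccontr)
  assume ni: "\<not> inspan m a K i"
  then have "i ~: K" using inspan_self[OF fK] by blast
  then have "?P (insert i K)" using K(1) i fK card_spanmod_insert_ge[where a = a, OF m X fK ni] by auto
  then have "card (insert i K) <= card K" by (rule K(2))
  then show False using \<open>i ~: K\<close> fK by simp
 qed
 then show thesis using that K(1) by blast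
qed


text \<open>The binary logarithm of the index of the span of \<open>A\<close> in that of
  \<open>G\<close>. An unspanned row lowers it by at least 1, which makes it the measure of
  progress.\<close>

definition coidx :: "int => ('i => 'x => int) => 'i set => 'i set => real" where
 "coidx m a G A = log 2 (card (spanmod m a G)) - log 2 (card (spanmod m a A))"

text \<open>Every image of a small spanning set \<open>K\<close> under the group still spans, and so
  contains at least \<open>coidx / m\<close> unspanned rows. By transitivity a fraction of at least
  \<open>coidx / La\<close> of all rows is unspanned, and a random row lowers \<open>coidx\<close>
  by the factor 1 - 1/\<open>La\<close> on average. After \<open>T\<close> rows it is below 1, which
  leaves no unspanned row.\<close>

lemma random_cover:
 fixes p La :: real and a :: "'i => 'x => int" and act :: "'g => 'i => 'i" and inc :: "'w => 'i => bool"
 assumes m: "m > 0" and X: "finite X" "!!i x. x ~: X ==> a i x = 0" and G: "finite G" "G ~= {}"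
  and Gam: "finite Gm" "Gm ~= {}" "!!sg. sg : Gm ==> inj_on (act sg) G" "!!sg i. sg : Gm ==> i : G ==> act sg i : G"
  "!!i j. i : G ==> j : G ==> card {sg : Gm. act sg i = j} * card G = card Gm"
  and inv: "!!K sg. K <= G ==> sg : Gm ==> (!!i. i : G ==> inspan m a K i) ==> (!!i. i : G ==> inspan m a (act sg ` K) i)"
  and W: "finite Ws" "Ws ~= {}" and p: "!!w. w : Ws ==> real (card {i : G. inc w i}) <= p * card G"
  and Lam: "rint m * rint m * card X <= La" "La > 0"
  and T: "La * ln (2 * (rint m * card X + 1)) < real T"
 shows "EX B <= G. (ALL i:G. inspan m a B i) & (ALL w:Ws. ln 2 * card {i : B. inc w i} <= ln (2 * card Ws) + p * T)"
proof -
 define L where "L = coidx m a G"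
 \<comment> \<open>The added 1 keeps \<open>L0\<close> positive when \<open>X\<close> is
   empty.\<close>
 define L0 where "L0 = rint m * card X + 1"
 have L0: "L0 > 0" using m by (simp add: L0_def add_nonneg_pos)
 have posS: "card (spanmod m a A) > 0" for A using spanmod_card_le(1)[where a = a, OF m X, where A = A] spanmodI[where A=A and a=a and m=m] by (auto simp: card_gt_0_iff)
 have posSr: "real (card (spanmod m a A)) > 0" for A using posS[of A] by simp
 have mono: "card (spanmod m a A) <= card (spanmod m a B)" if "A <= B" "finite B" for A B
  using spanmod_mono[OF that(2,1)] spanmod_card_le(1)[where a = a, OF m X] by (intro card_mono) auto
 have L_anti: "L B <= L A" if "A <= B" "finite B" for A B
 proof -
  have "log 2 (real (card (spanmod m a A))) <= log 2 (real (card (spanmod m a B)))" using mono[OF that] posSr[of A] by (subst log_le_cancel_iff) auto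
  then show ?thesis by (simp add: L_def coidx_def)
 qed
 have L_nonneg: "L A >= 0" if "A <= G" for A using L_anti[OF that G(1)] by (simp add: L_def coidx_def)
 have logm: "log 2 (real (nat m)) <= rint m"
 proof -
  have "real (nat m) <= 2 ^ nat m" using less_exp[of "nat m"] by (metis less_imp_le of_nat_le_iff of_nat_numeral of_nat_power)
  then have "log 2 (real (nat m)) <= log 2 (2 ^ nat m)" using m by (subst log_le_cancel_iff) auto
  then show ?thesis using m by (simp add: log_nat_power)
 qed
 have log_pow: "log 2 (real (nat m ^ j)) <= rint m * j" for j using m logm mult_right_mono[OF logm, of "real j"] by (simp add: log_nat_power mult.commute)
 have L_empty: "L {} <= L0"
 proof -
  have "log 2 (real (card (spanmod m a G))) <= log 2 (real (nat m ^ card X))"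
  using spanmod_card_le(2)[where a = a, OF m X, where A = G] posSr[of G] m by (subst log_le_cancel_iff) (auto simp flip: of_nat_power)
  also have "... <= rint m * card X" by (rule log_pow)
  finally have "log 2 (real (card (spanmod m a G))) <= rint m * card X" .
  moreover have "log 2 (real (card (spanmod m a {}))) >= 0" using posS[of "{}"] by (simp add: Suc_leI)
  ultimately show ?thesis by (simp add: L_def coidx_def L0_def)
 qed
 obtain K where K: "K <= G" "!!i. i : G ==> inspan m a K i" "2 ^ card K <= card (spanmod m a K)" using small_spanning_set[where a = a, OF m X G(1)] by blast
 have finK: "finite K" using K(1) G(1) finite_subset by blast
 have cK: "real (card K) <= rint m * card X"
 proof -
  have "(2::nat) ^ card K <= nat m ^ card X" using K(3) spanmod_card_le(2)[where a = a, OF m X, where A = K] by simp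
  then have "log 2 (real (2 ^ card K)) <= log 2 (real (nat m ^ card X))" using m by (subst log_le_cancel_iff) (auto simp flip: of_nat_power)
  also have "... <= rint m * card X" by (rule log_pow)
  finally show ?thesis by (simp add: log_nat_power)
 qed
 have LU: "L A * card G <= La * card {i : G. \<not> inspan m a A i}" if A: "A <= G" for A
 proof -
  let ?U = "{i : G. \<not> inspan m a A i}"
  have finA: "finite A" using A G(1) finite_subset by blast
  have one: "L A <= rint m * card {i : K. act sg i : ?U}" if s: "sg : Gm" for sg
  proof -
  let ?K = "act sg ` K"
  \<comment> \<open>Adding only the unspanned elements of the rotated \<open>K\<close> already gives
    the whole span, at the price of a factor \<open>m\<close> in cardinality for each of
    them.\<close>
  let ?A = "A Un (?K Int ?U)"
  have KG: "?K <= G" using K(1) Gam(4)[OF s] by blast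
  have full: "inspan m a ?K i" if "i : G" for i using inv[OF K(1) s K(2) that] .
  have fA: "finite ?A" "finite (?A Un ?K)" using finA finK by auto
  have sp: "inspan m a ?A i" if "i : ?K" for i
  proof (cases "i : ?U")
  case True
  then show ?thesis by (intro inspan_self[OF fA(1)]) (use that in blast)
  next
  case False
  then have "inspan m a A i" using that KG by blast
  then show ?thesis using spanmod_mono[OF fA(1), of A m a] by blast
  qed
  have e1: "spanmod m a (?A Un ?K) = spanmod m a ?A" by (rule spanmod_union_absorb) (use finK fA sp in auto)
  have e2: "spanmod m a ((?A Un ?K) Un G) = spanmod m a (?A Un ?K)"
  proof (rule spanmod_union_absorb[OF G(1) fA(2)])
  fix i assume "i : G"
  then show "inspan m a (?A Un ?K) i" using full spanmod_mono[OF fA(2), of ?K m a] by blast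
  qed
  have "card (spanmod m a G) <= card (spanmod m a ((?A Un ?K) Un G))" by (rule mono) (use fA G in auto)
  also have "... <= nat m ^ card (?K Int ?U) * card (spanmod m a A)" unfolding e2 e1 by (rule card_spanmod_union_le[where a = a, OF m X finA]) (use finK in auto)
  finally have le: "card (spanmod m a G) <= nat m ^ card (?K Int ?U) * card (spanmod m a A)" .
  have "log 2 (real (card (spanmod m a G))) <= log 2 (real (nat m ^ card (?K Int ?U) * card (spanmod m a A)))"
  using le posS[of G] posS[of A] m by (subst log_le_cancel_iff) (auto simp del: of_nat_mult)
  also have "... = log 2 (real (nat m ^ card (?K Int ?U))) + log 2 (real (card (spanmod m a A)))" using posS[of A] m by (simp only: of_nat_mult) (subst log_mult, auto)
  finally have "L A <= log 2 (real (nat m ^ card (?K Int ?U)))" by (simp add: L_def coidx_def)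
  also have "... <= rint m * card (?K Int ?U)" by (rule log_pow)
  also have "... <= rint m * card {i : K. act sg i : ?U}"
  proof -
  have "?K Int ?U = act sg ` {i : K. act sg i : ?U}" by blast
  then have "card (?K Int ?U) <= card {i : K. act sg i : ?U}" using finK card_image_le[of "{i : K. act sg i : ?U}" "act sg"] by simp
  then show ?thesis using m by (intro mult_left_mono) auto
  qed
  finally show ?thesis .
  qed
  have "real (card Gm) * L A = (SUM sg:Gm. L A)" by simp
  also have "... <= (SUM sg:Gm. rint m * card {i : K. act sg i : ?U})" by (rule sum_mono) (rule one)
  also have "... = rint m * real (SUM sg:Gm. card {i : K. act sg i : ?U})" by (simp add: sum_distrib_left)
  also have "(SUM sg:Gm. card {i : K. act sg i : ?U}) = (SUM i:K. card {sg : Gm. act sg i : ?U})"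
  using sum_multicount_gen[of Gm K "%sg i. act sg i : ?U" "%i. card {sg : Gm. act sg i : ?U}"] Gam(1) finK by simp
  finally have s1: "real (card Gm) * L A <= rint m * real (SUM i:K. card {sg : Gm. act sg i : ?U})" .
  have "card {sg : Gm. act sg i : ?U} * card G = card ?U * card Gm" if i: "i : K" for i
  proof -
  have iG: "i : G" using i K(1) by blast
  have "card {sg : Gm. act sg i : ?U} = (SUM j:?U. card {sg : {sg : Gm. act sg i : ?U}. act sg i = j})" by (rule card_fibers) (use Gam(1) G(1) in auto)
  also have "... = (SUM j:?U. card {sg : Gm. act sg i = j})" by (rule sum.cong[OF refl], rule arg_cong[where f = card]) auto
  finally have "card {sg : Gm. act sg i : ?U} * card G = (SUM j:?U. card {sg : Gm. act sg i = j} * card G)" by (simp add: sum_distrib_right)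
  also have "... = (SUM j:?U. card Gm)" by (rule sum.cong[OF refl]) (use Gam(5)[OF iG] in auto)
  finally show ?thesis by simp
  qed
  then have "(SUM i:K. card {sg : Gm. act sg i : ?U}) * card G = card K * (card ?U * card Gm)" by (simp add: sum_distrib_right)
  from arg_cong[OF this, of real] have s2: "real (SUM i:K. card {sg : Gm. act sg i : ?U}) * card G = real (card K) * (real (card ?U) * card Gm)" by (simp only: of_nat_mult)
  have "real (card Gm) * (L A * card G) = real (card Gm) * L A * card G" by (simp only: mult.assoc)
  also have "... <= rint m * real (SUM i:K. card {sg : Gm. act sg i : ?U}) * card G" by (rule mult_right_mono[OF s1]) simp
  also have "... = rint m * (real (SUM i:K. card {sg : Gm. act sg i : ?U}) * card G)" by (simp only: mult.assoc)
  also have "... = real (card Gm) * (rint m * card K * card ?U)" unfolding s2 by (simp only: mult_ac)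
  finally have "L A * card G <= rint m * card K * card ?U" using Gam(1,2) by (simp add: card_gt_0_iff)
  also have "... <= La * card ?U"
  proof (rule mult_right_mono)
  have "rint m * card K <= rint m * (rint m * card X)" using cK m by (intro mult_left_mono) auto
  also have "... <= La" using Lam(1) by (simp only: mult.assoc)
  finally show "rint m * card K <= La" .
  qed simp
  finally show ?thesis .
 qed
 have stepL: "(SUM i:G. L (insert i A)) <= card G * (L A * exp (- 1 / La))" if A: "A <= G" for A
 proof -
  let ?U = "{i : G. \<not> inspan m a A i}"
  have finA: "finite A" using A G(1) finite_subset by blast
  have "L (insert i A) <= L A - (if i : ?U then 1 else 0)" if i: "i : G" for i
  proof (cases "i : ?U")
  case True
  have "log 2 (real (2 * card (spanmod m a A))) <= log 2 (real (card (spanmod m a (insert i A))))"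
  using card_spanmod_insert_ge[where a = a, OF m X finA, of i] True posS[of A] posS[of "insert i A"] by (subst log_le_cancel_iff) auto
  moreover have "log 2 (real (2 * card (spanmod m a A))) = 1 + log 2 (real (card (spanmod m a A)))" using posSr[of A] log_mult[of 2 2 "real (card (spanmod m a A))"] by simp
  ultimately show ?thesis using True by (simp add: L_def coidx_def)
  next
  case False
  then show ?thesis using L_anti[of A "insert i A"] finA by auto
  qed
  then have "(SUM i:G. L (insert i A)) <= (SUM i:G. L A - (if i : ?U then 1 else 0))" by (rule sum_mono)
  also have "... = card G * L A - card ?U"
  proof -
  have "(SUM i:G. if i : ?U then 1 else (0::real)) = (SUM i:?U. 1)" using G(1) by (intro sum.mono_neutral_cong_right) auto
  then show ?thesis by (simp add: sum_subtractf)
  qed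
  also have "... <= card G * (L A * exp (- 1 / La))"
  proof -
  have u1: "L A * card G / La <= card ?U" using LU[OF A] Lam(2) by (simp add: pos_divide_le_eq mult.commute)
  have "L A * (1 + - 1 / La) <= L A * exp (- 1 / La)" by (rule mult_left_mono[OF exp_ge_add_one_self L_nonneg[OF A]])
  then have u2: "card G * (L A * (1 + - 1 / La)) <= card G * (L A * exp (- 1 / La))" by (rule mult_left_mono) simp
  have u3: "card G * (L A * (1 + - 1 / La)) = card G * L A - L A * card G / La" by (simp add: algebra_simps)
  show ?thesis using order_trans[OF diff_left_mono[OF u1] u2[unfolded u3]] .
  qed
  finally show ?thesis .
 qed
 define dg where "dg h w = length (filter (inc w) h)" for h w
 \<comment> \<open>Two potentials in one, the normalised \<open>coidx\<close> and the mean over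
   \<open>Ws\<close> of 2 to the degree, each scaled so that a random row does not raise its
   average. Each starts at most at 1, so each ends at most at 2.\<close>
 define P where "P h = L (set h) * exp (real (length h) / La) / L0
  + (SUM w:Ws. 2 ^ dg h w * exp (- p * real (length h))) / card Ws" for h
 have cW: "real (card Ws) > 0" using W by (simp add: card_gt_0_iff)
 have cG: "real (card G) > 0" using G by (simp add: card_gt_0_iff)
 have "EX h. length h = T & (ALL i<T. h ! i : G) & P h <= P []"
 proof (rule greedy_list[of T "%_. G" P])
  fix h assume h: "!!i. i < length h ==> h ! i : G"
  then have hG: "set h <= G" by (auto simp: in_set_conv_nth)
  have a1: "(SUM x:G. L (insert x (set h)) * exp (real (Suc (length h)) / La) / L0)
  <= card G * (L (set h) * exp (real (length h) / La) / L0)"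
  proof -
  have ex: "exp (- 1 / La) * exp (real (Suc (length h)) / La) = exp (real (length h) / La)"
  proof -
  have "- 1 / La + real (Suc (length h)) / La = real (length h) / La" unfolding add_divide_distrib[symmetric] by simp
  then show ?thesis by (simp only: exp_add[symmetric])
  qed
  have "(SUM x:G. L (insert x (set h)) * exp (real (Suc (length h)) / La) / L0)
  = (SUM x:G. L (insert x (set h))) * (exp (real (Suc (length h)) / La) / L0)" unfolding sum_distrib_right by (simp only: times_divide_eq_right)
  also have "... <= card G * (L (set h) * exp (- 1 / La)) * (exp (real (Suc (length h)) / La) / L0)" by (rule mult_right_mono[OF stepL[OF hG]]) (use L0 in simp)
  also have "... = card G * (L (set h) * (exp (- 1 / La) * exp (real (Suc (length h)) / La)) / L0)" by (simp only: mult.assoc times_divide_eq_right)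
  finally show ?thesis unfolding ex .
  qed
  have a2: "(SUM x:G. (2::real) ^ dg (h @ [x]) w * exp (- p * real (Suc (length h)))) <= card G * (2 ^ dg h w * exp (- p * real (length h)))"
  if w: "w : Ws" for w
  proof -
  have "(SUM x:G. (2::real) ^ dg (h @ [x]) w) = (SUM x:G. 2 ^ dg h w * (1 + (if inc w x then 1 else 0)))" by (rule sum.cong[OF refl]) (simp add: dg_def)
  also have "... = 2 ^ dg h w * (real (card G) + real (card {i : G. inc w i}))"
  proof -
  have "(SUM x:G. if inc w x then 1 else (0::real)) = (SUM x:{i : G. inc w i}. 1)" using G(1) by (intro sum.mono_neutral_cong_right) auto
  then show ?thesis by (simp add: sum_distrib_left[symmetric] sum.distrib)
  qed
  also have "... <= 2 ^ dg h w * (card G * exp p)"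
  proof (rule mult_left_mono)
  have "real (card G) * (1 + p) <= card G * exp p" by (rule mult_left_mono[OF exp_ge_add_one_self]) simp
  moreover have "real (card G) * (1 + p) = card G + p * card G" by (simp add: algebra_simps)
  ultimately show "real (card G) + real (card {i : G. inc w i}) <= card G * exp p" using p[OF w] by simp
  qed simp
  finally have b: "(SUM x:G. (2::real) ^ dg (h @ [x]) w) <= 2 ^ dg h w * (card G * exp p)" .
  have ex: "exp p * exp (- p * real (Suc (length h))) = exp (- p * real (length h))" by (simp add: exp_add[symmetric] algebra_simps)
  have "(SUM x:G. (2::real) ^ dg (h @ [x]) w * exp (- p * real (Suc (length h)))) = (SUM x:G. (2::real) ^ dg (h @ [x]) w) * exp (- p * real (Suc (length h)))"
  by (simp only: sum_distrib_right)
  also have "... <= 2 ^ dg h w * (card G * exp p) * exp (- p * real (Suc (length h)))" by (rule mult_right_mono[OF b]) simp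
  also have "... = card G * (2 ^ dg h w * (exp p * exp (- p * real (Suc (length h)))))" by (simp only: mult_ac)
  finally show ?thesis unfolding ex .
  qed
  have a3: "(SUM x:G. (SUM w:Ws. (2::real) ^ dg (h @ [x]) w * exp (- p * real (Suc (length h)))) / card Ws)
  <= card G * ((SUM w:Ws. 2 ^ dg h w * exp (- p * real (length h))) / card Ws)"
  proof -
  have "(SUM x:G. SUM w:Ws. (2::real) ^ dg (h @ [x]) w * exp (- p * real (Suc (length h))))
  = (SUM w:Ws. SUM x:G. (2::real) ^ dg (h @ [x]) w * exp (- p * real (Suc (length h))))" by (rule sum.swap)
  also have "... <= (SUM w:Ws. card G * (2 ^ dg h w * exp (- p * real (length h))))" by (rule sum_mono) (rule a2)
  also have "... = card G * (SUM w:Ws. 2 ^ dg h w * exp (- p * real (length h)))" by (simp only: sum_distrib_left)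
  finally have "(SUM x:G. SUM w:Ws. (2::real) ^ dg (h @ [x]) w * exp (- p * real (Suc (length h)))) / card Ws
  <= card G * (SUM w:Ws. 2 ^ dg h w * exp (- p * real (length h))) / card Ws" by (rule divide_right_mono) simp
  then show ?thesis unfolding sum_divide_distrib[symmetric] by (simp only: times_divide_eq_right)
  qed
  have "(SUM x:G. P (h @ [x])) = (SUM x:G. L (insert x (set h)) * exp (real (Suc (length h)) / La) / L0)
  + (SUM x:G. (SUM w:Ws. (2::real) ^ dg (h @ [x]) w * exp (- p * real (Suc (length h)))) / card Ws)" unfolding P_def by (subst sum.distrib[symmetric]) simp
  also have "... <= card G * P h" using add_mono[OF a1 a3] unfolding P_def distrib_left by (simp only:)
  finally show "finite G & G ~= {} & (SUM x:G. P (h @ [x])) <= card G * P h" using G by simp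
 qed
 then obtain h where h: "length h = T" "ALL i<T. h ! i : G" "P h <= P []" by blast
 define B where "B = set h"
 have BG: "B <= G" using h(1,2) by (auto simp: B_def in_set_conv_nth)
 have finB: "finite B" by (simp add: B_def)
 have "P [] <= 2" using L_empty L0 cW by (simp add: P_def dg_def)
 then have P2: "P h <= 2" using h(3) by simp
 have nn1: "L B * exp (real T / La) / L0 >= 0" using L_nonneg[OF BG] L0 by simp
 have nn2: "(SUM w:Ws. (2::real) ^ dg h w * exp (- p * real T)) / card Ws >= 0" using cW by (intro divide_nonneg_pos sum_nonneg) auto
 have PP: "P h = L B * exp (real T / La) / L0 + (SUM w:Ws. 2 ^ dg h w * exp (- p * real T)) / card Ws" unfolding P_def h(1) B_def ..
 have "ALL i:G. inspan m a B i"
 proof (rule ccontr)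
  assume "\<not> (ALL i:G. inspan m a B i)"
  then obtain i where i: "i : G" "\<not> inspan m a B i" by blast
  have "log 2 (real (2 * card (spanmod m a B))) <= log 2 (real (card (spanmod m a (insert i B))))"
  using card_spanmod_insert_ge[where a = a, OF m X finB i(2)] posS[of B] posS[of "insert i B"] by (subst log_le_cancel_iff) auto
  also have "... <= log 2 (real (card (spanmod m a G)))" using mono[of "insert i B" G] G(1) BG i(1) posS[of G] posS[of "insert i B"] by (subst log_le_cancel_iff) auto
  also have "log 2 (real (2 * card (spanmod m a B))) = 1 + log 2 (real (card (spanmod m a B)))" using posSr[of B] log_mult[of 2 2 "real (card (spanmod m a B))"] by simp
  finally have L1: "L B >= 1" by (simp add: L_def coidx_def)
  have "exp (real T / La) / L0 <= L B * exp (real T / La) / L0" using mult_right_mono[OF L1, of "exp (real T / La) / L0"] L0 by simp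
  also have "... <= 2" using P2 nn2 unfolding PP by linarith
  finally have "exp (real T / La) <= 2 * L0" using L0 by (simp add: pos_divide_le_eq)
  moreover have "2 * L0 < exp (real T / La)"
  proof -
  have "ln (2 * L0) < real T / La" using T unfolding L0_def pos_less_divide_eq[OF Lam(2)] by (simp only: mult.commute)
  then have "exp (ln (2 * L0)) < exp (real T / La)" by (simp only: exp_less_cancel_iff)
  then show ?thesis using L0 by simp
  qed
  ultimately show False by linarith
 qed
 moreover have "ln 2 * card {i : B. inc w i} <= ln (2 * card Ws) + p * T" if w: "w : Ws" for w
 proof -
  have "card {i : B. inc w i} <= dg h w" unfolding dg_def B_def using card_length[of "filter (inc w) h"] by simp
  moreover have "2 ^ dg h w * exp (- p * real T) <= 2 * card Ws"
  proof -
  have "2 ^ dg h w * exp (- p * real T) <= (SUM w:Ws. 2 ^ dg h w * exp (- p * real T))" by (rule member_le_sum[OF w]) (use W in auto)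
  also have "... <= 2 * card Ws"
  proof -
  have "(SUM w:Ws. 2 ^ dg h w * exp (- p * real T)) / card Ws <= 2" using P2 nn1 unfolding PP by linarith
  then show ?thesis using cW by (simp add: pos_divide_le_eq)
  qed
  finally show ?thesis .
  qed
  then have "ln (2 ^ dg h w * exp (- p * real T)) <= ln (2 * card Ws)" using cW by (subst ln_le_cancel_iff) auto
  then have d1: "ln 2 * real (dg h w) <= ln (2 * card Ws) + p * T" by (simp add: ln_mult ln_realpow mult.commute)
  have "ln 2 * real (card {i : B. inc w i}) <= ln 2 * real (dg h w)" using \<open>card {i : B. inc w i} <= dg h w\<close> by (intro mult_left_mono) auto
  then show ?thesis using d1 by (rule order_trans)
 qed
 ultimately show ?thesis using BG by blast
qed

lemma boundary_unit_GL:
 fixes S :: "'a::{field,finite} vs"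
 assumes g: "g : GL n"
 shows "boundary n t u (unit_vec (g ` S)) (g ` V) = boundary n t u (unit_vec S) V"
proof -
 have "(%T. unit_vec (g ` S) (g ` T)) = unit_vec S" unfolding unit_vec_def by (rule ext) (simp only: GL_eq_iff[OF g])
 then show ?thesis using boundary_push[OF g, of t u "unit_vec (g ` S)" V] by simp
qed

lemma GL_Gr_count:
 assumes "S1 : Gr n s" "S2 : Gr n s"
 shows "card {g : GL n. g ` S1 = (S2 :: 'a::{field,finite} vs)} * card (Gr n s :: 'a vs set) = card (GL n :: ('a vec => _) set)"
proof (rule orbit_count[where act = "%g T. g ` T", OF finite_Gr _ _ _ assms])
 show "g ` x : Gr n s" if "g : GL n" "x : Gr n s" for g and x :: "'a vs" using GL_Gr that .
 show "(g \<circ> h) ` x = g ` h ` x" for g h and x :: "'a vs" by (simp add: image_comp)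
 fix x y :: "'a vs" assume xy: "x : Gr n s" "y : Gr n s"
 have c: "card x = card y" using GrD(5)[OF xy(1)] GrD(5)[OF xy(2)] by simp
 obtain g where "g : GL n" "g ` x = y" by (rule GL_pair_transitive[OF GrD(1)[OF xy(1)] GrD(2)[OF xy(1)] GrD(1)[OF xy(1)] GrD(2)[OF xy(1)]
  GrD(1)[OF xy(2)] GrD(2)[OF xy(2)] GrD(1)[OF xy(2)] GrD(2)[OF xy(2)] c c]) (simp_all add: c)
 then show "EX g:GL n. g ` x = y" by blast
qed

lemma boundary_expand:
 fixes f :: "'a::{field,finite} vs => int"
 assumes "f : ZGr n t"
 shows "boundary n t u f V = (SUM S:Gr n t. f S * boundary n t u (unit_vec S) V)" by (subst ZGr_expand[OF assms]) (simp only: boundary_lincomb)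

text \<open>\<open>random_cover\<close> for the boundaries of all s-spaces, with \<open>GL d\<close>
  acting. A w-space lies in a fraction \<open>p\<close> of order q^(-dw) of them, and the number of
  rows needed is of order d q^(d(w+1)), where d comes from the logarithm. The product is the degree
  d q^d. Coefficients can be taken in [0,m], as only their classes matter.\<close>

lemma mod_cover:
 fixes m :: int
 assumes m: "m > 0" and ws: "Suc w <= s"
 obtains c :: real where "c > 0"
  "!!d. 2 * s < d ==> EX B <= (Gr d s :: 'a::{field,finite} vs set).
  (ALL Ps:ZGr d s. EX Ph:ZGr d s. (ALL S. Ph S ~= 0 --> S : B) & (ALL S. 0 <= Ph S & Ph S <= m) &
  (ALL R. m dvd (boundary d s (Suc w) Ps R - boundary d s (Suc w) Ph R))) &
  (ALL W:Gr d w. real (card {S : B. W <= S}) <= c * real d * real CARD('a) ^ d)"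
proof -
 let ?q = "real CARD('a)"
 define mr where "mr = rint m"
 have mr1: "mr >= 1" using m by (simp add: mr_def)
 have q2: "?q >= 2"
 proof -
  have "real 2 <= real CARD('a)" using card_field_ge2[where 'a='a] by (simp only: of_nat_le_iff)
  then show ?thesis by simp
 qed
 define kp where "kp = kap CARD('a) s ^ s"
 have kp1: "kp >= 1" unfolding kp_def by (rule one_le_power, rule kap_ge1) (use card_field_ge2[where 'a='a] in simp)
 define y0 where "y0 = 4 * mr + real (Suc w) * ?q"
 have y0: "y0 >= 1" using mr1 q2 by (simp add: y0_def add_increasing2)
 define c where "c = 2 * (1 + real s * ?q + kp * (mr * mr * y0 + 2))"
 have "c > 0" using kp1 y0 mr1 by (simp add: c_def add_pos_nonneg)
 moreover have "EX B <= (Gr d s :: 'a::{field,finite} vs set).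
  (ALL Ps:ZGr d s. EX Ph:ZGr d s. (ALL S. Ph S ~= 0 --> S : B) & (ALL S. 0 <= Ph S & Ph S <= m) &
  (ALL R. m dvd (boundary d s (Suc w) Ps R - boundary d s (Suc w) Ph R))) &
  (ALL W:Gr d w. real (card {S : B. W <= S}) <= c * real d * ?q ^ d)" if d: "2 * s < d" for d
 proof -
  let ?G = "Gr d s :: 'a vs set" and ?X = "Gr d (Suc w) :: 'a vs set" and ?Ws = "Gr d w :: 'a vs set"
  define a where "a S R = boundary d s (Suc w) (unit_vec S) R" for S R :: "'a vs"
  have a0: "a S R = 0" if "R ~: ?X" for S R unfolding a_def boundary_apply using that by (simp only: if_False)
  have sd: "s <= d" "w <= d" "w <= s" using d ws by auto
  have Gne: "?G ~= {}" "?Ws ~= {}" using nspace_Gr[OF sd(1), where 'a='a] nspace_Gr[OF sd(2), where 'a='a] by blast+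
  define p where "p = kp / ?q ^ (d * w)"
  have q0: "?q > 0" using q2 by simp
  have pc: "real (card {S : ?G. W <= S}) <= p * card ?G" if W: "W : ?Ws" for W
  proof -
  have "real (card {S : ?G. W <= S}) <= real (CARD('a) ^ (d * (s - w)))" using card_Gr_above_le[OF W sd(3)] by (simp only: of_nat_le_iff)
  also have "... = ?q ^ (d * (s - w))" by simp
  also have "... = p * (?q ^ d / kap CARD('a) s) ^ s"
  proof -
  have "d * s = d * (s - w) + d * w" using sd(3) by (simp add: add_mult_distrib2[symmetric])
  then have "?q ^ (d * s) = ?q ^ (d * (s - w)) * ?q ^ (d * w)" by (simp only: power_add)
  moreover have "p * (?q ^ d / kap CARD('a) s) ^ s = ?q ^ (d * s) / ?q ^ (d * w)" using kp1 kap_pos[where 'a='a and s=s] by (simp add: p_def kp_def power_divide power_mult)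
  ultimately show ?thesis using q0 by simp
  qed
  also have "... <= p * card ?G" by (rule mult_left_mono[OF card_Gr_ge[OF order_refl d]]) (use kp1 in \<open>simp add: p_def\<close>)
  finally show ?thesis .
  qed
  \<comment> \<open>The quantity required by \<open>random_cover\<close>, with the number of
    (w+1)-spaces replaced by its upper bound, so that \<open>p * La\<close> is a constant times
    q^d.\<close>
  define La where "La = mr * mr * ?q ^ (d * Suc w)"
  have La0: "La > 0" using mr1 q0 by (simp add: La_def)
  have cX: "real (card ?X) <= ?q ^ (d * Suc w)" using card_Gr_le[of d "Suc w", where 'a='a] by (simp only: of_nat_le_iff[where 'a=real, symmetric] of_nat_power)
  have Lam: "rint m * rint m * card ?X <= La" unfolding La_def mr_def by (rule mult_left_mono[OF cX]) simp
  define y where "y = y0 * d"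
  have lq: "ln ?q <= ?q" using ln_le_minus_one[OF q0] by simp
  have d1: "real d >= 1" using d by simp
  have yle: "ln (2 * (rint m * card ?X + 1)) <= y"
  proof -
  have le: "2 * (rint m * card ?X + 1) <= 4 * mr * ?q ^ (d * Suc w)"
  proof -
  have "rint m * card ?X <= mr * ?q ^ (d * Suc w)" unfolding mr_def by (rule mult_left_mono[OF cX]) (use m in simp)
  moreover have "1 <= mr * ?q ^ (d * Suc w)" using mult_mono[OF mr1 one_le_power[of ?q "d * Suc w"]] q2 mr1 by simp
  ultimately show ?thesis by simp
  qed
  have "ln (2 * (rint m * card ?X + 1)) <= ln (4 * mr * ?q ^ (d * Suc w))"
  proof -
  have "0 < 2 * (rint m * card ?X + 1)" using m by (simp add: add_nonneg_pos)
  then show ?thesis using le by (subst ln_le_cancel_iff) linarith+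
  qed
  also have "... = ln (4 * mr) + real (d * Suc w) * ln ?q" using mr1 q0 by (auto simp: ln_mult ln_realpow)
  also have "... <= 4 * mr + real (d * Suc w) * ?q"
  proof (rule add_mono)
  show "ln (4 * mr) <= 4 * mr" using ln_le_minus_one[of "4 * mr"] mr1 by simp
  show "real (d * Suc w) * ln ?q <= real (d * Suc w) * ?q" by (rule mult_left_mono[OF lq]) simp
  qed
  also have "... <= 4 * mr * d + real (d * Suc w) * ?q" using mult_left_mono[OF d1, of "4 * mr"] mr1 by simp
  also have "... = y" unfolding y_def y0_def by (simp only: of_nat_mult distrib_right distrib_left mult_ac)
  finally show ?thesis .
  qed
  define T where "T = nat \<lceil>La * y\<rceil> + 1"
  have y1: "y >= 0" using y0 by (simp add: y_def)
  have T1: "La * y < real T" "real T <= La * y + 2"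
  proof -
  have z: "0 <= La * y" using La0 y1 by simp
  have "real (nat \<lceil>La * y\<rceil>) = of_int \<lceil>La * y\<rceil>" using z by simp
  then show "La * y < real T" "real T <= La * y + 2" unfolding T_def using ceiling_correct[of "La * y"] by linarith+
  qed
  have T2: "La * ln (2 * (rint m * card ?X + 1)) < real T" using mult_left_mono[OF yle, of La] La0 T1(1) by linarith
  have inv: "inspan m a ((`) g ` K) S" if K: "K <= ?G" and g: "g : GL d" and sp: "!!S. S : ?G ==> inspan m a K S" and S: "S : ?G" for K g S
  proof -
  have gi: "inv g : GL d" by (rule GL_inv[OF g])
  have "inspan m a K (inv g ` S)" by (rule sp[OF GL_Gr[OF gi S]])
  then obtain c where c: "(%x. a (inv g ` S) x mod m) = (%x. (SUM i:K. c i * a i x) mod m)" by (rule spanmodE)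
  have inj: "inj_on ((`) g) K" by (rule inj_onI) (simp only: GL_eq_iff[OF g])
  have "a S R mod m = (SUM T:(`) g ` K. c (inv g ` T) * a T R) mod m" for R
  proof -
  have e: "a (g ` T) R = a T (inv g ` R)" for T using boundary_unit_GL[OF g, of s "Suc w" T "inv g ` R"] by (simp only: a_def GL_inv_image(2)[OF g])
  have "(SUM T:(`) g ` K. c (inv g ` T) * a T R) = (SUM T:K. c T * a T (inv g ` R))" by (subst sum.reindex[OF inj]) (simp only: o_def e GL_inv_image(1)[OF g])
  moreover have "a S R = a (inv g ` S) (inv g ` R)" using e[of "inv g ` S"] by (simp only: GL_inv_image(2)[OF g])
  ultimately show ?thesis using fun_cong[OF c, of "inv g ` R"] by (simp only:)
  qed
  then show ?thesis unfolding spanmod_def by (intro image_eqI[of _ _ "%T. c (inv g ` T)"]) auto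
  qed
  have "EX B <= ?G. (ALL i:?G. inspan m a B i) & (ALL W:?Ws. ln 2 * card {i : B. W <= i} <= ln (2 * card ?Ws) + p * T)"
  proof (rule random_cover[where act = "%g T. g ` T" and Gm = "GL d" and X = ?X and inc = "%W S. W <= S" and La = La])
  show "m > 0" by (rule m)
  show "finite ?X" "finite ?G" "finite ?Ws" by (rule finite_Gr)+
  show "a i x = 0" if "x ~: ?X" for i x by (rule a0[OF that])
  show "?G ~= {}" "?Ws ~= {}" by (rule Gne)+
  show "finite (GL d :: ('a vec => _) set)" by (rule finite_GL)
  show "(GL d :: ('a vec => _) set) ~= {}" using GL_id by blast
  show "inj_on ((`) g) ?G" if "g : GL d" for g by (rule inj_onI) (simp only: GL_eq_iff[OF that])
  show "g ` i : ?G" if "g : GL d" "i : ?G" for g i by (rule GL_Gr[OF that])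
  show "card {g : GL d. g ` i = j} * card ?G = card (GL d :: ('a vec => _) set)" if "i : ?G" "j : ?G" for i j by (rule GL_Gr_count[OF that])
  show "real (card {i : ?G. W <= i}) <= p * card ?G" if "W : ?Ws" for W by (rule pc[OF that])
  qed (rule inv Lam La0 T2; assumption?)+
  then obtain B where B: "B <= ?G" "ALL i:?G. inspan m a B i" "ALL W:?Ws. ln 2 * card {i : B. W <= i} <= ln (2 * card ?Ws) + p * T" by blast
  have finB: "finite B" using B(1) finite_Gr finite_subset by blast
  have spB: "spanmod m a (B Un ?G) = spanmod m a B" by (rule spanmod_union_absorb[OF finite_Gr finB]) (use B(2) in blast)
  have "EX Ph:ZGr d s. (ALL S. Ph S ~= 0 --> S : B) & (ALL S. 0 <= Ph S & Ph S <= m) &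
  (ALL R. m dvd (boundary d s (Suc w) Ps R - boundary d s (Suc w) Ph R))" if Psi: "Ps : ZGr d s" for Ps
  proof -
  have BG: "B Un ?G = ?G" using B(1) by blast
  have "(%R. (SUM S:?G. Ps S * a S R) mod m) : spanmod m a ?G" by (rule spanmodI)
  then have "(%R. (SUM S:?G. Ps S * a S R) mod m) : spanmod m a B" using spB unfolding BG by simp
  then obtain c where c: "(%R. (SUM S:?G. Ps S * a S R) mod m) = (%R. (SUM S:B. c S * a S R) mod m)" by (rule spanmodE)
  define Ph where "Ph S = (if S : B then c S mod m else 0)" for S
  have PG: "Ph : ZGr d s" using B(1) by (auto simp: Ph_def ZGr_def)
  have "m dvd (boundary d s (Suc w) Ps R - boundary d s (Suc w) Ph R)" for R
  proof -
  have e1: "boundary d s (Suc w) Ps R = (SUM S:?G. Ps S * a S R)" unfolding a_def by (rule boundary_expand[OF Psi])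
  have "boundary d s (Suc w) Ph R = (SUM S:?G. Ph S * a S R)" unfolding a_def by (rule boundary_expand[OF PG])
  also have "... = (SUM S:B. (c S mod m) * a S R)" using B(1) by (intro sum.mono_neutral_cong_right finite_Gr) (auto simp: Ph_def)
  finally have e2: "boundary d s (Suc w) Ph R = (SUM S:B. (c S mod m) * a S R)" .
  have "m dvd (SUM S:?G. Ps S * a S R) - (SUM S:B. c S * a S R)" using fun_cong[OF c, of R] by (simp only: mod_eq_dvd_iff)
  moreover have "m dvd (SUM S:B. c S * a S R) - (SUM S:B. (c S mod m) * a S R)" unfolding sum_subtractf[symmetric] left_diff_distrib[symmetric]
  by (intro dvd_sum dvd_mult2) (simp add: minus_mod_eq_mult_div)
  ultimately have "m dvd ((SUM S:?G. Ps S * a S R) - (SUM S:B. c S * a S R)) + ((SUM S:B. c S * a S R) - (SUM S:B. (c S mod m) * a S R))" by (rule dvd_add)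
  then show ?thesis unfolding e1 e2 by simp
  qed
  moreover have "0 <= Ph S & Ph S <= m" for S
  proof (cases "S : B")
  case True
  then have "Ph S = c S mod m" by (simp add: Ph_def)
  then show ?thesis using pos_mod_bound[OF m, of "c S"] pos_mod_sign[OF m, of "c S"] by linarith
  qed (use m in \<open>simp add: Ph_def\<close>)
  moreover have "Ph S ~= 0 --> S : B" for S by (simp add: Ph_def)
  ultimately show ?thesis using PG by blast
  qed
  moreover have "real (card {S : B. W <= S}) <= c * real d * ?q ^ d" if W: "W : ?Ws" for W
  proof -
  have qd1: "?q ^ d >= 1" using q2 by (intro one_le_power) simp
  have dq: "real d <= real d * ?q ^ d" using mult_left_mono[OF qd1, of "real d"] by simp
  have lnW: "ln (2 * card ?Ws) <= (1 + real s * ?q) * (real d * ?q ^ d)"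
  proof -
  have cW: "real (card ?Ws) > 0" using Gne finite_Gr by (simp add: card_gt_0_iff)
  have "ln (2 * card ?Ws) = ln 2 + ln (card ?Ws)" using cW by (simp add: ln_mult)
  also have "... <= 1 + real d * real s * ?q"
  proof (rule add_mono)
  show "ln 2 <= (1::real)" using ln_le_minus_one[of 2] by simp
  have "ln (real (card ?Ws)) <= real d * real s * ln ?q" by (rule ln_card_Gr[OF sd(3)])
  also have "... <= real d * real s * ?q" by (rule mult_left_mono[OF lq]) simp
  finally show "ln (real (card ?Ws)) <= real d * real s * ?q" .
  qed
  also have "... <= (1 + real s * ?q) * real d"
  proof -
  have "(1 + real s * ?q) * real d = real d + real d * real s * ?q" by (simp only: distrib_right distrib_left mult_1 mult_1_right mult_ac)
  then show ?thesis using d1 by linarith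
  qed
  also have "... <= (1 + real s * ?q) * (real d * ?q ^ d)" using q0 by (intro mult_left_mono[OF dq]) simp
  finally show ?thesis .
  qed
  have pT: "p * T <= kp * (mr * mr * y0 + 2) * (real d * ?q ^ d)"
  proof -
  have p0: "p >= 0" using kp1 by (simp add: p_def)
  have pkp: "p <= kp"
  proof -
  have "?q ^ (d * w) >= 1" using q2 by (intro one_le_power) simp
  then show ?thesis using kp1 frac_le[of kp kp 1 "?q ^ (d * w)"] by (simp add: p_def)
  qed
  have "?q ^ (d * Suc w) = ?q ^ (d * w) * ?q ^ d" by (simp add: power_add[symmetric] add.commute)
  then have pl: "p * La = kp * (mr * mr) * ?q ^ d" using q0 by (simp add: p_def La_def)
  have "p * T <= p * (La * y + 2)" by (rule mult_left_mono[OF T1(2) p0])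
  also have "... = p * La * y + p * 2" by (simp only: distrib_left mult.assoc)
  also have "... = kp * (mr * mr) * ?q ^ d * y + p * 2" unfolding pl ..
  also have "... <= kp * (mr * mr) * ?q ^ d * y + kp * 2" using pkp by simp
  also have "... <= kp * (mr * mr) * ?q ^ d * y + kp * 2 * (real d * ?q ^ d)"
  proof -
  have "1 <= real d * ?q ^ d" using dq d1 by linarith
  then have "kp * 2 * 1 <= kp * 2 * (real d * ?q ^ d)" using kp1 by (intro mult_left_mono) auto
  then show ?thesis by simp
  qed
  also have "... = kp * (mr * mr * y0 + 2) * (real d * ?q ^ d)" unfolding y_def by (simp only: distrib_left distrib_right mult_ac)
  finally show ?thesis .
  qed
  have "ln 2 * real (card {S : B. W <= S}) <= ln (2 * card ?Ws) + p * T" using B(3) W by blast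
  also have "... <= (1 + real s * ?q + kp * (mr * mr * y0 + 2)) * (real d * ?q ^ d)" using add_mono[OF lnW pT] by (simp only: distrib_right)
  finally have l: "ln 2 * real (card {S : B. W <= S}) <= (1 + real s * ?q + kp * (mr * mr * y0 + 2)) * (real d * ?q ^ d)" .
  have ln2: "1 / 2 <= ln (2::real)" using exp_le_linear[of "1 / 2"] by (subst ln_ge_iff) auto
  have "1 / 2 * real (card {S : B. W <= S}) <= ln 2 * real (card {S : B. W <= S})" using ln2 by (intro mult_right_mono) auto
  then have "real (card {S : B. W <= S}) <= 2 * ((1 + real s * ?q + kp * (mr * mr * y0 + 2)) * (real d * ?q ^ d))" using l by linarith
  then show ?thesis unfolding c_def by (simp only: mult.assoc)
  qed
  ultimately show ?thesis using B(1) by blast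
 qed
 ultimately show thesis by (rule that)
qed

section \<open>Counting and choosing gadgets\<close>

lemma crt_count:
 fixes H :: "'a::{field,finite} vs set"
 assumes H: "tfam n k m0 H" and C: "finite C" "C <= H" "card C <= m0"
  and w: "!!X. X : C ==> w X : nspace n"
 shows "card {v : nspace n. ALL X:C. v - w X : X} * CARD('a) ^ (k * card C) = CARD('a) ^ n"
proof -
 let ?U = "nspace n Int \<Inter>C"
 have "EX v:nspace n. ALL X:C. v - w X : X" by (rule crt[OF H C]) (rule w)
 then obtain v where v: "v : nspace n" "ALL X:C. v - w X : X" by blast
 have XS: "nsub X" if "X : C" for X using tfamD(1)[OF H] C(2) that by blast
 have "{v : nspace n. ALL X:C. v - w X : X} = (%u. u + v) ` ?U"
 proof (rule set_eqI, rule iffI)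
  fix x assume x: "x : {v : nspace n. ALL X:C. v - w X : X}"
  have "x - v : X" if "X : C" for X
  proof -
  have "x - w X : X" "v - w X : X" using x v(2) that by blast+
  then have "(x - w X) - (v - w X) : X" by (rule nv.subspace_diff[OF XS[OF that]])
  then show ?thesis by simp
  qed
  moreover have "x - v : nspace n" using x v(1) by (intro nv.subspace_diff[OF subspace_nspace]) auto
  ultimately have "x - v : ?U" by blast
  then have "(x - v) + v : (%u. u + v) ` ?U" by (rule imageI)
  then show "x : (%u. u + v) ` ?U" by simp
 next
  fix x assume "x : (%u. u + v) ` ?U"
  then obtain u where u: "u : nspace n" "ALL X:C. u : X" "x = u + v" by blast
  have "x - w X : X" if "X : C" for X
  proof -
  have "u : X" "v - w X : X" using u(2) v(2) that by blast+
  then have "u + (v - w X) : X" by (rule nv.subspace_add[OF XS[OF that]])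
  then show ?thesis unfolding u(3) by (simp add: add_diff_eq)
  qed
  moreover have "x : nspace n" unfolding u(3) by (rule nv.subspace_add[OF subspace_nspace u(1) v(1)])
  ultimately show "x : {v : nspace n. ALL X:C. v - w X : X}" by blast
 qed
 then have "card {v : nspace n. ALL X:C. v - w X : X} = card ?U" by (simp only:) (rule card_image, simp add: inj_on_def)
 then show ?thesis using tfamD(3)[OF H C(2,1,3)] by (simp only:)
qed

text \<open>The linear map that sends the i-th unit vector to \<open>ys ! i\<close>. Embeddings are
  stored as lists, so that they can be built and counted one vector at a time.\<close>

definition lin :: "(nat => 'a::field) list => 'a vec => nat => 'a" where
 "lin ys x = (SUM i<length ys. vscale (x i) (ys ! i))"

lemma lin_lin: "lin_map (lin ys)"
proof (rule lin_mapI)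
 fix x y :: "nat => 'a" and c :: 'a
 show "lin ys (x + y) = lin ys x + lin ys y" unfolding lin_def plus_fun_apply nv.scale_left_distrib sum.distrib ..
 have "vscale (vscale c x i) (ys ! i) = vscale c (vscale (x i) (ys ! i))" for i unfolding vscale_def by (simp only: mult.assoc)
 then show "lin ys (vscale c x) = vscale c (lin ys x)" unfolding lin_def nv.scale_sum_right by (simp only:)
qed

lemma lin_append: "lin (ys @ [v]) x = lin ys x + vscale (x (length ys)) v"
proof -
 have "(SUM i<length ys. vscale (x i) ((ys @ [v]) ! i)) = (SUM i<length ys. vscale (x i) (ys ! i))" by (rule sum.cong) (auto simp: nth_append)
 then show ?thesis by (simp add: lin_def)
qed

lemma lin_nspace: "set ys <= nspace n ==> lin ys x : nspace n" unfolding lin_def by (intro nv.subspace_sum[OF subspace_nspace] nv.subspace_scale[OF subspace_nspace]) auto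

lemma nspace_SucD: "x : nspace (Suc j) ==> x j = 0 ==> x : nspace j" by (auto simp: nspace_def) (metis le_antisym not_less_eq_eq)

lemma nspace_top: "x : nspace j ==> x j = 0" by (simp add: nspace_def)

text \<open>The indices whose space gains a dimension at coordinate \<open>j\<close>. Just these
  restrict the vector with number \<open>j\<close>, each to one coset of its member.\<close>

definition grow :: "'i set => ('i => (nat => 'a::field) set) => nat => 'i set" where
 "grow QQ Qf j = {i : QQ. EX z:Qf i. z : nspace (Suc j) & z j = 1}"

text \<open>Partial maps with a prescribed prefix of length \<open>v\<close>, such that whatever
  part of \<open>Qf i\<close> is already determined lies in its assigned member
  \<open>io i\<close>.\<close>

definition Exts :: "nat => nat => (nat => 'a::field) list => 'i set => ('i => 'a vs) => ('i => 'a vs) => nat => 'a vec list set" where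
 "Exts n v y0 QQ Qf io j = {ys. length ys = j & take v ys = y0 & set ys <= nspace n & (ALL i:QQ. lin ys ` (Qf i Int nspace j) <= io i)}"

lemma finite_Exts: "finite (Exts n v y0 QQ Qf io j :: 'a::{field,finite} vec list set)"
 by (rule finite_subset[OF _ finite_lists_length_eq[OF finite_nspace[of n], of j]]) (auto simp: Exts_def)

lemma not_grow:
 fixes Qf :: "'i => (nat => 'a::field) set"
 assumes "i : QQ" "nsub (Qf i)" "i ~: grow QQ Qf j"
 shows "Qf i Int nspace (Suc j) = Qf i Int nspace j"
proof -
 define Q where "Q = Qf i"
 note assms = assms(1) assms(2)[folded Q_def] assms(3)
 have "Q Int nspace (Suc j) = Q Int nspace j"
proof
 show "Q Int nspace (Suc j) <= Q Int nspace j"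
 proof
  fix x assume x: "x : Q Int nspace (Suc j)"
  have "x j = 0"
  proof (rule ccontr)
  assume "x j ~= 0"
  then have "vscale (inverse (x j)) x : Q" "vscale (inverse (x j)) x : nspace (Suc j)" "vscale (inverse (x j)) x j = 1"
  using x nv.subspace_scale[OF assms(2)] nv.subspace_scale[OF subspace_nspace] by (auto simp: vscale_def)
  then show False using assms(1,3) unfolding grow_def Q_def by blast
  qed
  then show "x : Q Int nspace j" using x nspace_SucD by blast
 qed
 show "Q Int nspace j <= Q Int nspace (Suc j)" using nspace_mono[of j "Suc j"] by auto
qed
 then show ?thesis unfolding Q_def .
qed

lemma card_grow:
 fixes Qf :: "'i => 'a::{field,finite} vs"
 assumes "nsub (Qf i)" "i : grow QQ Qf j"
 shows "card (Qf i Int nspace (Suc j)) = card (Qf i Int nspace j) * CARD('a)"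
proof -
 define Q where "Q = Qf i"
 note assms = assms(1)[folded Q_def] assms(2)
 obtain z where z: "z : Q" "z : nspace (Suc j)" "z j = 1" using assms(2) by (auto simp: grow_def Q_def)
 let ?V = "Q Int nspace j"
 have sV: "nsub ?V" by (rule nv.subspace_inter[OF assms(1) subspace_nspace])
 have "nv.span (insert z ?V) = Q Int nspace (Suc j)"
 proof
  show "nv.span (insert z ?V) <= Q Int nspace (Suc j)" by (rule nv.span_minimal[OF _ nv.subspace_inter[OF assms(1) subspace_nspace]]) (use z nspace_mono[of j "Suc j"] in auto)
  show "Q Int nspace (Suc j) <= nv.span (insert z ?V)"
  proof
  fix x assume x: "x : Q Int nspace (Suc j)"
  have "x - vscale (x j) z : Q" using x z by (intro nv.subspace_diff[OF assms(1)] nv.subspace_scale[OF assms(1)]) auto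
  moreover have "x - vscale (x j) z : nspace (Suc j)" using x z by (intro nv.subspace_diff[OF subspace_nspace] nv.subspace_scale[OF subspace_nspace]) auto
  moreover have "(x - vscale (x j) z) j = 0" using z(3) by (simp add: vscale_def)
  ultimately have "x - vscale (x j) z : ?V" using nspace_SucD by blast
  then have "(x - vscale (x j) z) + vscale (x j) z : nv.span (insert z ?V)" by (intro nv.span_add nv.span_scale nv.span_base) auto
  then show "x : nv.span (insert z ?V)" by simp
  qed
 qed
 moreover have "z ~: nv.span ?V" unfolding span_subspace_id[OF sV] using nspace_top[of z j] z(3) by auto
 ultimately have "card (Q Int nspace (Suc j)) = CARD('a) * card ?V" using card_span_insert[of z ?V] unfolding span_subspace_id[OF sV] by simp
 then show ?thesis unfolding Q_def by (simp only: mult.commute)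
qed

text \<open>A growing index has a vector with last coordinate 1; its image fixes the residue of the
  new vector modulo \<open>io Q\<close>. As \<open>io\<close> is injective, the congruences belong
  to distinct members, and \<open>crt_count\<close> counts the solutions exactly.\<close>

lemma Exts_Suc:
 fixes H :: "'a::{field,finite} vs set" and io Qf :: "'i => 'a vs"
 assumes H: "tfam n k m0 H" and QQ: "finite QQ" "card QQ <= m0" "!!Q. Q : QQ ==> nsub (Qf Q)"
  and i: "inj_on io QQ" "!!Q. Q : QQ ==> io Q : H" and ys: "ys : Exts n v y0 QQ Qf io j" and vj: "v <= j"
 shows "card {x. ys @ [x] : Exts n v y0 QQ Qf io (Suc j)} * CARD('a) ^ (k * card (grow QQ Qf j)) = CARD('a) ^ n"
proof -
 have ys': "length ys = j" "take v ys = y0" "set ys <= nspace n" "ALL Q:QQ. lin ys ` (Qf Q Int nspace j) <= io Q" using ys by (auto simp: Exts_def)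
 have "ALL Q:grow QQ Qf j. EX z. z : Qf Q & z : nspace (Suc j) & z j = 1" by (auto simp: grow_def)
 from bchoice[OF this] obtain z where z: "ALL Q:grow QQ Qf j. z Q : Qf Q & z Q : nspace (Suc j) & z Q j = 1" ..
 have gQ: "grow QQ Qf j <= QQ" by (auto simp: grow_def)
 define C where "C = io ` grow QQ Qf j"
 have inj: "inj_on io (grow QQ Qf j)" by (rule inj_on_subset[OF i(1) gQ])
 have cC: "card C = card (grow QQ Qf j)" unfolding C_def by (rule card_image[OF inj])
 define w where "w X = - lin ys (z (inv_into (grow QQ Qf j) io X))" for X
 have wi: "w (io Q) = - lin ys (z Q)" if "Q : grow QQ Qf j" for Q unfolding w_def inv_into_f_f[OF inj that] ..
 have iff: "ys @ [x] : Exts n v y0 QQ Qf io (Suc j) \<longleftrightarrow> x : nspace n & (ALL X:C. x - w X : X)" for x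
 proof -
  have l0: "lin (ys @ [x]) y = lin ys y" if "y : nspace j" for y unfolding lin_append ys'(1) nspace_top[OF that] by simp
  have cond: "lin (ys @ [x]) ` (Qf Q Int nspace (Suc j)) <= io Q \<longleftrightarrow> (Q : grow QQ Qf j --> x - w (io Q) : io Q)" if Q: "Q : QQ" for Q
  proof (cases "Q : grow QQ Qf j")
  case True
  have sX: "nsub (io Q)" using tfamD(1)[OF H] i(2) Q by blast
  have zQ: "z Q : Qf Q" "z Q : nspace (Suc j)" "z Q j = 1" using z True by blast+
  have lz: "lin (ys @ [x]) (z Q) = x - w (io Q)" unfolding lin_append ys'(1) zQ(3) wi[OF True] by simp
  have "lin (ys @ [x]) ` (Qf Q Int nspace (Suc j)) <= io Q" if a: "x - w (io Q) : io Q"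
  proof (rule image_subsetI)
  fix y assume y: "y : Qf Q Int nspace (Suc j)"
  let ?y = "y - vscale (y j) (z Q)"
  have "?y : Qf Q" using y zQ by (intro nv.subspace_diff[OF QQ(3)[OF Q]] nv.subspace_scale[OF QQ(3)[OF Q]]) auto
  moreover have "?y : nspace (Suc j)" using y zQ by (intro nv.subspace_diff[OF subspace_nspace] nv.subspace_scale[OF subspace_nspace]) auto
  moreover have "?y j = 0" using zQ(3) by (simp add: vscale_def)
  ultimately have yj: "?y : Qf Q Int nspace j" using nspace_SucD by blast
  then have "lin ys ?y : io Q" using ys'(4) Q by blast
  then have "lin (ys @ [x]) ?y : io Q" using l0 yj by auto
  moreover have "vscale (y j) (lin (ys @ [x]) (z Q)) : io Q" using a unfolding lz[symmetric] by (rule nv.subspace_scale[OF sX])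
  ultimately have "lin (ys @ [x]) ?y + vscale (y j) (lin (ys @ [x]) (z Q)) : io Q" by (rule nv.subspace_add[OF sX])
  then have "lin (ys @ [x]) (?y + vscale (y j) (z Q)) : io Q" unfolding lin_map_add[OF lin_lin] lin_map_scale[OF lin_lin] .
  then show "lin (ys @ [x]) y : io Q" by simp
  qed
  moreover have "x - w (io Q) : io Q" if "lin (ys @ [x]) ` (Qf Q Int nspace (Suc j)) <= io Q" using that zQ unfolding lz[symmetric] by blast
  ultimately show ?thesis using True by blast
  next
  case False
  have "lin (ys @ [x]) ` (Qf Q Int nspace j) = lin ys ` (Qf Q Int nspace j)" by (rule image_cong[OF refl]) (use l0 in blast)
  then show ?thesis unfolding not_grow[where Qf = Qf, OF Q QQ(3)[OF Q] False] using False ys'(4) Q by simp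
  qed
  have "ys @ [x] : Exts n v y0 QQ Qf io (Suc j) \<longleftrightarrow> x : nspace n & (ALL Q:QQ. lin (ys @ [x]) ` (Qf Q Int nspace (Suc j)) <= io Q)"
  using ys' vj by (auto simp: Exts_def)
  also have "(ALL Q:QQ. lin (ys @ [x]) ` (Qf Q Int nspace (Suc j)) <= io Q) \<longleftrightarrow> (ALL X:C. x - w X : X)" unfolding C_def using cond gQ by blast
  finally show ?thesis .
 qed
 have "card {x : nspace n. ALL X:C. x - w X : X} * CARD('a) ^ (k * card C) = CARD('a) ^ n"
 proof (rule crt_count[OF H])
  show "finite C" unfolding C_def using QQ(1) gQ finite_subset by blast
  show "C <= H" unfolding C_def using i(2) gQ by blast
  show "card C <= m0" unfolding cC using card_mono[OF QQ(1) gQ] QQ(2) by linarith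
  show "w X : nspace n" for X unfolding w_def by (rule nv.subspace_neg[OF subspace_nspace lin_nspace[OF ys'(3)]])
 qed
 moreover have "{x. ys @ [x] : Exts n v y0 QQ Qf io (Suc j)} = {x : nspace n. ALL X:C. x - w X : X}" using iff by blast
 ultimately show ?thesis unfolding cC by (simp only:)
qed

text \<open>Designed to make \<open>card (Exts ...) * KK\<close> grow by a factor q^n per
  coordinate: \<open>KK\<close> gains q^k for each growing index, which is what
  \<open>Exts_Suc\<close> loses.\<close>

definition KK :: "nat => 'i set => ('i => (nat => 'a::field) set) => nat => nat" where
 "KK k QQ Qf j = (PROD i:QQ. card (Qf i Int nspace j) ^ k)"

lemma KK_Suc:
 fixes Qf :: "'i => 'a::{field,finite} vs"
 assumes QQ: "finite QQ" "!!Q. Q : QQ ==> nsub (Qf Q)"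
 shows "KK k QQ Qf (Suc j) = KK k QQ Qf j * CARD('a) ^ (k * card (grow QQ Qf j))"
proof -
 have "KK k QQ Qf (Suc j) = (PROD Q:QQ. card (Qf Q Int nspace j) ^ k * (if Q : grow QQ Qf j then CARD('a) ^ k else 1))" unfolding KK_def
 proof (rule prod.cong[OF refl])
  fix Q assume Q: "Q : QQ"
  show "card (Qf Q Int nspace (Suc j)) ^ k = card (Qf Q Int nspace j) ^ k * (if Q : grow QQ Qf j then CARD('a) ^ k else 1)"
  proof (cases "Q : grow QQ Qf j")
  case True
  show ?thesis unfolding card_grow[where Qf = Qf and QQ = QQ and j = j, OF QQ(2)[OF Q] True] using True by (simp add: power_mult_distrib)
  next
  case False
  show ?thesis unfolding not_grow[where Qf = Qf and j = j, OF Q QQ(2)[OF Q] False] using False by simp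
  qed
 qed
 also have "... = KK k QQ Qf j * (PROD Q:QQ. if Q : grow QQ Qf j then CARD('a) ^ k else 1)" unfolding KK_def by (rule prod.distrib)
 also have "(PROD Q:QQ. if Q : grow QQ Qf j then CARD('a) ^ k else 1) = (PROD Q:grow QQ Qf j. CARD('a) ^ k)"
  using QQ(1) by (intro prod.mono_neutral_cong_right) (auto simp: grow_def)
 also have "... = CARD('a) ^ (k * card (grow QQ Qf j))" by (simp add: power_mult)
 finally show ?thesis .
qed

lemma lin_take:
 assumes "x : nspace v" "v <= length ys"
 shows "lin (take v ys) x = lin ys x"
proof -
 have "(SUM i<length ys. vscale (x i) (ys ! i)) = (SUM i<v. vscale (x i) (ys ! i))"
 proof (rule sum.mono_neutral_right)
  show "{..<v} <= {..<length ys}" using assms(2) by auto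
  show "ALL i:{..<length ys} - {..<v}. vscale (x i) (ys ! i) = 0" using assms(1) by (simp add: nspace_def)
 qed simp
 then show ?thesis using assms(2) by (simp add: lin_def min_absorb2)
qed

lemma Exts_butlast:
 assumes "zs : Exts n v y0 QQ Qf io (Suc j)" "v <= j"
 shows "butlast zs : Exts n v y0 QQ Qf io j" "zs = butlast zs @ [last zs]"
proof -
 have z: "length zs = Suc j" "take v zs = y0" "set zs <= nspace n" "ALL i:QQ. lin zs ` (Qf i Int nspace (Suc j)) <= io i" using assms(1) by (auto simp: Exts_def)
 show e: "zs = butlast zs @ [last zs]" using z(1) by (metis append_butlast_last_id length_0_conv nat.distinct(1))
 have b: "butlast zs = take j zs" using z(1) by (simp add: butlast_conv_take)
 have "lin (take j zs) x : io i" if "i : QQ" "x : Qf i Int nspace j" for i x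
 proof -
  have "lin (take j zs) x = lin zs x" by (rule lin_take) (use that z(1) in auto)
  moreover have "x : Qf i Int nspace (Suc j)" using that nspace_mono[of j "Suc j"] by auto
  ultimately show ?thesis using z(4) that(1) by auto
 qed
 moreover have "set (take j zs) <= nspace n" using z(3) set_take_subset by fast
 ultimately show "butlast zs : Exts n v y0 QQ Qf io j" unfolding b Exts_def using z(1,2) assms(2) by (auto simp: min_absorb1)
qed

lemma Exts_upper:
 fixes H :: "'a::{field,finite} vs set" and io Qf :: "'i => 'a vs"
 assumes H: "tfam n k m0 H" and QQ: "finite QQ" "card QQ <= m0" "!!Q. Q : QQ ==> nsub (Qf Q)"
  and i: "inj_on io QQ" "!!Q. Q : QQ ==> io Q : H" and vj: "v <= j"
 shows "card (Exts n v y0 QQ Qf io j) * KK k QQ Qf j <= CARD('a) ^ (n * (j - v)) * KK k QQ Qf v" using vj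
proof (induction j rule: dec_induct)
 case base
 have "Exts n v y0 QQ Qf io v <= {y0}" by (auto simp: Exts_def)
 then have "card (Exts n v y0 QQ Qf io v) <= 1" using card_mono[of "{y0}"] by fastforce
 then have "card (Exts n v y0 QQ Qf io v) * KK k QQ Qf v <= 1 * KK k QQ Qf v" by (rule mult_le_mono1)
 then show ?case by simp
next
 case (step j)
 have KS: "KK k QQ Qf (Suc j) = KK k QQ Qf j * CARD('a) ^ (k * card (grow QQ Qf j))" by (rule KK_Suc[OF QQ(1)]) (rule QQ(3))
 let ?E = "Exts n v y0 QQ Qf io"
 let ?X = "%ys. {x. ys @ [x] : ?E (Suc j)}"
 have "?E (Suc j) <= (%(ys, x). ys @ [x]) ` (SIGMA ys:?E j. ?X ys)"
 proof
  fix zs assume zs: "zs : ?E (Suc j)"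
  note bl = Exts_butlast[OF zs step.hyps(1)]
  have "(butlast zs, last zs) : (SIGMA ys:?E j. ?X ys)" using bl zs by auto
  then show "zs : (%(ys, x). ys @ [x]) ` (SIGMA ys:?E j. ?X ys)" using bl(2) by (intro image_eqI[of _ _ "(butlast zs, last zs)"]) auto
 qed
 moreover have fX: "finite (?X ys)" for ys by (rule finite_subset[OF _ finite_nspace[of n]]) (auto simp: Exts_def)
 ultimately have "card (?E (Suc j)) <= card (SIGMA ys:?E j. ?X ys)"
  using card_mono[of "(%(ys, x). ys @ [x]) ` (SIGMA ys:?E j. ?X ys)" "?E (Suc j)"] card_image_le[of "SIGMA ys:?E j. ?X ys" "%(ys, x). ys @ [x]"] finite_Exts[of n v y0 QQ Qf io j]
  by (meson finite_SigmaI finite_imageI le_trans)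
 also have "... = (SUM ys:?E j. card (?X ys))" by (rule card_SigmaI[OF finite_Exts]) (use fX in blast)
 finally have c: "card (?E (Suc j)) <= (SUM ys:?E j. card (?X ys))" .
 have "card (?E (Suc j)) * CARD('a) ^ (k * card (grow QQ Qf j)) <= (SUM ys:?E j. card (?X ys)) * CARD('a) ^ (k * card (grow QQ Qf j))" by (rule mult_le_mono1[OF c])
 also have "... = (SUM ys:?E j. card (?X ys) * CARD('a) ^ (k * card (grow QQ Qf j)))" by (rule sum_distrib_right)
 also have "... = (SUM ys:?E j. CARD('a) ^ n)" by (rule sum.cong[OF refl]) (rule Exts_Suc[OF H QQ i _ step.hyps(1)])
 also have "... = card (?E j) * CARD('a) ^ n" by simp
 finally have d: "card (?E (Suc j)) * CARD('a) ^ (k * card (grow QQ Qf j)) <= card (?E j) * CARD('a) ^ n" .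
 have "card (?E (Suc j)) * KK k QQ Qf (Suc j) = card (?E (Suc j)) * CARD('a) ^ (k * card (grow QQ Qf j)) * KK k QQ Qf j" unfolding KS by (simp only: mult_ac)
 also have "... <= card (?E j) * CARD('a) ^ n * KK k QQ Qf j" by (rule mult_le_mono1[OF d])
 also have "... = card (?E j) * KK k QQ Qf j * CARD('a) ^ n" by (simp only: mult_ac)
 also have "... <= CARD('a) ^ (n * (j - v)) * KK k QQ Qf v * CARD('a) ^ n" by (rule mult_le_mono1[OF step.IH])
 also have "... = CARD('a) ^ (n * (j - v)) * CARD('a) ^ n * KK k QQ Qf v" by (simp only: mult_ac)
 also have "CARD('a) ^ (n * (j - v)) * CARD('a) ^ n = CARD('a) ^ (n * (Suc j - v))" using step.hyps(1) by (simp add: Suc_diff_le power_add[symmetric] add.commute)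
 finally show ?case .
qed

definition FExts :: "nat => nat => (nat => 'a::field) list => 'i set => ('i => 'a vs) => ('i => 'a vs) => nat => 'a vec list set" where
 "FExts n v y0 QQ Qf io j = {ys : Exts n v y0 QQ Qf io j. inj_on (lin ys) (nspace j)}"

lemma inj_append:
 assumes "inj_on (lin ys) (nspace (length ys))" "x ~: lin ys ` nspace (length ys)"
 shows "inj_on (lin (ys @ [x])) (nspace (Suc (length ys)))"
proof (rule inj_onI)
 let ?j = "length ys"
 fix a b assume ab: "a : nspace (Suc ?j)" "b : nspace (Suc ?j)" "lin (ys @ [x]) a = lin (ys @ [x]) b"
 define d where "d = a - b"
 have dn: "d : nspace (Suc ?j)" unfolding d_def by (rule nv.subspace_diff[OF subspace_nspace ab(1,2)])
 have "lin (ys @ [x]) (d + b) = lin (ys @ [x]) d + lin (ys @ [x]) b" by (rule lin_map_add[OF lin_lin])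
 then have z: "lin ys d + vscale (d ?j) x = 0" using ab(3) unfolding lin_append by (simp add: d_def)
 have hd: "lin ys (head_part ?j d) = lin ys d" unfolding lin_def by (rule sum.cong) (auto simp: head_part_def)
 have d0: "d ?j = 0"
 proof (rule ccontr)
  assume nz: "d ?j ~= 0"
  have "vscale (d ?j) x = - lin ys d" using z by (simp add: eq_neg_iff_add_eq_0 add.commute)
  then have "vscale (inverse (d ?j)) (vscale (d ?j) x) = vscale (inverse (d ?j)) (- lin ys d)" by simp
  then have "x = vscale (- inverse (d ?j)) (lin ys (head_part ?j d))" using nz hd by simp
  also have "... = lin ys (vscale (- inverse (d ?j)) (head_part ?j d))" by (rule lin_map_scale[OF lin_lin, symmetric])
  finally have "x : lin ys ` nspace ?j" using nv.subspace_scale[OF subspace_nspace head_part_in] by (rule image_eqI)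
  then show False using assms(2) by simp
 qed
 then have dj: "d : nspace ?j" by (rule nspace_SucD[OF dn])
 have "lin ys d = lin ys 0" using z d0 by (simp add: lin_def)
 then have "d = 0" using inj_onD[OF assms(1) _ dj nv.subspace_0[OF subspace_nspace]] by simp
 then show "a = b" by (simp add: d_def)
qed

text \<open>Injectivity excludes at most q^s candidates for the next vector. By \<open>sz\<close>
  this is at most half of them, hence a factor 2 per coordinate.\<close>

lemma FExts_lower:
 fixes H :: "'a::{field,finite} vs set" and io Qf :: "'i => 'a vs"
 assumes H: "tfam n k m0 H" and QQ: "finite QQ" "card QQ <= m0" "!!Q. Q : QQ ==> nsub (Qf Q)"
  and i: "inj_on io QQ" "!!Q. Q : QQ ==> io Q : H" and y0: "y0 : FExts n v y0 QQ Qf io v"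
  and js: "v <= j" "j <= s" and sz: "2 * CARD('a) ^ s * CARD('a) ^ (k * m0) <= CARD('a) ^ n"
 shows "CARD('a) ^ (n * (j - v)) * KK k QQ Qf v <= 2 ^ (j - v) * card (FExts n v y0 QQ Qf io j) * KK k QQ Qf j" using js
proof (induction j rule: dec_induct)
 case base
 have "card (FExts n v y0 QQ Qf io v) >= 1" using y0 finite_Exts[of n v y0 QQ Qf io v] by (auto simp: FExts_def Suc_le_eq card_gt_0_iff)
 then have "1 * KK k QQ Qf v <= card (FExts n v y0 QQ Qf io v) * KK k QQ Qf v" by (rule mult_le_mono1)
 then show ?case by simp
next
 case (step j)
 have KS: "KK k QQ Qf (Suc j) = KK k QQ Qf j * CARD('a) ^ (k * card (grow QQ Qf j))" by (rule KK_Suc[OF QQ(1)]) (rule QQ(3))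
 let ?F = "FExts n v y0 QQ Qf io" and ?E = "Exts n v y0 QQ Qf io"
 let ?X = "%ys. {x. ys @ [x] : ?F (Suc j)}"
 have fF: "finite (?F l)" for l unfolding FExts_def using finite_Exts[of n v y0 QQ Qf io l] by simp
 have fX: "finite (?X ys)" for ys by (rule finite_subset[OF _ finite_nspace[of n]]) (auto simp: FExts_def Exts_def)
 let ?g = "CARD('a) ^ (k * card (grow QQ Qf j))"
 have one: "CARD('a) ^ n <= 2 * (card (?X ys) * ?g)" if ys: "ys : ?F j" for ys
 proof -
  have yE: "ys : ?E j" "inj_on (lin ys) (nspace j)" "length ys = j" using ys by (auto simp: FExts_def Exts_def)
  let ?Y = "{x. ys @ [x] : ?E (Suc j)}"
  have c: "card ?Y * ?g = CARD('a) ^ n" by (rule Exts_Suc[OF H QQ i yE(1) step.hyps(1)])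
  have "?Y - lin ys ` nspace j <= ?X ys" using inj_append[of ys] yE(2,3) unfolding FExts_def by auto
  then have "card (?Y - lin ys ` nspace j) <= card (?X ys)" by (rule card_mono[OF fX])
  moreover have "card ?Y - card (lin ys ` nspace j) <= card (?Y - lin ys ` nspace j)" by (rule diff_card_le_card_Diff) (simp add: finite_nspace)
  moreover have "card (lin ys ` nspace j) <= CARD('a) ^ s"
  proof -
  have "card (lin ys ` nspace j) <= card (nspace j :: 'a vs)" by (rule card_image_le[OF finite_nspace])
  also have "... <= CARD('a) ^ s" unfolding card_nspace using step.prems card_field_ge2[where 'a='a] by (intro power_increasing) auto
  finally show ?thesis .
  qed
  ultimately have "card ?Y <= card (?X ys) + CARD('a) ^ s" by linarith
  then have "card ?Y * ?g <= (card (?X ys) + CARD('a) ^ s) * ?g" by (rule mult_le_mono1)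
  then have a: "CARD('a) ^ n <= card (?X ys) * ?g + CARD('a) ^ s * ?g" unfolding c add_mult_distrib .
  have "?g <= CARD('a) ^ (k * m0)"
  proof -
  have "card (grow QQ Qf j) <= m0" using card_mono[OF QQ(1), of "grow QQ Qf j"] QQ(2) by (auto simp: grow_def)
  then show ?thesis using card_field_ge2[where 'a='a] by (intro power_increasing mult_le_mono2) auto
  qed
  then have "CARD('a) ^ s * ?g <= CARD('a) ^ s * CARD('a) ^ (k * m0)" by (rule mult_le_mono2)
  then show ?thesis using a sz by linarith
 qed
 have c: "(SUM ys:?F j. card (?X ys)) <= card (?F (Suc j))"
 proof -
  have "(SUM ys:?F j. card (?X ys)) = card (SIGMA ys:?F j. ?X ys)" by (rule card_SigmaI[OF fF, symmetric]) (use fX in blast)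
  also have "... <= card (?F (Suc j))" by (rule card_inj_on_le[of "%(ys, x). ys @ [x]", OF _ _ fF]) (auto simp: inj_on_def)
  finally show ?thesis .
 qed
 have d: "card (?F j) * CARD('a) ^ n <= 2 * (card (?F (Suc j)) * ?g)"
 proof -
  have "card (?F j) * CARD('a) ^ n = (SUM ys:?F j. CARD('a) ^ n)" by simp
  also have "... <= (SUM ys:?F j. 2 * (card (?X ys) * ?g))" by (rule sum_mono) (rule one)
  also have "... = 2 * ((SUM ys:?F j. card (?X ys)) * ?g)" by (simp only: sum_distrib_left sum_distrib_right)
  also have "... <= 2 * (card (?F (Suc j)) * ?g)" by (rule mult_le_mono2[OF mult_le_mono1[OF c]])
  finally show ?thesis .
 qed
 have pe: "CARD('a) ^ (n * (Suc j - v)) = CARD('a) ^ (n * (j - v)) * CARD('a) ^ n" using step.hyps(1) by (simp add: Suc_diff_le power_add[symmetric] add.commute)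
 have "CARD('a) ^ (n * (Suc j - v)) * KK k QQ Qf v = CARD('a) ^ (n * (j - v)) * KK k QQ Qf v * CARD('a) ^ n" unfolding pe by (simp only: mult_ac)
 also have "... <= 2 ^ (j - v) * card (?F j) * KK k QQ Qf j * CARD('a) ^ n" using step.IH step.prems by (intro mult_le_mono1) simp
 also have "... = 2 ^ (j - v) * KK k QQ Qf j * (card (?F j) * CARD('a) ^ n)" by (simp only: mult_ac)
 also have "... <= 2 ^ (j - v) * KK k QQ Qf j * (2 * (card (?F (Suc j)) * ?g))" by (rule mult_le_mono2[OF d])
 also have "... = 2 ^ Suc (j - v) * card (?F (Suc j)) * KK k QQ Qf (Suc j)" unfolding KS power_Suc by (simp only: mult_ac)
 also have "Suc (j - v) = Suc j - v" using step.hyps(1) by simp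
 finally show ?case .
qed

text \<open>At most \<open>b\<close> values are taken where at least \<open>2 * b\<close> are
  available, so each coordinate loses a factor of at most 2.\<close>

lemma inj_PiE_lower:
 fixes A :: "'i => 'b set"
 assumes "finite QQ" "!!i. i : QQ ==> finite (A i)" "!!i. i : QQ ==> 2 * b <= card (A i)" "card QQ <= b"
 shows "(PROD i:QQ. card (A i)) <= 2 ^ card QQ * card {f : PiE QQ A. inj_on f QQ}" using assms
proof (induction QQ rule: finite_induct)
 case empty
 have "{f : PiE {} A. inj_on f {}} = {%_. undefined}" by auto
 then show ?case by simp
next
 case (insert q QQ)
 let ?F = "{f : PiE QQ A. inj_on f QQ}" and ?G = "{f : PiE (insert q QQ) A. inj_on f (insert q QQ)}"
 have fF: "finite ?F" using insert.hyps insert.prems(1) by (simp add: finite_PiE)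
 have fP: "finite (PiE (insert q QQ) A)" by (rule finite_PiE) (use insert.hyps insert.prems(1) in auto)
 have fG: "finite ?G" by (rule finite_subset[OF _ fP]) blast
 have fA: "finite (A q)" using insert.prems(1) by simp
 have one: "card (A q) <= 2 * card (A q - f ` QQ)" for f
 proof -
  have "card (A q) - card (f ` QQ) <= card (A q - f ` QQ)" by (rule diff_card_le_card_Diff) (use insert.hyps in simp)
  moreover have "card (f ` QQ) <= b" using card_image_le[OF insert.hyps(1), of f] insert.prems(3) insert.hyps by simp
  moreover have "2 * b <= card (A q)" using insert.prems(2) by simp
  ultimately show ?thesis by linarith
 qed
 have "(SIGMA f:?F. A q - f ` QQ) ~= {} \<or> True" by simp
 have "card (SIGMA f:?F. A q - f ` QQ) <= card ?G"
 proof (rule card_inj_on_le[of "%(f, x). f(q := x)", OF _ _ fG])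
  show "inj_on (%(f, x). f(q := x)) (SIGMA f:?F. A q - f ` QQ)"
  proof (rule inj_onI, clarify)
  fix f x g y assume a: "f : PiE QQ A" "g : PiE QQ A" "f(q := x) = g(q := y)"
  have "x = y" using fun_cong[OF a(3), of q] by simp
  moreover have "f i = g i" for i
  proof (cases "i = q")
  case True
  then show ?thesis using PiE_arb[OF a(1), of q] PiE_arb[OF a(2), of q] insert.hyps(2) by simp
  next
  case False
  then show ?thesis using fun_cong[OF a(3), of i] by simp
  qed
  ultimately show "f = g & x = y" by auto
  qed
  show "(%(f, x). f(q := x)) ` (SIGMA f:?F. A q - f ` QQ) <= ?G"
  proof (rule image_subsetI, clarify)
  fix f x assume f: "f : PiE QQ A" "inj_on f QQ" and x: "x : A q" "x ~: f ` QQ"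
  have "f(q := x) : PiE (insert q QQ) A" using f(1) x(1) by (rule PiE_fun_upd[rotated])
  moreover have "inj_on (f(q := x)) (insert q QQ)" using f(2) x(2) insert.hyps(2) by (auto simp: inj_on_def)
  ultimately show "f(q := x) : PiE (insert q QQ) A & inj_on (f(q := x)) (insert q QQ)" by blast
  qed
 qed
 moreover have "card (SIGMA f:?F. A q - f ` QQ) = (SUM f:?F. card (A q - f ` QQ))" by (rule card_SigmaI[OF fF]) (use fA in blast)
 ultimately have c: "(SUM f:?F. card (A q - f ` QQ)) <= card ?G" by simp
 have IH: "(PROD i:QQ. card (A i)) <= 2 ^ card QQ * card ?F" by (rule insert.IH) (use insert.prems insert.hyps in auto)
 have "card ?F * card (A q) = (SUM f:?F. card (A q))" by simp
 also have "... <= (SUM f:?F. 2 * card (A q - f ` QQ))" by (rule sum_mono) (rule one)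
 also have "... = 2 * (SUM f:?F. card (A q - f ` QQ))" by (rule sum_distrib_left[symmetric])
 finally have d: "card ?F * card (A q) <= 2 * card ?G" using c by linarith
 have "(PROD i:insert q QQ. card (A i)) = (PROD i:QQ. card (A i)) * card (A q)" using insert.hyps by (simp add: mult.commute)
 also have "... <= 2 ^ card QQ * card ?F * card (A q)" by (rule mult_le_mono1[OF IH])
 also have "... = 2 ^ card QQ * (card ?F * card (A q))" by (simp only: mult.assoc)
 also have "... <= 2 ^ card QQ * (2 * card ?G)" by (rule mult_le_mono2[OF d])
 also have "... = 2 ^ card (insert q QQ) * card ?G" using insert.hyps by simp
 finally show ?case .
qed

lemma sum_apply_fun: "(SUM i:I. f i) x = (SUM i:I. f i x)" by (induction I rule: infinite_finite_induct) simp_all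

lemma lin_basis_images:
 fixes g :: "(nat => 'a::field) => 'a vec"
 assumes g: "lin_map g" and x: "x : nspace j"
 shows "lin (map (%i. g (%l. if l = i then 1 else 0)) [0..<j]) x = g x"
proof -
 have "x = (SUM i<j. vscale (x i) (%l. if l = i then 1 else 0))"
 proof
  fix l
  have "(SUM i<j. vscale (x i) (%l. if l = i then 1 else 0)) l = (SUM i<j. if i = l then x i else 0)" unfolding sum_apply_fun vscale_def by (rule sum.cong) auto
  also have "... = x l" using x by (auto simp: nspace_def)
  finally show "x l = (SUM i<j. vscale (x i) (%l. if l = i then 1 else 0)) l" by simp
 qed
 then have "g x = g (SUM i<j. vscale (x i) (%l. if l = i then 1 else 0))" by simp
 also have "... = (SUM i<j. g (vscale (x i) (%l. if l = i then 1 else 0)))" by (rule nn.linear_sum[OF g])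
 also have "... = (SUM i<j. vscale (x i) (g (%l. if l = i then 1 else 0)))" by (simp only: lin_map_scale[OF g])
 also have "... = lin (map (%i. g (%l. if l = i then 1 else 0)) [0..<j]) x" unfolding lin_def by simp
 finally show ?thesis by simp
qed

lemma lin_unit: "i < length ys ==> lin ys (%l. if l = i then 1 else 0) = (ys ! i :: nat => 'a::field)"
proof -
 assume i: "i < length ys"
 have "(SUM j<length ys. vscale (if j = i then 1 else 0) (ys ! j)) = (SUM j<length ys. if j = i then ys ! j else 0)" by (rule sum.cong) auto
 then show ?thesis using i by (simp add: lin_def)
qed

lemma unit_in_nspace: "i < j ==> (%l. if l = i then 1 else 0) : nspace j" by (auto simp: nspace_def)

lemma GL_move_nspace:
 assumes "W : (Gr n w :: 'a::{field,finite} vs set)" "w <= n"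
 obtains h where "h : GL n" "h ` nspace w = W"
proof -
 have "card {g : GL n. g ` nspace w = W} * card (Gr n w :: 'a vs set) ~= 0" using GL_Gr_count[OF nspace_Gr[OF assms(2)] assms(1)] GL_pos[of n, where 'a='a] by simp
 then have "{g : GL n. g ` nspace w = W} ~= {}" by (auto simp only: card.empty mult_0)
 then show thesis using that by blast
qed

lemma ratio_identity:
 fixes B Y CC qa qn KS cc d e :: real
 assumes "KS > 0" "cc > 0" "qa > 0"
 shows "B * (Y * (CC * (qa * qn))) / KS / (cc * qa / (d * e * KS)) = B * Y * (e * CC / cc) * d * qn" using assms by (simp add: divide_simps)

text \<open>\<open>cnt\<close> says that the family behaves like a random one: the number of members
  through a small space is proportional to \<open>card Z\<close> to the power -k, up to constants.
  \<open>c1\<close> and \<open>C1\<close> may both scale with the size of the family, since the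
  degree bound in \<open>gadget\<close> depends on them only through their ratio.\<close>

locale gadget_setup =
 fixes n k m0 w s :: nat and H :: "'a::{field,finite} vs set" and c1 C1 :: real and b :: nat
 assumes H: "tfam n k m0 H" and ws: "Suc w <= s" and bdef: "b = 2 ^ (CARD('a) ^ s)" and bm: "b <= m0"
  and sz: "2 * CARD('a) ^ s * CARD('a) ^ (k * m0) <= CARD('a) ^ n" and sn: "s <= n"
  and c1: "c1 > 0"
  and cnt: "!!Z :: 'a vs. nsub Z ==> Z <= nspace n ==> card Z < CARD('a) ^ Suc w ==>
  c1 <= real (card {X : H. Z <= X} * card Z ^ k) & real (card {X : H. Z <= X} * card Z ^ k) <= C1 & 2 * b <= card {X : H. Z <= X}"
begin

text \<open>The model of a gadget is \<open>nspace s\<close> with \<open>nspace (Suc w)\<close>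
  marked; these are the other (w+1)-spaces, each of which has to go into a member.\<close>

definition QI :: "'a vs set" where "QI = Gr s (Suc w) - {nspace (Suc w)}"

text \<open>Embeddings of the model together with the assignment of members. Distinct spaces get
  distinct members, so that their conditions are congruences modulo different members of a
  transversal family.\<close>

definition conf :: "('a vec list \<times> ('a vs => 'a vs)) set" where
 "conf = {(ys, io). length ys = s & set ys <= nspace n & inj_on (lin ys) (nspace s) & io : QI \<rightarrow>\<^sub>E H & inj_on io QI &
  (ALL Q:QI. lin ys ` Q <= io Q)}"

definition Opt :: "'a vs => ('a vec list \<times> ('a vs => 'a vs)) set" where
 "Opt R = {p : conf. lin (fst p) ` nspace (Suc w) = R}"

definition KS :: real where "KS = real ((CARD('a) ^ Suc w) ^ k) ^ card QI"

lemma finite_QI: "finite QI" unfolding QI_def using finite_Gr by blast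

lemma QI_D: "Q : QI ==> nsub Q" "Q : QI ==> Q <= nspace s" "Q : QI ==> card Q = CARD('a) ^ Suc w" unfolding QI_def using GrD(1,2,5) by blast+

lemma card_QI: "card QI <= b" "card QI <= m0"
proof -
 have "card QI <= card {R. R : Gr s (Suc w) & True & R <= (nspace s :: 'a vs)}"
 proof (rule card_mono)
  show "finite {R. R : Gr s (Suc w) & True & R <= (nspace s :: 'a vs)}" by (rule finite_subset[OF _ finite_Gr[of s "Suc w"]]) blast
  show "QI <= {R. R : Gr s (Suc w) & True & R <= (nspace s :: 'a vs)}" unfolding QI_def using GrD(2) by blast
 qed
 also have "... <= b" unfolding bdef by (rule card_subsets_le[OF nspace_Gr[OF order_refl]])
 finally show "card QI <= b" .
 then show "card QI <= m0" using bm by simp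
qed

lemma KS_pos: "KS > 0" unfolding KS_def using card_field_ge2[where 'a='a] by (intro zero_less_power) simp

lemma finite_H: "finite H" by (rule tfam_finite[OF H])

lemma finite_conf: "finite conf" by (rule finite_subset[of _ "{ys. set ys <= nspace n & length ys = s} \<times> (QI \<rightarrow>\<^sub>E H)"])
  (auto simp: conf_def finite_nspace finite_lists_length_eq finite_PiE finite_QI finite_H)

lemma KK_at_s:
 assumes "!!Q. Q : QI ==> Qf Q <= nspace s" "!!Q. Q : QI ==> card (Qf Q) = CARD('a) ^ Suc w"
 shows "real (KK k QI Qf s) = KS"
proof -
 have "KK k QI Qf s = (PROD Q:QI. (CARD('a) ^ Suc w) ^ k)" unfolding KK_def by (rule prod.cong[OF refl]) (simp only: assms Int_absorb2)
 then show ?thesis by (simp add: KS_def)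
qed

lemma C1_nonneg: "C1 >= 0"
proof -
 have z: "nsub {0 :: nat => 'a}" "{0 :: nat => 'a} <= nspace n" using GrD(1,2)[OF zero_Gr[of n]] by auto
 have "(1 :: nat) < CARD('a) ^ Suc w" by (rule one_less_power) (use card_field_ge2[where 'a='a] in auto)
 then have "card {0 :: nat => 'a} < CARD('a) ^ Suc w" by (simp only: card_1_singleton_iff[THEN iffD2, OF exI[of _ 0], OF refl])
 from cnt[OF z this] show ?thesis using c1 by linarith
qed

text \<open>The members still possible for \<open>Q\<close> once the prefix \<open>y0\<close> is
  fixed. Their number times the matching factor of \<open>KK\<close> lies between \<open>c1\<close>
  and \<open>C1\<close>.\<close>

definition AA :: "nat => 'a vec list => ('a vs => 'a vs) => 'a vs => 'a vs set" where
 "AA v y0 Qf Q = {X : H. lin y0 ` (Qf Q Int nspace v) <= X}"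

lemma AA_bounds:
 assumes Qf: "!!Q. Q : QI ==> nsub (Qf Q)" "!!Q. Q : QI ==> card (Qf Q Int nspace v) < CARD('a) ^ Suc w"
  and y0: "set y0 <= nspace n" "inj_on (lin y0) (nspace v)"
 shows "Q : QI ==> 2 * b <= card (AA v y0 Qf Q)"
  "real (PROD Q:QI. card (AA v y0 Qf Q)) * real (KK k QI Qf v) <= C1 ^ card QI"
  "c1 ^ card QI <= real (PROD Q:QI. card (AA v y0 Qf Q)) * real (KK k QI Qf v)"
proof -
 have one: "c1 <= real (card (AA v y0 Qf Q) * card (Qf Q Int nspace v) ^ k) & real (card (AA v y0 Qf Q) * card (Qf Q Int nspace v) ^ k) <= C1 & 2 * b <= card (AA v y0 Qf Q)"
  if Q: "Q : QI" for Q
 proof -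
  let ?Z = "lin y0 ` (Qf Q Int nspace v)"
  have "card ?Z = card (Qf Q Int nspace v)" by (rule card_image, rule inj_on_subset[OF y0(2)]) blast
  moreover have "nsub ?Z" by (rule nn.linear_subspace_image[OF lin_lin nv.subspace_inter[OF Qf(1)[OF Q] subspace_nspace]])
  moreover have "?Z <= nspace n" using lin_nspace[OF y0(1)] by blast
  ultimately show ?thesis using cnt[of ?Z] Qf(2)[OF Q] unfolding AA_def by simp
 qed
 show "Q : QI ==> 2 * b <= card (AA v y0 Qf Q)" using one by blast
 have e: "real (PROD Q:QI. card (AA v y0 Qf Q)) * real (KK k QI Qf v) = (PROD Q:QI. real (card (AA v y0 Qf Q) * card (Qf Q Int nspace v) ^ k))"
  unfolding KK_def by (simp add: prod.distrib)
 have "(PROD Q:QI. real (card (AA v y0 Qf Q) * card (Qf Q Int nspace v) ^ k)) <= (PROD Q:QI. C1)" by (rule prod_mono) (use one in auto)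
 then show "real (PROD Q:QI. card (AA v y0 Qf Q)) * real (KK k QI Qf v) <= C1 ^ card QI" unfolding e by simp
 have "(PROD Q:QI. c1) <= (PROD Q:QI. real (card (AA v y0 Qf Q) * card (Qf Q Int nspace v) ^ k))" by (rule prod_mono) (use one c1 in auto)
 then show "c1 ^ card QI <= real (PROD Q:QI. card (AA v y0 Qf Q)) * real (KK k QI Qf v)" unfolding e by simp
qed

text \<open>A basis of \<open>R\<close> is the prefix; the other \<open>s - Suc w\<close> vectors
  are almost free. What the congruences cost is regained from the number of available members, the
  two being balanced by \<open>KK\<close>. No space in \<open>QI\<close> lies inside the marked one,
  so its part in the prefix is small enough for \<open>cnt\<close>.\<close>

lemma Opt_lower:
 assumes R: "R : Gr n (Suc w)"
 shows "c1 ^ card QI * real CARD('a) ^ (n * (s - Suc w)) <= 2 ^ (s - Suc w) * 2 ^ card QI * KS * real (card (Opt R))"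
proof -
 have rn: "Suc w <= n" using ws sn by simp
 obtain g where g: "g : GL n" "g ` nspace (Suc w) = R" by (rule GL_move_nspace[OF R rn])
 define y0 where "y0 = map (%i. g (%l. if l = i then 1 else 0)) [0..<Suc w]"
 have ly: "length y0 = Suc w" by (simp add: y0_def)
 have lg: "lin y0 x = g x" if "x : nspace (Suc w)" for x unfolding y0_def by (rule lin_basis_images[OF GL_lin[OF g(1)] that])
 have y0n: "set y0 <= nspace n"
 proof
  fix y assume "y : set y0"
  then obtain i where i: "i < Suc w" "y = g (%l. if l = i then 1 else 0)" unfolding y0_def set_map set_upt by auto
  then have "y : R" using g(2) unit_in_nspace[OF i(1)] by blast
  then show "y : nspace n" using GrD(2)[OF R] by blast
 qed
 have y0i: "inj_on (lin y0) (nspace (Suc w))"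
 proof (rule inj_onI)
  fix x y assume "x : nspace (Suc w)" "y : nspace (Suc w)" "lin y0 x = lin y0 y"
  then have "g x = g y" using lg by simp
  then show "x = y" using bij_is_inj[OF GL_bij[OF g(1)]] by (simp add: inj_eq)
 qed
 let ?id = "%Q :: 'a vs. Q"
 have small: "card (Q Int nspace (Suc w)) < CARD('a) ^ Suc w" if Q: "Q : QI" for Q
 proof -
  have fQ: "finite Q" using QI_D(2)[OF Q] by (rule finite_sub_nspace)
  have "Q Int nspace (Suc w) ~= Q"
  proof
  assume "Q Int nspace (Suc w) = Q"
  then have "Q <= nspace (Suc w)" by blast
  then have "Q = nspace (Suc w)" by (rule card_subset_eq[OF finite_nspace]) (simp only: QI_D(3)[OF Q] card_nspace)
  then show False using Q by (simp add: QI_def)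
  qed
  then have "Q Int nspace (Suc w) \<subset> Q" by blast
  from psubset_card_mono[OF fQ this] show ?thesis unfolding QI_D(3)[OF Q] .
 qed
 note ab = AA_bounds[of ?id "Suc w" y0, OF QI_D(1) small y0n y0i]
 let ?A = "AA (Suc w) y0 ?id"
 let ?I = "{f : PiE QI ?A. inj_on f QI}"
 have fA: "finite (?A Q)" for Q unfolding AA_def using finite_H by simp
 have IP: "(PROD Q:QI. card (?A Q)) <= 2 ^ card QI * card ?I" by (rule inj_PiE_lower[OF finite_QI fA ab(1) card_QI(1)])
 have fI: "finite ?I" using finite_PiE[OF finite_QI fA] by simp
 let ?F = "%f. FExts n (Suc w) y0 QI ?id f s"
 have fF: "finite (?F f)" for f unfolding FExts_def using finite_Exts[of n "Suc w" y0 QI ?id f s] by simp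
 have lowF: "CARD('a) ^ (n * (s - Suc w)) * KK k QI ?id (Suc w) <= 2 ^ (s - Suc w) * card (?F f) * KK k QI ?id s" if f: "f : ?I" for f
 proof (rule FExts_lower[OF H finite_QI card_QI(2) QI_D(1) _ _ _ ws order_refl sz])
  show "inj_on f QI" using f by blast
  show "f Q : H" if "Q : QI" for Q using f that by (auto simp: AA_def PiE_iff)
  have "lin y0 ` (Q Int nspace (Suc w)) <= f Q" if "Q : QI" for Q using f that by (auto simp: AA_def PiE_iff)
  then show "y0 : FExts n (Suc w) y0 QI ?id f (Suc w)" unfolding FExts_def Exts_def using y0i y0n ly by simp
 qed
 have "(SIGMA f:?I. ?F f) <= (%(ys, f). (f, ys)) ` Opt R"
 proof
  fix p assume "p : (SIGMA f:?I. ?F f)"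
  then obtain f ys where p: "p = (f, ys)" "f : ?I" "ys : ?F f" by blast
  have ys: "length ys = s" "take (Suc w) ys = y0" "set ys <= nspace n" "ALL Q:QI. lin ys ` (Q Int nspace s) <= f Q" "inj_on (lin ys) (nspace s)"
  using p(3) by (auto simp: FExts_def Exts_def)
  have "lin ys ` Q <= f Q" if "Q : QI" for Q using ys(4) that Int_absorb2[OF QI_D(2)[OF that]] by auto
  moreover have "f : QI \<rightarrow>\<^sub>E H" "inj_on f QI" using p(2) by (auto simp: AA_def PiE_iff)
  ultimately have "(ys, f) : conf" using ys by (simp add: conf_def)
  moreover have "lin ys ` nspace (Suc w) = R"
  proof -
  have "lin ys x = g x" if "x : nspace (Suc w)" for x using lin_take[OF that, of ys] ys(1,2) ws lg[OF that] by simp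
  then have "lin ys ` nspace (Suc w) = g ` nspace (Suc w)" by (rule image_cong[OF refl])
  then show ?thesis using g(2) by simp
  qed
  ultimately have "(ys, f) : Opt R" by (simp add: Opt_def)
  then show "p : (%(ys, f). (f, ys)) ` Opt R" unfolding p(1) by (intro image_eqI[of _ _ "(ys, f)"]) auto
 qed
 moreover have fO: "finite (Opt R)" unfolding Opt_def using finite_conf by simp
 ultimately have "card (SIGMA f:?I. ?F f) <= card ((%(ys, f). (f, ys)) ` Opt R)" by (intro card_mono) auto
 also have "... <= card (Opt R)" by (rule card_image_le[OF fO])
 finally have "(SUM f:?I. card (?F f)) <= card (Opt R)" using card_SigmaI[OF fI, of ?F] fF by simp
 then have O: "real (SUM f:?I. card (?F f)) <= real (card (Opt R))" by (simp only: of_nat_le_iff)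
 have KSe: "real (KK k QI ?id s) = KS" by (rule KK_at_s) (rule QI_D, assumption)+
 have "card ?I * (CARD('a) ^ (n * (s - Suc w)) * KK k QI ?id (Suc w)) = (SUM f:?I. CARD('a) ^ (n * (s - Suc w)) * KK k QI ?id (Suc w))" by simp
 also have "... <= (SUM f:?I. 2 ^ (s - Suc w) * card (?F f) * KK k QI ?id s)" by (rule sum_mono) (rule lowF)
 also have "... = 2 ^ (s - Suc w) * (SUM f:?I. card (?F f)) * KK k QI ?id s" by (simp only: sum_distrib_left sum_distrib_right)
 finally have "real (card ?I * (CARD('a) ^ (n * (s - Suc w)) * KK k QI ?id (Suc w))) <= real (2 ^ (s - Suc w) * (SUM f:?I. card (?F f)) * KK k QI ?id s)"
  by (simp only: of_nat_le_iff)
 then have L: "real (card ?I) * (real CARD('a) ^ (n * (s - Suc w)) * real (KK k QI ?id (Suc w))) <= 2 ^ (s - Suc w) * real (SUM f:?I. card (?F f)) * KS"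
  unfolding of_nat_mult of_nat_power of_nat_numeral KSe .
 have IPr: "real (PROD Q:QI. card (?A Q)) <= 2 ^ card QI * real (card ?I)"
 proof -
  have "real (PROD Q:QI. card (?A Q)) <= real (2 ^ card QI * card ?I)" using IP by (simp only: of_nat_le_iff)
  then show ?thesis by (simp only: of_nat_mult of_nat_power of_nat_numeral)
 qed
 let ?qn = "real CARD('a) ^ (n * (s - Suc w))" and ?K1 = "real (KK k QI ?id (Suc w))"
 have "c1 ^ card QI * ?qn <= real (PROD Q:QI. card (?A Q)) * ?K1 * ?qn" by (rule mult_right_mono[OF ab(3) zero_le_power[OF of_nat_0_le_iff]])
 also have "... <= 2 ^ card QI * real (card ?I) * ?K1 * ?qn" by (intro mult_right_mono IPr) simp_all
 also have "... = 2 ^ card QI * (real (card ?I) * (?qn * ?K1))" by (simp only: mult_ac)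
 also have "... <= 2 ^ card QI * (2 ^ (s - Suc w) * real (SUM f:?I. card (?F f)) * KS)" by (rule mult_left_mono[OF L]) simp
 also have "... <= 2 ^ card QI * (2 ^ (s - Suc w) * real (card (Opt R)) * KS)" by (intro mult_left_mono mult_right_mono O) (use KS_pos in simp_all)
 also have "... = 2 ^ (s - Suc w) * 2 ^ card QI * KS * real (card (Opt R))" by (simp only: mult_ac)
 finally show ?thesis .
qed

text \<open>A change of coordinates in the model turns \<open>W'\<close> into
  \<open>nspace w\<close>, so that a basis of \<open>W\<close> becomes the prefix. Then
  \<open>s - w\<close> vectors remain, one more than in \<open>Opt_lower\<close>; the quotient of
  the two counts is the q^n in the degree of the gadgets.\<close>

lemma conf_fixed_upper:
 assumes W: "W : Gr n w" and W': "W' : Gr s w"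
 shows "real (card {p : conf. lin (fst p) ` W' = W}) * KS <= real ((CARD('a) ^ w) ^ w) * (C1 ^ card QI * real CARD('a) ^ (n * (s - w)))"
proof -
 let ?e = "%i l. if l = i then 1 else (0::'a)"
 have w: "w <= s" using ws by simp
 obtain h where h: "h : GL s" "h ` nspace w = W'" by (rule GL_move_nspace[OF W' w])
 have hi: "inv h : GL s" by (rule GL_inv[OF h(1)])
 have hin: "h (inv h x) = x" "inv h (h x) = x" for x using surj_f_inv_f[OF bij_is_surj[OF GL_bij[OF h(1)]]] inv_f_f[OF bij_is_inj[OF GL_bij[OF h(1)]]] by auto
 define Qf where "Qf Q = inv h ` Q" for Q
 have Qf: "nsub (Qf Q)" "Qf Q <= nspace s" "card (Qf Q) = CARD('a) ^ Suc w" if "Q : QI" for Q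
  unfolding Qf_def using GL_image_subspace[OF hi QI_D(1)[OF that]] GL_image_subset[OF hi QI_D(2)[OF that]] GL_card[OF hi, of Q] QI_D(3)[OF that] by auto
 have hs: "h x : nspace s" if "x : nspace s" for x using GL_nspace[OF h(1)] that by blast
 \<comment> \<open>The same embedding, written in the coordinates in which \<open>W'\<close> is
   \<open>nspace w\<close>.\<close>
 define tr where "tr ys = map (%i. lin ys (h (?e i))) [0..<s]" for ys
 have tr: "lin (tr ys) x = lin ys (h x)" if "x : nspace s" for ys x
 proof -
  have "lin_map (%x. lin ys (h x))"
  by (rule lin_mapI) (simp_all only: lin_map_add[OF GL_lin[OF h(1)]] lin_map_scale[OF GL_lin[OF h(1)]] lin_map_add[OF lin_lin] lin_map_scale[OF lin_lin])
  from lin_basis_images[OF this that] show ?thesis unfolding tr_def .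
 qed
 have ltr: "length (tr ys) = s" for ys by (simp add: tr_def)
 define Y0 where "Y0 = {y0. set y0 <= W & length y0 = w & inj_on (lin y0) (nspace w)}"
 have Y0sub: "Y0 <= {y0. set y0 <= W & length y0 = w}" by (auto simp: Y0_def)
 have fL: "finite {y0. set y0 <= W & length y0 = w}" by (rule finite_lists_length_eq[OF GrD(4)[OF W]])
 have fY: "finite Y0" by (rule finite_subset[OF Y0sub fL])
 have cY: "card Y0 <= (CARD('a) ^ w) ^ w" using card_mono[OF fL Y0sub] unfolding card_lists_length_eq[OF GrD(4)[OF W]] GrD(5)[OF W] .
 let ?A = "%y0. AA w y0 Qf"
 let ?I = "%y0. {f : PiE QI (?A y0). inj_on f QI}"
 have fA: "finite (?A y0 Q)" for y0 Q unfolding AA_def using finite_H by simp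
 have fP: "finite (PiE QI (?A y0))" for y0 by (rule finite_PiE[OF finite_QI fA])
 have fI: "finite (?I y0)" for y0 using fP[of y0] by simp
 let ?E = "%y0 f. Exts n w y0 QI Qf f s"
 let ?D = "{p : conf. lin (fst p) ` W' = W}"
 let ?S = "SIGMA y0:Y0. SIGMA f:?I y0. ?E y0 f"
 let ?\<phi> = "%(ys, f). (take w (tr ys), f, tr ys)"
 have inj: "inj_on ?\<phi> ?D"
 proof (rule inj_onI)
  fix p p' assume a: "p : ?D" "p' : ?D" "?\<phi> p = ?\<phi> p'"
  obtain ys f where p: "p = (ys, f)" by (cases p)
  obtain ys' f' where p': "p' = (ys', f')" by (cases p')
  have l: "length ys = s" "length ys' = s" using a(1,2) by (auto simp: p p' conf_def)
  have t: "f = f'" "tr ys = tr ys'" using a(3) by (auto simp: p p')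
  have "lin ys x = lin ys' x" if x: "x : nspace s" for x
  proof -
  have "inv h x : nspace s" using GL_nspace[OF hi] x by blast
  from tr[OF this, of ys] tr[OF this, of ys'] t(2) show ?thesis unfolding hin by simp
  qed
  then have "ys ! i = ys' ! i" if "i < s" for i using lin_unit[of i ys] lin_unit[of i ys'] l that unit_in_nspace[OF that] by metis
  then have "ys = ys'" using l by (intro nth_equalityI) auto
  then show "p = p'" using t(1) by (simp add: p p')
 qed
 have im: "?\<phi> ` ?D <= ?S"
 proof (rule image_subsetI)
  fix p assume a: "p : ?D"
  obtain ys f where p: "p = (ys, f)" by (cases p)
  have c: "length ys = s" "set ys <= nspace n" "inj_on (lin ys) (nspace s)" "f : QI \<rightarrow>\<^sub>E H" "inj_on f QI" "ALL Q:QI. lin ys ` Q <= f Q" "lin ys ` W' = W"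
  using a by (auto simp: p conf_def)
  let ?y0 = "take w (tr ys)"
  have tk: "lin ?y0 x = lin ys (h x)" if x: "x : nspace w" for x
  proof -
  have "x : nspace s" using x nspace_mono[OF w] by blast
  then show ?thesis using lin_take[OF x, of "tr ys"] tr[of x ys] ltr w by simp
  qed
  have "set ?y0 <= W"
  proof
  fix y assume "y : set ?y0"
  then obtain i where i: "i < w" "y = lin ys (h (?e i))" using w ltr[of ys] by (auto simp: in_set_conv_nth tr_def)
  then show "y : W" using c(7) h(2) unit_in_nspace[OF i(1)] by blast
  qed
  moreover have "inj_on (lin ?y0) (nspace w)"
  proof (rule inj_onI)
  fix x y assume xy: "x : nspace w" "y : nspace w" "lin ?y0 x = lin ?y0 y"
  have s: "x : nspace s" "y : nspace s" using xy nspace_mono[OF w] by blast+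
  have "lin ys (h x) = lin ys (h y)" using xy tk by simp
  then have "h x = h y" using inj_onD[OF c(3)] hs[OF s(1)] hs[OF s(2)] by blast
  then show "x = y" using hin(2) by metis
  qed
  ultimately have y0: "?y0 : Y0" using ltr w by (simp add: Y0_def)
  have in_f: "lin ys (h x) : f Q" if "Q : QI" "x : Qf Q" for x Q
  proof -
  have "h x : Q" using that(2) hin(1) by (auto simp: Qf_def)
  then show ?thesis using c(6) that(1) by blast
  qed
  have "lin ?y0 ` (Qf Q Int nspace w) <= f Q" if "Q : QI" for Q using in_f[OF that] tk by auto
  then have fI': "f : ?I ?y0" using c(4,5) by (auto simp: AA_def PiE_iff)
  have "lin (tr ys) ` (Qf Q Int nspace s) <= f Q" if "Q : QI" for Q using in_f[OF that] tr by auto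
  moreover have "set (tr ys) <= nspace n" using lin_nspace[OF c(2)] by (auto simp: tr_def)
  ultimately have "tr ys : ?E ?y0 f" using ltr by (simp add: Exts_def)
  then show "?\<phi> p : ?S" using y0 fI' by (simp add: p)
 qed
 have fE: "finite (?E y0 f)" for y0 f by (rule finite_Exts)
 have fSf: "finite (SIGMA f:?I y0. ?E y0 f)" for y0 using fI fE by blast
 have fS: "finite ?S" using fY fSf by blast
 have "card ?D <= card ?S" by (rule card_inj_on_le[OF inj im fS])
 also have "... = (SUM y0:Y0. card (SIGMA f:?I y0. ?E y0 f))" by (rule card_SigmaI[OF fY]) (use fSf in blast)
 also have "... = (SUM y0:Y0. SUM f:?I y0. card (?E y0 f))" by (rule sum.cong[OF refl], rule card_SigmaI[OF fI]) (use fE in blast)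
 finally have "real (card ?D) <= real (SUM y0:Y0. SUM f:?I y0. card (?E y0 f))" by (simp only: of_nat_le_iff)
 then have D: "real (card ?D) <= (SUM y0:Y0. SUM f:?I y0. real (card (?E y0 f)))" by (simp only: of_nat_sum)
 have KSe: "real (KK k QI Qf s) = KS" by (rule KK_at_s) (rule Qf, assumption)+
 let ?qn = "real CARD('a) ^ (n * (s - w))"
 have one: "(SUM f:?I y0. real (card (?E y0 f))) * KS <= C1 ^ card QI * ?qn" if y0: "y0 : Y0" for y0
 proof -
  have y0': "set y0 <= nspace n" "inj_on (lin y0) (nspace w)" using y0 GrD(2)[OF W] by (auto simp: Y0_def)
  have small: "card (Qf Q Int nspace w) < CARD('a) ^ Suc w" if "Q : QI" for Q
  proof -
  have "card (Qf Q Int nspace w) <= card (nspace w :: 'a vs)" by (rule card_mono[OF finite_nspace]) blast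
  also have "... < CARD('a) ^ Suc w" unfolding card_nspace card_field_power_iff(1) by simp
  finally show ?thesis .
  qed
  note ab = AA_bounds[of Qf w y0, OF Qf(1) small y0']
  have ex: "real (card (?E y0 f)) * KS <= ?qn * real (KK k QI Qf w)" if f: "f : ?I y0" for f
  proof -
  have "card (?E y0 f) * KK k QI Qf s <= CARD('a) ^ (n * (s - w)) * KK k QI Qf w"
  proof (rule Exts_upper[OF H finite_QI card_QI(2) Qf(1) _ _ w])
  show "inj_on f QI" using f by blast
  show "f Q : H" if "Q : QI" for Q using f that by (auto simp: AA_def PiE_iff)
  qed
  then have "real (card (?E y0 f) * KK k QI Qf s) <= real (CARD('a) ^ (n * (s - w)) * KK k QI Qf w)" by (simp only: of_nat_le_iff)
  then show ?thesis unfolding of_nat_mult of_nat_power KSe .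
  qed
  have "(SUM f:?I y0. real (card (?E y0 f))) * KS = (SUM f:?I y0. real (card (?E y0 f)) * KS)" by (rule sum_distrib_right)
  also have "... <= (SUM f:?I y0. ?qn * real (KK k QI Qf w))" by (rule sum_mono) (rule ex)
  also have "... = real (card (?I y0)) * (?qn * real (KK k QI Qf w))" by simp
  also have "... <= real (PROD Q:QI. card (?A y0 Q)) * (?qn * real (KK k QI Qf w))"
  proof (rule mult_right_mono)
  have "card (?I y0) <= card (PiE QI (?A y0))" by (rule card_mono[OF fP]) blast
  then show "real (card (?I y0)) <= real (PROD Q:QI. card (?A y0 Q))" unfolding card_PiE[OF finite_QI] by (simp only: of_nat_le_iff)
  qed simp
  also have "... = (real (PROD Q:QI. card (?A y0 Q)) * real (KK k QI Qf w)) * ?qn" by (simp only: mult_ac)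
  also have "... <= C1 ^ card QI * ?qn" by (rule mult_right_mono[OF ab(2) zero_le_power[OF of_nat_0_le_iff]])
  finally show ?thesis .
 qed
 have C1n: "C1 ^ card QI * ?qn >= 0"
 proof -
  have "C1 >= 0" by (rule C1_nonneg)
  then show ?thesis by simp
 qed
 have "real (card ?D) * KS <= (SUM y0:Y0. SUM f:?I y0. real (card (?E y0 f))) * KS" by (rule mult_right_mono[OF D]) (use KS_pos in simp)
 also have "... = (SUM y0:Y0. (SUM f:?I y0. real (card (?E y0 f))) * KS)" by (rule sum_distrib_right)
 also have "... <= (SUM y0:Y0. C1 ^ card QI * ?qn)" by (rule sum_mono) (rule one)
 also have "... = real (card Y0) * (C1 ^ card QI * ?qn)" by simp
 also have "... <= real ((CARD('a) ^ w) ^ w) * (C1 ^ card QI * ?qn)" by (rule mult_right_mono[OF _ C1n]) (use cY in \<open>simp only: of_nat_le_iff\<close>)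
 finally show ?thesis .
qed

lemma conf_above_upper:
 assumes W: "W : Gr n w"
 shows "real (card {p : conf. W <= lin (fst p) ` nspace s}) * KS <= real b * (real ((CARD('a) ^ w) ^ w) * (C1 ^ card QI * real CARD('a) ^ (n * (s - w))))"
proof -
 let ?G = "Gr s w :: 'a vs set"
 have sub: "{p : conf. W <= lin (fst p) ` nspace s} <= (UN W':?G. {p : conf. lin (fst p) ` W' = W})"
 proof
  fix p assume p: "p : {p : conf. W <= lin (fst p) ` nspace s}"
  define W' where "W' = {x : nspace s. lin (fst p) x : W}"
  have im: "lin (fst p) ` W' = W" using p by (auto simp: W'_def)
  have inj: "inj_on (lin (fst p)) (nspace s)" using p by (auto simp: conf_def)
  have "nsub W'" using nv.subspace_inter[OF subspace_nspace nn.linear_subspace_vimage[OF lin_lin GrD(1)[OF W]]] by (simp add: W'_def vimage_def Int_def)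
  moreover have "card W' = card W" unfolding im[symmetric] by (rule card_image[symmetric], rule inj_on_subset[OF inj]) (auto simp: W'_def)
  ultimately have "W' : ?G" using GrD(5)[OF W] by (auto simp: Gr_iff W'_def)
  then show "p : (UN W':?G. {p : conf. lin (fst p) ` W' = W})" using p im by blast
 qed
 have "card {p : conf. W <= lin (fst p) ` nspace s} <= card (UN W':?G. {p : conf. lin (fst p) ` W' = W})"
 proof (rule card_mono[OF _ sub])
  show "finite (UN W':?G. {p : conf. lin (fst p) ` W' = W})" by (rule finite_UN_I[OF finite_Gr]) (simp add: finite_conf)
 qed
 also have "... <= (SUM W':?G. card {p : conf. lin (fst p) ` W' = W})" by (rule card_UN_le[OF finite_Gr])
 finally have c: "real (card {p : conf. W <= lin (fst p) ` nspace s}) <= (SUM W':?G. real (card {p : conf. lin (fst p) ` W' = W}))"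
  unfolding of_nat_sum[symmetric] by (simp only: of_nat_le_iff)
 let ?U = "real ((CARD('a) ^ w) ^ w) * (C1 ^ card QI * real CARD('a) ^ (n * (s - w)))"
 have "real (card {p : conf. W <= lin (fst p) ` nspace s}) * KS <= (SUM W':?G. real (card {p : conf. lin (fst p) ` W' = W})) * KS"
  by (rule mult_right_mono[OF c]) (use KS_pos in simp)
 also have "... = (SUM W':?G. real (card {p : conf. lin (fst p) ` W' = W}) * KS)" by (rule sum_distrib_right)
 also have "... <= (SUM W':?G. ?U)" by (rule sum_mono) (rule conf_fixed_upper[OF W])
 also have "... = real (card ?G) * ?U" by simp
 also have "... <= real b * ?U"
 proof (rule mult_right_mono)
  have "card ?G <= card {R. R : ?G & True & R <= (nspace s :: 'a vs)}"
  proof (rule card_mono)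
  show "finite {R. R : ?G & True & R <= (nspace s :: 'a vs)}" by (rule finite_subset[OF _ finite_Gr[of s w]]) blast
  show "?G <= {R. R : ?G & True & R <= (nspace s :: 'a vs)}" using GrD(2) by blast
  qed
  also have "... <= b" unfolding bdef by (rule card_subsets_le[OF nspace_Gr[OF order_refl]])
  finally show "real (card ?G) <= real b" by simp
  have "C1 >= 0" by (rule C1_nonneg)
  then show "?U >= 0" by simp
 qed
 finally show ?thesis .
qed

text \<open>One element of \<open>Opt R\<close> is selected for each \<open>R\<close>. These sets
  are disjoint for different \<open>R\<close>, so the mean number of selected gadgets above
  \<open>W\<close> is at most the number of all configurations above \<open>W\<close> divided by the
  least size \<open>Lo\<close> of an \<open>Opt R\<close>.\<close>

lemma gadget:
 assumes ln: "real n * real s * ln (real CARD('a)) <= real CARD('a) ^ n"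
 shows "EX S. (ALL R:Gr n (Suc w). S R : Gr n s & R <= S R & (ALL R':Gr n (Suc w). R' <= S R --> R' ~= R --> inK H R')) &
  (ALL W:Gr n w. real (card {R : Gr n (Suc w). W <= S R})
  <= (2 * (real b * real ((CARD('a) ^ w) ^ w) * (2 * C1 / c1) ^ card QI * 2 ^ (s - Suc w)) + 1) * real CARD('a) ^ n)"
proof -
 let ?R = "Gr n (Suc w) :: 'a vs set" and ?W = "Gr n w :: 'a vs set"
 let ?q = "real CARD('a)"
 have q0: "?q > 0" by (rule real_card_pos)
 define Lo where "Lo = c1 ^ card QI * ?q ^ (n * (s - Suc w)) / (2 ^ (s - Suc w) * 2 ^ card QI * KS)"
 have den: "2 ^ (s - Suc w) * 2 ^ card QI * KS > 0" using KS_pos by simp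
 have Lo0: "Lo > 0" unfolding Lo_def using c1 q0 KS_pos by simp
 have OL: "Lo <= real (card (Opt R))" if "R : ?R" for R unfolding Lo_def pos_divide_le_eq[OF den] using Opt_lower[OF that] by (simp only: mult_ac)
 have fO: "finite (Opt R)" for R unfolding Opt_def using finite_conf by simp
 have neO: "Opt R ~= {}" if "R : ?R" for R using OL[OF that] Lo0 by auto
 define wt where "wt R p W = (if W <= lin (fst p) ` nspace s then 1 else (0::real))" for R :: "'a vs" and p :: "'a vec list \<times> ('a vs => 'a vs)" and W
 obtain f where f: "!!R. R : ?R ==> f R : Opt R"
  "!!W. W : ?W ==> (SUM R:?R. wt R (f R) W) <= 2 * (SUM R:?R. (SUM p:Opt R. wt R p W) / card (Opt R)) + 1 * ln (card ?W)"
 proof (rule select[of ?R ?W 1 Opt wt])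
  show "finite ?R" "finite ?W" by (rule finite_Gr)+
  show "finite (Opt R) & Opt R ~= {}" if "R : ?R" for R using fO neO[OF that] by blast
  show "0 <= wt R p W & wt R p W <= 1" for R p W by (simp add: wt_def)
  fix f assume "!!R. R : ?R ==> f R : Opt R"
  "!!W. W : ?W ==> (SUM R:?R. wt R (f R) W) <= 2 * (SUM R:?R. (SUM p:Opt R. wt R p W) / card (Opt R)) + 1 * ln (card ?W)"
  then show thesis by (rule that)
 qed simp
 define S where "S R = lin (fst (f R)) ` nspace s" for R
 have S: "S R : Gr n s & R <= S R & (ALL R':?R. R' <= S R --> R' ~= R --> inK H R')" if R: "R : ?R" for R
 proof -
  obtain ys io where p: "f R = (ys, io)" by (cases "f R")
  have c: "length ys = s" "set ys <= nspace n" "inj_on (lin ys) (nspace s)" "io : QI \<rightarrow>\<^sub>E H" "ALL Q:QI. lin ys ` Q <= io Q" "lin ys ` nspace (Suc w) = R"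
  using f(1)[OF R] by (auto simp: Opt_def conf_def p)
  have SR: "S R = lin ys ` nspace s" by (simp add: S_def p)
  have "card (S R) = CARD('a) ^ s" unfolding SR card_image[OF c(3)] card_nspace ..
  moreover have "nsub (S R)" unfolding SR by (rule nn.linear_subspace_image[OF lin_lin subspace_nspace])
  moreover have "S R <= nspace n" unfolding SR using lin_nspace[OF c(2)] by blast
  ultimately have "S R : Gr n s" by (simp add: Gr_iff)
  moreover have "R <= S R" using image_mono[OF nspace_mono[OF ws], of "lin ys"] unfolding SR c(6) .
  moreover have "inK H R'" if R': "R' : ?R" "R' <= S R" "R' ~= R" for R'
  proof -
  define Q where "Q = {x : nspace s. lin ys x : R'}"
  have im: "lin ys ` Q = R'" using R'(2) unfolding SR by (auto simp: Q_def)
  have "nsub Q" using nv.subspace_inter[OF subspace_nspace nn.linear_subspace_vimage[OF lin_lin GrD(1)[OF R'(1)]]] by (simp add: Q_def vimage_def Int_def)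
  moreover have "card Q = card R'" unfolding im[symmetric] by (rule card_image[symmetric], rule inj_on_subset[OF c(3)]) (auto simp: Q_def)
  ultimately have "Q : Gr s (Suc w)" using GrD(5)[OF R'(1)] by (auto simp: Gr_iff Q_def)
  moreover have "Q ~= nspace (Suc w)" using im c(6) R'(3) by blast
  ultimately have Q: "Q : QI" by (simp add: QI_def)
  then have "R' <= io Q" using c(5) im by blast
  moreover have "io Q : H" using c(4) Q by (auto simp: PiE_iff)
  ultimately show ?thesis unfolding inK_def by blast
  qed
  ultimately show ?thesis by blast
 qed
 have "real (card {R : ?R. W <= S R}) <= (2 * (real b * real ((CARD('a) ^ w) ^ w) * (2 * C1 / c1) ^ card QI * 2 ^ (s - Suc w)) + 1) * ?q ^ n"
  if W: "W : ?W" for W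
 proof -
  let ?Y = "real b * real ((CARD('a) ^ w) ^ w)"
  have e1: "real (card {R : ?R. W <= S R}) = (SUM R:?R. wt R (f R) W)"
  proof -
  have "(SUM R:?R. wt R (f R) W) = (SUM R:{R : ?R. W <= S R}. 1)" unfolding wt_def S_def by (rule sum.mono_neutral_cong_right) (auto simp: finite_Gr)
  then show ?thesis by simp
  qed
  have dis: "(SUM R:?R. card {p : Opt R. W <= lin (fst p) ` nspace s}) <= card {p : conf. W <= lin (fst p) ` nspace s}"
  proof -
  have "(SUM R:?R. card {p : Opt R. W <= lin (fst p) ` nspace s}) = card (UN R:?R. {p : Opt R. W <= lin (fst p) ` nspace s})"
  proof (rule card_UN_disjoint[symmetric])
  show "finite ?R" by (rule finite_Gr)
  show "ALL R:?R. finite {p : Opt R. W <= lin (fst p) ` nspace s}" using fO by simp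
  qed (auto simp: Opt_def)
  also have "... <= card {p : conf. W <= lin (fst p) ` nspace s}" by (rule card_mono) (use finite_conf in \<open>auto simp: Opt_def\<close>)
  finally show ?thesis .
  qed
  have "(SUM R:?R. (SUM p:Opt R. wt R p W) / card (Opt R)) <= (SUM R:?R. real (card {p : Opt R. W <= lin (fst p) ` nspace s}) / Lo)"
  proof (rule sum_mono)
  fix R assume R: "R : ?R"
  have "(SUM p:Opt R. wt R p W) = (SUM p:{p : Opt R. W <= lin (fst p) ` nspace s}. 1)" unfolding wt_def by (rule sum.mono_neutral_cong_right) (use fO in auto)
  then have "(SUM p:Opt R. wt R p W) = real (card {p : Opt R. W <= lin (fst p) ` nspace s})" by simp
  then show "(SUM p:Opt R. wt R p W) / card (Opt R) <= real (card {p : Opt R. W <= lin (fst p) ` nspace s}) / Lo" using OL[OF R] Lo0 by (simp add: frac_le)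
  qed
  also have "... = real (SUM R:?R. card {p : Opt R. W <= lin (fst p) ` nspace s}) / Lo" by (simp add: sum_divide_distrib)
  also have "... <= real (card {p : conf. W <= lin (fst p) ` nspace s}) / Lo" using dis Lo0 by (intro divide_right_mono) (simp_all only: of_nat_le_iff less_imp_le)
  also have "... <= ?Y * (2 * C1 / c1) ^ card QI * 2 ^ (s - Suc w) * ?q ^ n"
  proof -
  have "real (card {p : conf. W <= lin (fst p) ` nspace s}) <= real b * (real ((CARD('a) ^ w) ^ w) * (C1 ^ card QI * ?q ^ (n * (s - w)))) / KS"
  using conf_above_upper[OF W] KS_pos by (simp only: pos_le_divide_eq)
  then have "real (card {p : conf. W <= lin (fst p) ` nspace s}) / Lo <= real b * (real ((CARD('a) ^ w) ^ w) * (C1 ^ card QI * ?q ^ (n * (s - w)))) / KS / Lo"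
  using Lo0 by (intro divide_right_mono) simp_all
  also have "... = ?Y * (2 * C1 / c1) ^ card QI * 2 ^ (s - Suc w) * ?q ^ n"
  proof -
  have "n * (s - w) = n * (s - Suc w) + n"
  proof -
  have "s - w = Suc (s - Suc w)" using ws by simp
  then show ?thesis by (simp only: mult_Suc_right add.commute)
  qed
  then have qq: "?q ^ (n * (s - w)) = ?q ^ (n * (s - Suc w)) * ?q ^ n" by (simp only: power_add)
  show ?thesis unfolding Lo_def qq power_divide power_mult_distrib by (rule ratio_identity) (use KS_pos q0 c1 in simp_all)
  qed
  finally show ?thesis .
  qed
  finally have main: "(SUM R:?R. (SUM p:Opt R. wt R p W) / card (Opt R)) <= ?Y * (2 * C1 / c1) ^ card QI * 2 ^ (s - Suc w) * ?q ^ n" .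
  have wss: "w <= s" using ws by simp
  have "ln (real (card ?W)) <= ?q ^ n" using ln_card_Gr[OF wss, of n, where 'a='a] ln by linarith
  then have "(SUM R:?R. wt R (f R) W) <= 2 * (?Y * (2 * C1 / c1) ^ card QI * 2 ^ (s - Suc w) * ?q ^ n) + ?q ^ n" using f(2)[OF W] main by linarith
  also have "... = (2 * (?Y * (2 * C1 / c1) ^ card QI * 2 ^ (s - Suc w)) + 1) * ?q ^ n" by (simp only: distrib_right mult_1 mult.assoc)
  finally show ?thesis unfolding e1 .
 qed
 then show ?thesis using S by (intro exI[of _ S] conjI ballI) blast+
qed

end

section \<open>Covers modulo \<open>m\<close> inside the members of a family\<close>

definition mcover :: "nat => nat => nat => int => real => 'a::{field,finite} vs set => bool" where
 "mcover d s w m c B \<longleftrightarrow> B <= Gr d s &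
  (ALL Ps:ZGr d s. EX Ph:ZGr d s. (ALL S. Ph S ~= 0 --> S : B) & (ALL S. 0 <= Ph S & Ph S <= m) &
  (ALL R. m dvd (boundary d s (Suc w) Ps R - boundary d s (Suc w) Ph R))) &
  (ALL W:Gr d w. real (card {S : B. W <= S}) <= c)"

text \<open>The vector is pulled back to \<open>nspace d\<close>, covered there, and pushed forward.
  The cover stays inside the given subspace, so the degree is zero at every \<open>W\<close> that
  does not lie in it.\<close>

lemma cover_in_subspace:
 fixes B :: "'a::{field,finite} vs set" and g :: "'a vec => nat => 'a" and Ps :: "'a vs => int"
 assumes B: "mcover d s w m c B" and dn: "d <= n" and g: "g : GL n" and m: "m >= 0"
  and Psi: "Ps : ZGr n s" "!!S. Ps S ~= 0 ==> S <= g ` nspace d"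
 shows "EX Ph:ZGr n s. (ALL R. m dvd (boundary n s (Suc w) Ps R - boundary n s (Suc w) Ph R)) &
  (ALL W:Gr n w. deg n s Ph W <= (if W <= g ` nspace d then rint m * c else 0))"
proof -
 have gi: "inv g : GL n" by (rule GL_inv[OF g])
 define Ps' where "Ps' T = Ps (g ` T)" for T
 have P1: "Ps' : ZGr d s" unfolding ZGr_def
 proof (intro CollectI allI impI)
  fix T :: "'a vs" assume T: "T ~: Gr d s"
  show "Ps' T = 0"
  proof (rule ccontr)
  assume nz: "Ps' T ~= 0"
  then have "g ` T : Gr n s" using Psi(1) by (auto simp: Ps'_def ZGr_def)
  then have "T : Gr n s" by (simp only: GL_Gr_iff[OF g])
  moreover have "g ` T <= g ` nspace d" using Psi(2) nz by (simp add: Ps'_def)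
  then have "T <= nspace d" by (simp only: GL_subset_iff[OF g])
  ultimately show False using T by (simp add: Gr_iff)
  qed
 qed
 obtain Ph' where F: "Ph' : ZGr d s" "ALL S. Ph' S ~= 0 --> S : B" "ALL S. 0 <= Ph' S & Ph' S <= m"
  "ALL R. m dvd (boundary d s (Suc w) Ps' R - boundary d s (Suc w) Ph' R)" using B P1 unfolding mcover_def by blast
 define Ph where "Ph T = Ph' (inv g ` T)" for T
 have Fn: "Ph' : ZGr n s" by (rule ZGr_mono[OF dn F(1)])
 have PZ: "Ph : ZGr n s" unfolding Ph_def by (rule push_ZGr[OF gi Fn])
 have "m dvd (boundary n s (Suc w) Ps R - boundary n s (Suc w) Ph R)" for R
 proof -
  have e1: "boundary n s (Suc w) Ph R = boundary d s (Suc w) Ph' (inv g ` R)" using boundary_push[OF gi, of s "Suc w" Ph' R] unfolding Ph_def boundary_restrict[OF dn F(1)] .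
  have "(%T. Ps' (inv g ` T)) = Ps" unfolding Ps'_def by (rule ext) (simp only: GL_inv_image(2)[OF g])
  then have e2: "boundary n s (Suc w) Ps R = boundary d s (Suc w) Ps' (inv g ` R)" using boundary_push[OF gi, of s "Suc w" Ps' R] unfolding boundary_restrict[OF dn P1] by simp
  show ?thesis unfolding e1 e2 using F(4) by blast
 qed
 moreover have "deg n s Ph W <= (if W <= g ` nspace d then rint m * c else 0)" if W: "W : Gr n w" for W
 proof -
  let ?W = "inv g ` W"
  have "deg n s Ph W = deg n s Ph' ?W" unfolding Ph_def by (rule deg_push[OF gi])
  also have "... <= (if W <= g ` nspace d then rint m * c else 0)"
  proof (cases "W <= g ` nspace d")
  case True
  have "?W <= inv g ` (g ` nspace d)" by (rule image_mono[OF True])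
  then have "?W <= nspace d" by (simp only: GL_inv_image(1)[OF g])
  moreover have "?W : Gr n w" by (rule GL_Gr[OF gi W])
  ultimately have Wd: "?W : Gr d w" by (simp add: Gr_iff)
  have fB: "finite B" using B finite_Gr finite_subset unfolding mcover_def by blast
  have "deg n s Ph' ?W <= (SUM S:{S : Gr n s. ?W <= S}. if S : B then rint m else 0)" unfolding deg_def
  proof (rule sum_mono)
  fix S
  have "0 <= Ph' S & Ph' S <= m" "Ph' S ~= 0 --> S : B" using F(2,3) by blast+
  then show "\<bar>rint (Ph' S)\<bar> <= (if S : B then rint m else 0)" by auto
  qed
  also have "... = (SUM S:{S : {S : Gr n s. ?W <= S}. S : B}. rint m)" by (rule sum.inter_filter[symmetric]) (simp add: finite_Gr)
  also have "... = rint m * real (card {S : {S : Gr n s. ?W <= S}. S : B})" by simp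
  also have "... <= rint m * real (card {S : B. ?W <= S})" by (intro mult_left_mono of_nat_mono card_mono) (use fB m in auto)
  also have "... <= rint m * c" using B Wd m unfolding mcover_def by (intro mult_left_mono) auto
  finally show ?thesis using True by simp
  next
  case False
  have "Ph' S = 0" if "?W <= S" for S
  proof (rule ccontr)
  assume "Ph' S ~= 0"
  then have "S <= nspace d" using F(1) by (auto simp: ZGr_def Gr_iff)
  then have "g ` ?W <= g ` nspace d" using that by (intro image_mono) blast
  then show False using False by (simp only: GL_inv_image(2)[OF g])
  qed
  then have "deg n s Ph' ?W = 0" unfolding deg_def by (intro sum.neutral) auto
  then show ?thesis using False by simp
  qed
  finally show ?thesis .
 qed
 ultimately show ?thesis using PZ by blast
qed

text \<open>Each space of the support is charged to one member that contains it, and the members are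
  covered separately. Only members through \<open>W\<close> contribute to the degree at
  \<open>W\<close>.\<close>

lemma cover_family:
 fixes H B :: "'a::{field,finite} vs set" and Ps :: "'a vs => int"
 assumes B: "mcover d s w m c B" and dn: "d <= n" and m: "m >= 0" and H: "finite H" "!!X. X : H ==> EX g:GL n. X = g ` nspace d"
  and Psi: "Ps : ZGr n s" "!!S. Ps S ~= 0 ==> inK H S"
 shows "EX Ph:ZGr n s. (ALL R. m dvd (boundary n s (Suc w) Ps R - boundary n s (Suc w) Ph R)) &
  (ALL W:Gr n w. deg n s Ph W <= real (card {X : H. W <= X}) * (rint m * c))"
proof -
 define pick where "pick S = (SOME X. X : H & S <= X)" for S
 have pick: "pick S : H & S <= pick S" if nz: "Ps S ~= 0" for S
 proof -
  obtain X where "X : H & S <= X" using Psi(2)[OF nz] unfolding inK_def by blast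
  then show ?thesis unfolding pick_def by (rule someI)
 qed
 define PX where "PX X S = (if pick S = X then Ps S else 0)" for X S
 have "ALL X:H. EX Ph. Ph : ZGr n s & (ALL R. m dvd (boundary n s (Suc w) (PX X) R - boundary n s (Suc w) Ph R)) &
  (ALL W:Gr n w. deg n s Ph W <= (if W <= X then rint m * c else 0))"
 proof
  fix X assume X: "X : H"
  obtain g where g: "g : GL n" "X = g ` nspace d" using H(2)[OF X] by blast
  have "PX X : ZGr n s" using Psi(1) by (auto simp: PX_def ZGr_def)
  moreover have "S <= g ` nspace d" if "PX X S ~= 0" for S
  proof -
  have "pick S = X" "Ps S ~= 0" using that by (auto simp: PX_def split: if_splits)
  then show ?thesis using pick[of S] g(2) by simp
  qed
  ultimately show "EX Ph. Ph : ZGr n s & (ALL R. m dvd (boundary n s (Suc w) (PX X) R - boundary n s (Suc w) Ph R)) &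
  (ALL W:Gr n w. deg n s Ph W <= (if W <= X then rint m * c else 0))" using cover_in_subspace[OF B dn g(1) m, of "PX X"] unfolding g(2)[symmetric] by blast
 qed
 from bchoice[OF this] obtain F where F: "ALL X:H. F X : ZGr n s & (ALL R. m dvd (boundary n s (Suc w) (PX X) R - boundary n s (Suc w) (F X) R)) &
  (ALL W:Gr n w. deg n s (F X) W <= (if W <= X then rint m * c else 0))" ..
 define Ph where "Ph = (%S. SUM X:H. F X S)"
 have "Ph : ZGr n s" unfolding ZGr_def Ph_def using F by (auto simp: ZGr_def intro!: sum.neutral)
 moreover have "m dvd (boundary n s (Suc w) Ps R - boundary n s (Suc w) Ph R)" for R
 proof -
  have "Ps = (%S. SUM X:H. PX X S)"
  proof
  fix S
  show "Ps S = (SUM X:H. PX X S)"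
  proof (cases "Ps S = 0")
  case True
  then have "(SUM X:H. PX X S) = 0" unfolding PX_def by (intro sum.neutral) simp
  then show ?thesis using True by simp
  next
  case False
  have "(SUM X:H. PX X S) = (SUM X:H. if pick S = X then Ps S else 0)" by (simp add: PX_def)
  also have "... = Ps S" using pick[OF False] H(1) by simp
  finally show ?thesis by simp
  qed
  qed
  then have "boundary n s (Suc w) Ps R = (SUM X:H. boundary n s (Suc w) (PX X) R)" using boundary_sum[of n s "Suc w" PX H] by simp
  moreover have "boundary n s (Suc w) Ph R = (SUM X:H. boundary n s (Suc w) (F X) R)" unfolding Ph_def boundary_sum ..
  ultimately have "boundary n s (Suc w) Ps R - boundary n s (Suc w) Ph R = (SUM X:H. boundary n s (Suc w) (PX X) R - boundary n s (Suc w) (F X) R)" by (simp only: sum_subtractf)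
  then show ?thesis using F by (auto intro!: dvd_sum)
 qed
 moreover have "deg n s Ph W <= real (card {X : H. W <= X}) * (rint m * c)" if W: "W : Gr n w" for W
 proof -
  have "deg n s Ph W <= (SUM X:H. deg n s (F X) W)" unfolding Ph_def by (rule deg_sum_le[OF H(1)])
  also have "... <= (SUM X:H. if W <= X then rint m * c else 0)" by (rule sum_mono) (use F W in blast)
  also have "... = (SUM X:{X : H. W <= X}. rint m * c)" by (rule sum.inter_filter[symmetric, OF H(1)])
  finally show ?thesis by simp
 qed
 ultimately show ?thesis by blast
qed

section \<open>Transversal families from random translates\<close>

lemma exp_minus_le: "0 <= t ==> t <= 1 ==> exp (- t) <= 1 - t / (2 :: real)"
proof -
 assume t: "0 <= t" "t <= 1"
 have "t * t <= t * 1" using t by (intro mult_left_mono) auto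
 then have "1 <= (1 - t / 2) * (1 + t)" by (simp add: algebra_simps)
 also have "... <= (1 - t / 2) * exp t" using t by (intro mult_left_mono exp_ge_add_one_self) auto
 finally have "1 * exp (- t) <= (1 - t / 2) * exp t * exp (- t)" by (intro mult_right_mono) auto
 then show ?thesis by (simp add: mult.assoc exp_minus)
qed

lemma linear_alg:
 fixes c a :: real
 shows "c + 2 * (c * a) = c * (1 + 2 * a)" "c - c * a / 2 = c * (1 + - (a / 2))"
proof -
 show "c + 2 * (c * a) = c * (1 + 2 * a)" unfolding distrib_left mult_1_right by (simp only: mult.left_commute)
 show "c - c * a / 2 = c * (1 + - (a / 2))" unfolding distrib_left mult_1_right by simp
qed

lemma exp_alg:
 fixes s f a l :: real
 shows "exp (s + f - 2 * a * (l + 1)) = exp f * exp (s - 2 * a * l - 2 * a)"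
  "exp (a / 2 * (l + 1) - (s + f)) = exp (- f) * exp (a / 2 * l - s + a / 2)"
proof -
 have "s + f - 2 * a * (l + 1) = f + (s - 2 * a * l - 2 * a)" unfolding distrib_left mult_1_right by linarith
 then show "exp (s + f - 2 * a * (l + 1)) = exp f * exp (s - 2 * a * l - 2 * a)" by (simp only: exp_add[symmetric])
 have "a / 2 * (l + 1) - (s + f) = - f + (a / 2 * l - s + a / 2)" unfolding distrib_left mult_1_right by linarith
 then show "exp (a / 2 * (l + 1) - (s + f)) = exp (- f) * exp (a / 2 * l - s + a / 2)" by (simp only: exp_add[symmetric])
qed

text \<open>A two-sided Chernoff bound by greedy choice with forbidden options. Restricting the
  choice to \<open>A h\<close> costs a factor exp (1/N) in the average, so a factor e over all
  \<open>N\<close> steps; this and the two tails account for \<open>2 * exp 1\<close> in the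
  logarithm.\<close>

lemma avoiding_selection:
 fixes f :: "'z => 'o => real" and av :: "'z => real"
 assumes G: "finite G" "G ~= {}" and Zs: "finite Zs" "Zs ~= {}" and N: "N > 0"
  and A: "!!h. length h < N ==> (!!i. i < length h ==> h ! i : A (take i h)) ==> A h <= G & real (card G) <= exp (1 / real N) * card (A h)"
  and f: "!!z x. z : Zs ==> x : G ==> 0 <= f z x & f z x <= 1"
  and av: "!!z. z : Zs ==> (SUM x:G. f z x) = card G * av z"
 shows "EX h. length h = N & (ALL i<N. h ! i : A (take i h)) &
  (ALL z:Zs. (SUM x<-h. f z x) <= ln (2 * exp 1 * card Zs) + 2 * av z * N & av z * N / 2 - ln (2 * exp 1 * card Zs) <= (SUM x<-h. f z x))"
proof -
 define Q where "Q h z = exp ((SUM x<-h. f z x) - 2 * av z * length h) + exp (av z / 2 * length h - (SUM x<-h. f z x))" for h z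
 define P where "P h = exp (- (real (length h) / N)) * (SUM z:Zs. Q h z)" for h
 have Q0: "Q h z >= 0" for h z by (simp add: Q_def add_nonneg_nonneg)
 have cG: "real (card G) > 0" using G by (simp add: card_gt_0_iff)
 have cZ: "real (card Zs) > 0" using Zs by (simp add: card_gt_0_iff)
 have stepQ: "(SUM x:G. Q (h @ [x]) z) <= card G * Q h z" if z: "z : Zs" for h z
 proof -
  let ?s = "SUM x<-h. f z x" and ?l = "real (length h)"
  have up: "(SUM x:G. exp (f z x)) <= card G * exp (2 * av z)"
  proof -
  have "(SUM x:G. exp (f z x)) <= (SUM x:G. 1 + 2 * f z x)" by (rule sum_mono) (use f[OF z] exp_le_linear in blast)
  also have "... = card G + 2 * (card G * av z)" unfolding sum.distrib sum_distrib_left[symmetric] av[OF z] by simp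
  also have "... = card G * (1 + 2 * av z)" by (rule linear_alg(1))
  also have "... <= card G * exp (2 * av z)" by (rule mult_left_mono[OF exp_ge_add_one_self]) simp
  finally show ?thesis .
  qed
  have dn: "(SUM x:G. exp (- f z x)) <= card G * exp (- (av z / 2))"
  proof -
  have "(SUM x:G. exp (- f z x)) <= (SUM x:G. 1 - f z x / 2)" by (rule sum_mono) (use f[OF z] exp_minus_le in blast)
  also have "... = card G - card G * av z / 2" unfolding sum_subtractf sum_divide_distrib[symmetric] av[OF z] by simp
  also have "... = card G * (1 + - (av z / 2))" by (rule linear_alg(2))
  also have "... <= card G * exp (- (av z / 2))" by (rule mult_left_mono[OF exp_ge_add_one_self]) simp
  finally show ?thesis .
  qed
  have len: "real (length (h @ [x])) = ?l + 1" and sl: "(SUM x<-h @ [x]. f z x) = ?s + f z x" for x by simp_all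
  have e1: "exp ((SUM x<-h @ [x]. f z x) - 2 * av z * real (length (h @ [x]))) = exp (f z x) * exp (?s - 2 * av z * ?l - 2 * av z)" for x unfolding len sl by (rule exp_alg(1))
  have e2: "exp (av z / 2 * real (length (h @ [x])) - (SUM x<-h @ [x]. f z x)) = exp (- f z x) * exp (av z / 2 * ?l - ?s + av z / 2)" for x unfolding len sl by (rule exp_alg(2))
  have "(SUM x:G. Q (h @ [x]) z) = (SUM x:G. exp (f z x)) * exp (?s - 2 * av z * ?l - 2 * av z) + (SUM x:G. exp (- f z x)) * exp (av z / 2 * ?l - ?s + av z / 2)"
  unfolding Q_def e1 e2 sum.distrib sum_distrib_right ..
  also have "... <= card G * exp (2 * av z) * exp (?s - 2 * av z * ?l - 2 * av z) + card G * exp (- (av z / 2)) * exp (av z / 2 * ?l - ?s + av z / 2)"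
  by (rule add_mono[OF mult_right_mono[OF up] mult_right_mono[OF dn]]) simp_all
  also have "... = card G * Q h z"
  proof -
  have a: "exp (2 * av z) * exp (?s - 2 * av z * ?l - 2 * av z) = exp (?s - 2 * av z * ?l)" by (simp add: exp_add[symmetric])
  have b: "exp (- (av z / 2)) * exp (av z / 2 * ?l - ?s + av z / 2) = exp (av z / 2 * ?l - ?s)" by (simp add: exp_add[symmetric])
  show ?thesis unfolding Q_def distrib_left a[symmetric] b[symmetric] by (simp only: mult.assoc)
  qed
  finally show ?thesis .
 qed
 have "EX h. length h = N & (ALL i<N. h ! i : A (take i h)) & P h <= P []"
 proof (rule greedy_list)
  fix h assume h: "length h < N" "!!i. i < length h ==> h ! i : A (take i h)"
  have Ah: "A h <= G" "real (card G) <= exp (1 / real N) * card (A h)" using A[OF h] by blast+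
  have fA: "finite (A h)" using Ah(1) G(1) finite_subset by blast
  have neA: "A h ~= {}" using Ah(2) cG by auto
  have P0: "P g >= 0" for g unfolding P_def by (intro mult_nonneg_nonneg sum_nonneg Q0) simp
  have "(SUM x:A h. P (h @ [x])) <= (SUM x:G. P (h @ [x]))" by (rule sum_mono2[OF G(1) Ah(1)]) (rule P0)
  also have "... = (SUM x:G. exp (- (real (Suc (length h)) / N)) * (SUM z:Zs. Q (h @ [x]) z))"
  unfolding P_def by (rule sum.cong[OF refl]) (simp only: length_append list.size add_0 add_Suc_right add_0_right)
  also have "... = exp (- (real (Suc (length h)) / N)) * (SUM x:G. SUM z:Zs. Q (h @ [x]) z)" by (rule sum_distrib_left[symmetric])
  also have "(SUM x:G. SUM z:Zs. Q (h @ [x]) z) = (SUM z:Zs. SUM x:G. Q (h @ [x]) z)" by (rule sum.swap)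
  also have "exp (- (real (Suc (length h)) / N)) * (SUM z:Zs. SUM x:G. Q (h @ [x]) z) <= exp (- (real (Suc (length h)) / N)) * (SUM z:Zs. card G * Q h z)"
  by (intro mult_left_mono sum_mono stepQ) simp_all
  also have "... = card G * (exp (- (real (Suc (length h)) / N)) * (SUM z:Zs. Q h z))" unfolding sum_distrib_left[symmetric] by (simp only: mult.left_commute)
  also have "... <= exp (1 / real N) * card (A h) * (exp (- (real (Suc (length h)) / N)) * (SUM z:Zs. Q h z))"
  by (rule mult_right_mono[OF Ah(2)]) (intro mult_nonneg_nonneg sum_nonneg Q0; simp)
  also have "... = card (A h) * (exp (1 / real N) * exp (- (real (Suc (length h)) / N)) * (SUM z:Zs. Q h z))" by (simp only: mult_ac)
  also have "exp (1 / real N) * exp (- (real (Suc (length h)) / N)) = exp (- (real (length h) / N))"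
  proof -
  have "1 / real N + - (real (Suc (length h)) / N) = - (real (length h) / N)" unfolding minus_divide_left add_divide_distrib[symmetric] by simp
  then show ?thesis by (simp only: exp_add[symmetric])
  qed
  finally show "finite (A h) & A h ~= {} & (SUM x:A h. P (h @ [x])) <= card (A h) * P h" using fA neA unfolding P_def by blast
 qed
 then obtain h where h: "length h = N" "ALL i<N. h ! i : A (take i h)" "P h <= P []" by blast
 have "(SUM x<-h. f z x) <= ln (2 * exp 1 * card Zs) + 2 * av z * N & av z * N / 2 - ln (2 * exp 1 * card Zs) <= (SUM x<-h. f z x)" if z: "z : Zs" for z
 proof -
  have "P [] = 2 * card Zs" by (simp add: P_def Q_def)
  then have "exp (- 1) * (SUM z:Zs. Q h z) <= 2 * card Zs" using h(3) N unfolding P_def h(1) by simp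
  then have "exp 1 * (exp (- 1) * (SUM z:Zs. Q h z)) <= exp 1 * (2 * card Zs)" by (rule mult_left_mono) simp
  then have "(SUM z:Zs. Q h z) <= 2 * exp 1 * card Zs" by (simp add: mult.assoc[symmetric] exp_add[symmetric])
  moreover have "Q h z <= (SUM z:Zs. Q h z)" by (rule member_le_sum[OF z]) (use Q0 Zs in auto)
  ultimately have Qz: "Q h z <= 2 * exp 1 * card Zs" by linarith
  have le: "t <= ln (2 * exp 1 * card Zs)" if "exp t <= Q h z" for t
  proof -
  have "exp t <= 2 * exp 1 * card Zs" using that Qz by linarith
  then have "ln (exp t) <= ln (2 * exp 1 * card Zs)" using cZ by (subst ln_le_cancel_iff) auto
  then show ?thesis by simp
  qed
  have "(SUM x<-h. f z x) - 2 * av z * length h <= ln (2 * exp 1 * card Zs)" by (rule le) (simp add: Q_def)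
  moreover have "av z / 2 * length h - (SUM x<-h. f z x) <= ln (2 * exp 1 * card Zs)" by (rule le) (simp add: Q_def)
  ultimately show ?thesis unfolding h(1) by simp
 qed
 then show ?thesis using h(1,2) by blast
qed

lemma GL_vector_count:
 fixes x y :: "nat => 'a::{field,finite}"
 assumes "x : nspace n - {0}" "y : nspace n - {0}"
 shows "card {g : GL n. g x = y} * card (nspace n - {0 :: nat => 'a}) = card (GL n :: ('a vec => _) set)"
proof (rule orbit_count[where act = "%g x. g x", OF _ _ _ _ assms])
 show "finite (nspace n - {0 :: nat => 'a})" using finite_nspace by blast
 fix g :: "'a vec => nat => 'a" and x :: "nat => 'a" assume g: "g : GL n" and x: "x : nspace n - {0}"
 have "g x : nspace n" using GL_nspace[OF g] x by blast
 moreover have "g x ~= 0"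
 proof
  assume "g x = 0"
  moreover have "g 0 = 0" using lin_map_scale[OF GL_lin[OF g], of 0 0] by simp
  ultimately have "x = 0" using bij_is_inj[OF GL_bij[OF g]] by (metis injD)
  then show False using x by simp
 qed
 ultimately show "g x : nspace n - {0}" by simp
next
 show "(g \<circ> h) x = g (h x)" for g h and x :: "nat => 'a" by simp
 fix x y :: "nat => 'a" assume x: "x : nspace n - {0}" and y: "y : nspace n - {0}"
 have ind: "nv.independent {z}" if "z ~= 0" for z :: "nat => 'a" by (rule nv.independent_insertI[OF _ nv.independent_empty]) (use that in simp)
 obtain g where "g : GL n" "!!b. b : {x} ==> g b = (%_. y) b" by (rule GL_extend[of "{x}" n "%_. y"]) (use x y ind[of x] ind[of y] in auto)
 then show "EX g:GL n. g x = y" by auto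
qed

lemma transversal_bad:
 fixes A B :: "'a::{field,finite} vs"
 assumes A: "nsub A" "A <= nspace n" and B: "nsub B" "B <= nspace n"
  and t: "card A * card B = CARD('a) ^ n * t" "t >= 1" and n: "n >= 1"
 shows "card {g : GL n. card (A Int g ` B) ~= t} * t <= card (GL n :: ('a vec => _) set)"
proof -
 let ?q = "CARD('a)" and ?GL = "GL n :: ('a vec => _) set"
 let ?bad = "{g : ?GL. card (A Int g ` B) ~= t}"
 have fA: "finite A" and fB: "finite B" using finite_sub_nspace A B by auto
 have A0: "0 : A" and B0: "0 : B" using nv.subspace_0 A B by auto
 have low: "t + (if g : ?bad then t else 0) <= card (A Int g ` B)" if g: "g : ?GL" for g
 proof -
  have sB: "nsub (g ` B)" by (rule GL_image_subspace[OF g B(1)])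
  have nB: "g ` B <= nspace n" by (rule GL_image_subset[OF g B(2)])
  let ?S = "ssum A (g ` B)"
  have sS: "nsub ?S" "?S <= nspace n" using subspace_ssum[OF A(1) sB] ssum_least[OF subspace_nspace A(2) nB] by auto
  have "card ?S * card (A Int g ` B) = card A * card (g ` B)" by (rule card_ssum[OF A(1) sB fA]) (use fB in simp)
  then have e: "card ?S * card (A Int g ` B) = ?q ^ n * t" unfolding GL_card[OF g] t(1) .
  have cS: "card ?S = ?q ^ nv.dim ?S" by (rule card_subspace[OF sS])
  have dS: "nv.dim ?S <= n" by (rule dim_le_n[OF sS])
  have "?q ^ n = ?q ^ nv.dim ?S * ?q ^ (n - nv.dim ?S)" using dS by (simp add: power_add[symmetric])
  then have "?q ^ nv.dim ?S * card (A Int g ` B) = ?q ^ nv.dim ?S * (?q ^ (n - nv.dim ?S) * t)" using e unfolding cS by (simp only: mult.assoc)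
  then have i: "card (A Int g ` B) = ?q ^ (n - nv.dim ?S) * t" by simp
  show ?thesis
  proof (cases "nv.dim ?S = n")
  case True
  then show ?thesis using i by simp
  next
  case False
  then have "?q ^ 1 <= ?q ^ (n - nv.dim ?S)" using dS card_field_ge2[where 'a='a] by (intro power_increasing) auto
  then have "2 <= ?q ^ (n - nv.dim ?S)" using card_field_ge2[where 'a='a] by simp
  then have c2: "2 * t <= card (A Int g ` B)" unfolding i by (rule mult_le_mono1)
  show ?thesis
  proof (cases "g : ?bad")
  case True
  show ?thesis unfolding if_P[OF True] using c2 by linarith
  next
  case False
  show ?thesis unfolding if_not_P[OF False] using c2 by linarith
  qed
  qed
 qed
 \<comment> \<open>The average is exact: a nonzero vector of \<open>B\<close> is sent to each
   nonzero vector of \<open>nspace n\<close> equally often.\<close>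
 have cnt: "(SUM g:?GL. card (A Int g ` B)) * (?q ^ n - 1) = card ?GL * (?q ^ n - 1) + (card A - 1) * (card B - 1) * card ?GL"
 proof -
  have e1: "card (A Int g ` B) = 1 + card {x : A - {0}. x : g ` (B - {0})}" if g: "g : ?GL" for g
  proof -
  have g0: "g 0 = 0" using lin_map_scale[OF GL_lin[OF g], of 0 0] by simp
  have "A Int g ` B = insert 0 {x : A - {0}. x : g ` (B - {0})}"
  proof (rule set_eqI, rule iffI)
  fix x assume x: "x : A Int g ` B"
  then obtain b where b: "b : B" "x = g b" by blast
  show "x : insert 0 {x : A - {0}. x : g ` (B - {0})}"
  proof (cases "x = 0")
  case False
  then have "b ~= 0" using b g0 by auto
  then show ?thesis using x b False by blast
  qed simp
  next
  fix x assume "x : insert 0 {x : A - {0}. x : g ` (B - {0})}"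
  moreover have "0 : g ` B" using g0 B0 by (metis imageI)
  ultimately show "x : A Int g ` B" using A0 by auto
  qed
  then show ?thesis using fA by simp
  qed
  have e2: "card {x : A - {0}. x : g ` (B - {0})} = (SUM x:A - {0}. SUM b:B - {0}. if g b = x then 1 else 0)" if g: "g : ?GL" for g
  proof -
  have inj: "inj g" using bij_is_inj[OF GL_bij[OF g]] .
  have "(SUM b:B - {0}. if g b = x then 1 else (0::nat)) = (if x : g ` (B - {0}) then 1 else 0)" for x
  proof (cases "x : g ` (B - {0})")
  case True
  then obtain b where b: "b : B - {0}" "x = g b" by blast
  have "(SUM b':B - {0}. if g b' = x then 1 else (0::nat)) = (SUM b':B - {0}. if b' = b then 1 else 0)" using inj b(2) by (intro sum.cong refl) (simp add: inj_eq)
  also have "... = 1" using b(1) fB by simp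
  finally show ?thesis using True by simp
  next
  case False
  then have "(SUM b':B - {0}. if g b' = x then 1 else (0::nat)) = 0" by (intro sum.neutral) auto
  then show ?thesis using False by simp
  qed
  then have "(SUM x:A - {0}. SUM b:B - {0}. if g b = x then 1 else 0) = (SUM x:A - {0}. if x : g ` (B - {0}) then 1 else (0::nat))" by simp
  also have "... = (SUM x:{x : A - {0}. x : g ` (B - {0})}. 1)" by (rule sum.inter_filter[symmetric]) (use fA in simp)
  finally show ?thesis by simp
  qed
  have "(SUM g:?GL. card (A Int g ` B)) = (SUM g:?GL. 1 + (SUM x:A - {0}. SUM b:B - {0}. if g b = x then 1 else 0))" by (rule sum.cong[OF refl]) (simp only: e1 e2)
  also have "... = card ?GL + (SUM g:?GL. SUM x:A - {0}. SUM b:B - {0}. if g b = x then 1 else 0)" by (simp only: sum.distrib) simp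
  also have "(SUM g:?GL. SUM x:A - {0}. SUM b:B - {0}. if g b = x then 1 else (0::nat)) = (SUM x:A - {0}. SUM b:B - {0}. SUM g:?GL. if g b = x then 1 else 0)"
  by (subst sum.swap, rule sum.cong[OF refl], rule sum.swap)
  also have "... = (SUM x:A - {0}. SUM b:B - {0}. card {g : ?GL. g b = x})" by (intro sum.cong refl) (simp add: sum.inter_filter[symmetric] finite_GL)
  finally have s: "(SUM g:?GL. card (A Int g ` B)) = card ?GL + (SUM x:A - {0}. SUM b:B - {0}. card {g : ?GL. g b = x})" .
  have cn: "card (nspace n - {0 :: nat => 'a}) = ?q ^ n - 1" using nv.subspace_0[OF subspace_nspace[of n]] by (subst card_Diff_singleton) (auto simp: card_nspace)
  have "(SUM x:A - {0}. SUM b:B - {0}. card {g : ?GL. g b = x}) * (?q ^ n - 1) = (SUM x:A - {0}. SUM b:B - {0}. card {g : ?GL. g b = x} * (?q ^ n - 1))"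
  by (simp only: sum_distrib_right)
  also have "... = (SUM x:A - {0}. SUM b:B - {0}. card ?GL)"
  proof (intro sum.cong refl)
  fix x b assume "x : A - {0}" "b : B - {0}"
  then show "card {g : ?GL. g b = x} * (?q ^ n - 1) = card ?GL" using GL_vector_count[of b n x] A(2) B(2) unfolding cn by blast
  qed
  also have "... = (card A - 1) * (card B - 1) * card ?GL" using A0 B0 fA fB by (simp add: card_Diff_singleton mult.assoc)
  finally show ?thesis unfolding s add_mult_distrib by (simp only:)
 qed
 have Q2: "?q ^ n >= 2"
 proof -
  have "?q ^ 1 <= ?q ^ n" using card_field_ge2[where 'a='a] n by (intro power_increasing) auto
  then show ?thesis using card_field_ge2[where 'a='a] by simp
 qed
 have AQ: "card A <= ?q ^ n" "card B <= ?q ^ n" using card_mono[OF finite_nspace A(2)] card_mono[OF finite_nspace B(2)] by (simp_all add: card_nspace)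
 have A1: "card A >= 1" "card B >= 1" using A0 B0 fA fB by (auto simp: Suc_le_eq card_gt_0_iff)
 have key: "(card A - 1) * (card B - 1) <= t * (?q ^ n - 1)"
 proof -
  have k1: "(card A - 1) * (card B - 1) <= (card A * card B - card B) - (card A - 1)" by (simp add: diff_mult_distrib diff_mult_distrib2)
  have k2: "card B + (card A - 1) >= t"
  proof -
  have "?q ^ n * t <= ?q ^ n * card B" unfolding t(1)[symmetric] using AQ(1) by (rule mult_le_mono1)
  then have "t <= card B" using Q2 by simp
  then show ?thesis by simp
  qed
  have "(card A - 1) * (card B - 1) <= ?q ^ n * t - t" using k1 k2 unfolding t(1) by linarith
  also have "... = t * (?q ^ n - 1)" by (simp add: diff_mult_distrib2 mult.commute)
  finally show ?thesis .
 qed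
 have "(SUM g:?GL. card (A Int g ` B)) * (?q ^ n - 1) <= (card ?GL * (1 + t)) * (?q ^ n - 1)"
 proof -
  have "(card A - 1) * (card B - 1) * card ?GL <= t * (?q ^ n - 1) * card ?GL" by (rule mult_le_mono1[OF key])
  then have "card ?GL * (?q ^ n - 1) + (card A - 1) * (card B - 1) * card ?GL <= card ?GL * (?q ^ n - 1) + t * (?q ^ n - 1) * card ?GL" by (rule add_left_mono)
  also have "... = (card ?GL * (1 + t)) * (?q ^ n - 1)" by (simp only: distrib_left distrib_right mult_1_right mult_ac)
  finally show ?thesis unfolding cnt .
 qed
 then have up: "(SUM g:?GL. card (A Int g ` B)) <= card ?GL * (1 + t)" using Q2 by simp
 have "(SUM g:?GL. t + (if g : ?bad then t else 0)) <= (SUM g:?GL. card (A Int g ` B))" by (rule sum_mono) (rule low)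
 moreover have "(SUM g:?GL. t + (if g : ?bad then t else 0)) = card ?GL * t + card ?bad * t"
 proof -
  have "(SUM g:?GL. if g : ?bad then t else 0) = (SUM g:?bad. t)" by (rule sum.mono_neutral_cong_right) (auto simp: finite_GL)
  then show ?thesis by (simp add: sum.distrib)
 qed
 ultimately have "card ?GL * t + card ?bad * t <= card ?GL * (1 + t)" using up by linarith
 then show ?thesis by simp
qed

text \<open>The condition on \<open>g\<close> that lets the image of \<open>H'\<close> be adjoined
  to \<open>H\<close> without losing transversality (\<open>tfam_union\<close>).\<close>

definition trans_pair :: "nat => nat => nat => 'a::{field,finite} vs set => 'a vs set => ('a vec => 'a vec) => bool" where
 "trans_pair n k m0 H H' g \<longleftrightarrow> (ALL C C'. C <= H & C' <= H' & card C + card C' <= m0 -->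
  card ((nspace n Int \<Inter>C) Int g ` (nspace n Int \<Inter>C')) = CARD('a) ^ (n - k * (card C + card C')))"

lemma small_subsets_card:
 assumes "finite H"
 shows "finite {C. C <= H & card C <= m0}" "card {C. C <= H & card C <= m0} <= Suc m0 * Suc (card H) ^ m0"
proof -
 let ?L = "{xs. set xs <= H & length xs <= m0}"
 have fL: "finite ?L" by (rule finite_lists_length_le[OF assms])
 have sub: "{C. C <= H & card C <= m0} <= set ` ?L"
 proof
  fix C assume C: "C : {C. C <= H & card C <= m0}"
  then have "finite C" using assms finite_subset by blast
  then obtain xs where "set xs = C" "distinct xs" using finite_distinct_list by blast
  then show "C : set ` ?L" using C distinct_card[of xs] by (intro image_eqI[of _ _ xs]) auto
 qed
 show "finite {C. C <= H & card C <= m0}" using finite_subset[OF sub] fL by blast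
 have "card {C. C <= H & card C <= m0} <= card ?L" using card_mono[OF finite_imageI[OF fL] sub] card_image_le[OF fL, of set] by linarith
 also have "... = (SUM i<=m0. card H ^ i)" by (rule card_lists_length_le[OF assms])
 also have "... <= (SUM i<=m0. Suc (card H) ^ m0)"
 proof (rule sum_mono)
  fix i assume "i : {..m0}"
  then have "Suc (card H) ^ i <= Suc (card H) ^ m0" by (intro power_increasing) auto
  moreover have "card H ^ i <= Suc (card H) ^ i" by (rule power_mono) auto
  ultimately show "card H ^ i <= Suc (card H) ^ m0" by linarith
 qed
 also have "... = Suc m0 * Suc (card H) ^ m0" by simp
 finally show "card {C. C <= H & card C <= m0} <= Suc m0 * Suc (card H) ^ m0" .
qed

lemma tfam_card:
 fixes H :: "'a::{field,finite} vs set"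
 assumes "tfam n k m0 H" "C <= H" "card C <= m0" "k * m0 <= n"
 shows "card (nspace n Int \<Inter>C) = CARD('a) ^ (n - k * card C)"
proof -
 have fC: "finite C" using assms(2) tfam_finite[OF assms(1)] finite_subset by blast
 have le: "k * card C <= n" using mult_le_mono2[OF assms(3), of k] assms(4) by linarith
 have "card (nspace n Int \<Inter>C) * CARD('a) ^ (k * card C) = CARD('a) ^ (n - k * card C) * CARD('a) ^ (k * card C)"
  using tfamD(3)[OF assms(1,2) fC assms(3)] le by (simp add: power_add[symmetric])
 then show ?thesis using card_field_ge2[where 'a='a] by simp
qed

text \<open>A union bound over pairs of small subfamilies. By \<open>transversal_bad\<close> each
  pair excludes a fraction of at most q^(-(n - k m0)) of the group, while the number of pairs is
  polynomial in the sizes of the families.\<close>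

lemma trans_pair_bad:
 fixes H H' :: "'a::{field,finite} vs set"
 assumes H: "tfam n k m0 H" and H': "tfam n k m0 H'" and km: "k * m0 <= n" and n: "n >= 1"
 shows "card {g : GL n. \<not> trans_pair n k m0 H H' g} * CARD('a) ^ (n - k * m0)
  <= (Suc m0 * Suc (card H) ^ m0) * (Suc m0 * Suc (card H') ^ m0) * card (GL n :: ('a vec => _) set)"
proof -
 let ?GL = "GL n :: ('a vec => _) set"
 let ?I = "{C. C <= H & card C <= m0}" and ?I' = "{C. C <= H' & card C <= m0}"
 let ?P = "{(C, C') : ?I \<times> ?I'. card C + card C' <= m0}"
 define bd where "bd p = {g : ?GL. card ((nspace n Int \<Inter>(fst p)) Int g ` (nspace n Int \<Inter>(snd p))) ~= CARD('a) ^ (n - k * (card (fst p) + card (snd p)))}" for p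
 note sH = small_subsets_card[OF tfam_finite[OF H], of m0] and sH' = small_subsets_card[OF tfam_finite[OF H'], of m0]
 have finP: "finite ?P" by (rule finite_subset[of _ "?I \<times> ?I'"]) (use sH(1) sH'(1) in auto)
 have one: "card (bd p) * CARD('a) ^ (n - k * m0) <= card ?GL" if p: "p : ?P" for p
 proof -
  obtain C C' where C: "p = (C, C')" "C <= H" "C' <= H'" "card C <= m0" "card C' <= m0" "card C + card C' <= m0" using p by auto
  have le: "k * (card C + card C') <= n" using mult_le_mono2[OF C(6), of k] km by linarith
  have le1: "k * card C <= n" "k * card C' <= n" using le by (simp_all add: distrib_left)
  let ?t = "CARD('a) ^ (n - k * (card C + card C'))"
  have "card (bd p) * ?t <= card ?GL" unfolding bd_def C(1) fst_conv snd_conv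
  proof (rule transversal_bad[OF subspace_common[OF H C(2)] _ subspace_common[OF H' C(3)] _ _ _ n])
  have "(n - k * card C) + (n - k * card C') = n + (n - k * (card C + card C'))" using le by (simp add: distrib_left)
  then show "card (nspace n Int \<Inter>C) * card (nspace n Int \<Inter>C') = CARD('a) ^ n * ?t"
  unfolding tfam_card[OF H C(2,4) km] tfam_card[OF H' C(3,5) km] power_add[symmetric] by (simp only:)
  show "1 <= ?t" using card_field_ge2[where 'a='a] by simp
  qed auto
  moreover have "CARD('a) ^ (n - k * m0) <= ?t" using mult_le_mono2[OF C(6), of k] card_field_ge2[where 'a='a] by (intro power_increasing) (linarith, simp)
  ultimately show ?thesis using mult_le_mono2[of "CARD('a) ^ (n - k * m0)" ?t "card (bd p)"] by linarith
 qed
 have sub: "{g : ?GL. \<not> trans_pair n k m0 H H' g} <= (UN p:?P. bd p)"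
 proof
  fix g assume g: "g : {g : ?GL. \<not> trans_pair n k m0 H H' g}"
  then obtain C C' where C: "C <= H" "C' <= H'" "card C + card C' <= m0"
  "card ((nspace n Int \<Inter>C) Int g ` (nspace n Int \<Inter>C')) ~= CARD('a) ^ (n - k * (card C + card C'))" unfolding trans_pair_def by blast
  then have "(C, C') : ?P" "g : bd (C, C')" using g by (auto simp: bd_def)
  then show "g : (UN p:?P. bd p)" by blast
 qed
 have fb: "finite (bd p)" for p unfolding bd_def by (rule finite_subset[OF _ finite_GL]) blast
 have "card {g : ?GL. \<not> trans_pair n k m0 H H' g} <= card (UN p:?P. bd p)" by (rule card_mono[OF _ sub]) (use finP fb in blast)
 also have "... <= (SUM p:?P. card (bd p))" by (rule card_UN_le[OF finP])
 finally have "card {g : ?GL. \<not> trans_pair n k m0 H H' g} * CARD('a) ^ (n - k * m0) <= (SUM p:?P. card (bd p)) * CARD('a) ^ (n - k * m0)" by (rule mult_le_mono1)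
 also have "... = (SUM p:?P. card (bd p) * CARD('a) ^ (n - k * m0))" by (rule sum_distrib_right)
 also have "... <= (SUM p:?P. card ?GL)" by (rule sum_mono) (rule one)
 also have "... = card ?P * card ?GL" by simp
 also have "... <= (Suc m0 * Suc (card H) ^ m0) * (Suc m0 * Suc (card H') ^ m0) * card ?GL"
 proof (rule mult_le_mono1)
  have "card ?P <= card (?I \<times> ?I')" by (rule card_mono) (use sH(1) sH'(1) in auto)
  also have "... = card ?I * card ?I'" by (rule card_cartesian_product)
  also have "... <= (Suc m0 * Suc (card H) ^ m0) * (Suc m0 * Suc (card H') ^ m0)" by (rule mult_le_mono[OF sH(2) sH'(2)])
  finally show "card ?P <= (Suc m0 * Suc (card H) ^ m0) * (Suc m0 * Suc (card H') ^ m0)" .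
 qed
 finally show ?thesis .
qed

lemma tfam_union:
 fixes H H' :: "'a::{field,finite} vs set"
 assumes H: "tfam n k m0 H" and H': "tfam n k m0 H'" and km: "k * m0 <= n" "k >= 1" "m0 >= 2"
  and g: "g : GL n" "trans_pair n k m0 H H' g"
 shows "tfam n k m0 (H Un (`) g ` H')" "H Int (`) g ` H' = {}"
proof -
 let ?q = "CARD('a)"
 have tp: "card ((nspace n Int \<Inter>C) Int g ` (nspace n Int \<Inter>C')) = ?q ^ (n - k * (card C + card C'))"
  if "C <= H" "C' <= H'" "card C + card C' <= m0" for C C' using g(2) that unfolding trans_pair_def by blast
 \<comment> \<open>A common member would have codimension \<open>k\<close> on its own and
   \<open>2 * k\<close> when counted once in each family.\<close>
 show disj: "H Int (`) g ` H' = {}"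
 proof (rule ccontr)
  assume "H Int (`) g ` H' ~= {}"
  then obtain X' where X': "X' : H'" "g ` X' : H" by blast
  have "nspace n Int \<Inter>{g ` X'} = g ` X'" "nspace n Int \<Inter>{X'} = X'" using tfamD(2)[OF H X'(2)] tfamD(2)[OF H' X'(1)] by auto
  then have "card (g ` X') = ?q ^ (n - k * 2)" using tp[of "{g ` X'}" "{X'}"] X' km(3) by (simp add: mult_2_right)
  moreover have "card (g ` X') = ?q ^ (n - k * 1)" using tfam_card[OF H, of "{g ` X'}"] X'(2) km tfamD(2)[OF H X'(2)] by (simp add: Int_absorb1)
  ultimately have "n - k * 2 = n - k * 1" using power_card_inj[of "n - k * 2" "n - k * 1", where 'a='a] by simp
  moreover have "k * 2 <= n" using mult_le_mono2[OF km(3), of k] km(1) by linarith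
  ultimately show False using km(2) by simp
 qed
 show "tfam n k m0 (H Un (`) g ` H')" unfolding tfam_def
 proof (intro conjI ballI allI impI)
  fix X assume "X : H Un (`) g ` H'"
  then consider "X : H" | X' where "X' : H'" "X = g ` X'" by blast
  then have "nsub X & X <= nspace n"
  proof cases
  case 1 then show ?thesis using tfamD(1,2)[OF H] by blast
  next
  case 2 then show ?thesis using GL_image_subspace[OF g(1) tfamD(1)[OF H']] GL_image_subset[OF g(1) tfamD(2)[OF H']] by blast
  qed
  then show "nsub X" "X <= nspace n" by auto
 next
  fix C assume C: "C <= H Un (`) g ` H'" "finite C" "card C <= m0"
  define C1 where "C1 = C Int H"
  define C2 where "C2 = {X : H'. g ` X : C}"
  have inj: "inj_on ((`) g) C2" by (rule inj_onI) (simp only: GL_eq_iff[OF g(1)])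
  have C12: "C = C1 Un (`) g ` C2" using C(1) by (auto simp: C1_def C2_def)
  have fC2: "finite C2" using tfam_finite[OF H'] by (simp add: C2_def)
  have "C1 Int (`) g ` C2 = {}" using disj by (auto simp: C1_def C2_def)
  then have cC: "card C = card C1 + card C2" unfolding C12 using C(2) fC2 card_image[OF inj] by (subst card_Un_disjoint) (auto simp: C1_def)
  have im: "g ` (nspace n Int \<Inter>C2) = nspace n Int \<Inter>((`) g ` C2)"
  proof -
  have "inj g" using bij_is_inj[OF GL_bij[OF g(1)]] .
  have "g ` (nspace n Int \<Inter>C2) = g ` (\<Inter>(insert (nspace n) C2))" by simp
  also have "... = (INT X:insert (nspace n) C2. g ` X)" using image_INT[of g UNIV "insert (nspace n) C2" "%X. X" "nspace n"] \<open>inj g\<close> by simp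
  also have "... = nspace n Int \<Inter>((`) g ` C2)" using GL_nspace[OF g(1)] by simp
  finally show ?thesis .
  qed
  have "nspace n Int \<Inter>C = (nspace n Int \<Inter>C1) Int g ` (nspace n Int \<Inter>C2)" unfolding im by (subst C12) blast
  then have "card (nspace n Int \<Inter>C) = ?q ^ (n - k * card C)" using tp[of C1 C2] C(3) cC by (simp add: C1_def C2_def)
  moreover have "k * card C <= n" using mult_le_mono2[OF C(3), of k] km(1) by linarith
  ultimately show "card (nspace n Int \<Inter>C) * ?q ^ (k * card C) = ?q ^ n" by (simp add: power_add[symmetric])
 qed
qed

lemma GL_above_count:
 fixes Z :: "'a::{field,finite} vs"
 assumes Z: "Z : Gr n z" and d: "d <= n"
 shows "card {g : GL n. Z <= g ` nspace d} * card (Gr n z :: 'a vs set) = card (Gr d z :: 'a vs set) * card (GL n :: ('a vec => _) set)"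
proof -
 let ?GL = "GL n :: ('a vec => _) set"
 have dn: "Gr d z <= (Gr n z :: 'a vs set)"
 proof
  fix T :: "'a vs" assume "T : Gr d z"
  then show "T : Gr n z" using nspace_mono[OF d] unfolding Gr_iff by blast
 qed
 have st: "inv g ` Z : Gr d z" if "g : ?GL" "Z <= g ` nspace d" for g
 proof -
  have "inv g ` Z <= inv g ` (g ` nspace d)" using that(2) by (rule image_mono)
  then have "inv g ` Z <= nspace d" unfolding GL_inv_image(1)[OF that(1)] .
  moreover have "inv g ` Z : Gr n z" by (rule GL_Gr[OF GL_inv[OF that(1)] Z])
  ultimately show ?thesis by (simp add: Gr_iff)
 qed
 have "card {g : ?GL. Z <= g ` nspace d} = (SUM Z':Gr d z. card {g : {g : ?GL. Z <= g ` nspace d}. inv g ` Z = Z'})"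
 proof (rule card_fibers)
  show "finite {g : ?GL. Z <= g ` nspace d}" by (rule finite_subset[OF _ finite_GL]) blast
  show "finite (Gr d z :: 'a vs set)" by (rule finite_Gr)
 qed (use st in blast)
 also have "... = (SUM Z':Gr d z. card {g : ?GL. g ` Z' = Z})"
 proof (rule sum.cong[OF refl], rule arg_cong[where f = card])
  fix Z' assume Z': "Z' : (Gr d z :: 'a vs set)"
  have "inv g ` Z = Z' \<longleftrightarrow> g ` Z' = Z" if "g : ?GL" for g using GL_inv_image[OF that] by metis
  moreover have "Z <= g ` nspace d" if "g ` Z' = Z" for g using Z' that by (auto simp: Gr_iff)
  ultimately show "{g : {g : ?GL. Z <= g ` nspace d}. inv g ` Z = Z'} = {g : ?GL. g ` Z' = Z}" by blast
 qed
 finally have "card {g : ?GL. Z <= g ` nspace d} * card (Gr n z :: 'a vs set) = (SUM Z':Gr d z. card {g : ?GL. g ` Z' = Z} * card (Gr n z :: 'a vs set))"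
  by (simp only: sum_distrib_right)
 also have "... = (SUM Z':(Gr d z :: 'a vs set). card ?GL)" by (rule sum.cong[OF refl]) (use GL_Gr_count[OF _ Z] dn in blast)
 finally show ?thesis by simp
qed

definition transl :: "'a vs set => ('a vec => 'a vec) list => 'a vs set" where
 "transl H0 h = (UN g:set h. (`) g ` H0)"

lemma transl_snoc: "transl H0 (h @ [g]) = transl H0 h Un (`) g ` H0" by (auto simp: transl_def)

definition topts :: "nat => nat => nat => 'a::{field,finite} vs set => ('a vec => 'a vec) list => ('a vec => 'a vec) set" where
 "topts n k m0 H0 h = {g : GL n. trans_pair n k m0 (transl H0 h) H0 g}"

text \<open>Transversality makes each new translate disjoint from the previous ones, so members
  above \<open>Z\<close> may be counted translate by translate.\<close>

lemma transl_valid: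
 fixes H0 :: "'a::{field,finite} vs set"
 assumes H0: "tfam n k m0 H0" and km: "k * m0 <= n" "k >= 1" "m0 >= 2"
  and h: "!!i. i < length h ==> h ! i : topts n k m0 H0 (take i h)"
 shows "tfam n k m0 (transl H0 h) & card (transl H0 h) <= length h * card H0 &
  (ALL Z. card {X : transl H0 h. Z <= X} = (SUM g<-h. card {X : H0. Z <= g ` X}))" using h
proof (induction h rule: rev_induct)
 case Nil
 show ?case by (auto simp: transl_def tfam_def card_nspace)
next
 case (snoc g h)
 have "h ! i : topts n k m0 H0 (take i h)" if "i < length h" for i using snoc.prems[of i] that by (simp add: nth_append)
 then have IH: "tfam n k m0 (transl H0 h)" "card (transl H0 h) <= length h * card H0"
  "ALL Z. card {X : transl H0 h. Z <= X} = (SUM g<-h. card {X : H0. Z <= g ` X})" using snoc.IH by auto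
 have g: "g : GL n" "trans_pair n k m0 (transl H0 h) H0 g" using snoc.prems[of "length h"] by (auto simp: topts_def)
 note tu = tfam_union[OF IH(1) H0 km g]
 have f1: "finite (transl H0 h)" by (rule tfam_finite[OF IH(1)])
 have f0: "finite H0" by (rule tfam_finite[OF H0])
 have "card (transl H0 (h @ [g])) <= card (transl H0 h) + card ((`) g ` H0)" unfolding transl_snoc by (rule card_Un_le)
 also have "... <= length h * card H0 + card H0" using IH(2) card_image_le[OF f0, of "(`) g"] by linarith
 finally have c: "card (transl H0 (h @ [g])) <= length (h @ [g]) * card H0" by simp
 have "card {X : transl H0 (h @ [g]). Z <= X} = (SUM g<-h @ [g]. card {X : H0. Z <= g ` X})" for Z
 proof -
  have e: "{X : transl H0 (h @ [g]). Z <= X} = {X : transl H0 h. Z <= X} Un (`) g ` {X : H0. Z <= g ` X}" unfolding transl_snoc by blast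
  have d: "{X : transl H0 h. Z <= X} Int (`) g ` {X : H0. Z <= g ` X} = {}" using tu(2) by blast
  have inj: "inj_on ((`) g) {X : H0. Z <= g ` X}" by (rule inj_onI) (simp only: GL_eq_iff[OF g(1)])
  have "card {X : transl H0 (h @ [g]). Z <= X} = card {X : transl H0 h. Z <= X} + card ((`) g ` {X : H0. Z <= g ` X})"
  unfolding e by (rule card_Un_disjoint[OF _ _ d]) (use f1 f0 in auto)
  then show ?thesis using IH(3) card_image[OF inj] by simp
 qed
 then show ?case using tu(1) c unfolding transl_snoc by blast
qed

text \<open>By \<open>bad\<close> at most a fraction 1/(2N) of the group is forbidden, which fits
  into the loss exp (1/N) that \<open>avoiding_selection\<close> allows.\<close>

lemma topts_card:
 fixes H0 :: "'a::{field,finite} vs set"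
 assumes H0: "tfam n k m0 H0" and H: "tfam n k m0 (transl H0 h)" "card (transl H0 h) <= N * N0" and N0: "card H0 <= N0"
  and km: "k * m0 <= n" and n: "n >= 1" and N: "N >= 1"
  and bad: "2 * N * ((Suc m0 * Suc (N * N0) ^ m0) * (Suc m0 * Suc N0 ^ m0)) <= CARD('a) ^ (n - k * m0)"
 shows "real (card (GL n :: ('a vec => _) set)) <= exp (1 / real N) * card (topts n k m0 H0 h)"
proof -
 let ?GL = "GL n :: ('a vec => _) set"
 let ?B = "{g : ?GL. \<not> trans_pair n k m0 (transl H0 h) H0 g}"
 let ?K = "(Suc m0 * Suc (N * N0) ^ m0) * (Suc m0 * Suc N0 ^ m0)"
 have K0: "?K > 0" by simp
 have "card ?B * (2 * N * ?K) <= card ?B * CARD('a) ^ (n - k * m0)" by (rule mult_le_mono2[OF bad])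
 also have "... <= (Suc m0 * Suc (card (transl H0 h)) ^ m0) * (Suc m0 * Suc (card H0) ^ m0) * card ?GL" by (rule trans_pair_bad[OF H(1) H0 km n])
 also have "... <= ?K * card ?GL" by (intro mult_le_mono order_refl power_mono) (use H(2) N0 in auto)
 finally have "?K * (card ?B * (2 * N)) <= ?K * card ?GL" by (simp only: mult_ac)
 then have b: "card ?B * (2 * N) <= card ?GL" using K0 by (simp only: mult_le_cancel1)
 have "card (topts n k m0 H0 h) + card ?B = card ?GL"
 proof -
  have "card (topts n k m0 H0 h Un ?B) = card (topts n k m0 H0 h) + card ?B" by (rule card_Un_disjoint) (auto simp: topts_def finite_GL)
  moreover have "topts n k m0 H0 h Un ?B = ?GL" by (auto simp: topts_def)
  ultimately show ?thesis by simp
 qed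
 then have t: "real (card (topts n k m0 H0 h)) = real (card ?GL) - real (card ?B)" by linarith
 have Np: "real N >= 1" using N by simp
 have "real (card ?B * (2 * N)) <= real (card ?GL)" using b by (simp only: of_nat_le_iff)
 then have "real (card ?B) * (2 * real N) <= real (card ?GL)" by (simp only: of_nat_mult of_nat_numeral)
 then have br: "real (card ?B) <= real (card ?GL) * (1 / (2 * real N))" using Np by (simp add: pos_le_divide_eq)
 have low: "real (card ?GL) * (1 - 1 / (2 * real N)) <= real (card (topts n k m0 H0 h))" using br unfolding t by (simp add: right_diff_distrib)
 have e: "1 <= exp (1 / real N) * (1 - 1 / (2 * real N))"
 proof -
  let ?x = "1 / real N"
  have x: "0 <= ?x" "?x <= 1" using Np by simp_all
  have gen: "1 <= (1 + y) * (1 - y / 2)" if "0 <= y" "y <= 1" for y :: real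
  proof -
  have "y * y <= y * 1" using that by (intro mult_left_mono) auto
  then show ?thesis by (simp add: algebra_simps)
  qed
  have h: "?x / 2 = 1 / (2 * real N)" by simp
  have "1 <= (1 + ?x) * (1 - ?x / 2)" by (rule gen[OF x])
  also have "... <= exp ?x * (1 - ?x / 2)" using x by (intro mult_right_mono exp_ge_add_one_self) auto
  finally show ?thesis unfolding h .
 qed
 have "real (card ?GL) * 1 <= real (card ?GL) * (exp (1 / real N) * (1 - 1 / (2 * real N)))" by (rule mult_left_mono[OF e]) simp
 also have "... = exp (1 / real N) * (real (card ?GL) * (1 - 1 / (2 * real N)))" by (simp only: mult.left_commute)
 also have "... <= exp (1 / real N) * card (topts n k m0 H0 h)" by (rule mult_left_mono[OF low]) simp
 finally show ?thesis by simp
qed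

text \<open>\<open>avoiding_selection\<close>, where each new translate must be transversal to the
  union of the earlier ones. It serves twice: to build the basic family from a single subspace, and
  to take conjugates of that family in \<open>first_stage\<close>.\<close>

lemma translates:
 fixes H0 :: "'a::{field,finite} vs set" and f :: "'z => ('a vec => 'a vec) => real" and av :: "'z => real"
 assumes H0: "tfam n k m0 H0" "card H0 <= N0" and km: "k * m0 <= n" "k >= 1" "m0 >= 2" and n: "n >= 1" and N: "N >= 1"
  and bad: "2 * N * ((Suc m0 * Suc (N * N0) ^ m0) * (Suc m0 * Suc N0 ^ m0)) <= CARD('a) ^ (n - k * m0)"
  and Zs: "finite Zs" "Zs ~= {}"
  and f: "!!z x. z : Zs ==> x : GL n ==> 0 <= f z x & f z x <= 1"
  and av: "!!z. z : Zs ==> (SUM x:GL n. f z x) = card (GL n :: ('a vec => _) set) * av z"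
 shows "EX h. length h = N & set h <= GL n & tfam n k m0 (transl H0 h) & card (transl H0 h) <= N * N0 &
  (ALL Z. card {X : transl H0 h. Z <= X} = (SUM g<-h. card {X : H0. Z <= g ` X})) &
  (ALL z:Zs. (SUM x<-h. f z x) <= ln (2 * exp 1 * card Zs) + 2 * av z * N & av z * N / 2 - ln (2 * exp 1 * card Zs) <= (SUM x<-h. f z x))"
proof -
 have "EX h. length h = N & (ALL i<N. h ! i : topts n k m0 H0 (take i h)) &
  (ALL z:Zs. (SUM x<-h. f z x) <= ln (2 * exp 1 * card Zs) + 2 * av z * N & av z * N / 2 - ln (2 * exp 1 * card Zs) <= (SUM x<-h. f z x))"
 proof (rule avoiding_selection[of "GL n"])
  show "finite (GL n :: ('a vec => _) set)" by (rule finite_GL)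
  show "(GL n :: ('a vec => _) set) ~= {}" using GL_id by blast
  show "finite Zs" "Zs ~= {}" by (rule Zs)+
  show "N > 0" using N by simp
  show "0 <= f z x & f z x <= 1" if "z : Zs" "x : GL n" for z x by (rule f[OF that])
  show "(SUM x:GL n. f z x) = card (GL n :: ('a vec => _) set) * av z" if "z : Zs" for z by (rule av[OF that])
  fix h assume h: "length h < N" "!!i. i < length h ==> h ! i : topts n k m0 H0 (take i h)"
  note tv = transl_valid[OF H0(1) km h(2)]
  have "length h * card H0 <= N * N0" using h(1) H0(2) by (intro mult_le_mono) auto
  then have "card (transl H0 h) <= N * N0" using tv by linarith
  then show "topts n k m0 H0 h <= GL n & real (card (GL n :: ('a vec => _) set)) <= exp (1 / real N) * card (topts n k m0 H0 h)"
  using topts_card[OF H0(1) _ _ H0(2) km(1) n N bad, of h] tv by (auto simp: topts_def)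
 qed
 then obtain h where h: "length h = N" "ALL i<N. h ! i : topts n k m0 H0 (take i h)"
  "ALL z:Zs. (SUM x<-h. f z x) <= ln (2 * exp 1 * card Zs) + 2 * av z * N & av z * N / 2 - ln (2 * exp 1 * card Zs) <= (SUM x<-h. f z x)" by blast
 have "h ! i : topts n k m0 H0 (take i h)" if "i < length h" for i using h(1,2) that by simp
 note tv = transl_valid[OF H0(1) km this]
 have "N * card H0 <= N * N0" using H0(2) by simp
 then have "card (transl H0 h) <= N * N0" using tv unfolding h(1) by linarith
 moreover have "set h <= GL n" using h(1,2) by (auto simp: in_set_conv_nth topts_def)
 ultimately show ?thesis using h(1,3) tv by (intro exI[of _ h] conjI) blast+
qed

text \<open>The members are translates of one subspace of codimension \<open>k\<close>. A random
  translate contains \<open>Z\<close> with probability about \<open>card Z\<close> to the power -k,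
  where "about" means up to the factor \<open>kap CARD('a) s ^ s\<close>; \<open>L\<close> is the
  logarithmic error of the selection.\<close>

lemma family:
 fixes s w n k m0 N :: nat
 assumes km: "k * m0 <= n" "k >= 1" "m0 >= 2" and N: "N >= 1" and ws: "w <= s" and d: "2 * s < n - k"
  and bad: "2 * N * ((Suc m0 * Suc (N * 1) ^ m0) * (Suc m0 * Suc 1 ^ m0)) <= CARD('a::{field,finite}) ^ (n - k * m0)"
  and L: "ln (2 * exp 1 * (SUM z<=w. card (Gr n z :: 'a vs set))) <= L"
 shows "EX H :: 'a vs set. tfam n k m0 H & card H <= N &
  (ALL Z. nsub Z & Z <= nspace n & card Z < CARD('a) ^ Suc w -->
  real (card {X : H. Z <= X}) <= L + 2 * (kap CARD('a) s ^ s * real N / real (card Z ^ k)) &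
  real N / (2 * kap CARD('a) s ^ s * real (card Z ^ k)) - L <= real (card {X : H. Z <= X}))"
proof -
 let ?q = "real CARD('a)" and ?kp = "kap CARD('a) s"
 let ?GL = "GL n :: ('a vec => _) set"
 have q0: "?q > 0" by (rule real_card_pos)
 have kp1: "?kp >= 1" by (rule kap_ge1) (use card_field_ge2[where 'a='a] in simp)
 define B0 where "B0 = (nspace (n - k) :: 'a vs)"
 have kn: "k <= n" using d by simp
 have B0n: "B0 <= nspace n" unfolding B0_def by (rule nspace_mono) simp
 have H0: "tfam n k m0 {B0}" unfolding tfam_def
 proof (intro conjI ballI allI impI)
  show "nsub X" "X <= nspace n" if "X : {B0}" for X using that B0n subspace_nspace by (auto simp: B0_def)
  fix C assume "C <= {B0}" "finite C" "card C <= m0"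
  then consider "C = {}" | "C = {B0}" by blast
  then show "card (nspace n Int \<Inter>C) * CARD('a) ^ (k * card C) = CARD('a) ^ n"
  proof cases
  case 1 then show ?thesis by (simp add: card_nspace)
  next
  case 2
  have "nspace n Int B0 = B0" using B0n by blast
  then show ?thesis using 2 kn by (simp add: B0_def card_nspace power_add[symmetric])
  qed
 qed
 define Zs where "Zs = (UN z:{..w}. Gr n z :: 'a vs set)"
 have fZ: "finite Zs" unfolding Zs_def using finite_Gr by blast
 have "{0} : Zs" unfolding Zs_def using zero_Gr[of n, where 'a='a] by blast
 then have neZ: "Zs ~= {}" by blast
 have cZ: "real (card Zs) > 0" using fZ neZ by (simp add: card_gt_0_iff)
 have lnZ: "ln (2 * exp 1 * card Zs) <= L"
 proof -
  have "card Zs <= (SUM z<=w. card (Gr n z :: 'a vs set))" unfolding Zs_def by (rule card_UN_le) simp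
  then have "real (card Zs) <= real (SUM z<=w. card (Gr n z :: 'a vs set))" by (simp only: of_nat_le_iff)
  then have "2 * exp 1 * real (card Zs) <= 2 * exp 1 * real (SUM z<=w. card (Gr n z :: 'a vs set))" by (rule mult_left_mono) simp
  then have "ln (2 * exp 1 * card Zs) <= ln (2 * exp 1 * real (SUM z<=w. card (Gr n z :: 'a vs set)))" using cZ by (intro ln_mono) auto
  then show ?thesis using L by linarith
 qed
 define f where "f Z g = (if Z <= g ` B0 then 1 else (0::real))" for Z :: "'a vs" and g :: "'a vec => nat => 'a"
 define av where "av Z = real (card {g : ?GL. Z <= g ` B0}) / card ?GL" for Z
 have G0: "real (card ?GL) > 0" using GL_pos[of n, where 'a='a] by simp
 have sumf: "(SUM g:?GL. f Z g) = real (card {g : ?GL. Z <= g ` B0})" for Z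
 proof -
  have "(SUM g:?GL. f Z g) = (SUM g:{g : ?GL. Z <= g ` B0}. 1)" unfolding f_def by (rule sum.mono_neutral_cong_right) (auto simp: finite_GL)
  then show ?thesis by simp
 qed
 have "EX h. length h = N & set h <= GL n & tfam n k m0 (transl {B0} h) & card (transl {B0} h) <= N * 1 &
  (ALL Z. card {X : transl {B0} h. Z <= X} = (SUM g<-h. card {X : {B0}. Z <= g ` X})) &
  (ALL z:Zs. (SUM x<-h. f z x) <= ln (2 * exp 1 * card Zs) + 2 * av z * N & av z * N / 2 - ln (2 * exp 1 * card Zs) <= (SUM x<-h. f z x))"
 proof (rule translates[OF H0 _ km _ N bad fZ neZ])
  show "card {B0} <= 1" by simp
  show "n >= 1" using d by simp
  show "0 <= f z x & f z x <= 1" for z x by (simp add: f_def)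
  show "(SUM x:?GL. f z x) = card ?GL * av z" for z unfolding sumf av_def using G0 by simp
 qed
 then obtain h where h: "tfam n k m0 (transl {B0} h)" "card (transl {B0} h) <= N"
  "!!Z. card {X : transl {B0} h. Z <= X} = (SUM g<-h. card {X : {B0}. Z <= g ` X})"
  "!!Z. Z : Zs ==> (SUM x<-h. f Z x) <= ln (2 * exp 1 * card Zs) + 2 * av Z * N"
  "!!Z. Z : Zs ==> av Z * N / 2 - ln (2 * exp 1 * card Zs) <= (SUM x<-h. f Z x)" by auto
 have cnt: "real (card {X : transl {B0} h. Z <= X}) = (SUM x<-h. f Z x)" for Z
 proof -
  have key: "real (card {X : {B0}. Z <= g ` X}) = f Z g" for g
  proof -
  have "{X : {B0}. Z <= g ` X} = (if Z <= g ` B0 then {B0} else {})" by auto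
  then show ?thesis by (simp add: f_def)
  qed
  have "real (SUM g<-l. card {X : {B0}. Z <= g ` X}) = (SUM x<-l. f Z x)" for l by (induction l) (simp_all only: list.map sum_list.Cons sum_list.Nil of_nat_add of_nat_0 key)
  then show ?thesis unfolding h(3) .
 qed
 have avb: "av Z <= ?kp ^ s / real (card Z ^ k) & 1 / (?kp ^ s * real (card Z ^ k)) <= av Z" if Z: "Z : Gr n z" "z <= w" for Z z
 proof -
  have zs: "z <= s" using Z(2) ws by simp
  have dn: "2 * s < n" using d by simp
  let ?a = "real (card (Gr (n - k) z :: 'a vs set))" and ?b = "real (card (Gr n z :: 'a vs set))"
  have b0: "?b > 0" using Z(1) finite_Gr by (auto simp: card_gt_0_iff)
  have "real (card {g : ?GL. Z <= g ` B0}) * ?b = ?a * real (card ?GL)" using GL_above_count[OF Z(1), of "n - k"] unfolding B0_def by (metis (lifting) diff_le_self of_nat_mult)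
  then have ave: "av Z = ?a / ?b" unfolding av_def using b0 G0 by (simp add: frac_eq_eq)
  have cz: "real (card Z ^ k) = ?q ^ (k * z)" unfolding GrD(5)[OF Z(1)] by (simp add: power_mult[symmetric] mult.commute)
  have a_up: "?a <= ?q ^ ((n - k) * z)" using card_Gr_le[of "n - k" z, where 'a='a] by (simp only: of_nat_le_iff[where 'a=real, symmetric] of_nat_power)
  have b_up: "?b <= ?q ^ (n * z)" using card_Gr_le[of n z, where 'a='a] by (simp only: of_nat_le_iff[where 'a=real, symmetric] of_nat_power)
  have a_lo: "?q ^ ((n - k) * z) / ?kp ^ z <= ?a" using card_Gr_ge[OF zs d, where 'a='a] by (simp add: power_divide power_mult)
  have b_lo: "?q ^ (n * z) / ?kp ^ z <= ?b" using card_Gr_ge[OF zs dn, where 'a='a] by (simp add: power_divide power_mult)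
  have kz: "?kp ^ z <= ?kp ^ s" by (rule power_increasing[OF zs kp1])
  have kz0: "?kp ^ z > 0" using kp1 by simp
  have qs: "?q ^ (n * z) = ?q ^ ((n - k) * z) * ?q ^ (k * z)" using kn by (simp add: power_add[symmetric] add_mult_distrib[symmetric])
  have q1: "?q ^ ((n - k) * z) > 0" "?q ^ (k * z) > 0" using q0 by simp_all
  have "?a / ?b <= ?q ^ ((n - k) * z) / (?q ^ (n * z) / ?kp ^ z)" by (rule frac_le[OF _ a_up _ b_lo]) (use q1 qs kz0 in auto)
  also have "... = ?kp ^ z / ?q ^ (k * z)" unfolding qs using q1 kz0 by simp
  also have "... <= ?kp ^ s / ?q ^ (k * z)" by (rule divide_right_mono[OF kz]) (use q1 in simp)
  finally have u: "av Z <= ?kp ^ s / ?q ^ (k * z)" unfolding ave .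
  have "1 / (?kp ^ s * ?q ^ (k * z)) <= 1 / (?kp ^ z * ?q ^ (k * z))" by (rule frac_le) (use kz kz0 q1 in \<open>auto intro: mult_right_mono\<close>)
  also have "... = (?q ^ ((n - k) * z) / ?kp ^ z) / ?q ^ (n * z)" unfolding qs using q1 kz0 by simp
  also have "... <= ?a / ?b" by (rule frac_le[OF _ a_lo b0 b_up]) simp
  finally have l: "1 / (?kp ^ s * ?q ^ (k * z)) <= av Z" unfolding ave .
  show ?thesis using u l unfolding cz by blast
 qed
 have "real (card {X : transl {B0} h. Z <= X}) <= L + 2 * (?kp ^ s * real N / real (card Z ^ k)) &
  real N / (2 * ?kp ^ s * real (card Z ^ k)) - L <= real (card {X : transl {B0} h. Z <= X})"
  if Z: "nsub Z" "Z <= nspace n" "card Z < CARD('a) ^ Suc w" for Z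
 proof -
  let ?z = "nv.dim Z"
  have "card Z = CARD('a) ^ ?z" by (rule card_subspace[OF Z(1,2)])
  then have zw: "?z <= w" using Z(3) card_field_power_iff(1)[of ?z "Suc w", where 'a='a] by simp
  have ZG: "Z : Gr n ?z" by (rule subspace_inGr[OF Z(1,2)])
  then have ZZ: "Z : Zs" using zw by (auto simp: Zs_def)
  note ab = avb[OF ZG zw]
  have "av Z * real N <= ?kp ^ s / real (card Z ^ k) * real N" by (rule mult_right_mono) (use ab in auto)
  moreover have "?kp ^ s / real (card Z ^ k) * real N = ?kp ^ s * real N / real (card Z ^ k)" by simp
  moreover have "1 / (?kp ^ s * real (card Z ^ k)) * real N <= av Z * real N" by (rule mult_right_mono) (use ab in auto)
  moreover have "1 / (?kp ^ s * real (card Z ^ k)) * real N / 2 = real N / (2 * ?kp ^ s * real (card Z ^ k))" by simp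
  ultimately show ?thesis using h(4,5)[OF ZZ] lnZ unfolding cnt by auto
 qed
 then show ?thesis using h(1,2) by (intro exI[of _ "transl {B0} h"] conjI allI impI) auto
qed

section \<open>Assembling a preimage of small degree\<close>

lemma sum_GL_inv: "(SUM g:GL n. \<phi> (inv g)) = (SUM g:(GL n :: ('a::{field,finite} vec => _) set). \<phi> g)"
 by (rule sum.reindex_bij_witness[of _ inv inv]) (auto simp: GL_inv inv_inv_eq GL_bij)

lemma sum_list_le_const:
 fixes x :: "'b => nat"
 shows "(!!g. g : set h ==> x g <= c) ==> (SUM g<-h. x g) <= length h * c"
proof (induction h)
 case (Cons g h)
 have "x g <= c" "(SUM g<-h. x g) <= length h * c" using Cons by auto
 then show ?case by simp
qed simp

text \<open>The gadgets \<open>S\<close> are tied to \<open>H0\<close>, and one conjugate of them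
  can load a w-space with as much as \<open>m * cg\<close>, far above \<open>D\<close>. On average
  over the group the load is a constant times \<open>D\<close>. With \<open>M\<close> conjugates the
  mean load is of that order plus \<open>m * cg * Lg / M\<close>; \<open>select\<close> then assigns
  each \<open>R\<close> to one conjugate.\<close>

lemma first_stage:
 fixes H0 :: "'a::{field,finite} vs set" and S :: "'a vs => 'a vs" and m D cg Lg :: real
  and J :: "'a vs => int"
 assumes H0: "tfam n k m0 H0" "card H0 <= N0" and km: "k * m0 <= n" "k >= 1" "m0 >= 2" and n: "2 * s < n" and M: "M >= 1"
  and bad: "2 * M * ((Suc m0 * Suc (M * N0) ^ m0) * (Suc m0 * Suc N0 ^ m0)) <= CARD('a) ^ (n - k * m0)"
  and ws: "Suc w <= s"
  and S: "!!R. R : Gr n (Suc w) ==> S R : Gr n s" "!!R. R : Gr n (Suc w) ==> R <= S R"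
  "!!R R'. R : Gr n (Suc w) ==> R' : Gr n (Suc w) ==> R' <= S R ==> R' ~= R ==> inK H0 R'"
  and dg: "!!W. W : Gr n w ==> real (card {R : Gr n (Suc w). W <= S R}) <= cg" and cg: "cg > 0"
  and J: "J : ZGr n (Suc w)" "!!R. \<bar>rint (J R)\<bar> <= m" "m > 0"
  and D: "!!W. W : Gr n w ==> deg n (Suc w) J W <= D" "D >= 0"
  and Lg: "ln (2 * exp 1 * card (Gr n w :: 'a vs set)) <= Lg"
 shows "EX h Ph. length h = M & set h <= GL n & tfam n k m0 (transl H0 h) &
  (ALL Z. card {X : transl H0 h. Z <= X} = (SUM g<-h. card {X : H0. Z <= g ` X})) &
  Ph : ZGr n s & (ALL R. J R - boundary n s (Suc w) Ph R ~= 0 --> inK (transl H0 h) R) &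
  (ALL W:Gr n w. deg n s Ph W <= 2 * (m * cg * Lg / M + 2 * (csym CARD('a) s * 2 ^ (CARD('a) ^ s) * D)) + m * Lg)"
proof -
 let ?R = "Gr n (Suc w) :: 'a vs set" and ?W = "Gr n w :: 'a vs set"
 let ?GL = "GL n :: ('a vec => _) set"
 let ?b = "2 ^ (CARD('a) ^ s) :: real"
 define A where "A R = \<bar>rint (J R)\<bar>" for R
 have A0: "A R >= 0" "A R <= m" for R using J(2) by (auto simp: A_def)
 define F where "F R1 W1 = (if W1 <= S R1 then 1 else (0::real))" for R1 W1
 have F0: "F R1 W1 >= 0" "F R1 W1 <= 1" for R1 W1 by (auto simp: F_def)
 \<comment> \<open>The gadget system conjugated by \<open>g\<close>; it belongs to the image of
   \<open>H0\<close> under \<open>g\<close>.\<close>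
 define Sg where "Sg g R = g ` S (inv g ` R)" for g and R :: "'a vs"
 have Sg: "Sg g R : Gr n s" "R <= Sg g R" if g: "g : ?GL" and R: "R : ?R" for g R
 proof -
  have iR: "inv g ` R : ?R" by (rule GL_Gr[OF GL_inv[OF g] R])
  show "Sg g R : Gr n s" unfolding Sg_def by (rule GL_Gr[OF g S(1)[OF iR]])
  have "g ` (inv g ` R) <= g ` S (inv g ` R)" by (rule image_mono[OF S(2)[OF iR]])
  then show "R <= Sg g R" unfolding Sg_def GL_inv_image(2)[OF g] .
 qed
 have FS: "F (inv g ` R) (inv g ` W) = (if W <= Sg g R then 1 else 0)" if g: "g : ?GL" for g R W
 proof -
  have "inv g ` W <= S (inv g ` R) \<longleftrightarrow> g ` (inv g ` W) <= g ` S (inv g ` R)" by (rule GL_subset_iff[OF g, symmetric])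
  then show ?thesis unfolding F_def Sg_def GL_inv_image(2)[OF g] by simp
 qed
 define T where "T g W = (SUM R:?R. A R * F (inv g ` R) (inv g ` W))" for g :: "'a vec => nat => 'a" and W
 have T0: "T g W >= 0" for g W unfolding T_def by (intro sum_nonneg mult_nonneg_nonneg A0 F0)
 have Tup: "T g W <= m * cg" if g: "g : ?GL" and W: "W : ?W" for g W
 proof -
  have gi: "inv g : ?GL" by (rule GL_inv[OF g])
  have bij: "bij_betw ((`) (inv g)) ?R ?R" by (rule GL_bij_Gr[OF gi])
  have iW: "inv g ` W : ?W" by (rule GL_Gr[OF gi W])
  have "T g W <= (SUM R:?R. m * F (inv g ` R) (inv g ` W))" unfolding T_def by (intro sum_mono mult_right_mono A0 F0)
  also have "... = (SUM R:?R. m * F R (inv g ` W))" by (rule sum.reindex_bij_betw[OF bij])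
  also have "... = m * (SUM R:?R. F R (inv g ` W))" by (rule sum_distrib_left[symmetric])
  also have "(SUM R:?R. F R (inv g ` W)) = (SUM R:{R : ?R. inv g ` W <= S R}. 1)" unfolding F_def by (rule sum.inter_filter[symmetric, OF finite_Gr])
  also have "m * (SUM R:{R : ?R. inv g ` W <= S R}. 1) <= m * cg" using dg[OF iW] J(3) by (intro mult_left_mono) auto
  finally show ?thesis .
 qed
 define cs where "cs = csym CARD('a) s * ?b * D"
 have Tavg: "(SUM g:?GL. T g W) <= card ?GL * cs" if W: "W : ?W" for W
 proof -
  have "(SUM g:?GL. T g W) = (SUM g:?GL. SUM R:?R. A R * F (g ` R) (g ` W))" unfolding T_def by (rule sum_GL_inv[of "%g. SUM R:?R. A R * F (g ` R) (g ` W)"])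
  also have "... = (SUM R:?R. SUM g:?GL. A R * F (g ` R) (g ` W))" by (rule sum.swap)
  also have "... = (SUM R:?R. A R * (SUM g:?GL. F (g ` R) (g ` W)))" by (simp only: sum_distrib_left)
  also have "... <= card ?GL * (csym CARD('a) s * ?b * D)"
  proof (rule sum_GL_weighted[OF W ws n])
  show "F R1 W1 >= 0" for R1 W1 by (rule F0)
  show "A R >= 0" for R by (rule A0)
  show "D >= 0" "?b >= 0" by (rule D) simp
  show "(SUM W1:?W. F R1 W1) <= ?b" if R1: "R1 : ?R" for R1
  proof -
  have "(SUM W1:?W. F R1 W1) = (SUM W1:{W1 : ?W. W1 <= S R1}. 1)" unfolding F_def by (rule sum.inter_filter[symmetric, OF finite_Gr])
  also have "... = real (card {W1 : ?W. W1 <= S R1})" by simp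
  also have "... <= real (2 ^ (CARD('a) ^ s))" using card_subsets_le[OF S(1)[OF R1], of w "%_. True"] by (simp only: of_nat_le_iff simp_thms)
  finally show ?thesis by simp
  qed
  show "(SUM R:{R : ?R. W <= R}. A R) <= D" if "W : ?W" for W using D(1)[OF that] unfolding deg_def A_def .
  qed
  finally show ?thesis unfolding cs_def .
 qed
 have mcg: "m * cg > 0" using J(3) cg by simp
 have G0: "real (card ?GL) > 0" using GL_pos[of n, where 'a='a] by simp
 have wn: "w <= n" using ws n by simp
 have neW: "?W ~= {}" using nspace_Gr[OF wn, where 'a='a] by blast
 define av where "av W = (SUM g:?GL. T g W / (m * cg)) / card ?GL" for W
 have "EX h. length h = M & set h <= GL n & tfam n k m0 (transl H0 h) & card (transl H0 h) <= M * N0 &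
  (ALL Z. card {X : transl H0 h. Z <= X} = (SUM g<-h. card {X : H0. Z <= g ` X})) &
  (ALL W:?W. (SUM g<-h. T g W / (m * cg)) <= ln (2 * exp 1 * card ?W) + 2 * av W * M & av W * M / 2 - ln (2 * exp 1 * card ?W) <= (SUM g<-h. T g W / (m * cg)))"
 proof (rule translates[OF H0 km _ M bad finite_Gr neW])
  show "n >= 1" using n by simp
  show "0 <= T g W / (m * cg) & T g W / (m * cg) <= 1" if "W : ?W" "g : ?GL" for W g using T0[of g W] Tup[OF that(2,1)] mcg by simp
  show "(SUM g:?GL. T g W / (m * cg)) = card ?GL * av W" for W unfolding av_def using G0 by simp
 qed
 then obtain h where h: "length h = M" "set h <= ?GL" "tfam n k m0 (transl H0 h)"
  "ALL Z. card {X : transl H0 h. Z <= X} = (SUM g<-h. card {X : H0. Z <= g ` X})"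
  "!!W. W : ?W ==> (SUM g<-h. T g W / (m * cg)) <= ln (2 * exp 1 * card ?W) + 2 * av W * M" by blast
 have hG: "h ! a : ?GL" if "a < M" for a using h(1,2) that by auto
 have Tsum: "(SUM a<M. T (h ! a) W) <= m * cg * Lg + 2 * cs * M" if W: "W : ?W" for W
 proof -
  have e: "(SUM g<-h. T g W / (m * cg)) = (SUM a<M. T (h ! a) W) / (m * cg)" unfolding sum_list_sum_nth by (simp add: h(1) sum_divide_distrib atLeast0LessThan)
  have "av W * (m * cg) <= cs"
  proof -
  have "av W * (m * cg) = (SUM g:?GL. T g W) / card ?GL" unfolding av_def sum_divide_distrib[symmetric] using J(3) cg by simp
  also have "... <= cs" using Tavg[OF W] G0 by (simp add: pos_divide_le_eq mult.commute)
  finally show ?thesis .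
  qed
  then have b: "2 * M * (av W * (m * cg)) <= 2 * M * cs" by (rule mult_left_mono) simp
  have "(SUM a<M. T (h ! a) W) / (m * cg) <= Lg + 2 * av W * M" using h(5)[OF W] Lg unfolding e by linarith
  then have "(SUM a<M. T (h ! a) W) <= (Lg + 2 * av W * M) * (m * cg)" using mcg by (simp only: pos_divide_le_eq)
  also have "... = m * cg * Lg + 2 * M * (av W * (m * cg))" by (simp only: distrib_left distrib_right mult_ac of_nat_mult of_nat_numeral)
  also have "... <= m * cg * Lg + 2 * M * cs" by (rule add_left_mono[OF b])
  finally show ?thesis by (simp only: mult_ac)
 qed
 define wt where "wt R a W = A R * F (inv (h ! a) ` R) (inv (h ! a) ` W)" for R a W
 obtain pk where pk: "!!R. R : ?R ==> pk R : {..<M}"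
  "!!W. W : ?W ==> (SUM R:?R. wt R (pk R) W) <= 2 * (SUM R:?R. (SUM a:{..<M}. wt R a W) / card {..<M}) + m * ln (card ?W)"
 proof (rule select[of ?R ?W m "%_. {..<M}" wt])
  show "finite ?R" "finite ?W" by (rule finite_Gr)+
  show "m > 0" by (rule J)
  show "finite {..<M} & {..<M} ~= {}" using M by (simp add: lessThan_empty_iff)
  show "0 <= wt R a W & wt R a W <= m" for R a W
  unfolding wt_def using A0[of R] F0[of "inv (h ! a) ` R" "inv (h ! a) ` W"] mult_mono[of "A R" m "F (inv (h ! a) ` R) (inv (h ! a) ` W)" 1] J(3) by simp
  fix f assume "!!R. R : ?R ==> f R : {..<M}"
  "!!W. W : ?W ==> (SUM R:?R. wt R (f R) W) <= 2 * (SUM R:?R. (SUM a:{..<M}. wt R a W) / card {..<M}) + m * ln (card ?W)"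
  then show thesis by (rule that)
 qed
 define SS where "SS R = Sg (h ! pk R) R" for R
 have pG: "h ! pk R : ?GL" if "R : ?R" for R using hG pk(1)[OF that] by simp
 have SS: "SS R : Gr n s" "R <= SS R" if "R : ?R" for R unfolding SS_def using Sg[OF pG[OF that] that] by auto
 define Ph where "Ph = (%U. SUM R:?R. J R * unit_vec (SS R) U)"
 have PZ: "Ph : ZGr n s" unfolding Ph_def ZGr_def using SS(1) by (auto simp: unit_vec_def intro!: sum.neutral)
 have supp: "inK (transl H0 h) R0" if nz: "J R0 - boundary n s (Suc w) Ph R0 ~= 0" for R0
 proof -
  have R0: "R0 : ?R"
  proof (rule ccontr)
  assume "R0 ~: ?R"
  then have "J R0 = 0" "boundary n s (Suc w) Ph R0 = 0" using J(1) unfolding ZGr_def boundary_apply by auto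
  then show False using nz by simp
  qed
  have "boundary n s (Suc w) Ph R0 = (SUM R:?R. J R * boundary n s (Suc w) (unit_vec (SS R)) R0)" unfolding Ph_def boundary_lincomb ..
  also have "... = (SUM R:?R. if R0 <= SS R then J R else 0)" by (rule sum.cong[OF refl]) (simp add: boundary_unit[OF SS(1)] R0)
  finally have e: "boundary n s (Suc w) Ph R0 = (SUM R:?R. if R0 <= SS R then J R else 0)" .
  \<comment> \<open>The gadget of \<open>R0\<close> itself contributes exactly \<open>J R0\<close>,
    so a nonzero remainder stems from the gadget of another space, whose unmarked (w+1)-spaces all
    lie in members.\<close>
  have "EX R:?R. R ~= R0 & R0 <= SS R"
  proof (rule ccontr)
  assume no: "\<not> (EX R:?R. R ~= R0 & R0 <= SS R)"
  have "(SUM R:?R. if R0 <= SS R then J R else 0) = (SUM R:?R. if R = R0 then J R else 0)" by (rule sum.cong[OF refl]) (use no SS(2)[OF R0] in auto)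
  also have "... = J R0" using R0 finite_Gr by (subst sum.delta) auto
  finally show False using nz e by simp
  qed
  then obtain R where R: "R : ?R" "R ~= R0" "R0 <= SS R" by blast
  let ?g = "h ! pk R"
  have g: "?g : ?GL" by (rule pG[OF R(1)])
  have gi: "inv ?g : ?GL" by (rule GL_inv[OF g])
  have "inv ?g ` R0 <= inv ?g ` (?g ` S (inv ?g ` R))" using R(3) unfolding SS_def Sg_def by (rule image_mono)
  then have "inv ?g ` R0 <= S (inv ?g ` R)" unfolding GL_inv_image(1)[OF g] .
  moreover have "inv ?g ` R0 ~= inv ?g ` R" using R(2) by (simp add: GL_eq_iff[OF gi])
  ultimately have "inK H0 (inv ?g ` R0)" by (intro S(3)[OF GL_Gr[OF gi R(1)] GL_Gr[OF gi R0]])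
  then obtain X where X: "X : H0" "inv ?g ` R0 <= X" by (auto simp: inK_def)
  have "?g ` (inv ?g ` R0) <= ?g ` X" by (rule image_mono[OF X(2)])
  then have "R0 <= ?g ` X" unfolding GL_inv_image(2)[OF g] .
  moreover have "?g : set h" using pk(1)[OF R(1)] h(1) by simp
  ultimately show ?thesis using X(1) unfolding inK_def transl_def by blast
 qed
 have dP: "deg n s Ph W <= 2 * (m * cg * Lg / M + 2 * (csym CARD('a) s * ?b * D)) + m * Lg" if W: "W : ?W" for W
 proof -
  have Mr: "real M > 0" using M by simp
  have "deg n s Ph W <= (SUM R:?R. deg n s (%U. J R * unit_vec (SS R) U) W)" unfolding Ph_def by (rule deg_sum_le[OF finite_Gr])
  also have "... = (SUM R:?R. wt R (pk R) W)"
  proof (rule sum.cong[OF refl])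
  fix R assume R: "R : ?R"
  have "deg n s (%U. J R * unit_vec (SS R) U) W = (SUM U:{U : Gr n s. W <= U}. if U = SS R then A R else 0)"
  unfolding deg_def by (rule sum.cong[OF refl]) (auto simp: unit_vec_def A_def)
  also have "... = (if W <= SS R then A R else 0)" using SS(1)[OF R] by (subst sum.delta) (auto simp: finite_Gr)
  also have "... = wt R (pk R) W" unfolding wt_def FS[OF pG[OF R]] SS_def by simp
  finally show "deg n s (%U. J R * unit_vec (SS R) U) W = wt R (pk R) W" .
  qed
  also have "... <= 2 * (SUM R:?R. (SUM a:{..<M}. wt R a W) / card {..<M}) + m * ln (card ?W)" by (rule pk(2)[OF W])
  also have "(SUM R:?R. (SUM a:{..<M}. wt R a W) / card {..<M}) = (SUM a<M. T (h ! a) W) / M" unfolding sum_divide_distrib[symmetric] T_def wt_def by (subst sum.swap) simp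
  also have "2 * ((SUM a<M. T (h ! a) W) / M) + m * ln (card ?W) <= 2 * (m * cg * Lg / M + 2 * cs) + m * Lg"
  proof (rule add_mono)
  have "(SUM a<M. T (h ! a) W) / M <= (m * cg * Lg + 2 * cs * M) / M" by (rule divide_right_mono[OF Tsum[OF W]]) simp
  also have "... = m * cg * Lg / M + 2 * cs" using Mr by (simp add: add_divide_distrib)
  finally show "2 * ((SUM a<M. T (h ! a) W) / M) <= 2 * (m * cg * Lg / M + 2 * cs)" by simp
  have cW: "real (card ?W) > 0" using neW finite_Gr by (simp add: card_gt_0_iff)
  have "1 * real (card ?W) <= (2 * exp 1) * real (card ?W)" using exp_ge_add_one_self[of 1] by (intro mult_right_mono) auto
  then have "ln (real (card ?W)) <= ln (2 * exp 1 * real (card ?W))" using cW by (subst ln_le_cancel_iff) auto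
  then have "ln (real (card ?W)) <= Lg" using Lg by linarith
  then show "m * ln (card ?W) <= m * Lg" using J(3) by (intro mult_left_mono) auto
  qed
  finally show ?thesis unfolding cs_def .
 qed
 show ?thesis using h(1-4) PZ supp dP by (intro exI[of _ h] exI[of _ Ph] conjI allI ballI impI) auto
qed

text \<open>\<open>Ph1\<close> cancels the residues of \<open>J\<close> up to something supported on
  the family, \<open>Ph2\<close> makes the rest divisible by \<open>m\<close>, and
  \<open>Ph3\<close> decodes it. Exactness applies because what \<open>Ph1\<close> leaves is a
  boundary: \<open>J\<close> is one, and so is \<open>J - Jm\<close> by decoding. Degrees are
  controlled for \<open>Ph1\<close>, \<open>Ph2\<close>, \<open>Ph3\<close> only;
  \<open>Ps0\<close>, \<open>Ps2\<close> and \<open>Ps\<close> may be huge.\<close>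

lemma solve:
 fixes H0 B :: "'a::{field,finite} vs set" and S :: "'a vs => 'a vs" and m :: int and D cg Lg c0 cc :: real and b :: nat
  and J :: "'a vs => int"
 assumes H0: "tfam n k m0 H0" "card H0 <= N0" and km: "k * m0 <= n" "k >= 1" "m0 >= 2" and n: "2 * s < n" and M: "M >= 1"
  and bad: "2 * M * ((Suc m0 * Suc (M * N0) ^ m0) * (Suc m0 * Suc N0 ^ m0)) <= CARD('a) ^ (n - k * m0)"
  and ws: "Suc w <= s"
  and S: "!!R. R : Gr n (Suc w) ==> S R : Gr n s" "!!R. R : Gr n (Suc w) ==> R <= S R"
  "!!R R'. R : Gr n (Suc w) ==> R' : Gr n (Suc w) ==> R' <= S R ==> R' ~= R ==> inK H0 R'"
  and dg: "!!W. W : Gr n w ==> real (card {R : Gr n (Suc w). W <= S R}) <= cg" and cg: "cg > 0"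
  and Lg: "ln (2 * exp 1 * card (Gr n w :: 'a vs set)) <= Lg"
  and m: "m >= 1"
  and dec: "!!R :: 'a vs. R : Gr n (Suc w) ==> EX D : ZGr n s. boundary n s (Suc w) D = (%V. m * unit_vec R V) & (SUM S:Gr n s. \<bar>rint (D S)\<bar>) <= c0"
  and c0: "c0 > 0"
  and B: "mcover (n - k) s w m cc B" and cc: "cc >= 0"
  and bdef: "b = 2 ^ (CARD('a) ^ s)"
  and P: "!!Z :: 'a vs. nsub Z ==> Z <= nspace n ==> card Z < CARD('a) ^ Suc w ==> m1 <= card {X : H0. Z <= X}"
  and cH: "!!W. W : Gr n w ==> card {X : H0. W <= X} <= cH"
  and m1: "(2 ^ b * b) ^ s * (2 ^ (2 * b) * 2) <= m1" "1 + b * (2 ^ (2 * b) * 2) <= m1" "m1 <= m0"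
  and sz: "CARD('a) ^ (2 * s) * CARD('a) ^ (2 * b) * CARD('a) ^ (k * m0) < CARD('a) ^ n"
  and J: "J : boundary n s (Suc w) ` ZGr n s" and D: "!!W. W : Gr n w ==> deg n (Suc w) J W <= D" "D >= 0"
  and D1: "D1 = 2 * (rint m * cg * Lg / M + 2 * (csym CARD('a) s * 2 ^ (CARD('a) ^ s) * D)) + rint m * Lg" "D1 >= 0"
  and D2: "D2 = real (M * cH) * (rint m * cc)"
  and D3: "D3 = 2 * (csym CARD('a) s * (2 ^ (CARD('a) ^ s) * c0) * (D + real b * D1 + real b * D2)) + c0 * (real n * real s * ln (real CARD('a)))"
 shows "EX Ph:ZGr n s. boundary n s (Suc w) Ph = J & (ALL W:Gr n w. deg n s Ph W <= D1 + D2 + D3)"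
proof -
 let ?bd = "boundary n s (Suc w) :: ('a vs => int) => _"
 obtain Ps0 where P0: "Ps0 : ZGr n s" "J = ?bd Ps0" using J by blast
 have JZ: "J : ZGr n (Suc w)" unfolding P0(2) by (rule boundary_in_ZGr)
 \<comment> \<open>The residue takes the sign of \<open>J R\<close>. Its absolute value is then at
   most that of \<open>J R\<close> as well as at most \<open>m\<close>, and the degree of
   \<open>Jm\<close> does not exceed that of \<open>J\<close>.\<close>
 define Jm where "Jm R = sgn (J R) * (\<bar>J R\<bar> mod m)" for R
 have Jm_dvd: "m dvd (J R - Jm R)" for R
 proof -
  have "J R = sgn (J R) * \<bar>J R\<bar>" by (simp add: sgn_mult_abs)
  then have "J R - Jm R = sgn (J R) * (\<bar>J R\<bar> - \<bar>J R\<bar> mod m)" unfolding Jm_def by (simp add: right_diff_distrib)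
  then show ?thesis by (simp add: minus_mod_eq_mult_div)
 qed
 have mod0: "0 <= \<bar>J R\<bar> mod m" "\<bar>J R\<bar> mod m < m" "\<bar>J R\<bar> mod m <= \<bar>J R\<bar>" for R using m by (auto intro: zmod_le_nonneg_dividend)
 have Jm_abs: "\<bar>Jm R\<bar> <= \<bar>J R\<bar> mod m" for R unfolding Jm_def abs_mult using mod0(1)[of R] by (cases "J R = 0") auto
 have Jm_le: "\<bar>Jm R\<bar> <= \<bar>J R\<bar>" "\<bar>Jm R\<bar> <= m" for R using Jm_abs[of R] mod0[of R] by linarith+
 have JmZ: "Jm : ZGr n (Suc w)" using JZ by (simp add: ZGr_def Jm_def)
 have mpos: "rint m > 0" using m by simp
 have Dm: "deg n (Suc w) Jm W <= D" if W: "W : Gr n w" for W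
 proof -
  have "deg n (Suc w) Jm W <= deg n (Suc w) J W" unfolding deg_def
  proof (rule sum_mono)
  fix R show "\<bar>rint (Jm R)\<bar> <= \<bar>rint (J R)\<bar>" using Jm_le(1)[of R] by (simp only: of_int_abs[symmetric] of_int_le_iff)
  qed
  then show ?thesis using D(1)[OF W] by linarith
 qed
 have divide: "EX Ph:ZGr n s. ?bd Ph = K & (ALL W:Gr n w. deg n s Ph W <= 2 * (csym CARD('a) s * (2 ^ (CARD('a) ^ s) * c0) * E) + c0 * (real n * real s * ln (real CARD('a))))"
  if K: "K : ZGr n (Suc w)" "!!R. m dvd K R" and E: "!!W. W : Gr n w ==> deg n (Suc w) K W <= E" "E >= 0" for K E
 proof -
  define K' where "K' R = K R div m" for R
  have KK: "K R = m * K' R" for R using K(2)[of R] by (simp add: K'_def)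
  have K'Z: "K' : ZGr n (Suc w)" using K(1) by (simp add: ZGr_def K'_def)
  have K'E: "deg n (Suc w) K' W <= E" if W: "W : Gr n w" for W
  proof -
  have "deg n (Suc w) K' W <= deg n (Suc w) K W" unfolding deg_def
  proof (rule sum_mono)
  fix R
  have "\<bar>K' R\<bar> * 1 <= \<bar>K' R\<bar> * m" using m by (intro mult_left_mono) auto
  then have "\<bar>K' R\<bar> <= \<bar>K R\<bar>" unfolding KK abs_mult using m by (simp add: mult.commute)
  then show "\<bar>rint (K' R)\<bar> <= \<bar>rint (K R)\<bar>" by (simp only: of_int_abs[symmetric] of_int_le_iff)
  qed
  then show ?thesis using E(1)[OF W] by linarith
  qed
  obtain Ph where F: "Ph : ZGr n s" "?bd Ph = (%V. m * K' V)"
  "!!W. W : Gr n w ==> deg n s Ph W <= 2 * (csym CARD('a) s * (2 ^ (CARD('a) ^ s) * c0) * E) + c0 * (real n * real s * ln (real CARD('a)))"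
  using decode_bounded[OF dec c0 ws n K'Z K'E E(2)] by blast
  have "?bd Ph = K" unfolding F(2) by (rule ext) (simp only: KK)
  then show ?thesis using F(1,3) by blast
 qed
 have JJmZ: "(%R. J R - Jm R) : ZGr n (Suc w)" using JZ JmZ by (simp add: ZGr_def)
 \<comment> \<open>This preimage only has to show that \<open>Jm\<close> is a boundary, so the total
   mass is good enough as a degree bound.\<close>
 have "EX Ph:ZGr n s. ?bd Ph = (%R. J R - Jm R) & (ALL W:Gr n w. deg n s Ph W <= 2 * (csym CARD('a) s * (2 ^ (CARD('a) ^ s) * c0) * (SUM R:Gr n (Suc w). \<bar>rint (J R - Jm R)\<bar>)) + c0 * (real n * real s * ln (real CARD('a))))"
 proof (rule divide[OF JJmZ Jm_dvd])
  show "deg n (Suc w) (%R. J R - Jm R) W <= (SUM R:Gr n (Suc w). \<bar>rint (J R - Jm R)\<bar>)" for W :: "'a vs" unfolding deg_def by (rule sum_mono2) (auto simp: finite_Gr)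
 qed (simp add: sum_nonneg)
 then obtain Ps2 where P2: "Ps2 : ZGr n s" "?bd Ps2 = (%R. J R - Jm R)" by blast
 obtain h Ph1 where h: "length h = M" "set h <= GL n" "tfam n k m0 (transl H0 h)"
  "ALL Z. card {X : transl H0 h. Z <= X} = (SUM g<-h. card {X : H0. Z <= g ` X})"
  and F1: "Ph1 : ZGr n s" "ALL R. Jm R - ?bd Ph1 R ~= 0 --> inK (transl H0 h) R" "ALL W:Gr n w. deg n s Ph1 W <= D1"
 proof -
  have "EX h Ph. length h = M & set h <= GL n & tfam n k m0 (transl H0 h) &
  (ALL Z. card {X : transl H0 h. Z <= X} = (SUM g<-h. card {X : H0. Z <= g ` X})) &
  Ph : ZGr n s & (ALL R. Jm R - boundary n s (Suc w) Ph R ~= 0 --> inK (transl H0 h) R) &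
  (ALL W:Gr n w. deg n s Ph W <= 2 * (rint m * cg * Lg / M + 2 * (csym CARD('a) s * 2 ^ (CARD('a) ^ s) * D)) + rint m * Lg)"
  proof (rule first_stage[where S = S, OF H0 km n M bad ws _ _ _ _ cg JmZ _ mpos _ D(2) Lg])
  show "\<bar>rint (Jm R)\<bar> <= rint m" for R using Jm_le(2)[of R] by (simp only: of_int_abs[symmetric] of_int_le_iff)
  qed (rule S dg Dm; assumption)+
  then show thesis unfolding D1(1)[symmetric] by (elim exE conjE) (rule that)
 qed
 let ?H = "transl H0 h"
 have cnt: "card {X : ?H. Z <= X} = (SUM g<-h. card {X : H0. inv g ` Z <= X})" for Z
 proof -
  have "card {X : H0. Z <= g ` X} = card {X : H0. inv g ` Z <= X}" if g: "g : set h" for g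
  proof -
  have gG: "g : GL n" using g h(2) by blast
  have "Z <= g ` X \<longleftrightarrow> inv g ` Z <= X" for X using GL_subset_iff[OF gG, of "inv g ` Z" X] by (simp only: GL_inv_image(2)[OF gG])
  then show ?thesis by simp
  qed
  then have eq: "map (%g. card {X : H0. Z <= g ` X}) h = map (%g. card {X : H0. inv g ` Z <= X}) h" by (rule map_cong[OF refl])
  show ?thesis unfolding h(4)[rule_format, of Z] eq ..
 qed
 define Psx where "Psx = (%T. (Ps0 T - Ps2 T) - Ph1 T)"
 have PxZ: "Psx : ZGr n s" using P0(1) P2(1) F1(1) by (simp add: ZGr_def Psx_def)
 have Pxb: "?bd Psx = (%R. Jm R - ?bd Ph1 R)" unfolding Psx_def boundary_diff P2(2) P0(2)[symmetric] by simp
 have "EX Ps:ZGr n s. (ALL S. Ps S ~= 0 --> inK ?H S) & ?bd Ps = ?bd Psx"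
 proof (rule exactness[OF bdef h(3) ws _ m1 sz PxZ])
  show "inK ?H R" if "?bd Psx R ~= 0" for R using that F1(2) unfolding Pxb by blast
  fix Z :: "'a vs" assume Z: "nsub Z" "Z <= nspace n" "card Z < CARD('a) ^ Suc w"
  obtain g h' where gh: "h = g # h'" using h(1) M by (cases h) auto
  have gi: "inv g : GL n" using h(2) gh GL_inv by auto
  have "m1 <= card {X : H0. inv g ` Z <= X}" by (rule P[OF GL_image_subspace[OF gi Z(1)] GL_image_subset[OF gi Z(2)]]) (simp only: GL_card[OF gi] Z(3))
  then show "m1 <= card {X : ?H. Z <= X}" unfolding cnt[of Z] unfolding gh by simp
 qed
 then obtain Ps where Psi: "Ps : ZGr n s" "!!S. Ps S ~= 0 ==> inK ?H S" "?bd Ps = ?bd Psx" by blast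
 have "EX Ph:ZGr n s. (ALL R. m dvd (?bd Ps R - ?bd Ph R)) & (ALL W:Gr n w. deg n s Ph W <= real (card {X : ?H. W <= X}) * (rint m * cc))"
 proof (rule cover_family[OF B _ _ tfam_finite[OF h(3)] _ Psi(1,2)])
  show "n - k <= n" "0 <= m" using m by auto
  fix X assume X: "X : ?H"
  have "card (nspace n Int \<Inter>{X}) = CARD('a) ^ (n - k * card {X})" by (rule tfam_card[OF h(3) _ _ km(1)]) (use X km(3) in auto)
  moreover have "nspace n Int \<Inter>{X} = X" using tfamD(2)[OF h(3) X] by auto
  ultimately have "X : Gr n (n - k)" using tfamD(1,2)[OF h(3) X] by (simp add: Gr_iff)
  then obtain g where "g : GL n" "g ` nspace (n - k) = X" by (rule GL_move_nspace) simp
  then show "EX g:GL n. X = g ` nspace (n - k)" by blast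
 qed
 then obtain Ph2 where F2: "Ph2 : ZGr n s" "ALL R. m dvd (?bd Ps R - ?bd Ph2 R)"
  "ALL W:Gr n w. deg n s Ph2 W <= real (card {X : ?H. W <= X}) * (rint m * cc)" by blast
 have d2: "deg n s Ph2 W <= D2" if W: "W : Gr n w" for W
 proof -
  have "card {X : H0. inv g ` W <= X} <= cH" if "g : set h" for g using h(2) that by (intro cH GL_Gr[OF _ W] GL_inv) blast
  then have "card {X : ?H. W <= X} <= M * cH" unfolding cnt h(1)[symmetric] by (rule sum_list_le_const)
  then have "real (card {X : ?H. W <= X}) * (rint m * cc) <= real (M * cH) * (rint m * cc)" using mpos cc by (intro mult_right_mono) (simp_all only: of_nat_le_iff, simp)
  then show ?thesis using F2(3) W unfolding D2 by (meson order_trans)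
 qed
 have D20: "D2 >= 0" unfolding D2 using mpos cc by simp
 define K where "K R = J R - ?bd Ph1 R - ?bd Ph2 R" for R
 have KZ: "K : ZGr n (Suc w)" using JZ boundary_in_ZGr[of n s "Suc w" Ph1] boundary_in_ZGr[of n s "Suc w" Ph2] by (simp add: ZGr_def K_def)
 have Km: "m dvd K R" for R
 proof -
  \<comment> \<open>\<open>?bd Ps\<close> equals what \<open>Ph1\<close> leaves of
    \<open>Jm\<close>. Both summands are divisible by \<open>m\<close>, the first by the choice of
    residues and the second by the cover.\<close>
  have "K R = (J R - Jm R) + (?bd Ps R - ?bd Ph2 R)" unfolding K_def Psi(3) Pxb by simp
  then show ?thesis using dvd_add[OF Jm_dvd[of R] spec[OF F2(2), of R]] by simp
 qed
 have KD: "deg n (Suc w) K W <= D + real b * D1 + real b * D2" if W: "W : Gr n w" for W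
 proof -
  have br: "real b = 2 ^ (CARD('a) ^ s)" unfolding bdef by simp
  have "deg n (Suc w) K W <= deg n (Suc w) J W + deg n (Suc w) (?bd Ph1) W + deg n (Suc w) (?bd Ph2) W" unfolding deg_def sum.distrib[symmetric]
  proof (rule sum_mono)
  fix R
  have "\<bar>K R\<bar> <= \<bar>J R\<bar> + \<bar>?bd Ph1 R\<bar> + \<bar>?bd Ph2 R\<bar>" unfolding K_def by linarith
  then have "rint \<bar>K R\<bar> <= rint (\<bar>J R\<bar> + \<bar>?bd Ph1 R\<bar> + \<bar>?bd Ph2 R\<bar>)" by (simp only: of_int_le_iff)
  then show "\<bar>rint (K R)\<bar> <= \<bar>rint (J R)\<bar> + \<bar>rint (?bd Ph1 R)\<bar> + \<bar>rint (?bd Ph2 R)\<bar>" by simp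
  qed
  moreover have "deg n (Suc w) (?bd Ph1) W <= real b * D1"
  proof -
  have "deg n (Suc w) (?bd Ph1) W <= real b * deg n s Ph1 W" unfolding br by (rule deg_boundary_le)
  also have "... <= real b * D1" using F1(3) W by (intro mult_left_mono) auto
  finally show ?thesis .
  qed
  moreover have "deg n (Suc w) (?bd Ph2) W <= real b * D2"
  proof -
  have "deg n (Suc w) (?bd Ph2) W <= real b * deg n s Ph2 W" unfolding br by (rule deg_boundary_le)
  also have "... <= real b * D2" using d2[OF W] by (intro mult_left_mono) auto
  finally show ?thesis .
  qed
  ultimately show ?thesis using D(1)[OF W] by linarith
 qed
 have "D + real b * D1 + real b * D2 >= 0" using D(2) D1(2) D20 by simp
 then obtain Ph3 where F3: "Ph3 : ZGr n s" "?bd Ph3 = K" "ALL W:Gr n w. deg n s Ph3 W <= D3" using divide[OF KZ Km KD] unfolding D3[symmetric] by blast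
 define Ph where "Ph = (%T. (Ph1 T + Ph2 T) + Ph3 T)"
 have "Ph : ZGr n s" using F1(1) F2(1) F3(1) by (simp add: ZGr_def Ph_def)
 moreover have "?bd Ph = J" unfolding Ph_def boundary_add F3(2) K_def by simp
 moreover have "deg n s Ph W <= D1 + D2 + D3" if W: "W : Gr n w" for W
 proof -
  have "deg n s Ph W <= deg n s (%T. Ph1 T + Ph2 T) W + deg n s Ph3 W" unfolding Ph_def by (rule deg_add)
  moreover have "deg n s (%T. Ph1 T + Ph2 T) W <= deg n s Ph1 W + deg n s Ph2 W" by (rule deg_add)
  moreover have "deg n s Ph1 W <= D1" "deg n s Ph3 W <= D3" using F1(3) F3(3) W by blast+
  ultimately show ?thesis using d2[OF W] by linarith
 qed
 ultimately show ?thesis by blast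
qed

section \<open>Choice of constants\<close>

lemma bad_bound:
 fixes q m0 a e E :: nat
 assumes q: "q >= 2" and E: "1 + a + 4 * m0 + (a + 2 * e) * m0 <= E"
 shows "2 * q ^ a * ((Suc m0 * Suc (q ^ a * q ^ e) ^ m0) * (Suc m0 * Suc (q ^ e) ^ m0)) <= q ^ E"
proof -
 have S: "Suc (q ^ i) <= q ^ Suc i" for i
 proof -
  have "1 <= q ^ i" using q by simp
  then have "Suc (q ^ i) <= 2 * q ^ i" by simp
  also have "... <= q * q ^ i" by (rule mult_le_mono1[OF q])
  finally show ?thesis by simp
 qed
 have m: "Suc m0 <= q ^ m0"
 proof -
  have "Suc m0 <= 2 ^ m0" by (induction m0) simp_all
  also have "... <= q ^ m0" by (rule power_mono[OF q]) simp
  finally show ?thesis .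
 qed
 have A: "Suc (q ^ a * q ^ e) ^ m0 <= (q ^ Suc (a + e)) ^ m0" unfolding power_add[symmetric] by (rule power_mono[OF S]) simp
 have B: "Suc (q ^ e) ^ m0 <= (q ^ Suc e) ^ m0" by (rule power_mono[OF S]) simp
 have "2 * q ^ a * ((Suc m0 * Suc (q ^ a * q ^ e) ^ m0) * (Suc m0 * Suc (q ^ e) ^ m0))
  <= q * q ^ a * ((q ^ m0 * (q ^ Suc (a + e)) ^ m0) * (q ^ m0 * (q ^ Suc e) ^ m0))" by (intro mult_le_mono q m A B order_refl)
 also have "... = q ^ (1 + a + ((m0 + Suc (a + e) * m0) + (m0 + Suc e * m0)))" unfolding power_add power_mult power_one_right ..
 also have "1 + a + ((m0 + Suc (a + e) * m0) + (m0 + Suc e * m0)) = 1 + a + 4 * m0 + (a + 2 * e) * m0" by (simp add: algebra_simps)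
 also have "q ^ ... <= q ^ E" using q by (intro power_increasing[OF E]) simp
 finally show ?thesis .
qed

lemma eventually_poly_exp:
 fixes A B :: real
 shows "eventually (%u. A + B * real (Suc u) <= 2 ^ u) sequentially"
proof (rule eventually_sequentiallyI[of "nat \<lceil>2 * \<bar>A\<bar> + 2 * \<bar>B\<bar>\<rceil>"])
 have p: "real u * real (Suc u) + 2 <= 2 * 2 ^ u" for u
 proof (induction u)
  case (Suc u)
  have "real u <= real (u * u)" by (simp only: of_nat_le_iff le_square)
  then show ?case using Suc by (simp add: algebra_simps)
 qed simp
 fix u assume "nat \<lceil>2 * \<bar>A\<bar> + 2 * \<bar>B\<bar>\<rceil> <= u"
 then have "2 * \<bar>A\<bar> + 2 * \<bar>B\<bar> <= real u" by linarith
 then have "(2 * \<bar>A\<bar> + 2 * \<bar>B\<bar>) * real (Suc u) <= real u * real (Suc u)" by (rule mult_right_mono) simp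
 moreover have "2 * \<bar>A\<bar> * 1 <= 2 * \<bar>A\<bar> * real (Suc u)" by (rule mult_left_mono) auto
 moreover have "2 * B * real (Suc u) <= 2 * \<bar>B\<bar> * real (Suc u)" by (rule mult_right_mono) auto
 ultimately show "A + B * real (Suc u) <= 2 ^ u" using p[of u] by (simp only: distrib_right)
qed

lemma bounded_vec_mono:
 fixes J :: "'a::{field,finite} vs => int"
 assumes "bounded_vec n r tht J" "tht <= tht'"
 shows "bounded_vec n r tht' J"
proof -
 have "tht * real CARD('a) ^ n <= tht' * real CARD('a) ^ n" by (rule mult_right_mono[OF assms(2)]) simp
 then show ?thesis using assms(1) unfolding bounded_vec_def by linarith
qed

lemma constants_alg:
 fixes M G cs B t c0 K1 K2 x k c Q :: real
 shows "(2 * M * G + 8 * (cs * B) + M) * t = 2 * (M * (G * t) + 2 * (cs * B * (2 * t))) + M * t"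
  "(2 * (cs * (B * c0) * (2 + B * K1 + B * K2)) + c0) * t = 2 * (cs * (B * c0) * (2 * t + B * (K1 * t) + B * (K2 * t))) + c0 * t"
  "x * x * ((1 + 2 * k) * x ^ 4) * (M * (c * x * Q)) = (1 + 2 * k) * M * c * (x ^ 7 * Q)"
proof -
 have "x ^ 7 = x * x * x ^ 4 * x" by (simp add: eval_nat_numeral)
 then show "x * x * ((1 + 2 * k) * x ^ 4) * (M * (c * x * Q)) = (1 + 2 * k) * M * c * (x ^ 7 * Q)" by (simp only: mult_ac)
next
 have e: "cs * B * (2 * t) = 2 * (cs * B * t)" by (simp only: mult.left_commute)
 have l: "2 * p + 8 * q + r = 2 * (p + 2 * (2 * q)) + r" for p q r :: real by simp
 have X: "(2 * M * G + 8 * (cs * B) + M) * t = 2 * (M * (G * t)) + 8 * (cs * B * t) + M * t" by (simp only: distrib_right mult.assoc)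
 show "(2 * M * G + 8 * (cs * B) + M) * t = 2 * (M * (G * t) + 2 * (cs * B * (2 * t))) + M * t" unfolding e X by (rule l)
 have f: "2 * t + B * (K1 * t) + B * (K2 * t) = (2 + B * K1 + B * K2) * t" by (simp only: distrib_right mult.assoc)
 show "(2 * (cs * (B * c0) * (2 + B * K1 + B * K2)) + c0) * t = 2 * (cs * (B * c0) * (2 * t + B * (K1 * t) + B * (K2 * t))) + c0 * t"
  unfolding f by (simp only: distrib_right mult.assoc)
qed

text \<open>All contributions are compared with \<open>tht * Q ^ n\<close>, which by
  \<open>th\<close> is at least q^(n-u). Terms that do not scale with \<open>tht\<close> therefore
  only have to be of order q^(n-u).\<close>

lemma main_estimate:
 fixes s w n u m0 m1 b :: nat and m :: int and tht c0 cL ka G0 K1 K2 K3 :: real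
  and J :: "'a::{field,finite} vs => int"
 defines "q \<equiv> CARD('a)" and "Q \<equiv> real CARD('a)"
 assumes ws: "Suc w <= s" and bdef: "b = 2 ^ (q ^ s)"
  and m1: "m1 = (2 ^ b * b) ^ s * (2 ^ (2 * b) * 2) + (1 + b * (2 ^ (2 * b) * 2)) + 2 * b" and m0: "m0 = m1 + 2"
  and kdef: "ka = kap q s ^ s"
  and u: "u >= 1" "n >= (m0 * (16 * w + 30) + 2 * s + 2 * b + 20) * u"
  and ln1: "2 + real w + real n * real w * Q <= Q ^ u" and k4: "4 * ka <= Q ^ u" and m14: "real m1 * (4 * ka) <= Q ^ u"
  and nu: "real n <= Q ^ u" and ns: "real n * real s * Q <= Q ^ u"
  and m: "m >= 1" and c0: "c0 > 0"
  and dec: "!!R :: 'a vs. R : Gr n (Suc w) ==> EX D : ZGr n s. boundary n s (Suc w) D = (%V. m * unit_vec R V) & (SUM S:Gr n s. \<bar>rint (D S)\<bar>) <= c0"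
  and cL: "cL > 0" and mc: "!!d. 2 * s < d ==> EX B :: 'a vs set. mcover d s w m (cL * real d * Q ^ d) B"
  and G0: "G0 = 2 * (real b * real ((q ^ w) ^ w) * (8 * ka * (1 + 2 * ka)) ^ b * 2 ^ s) + 1"
  and K1: "K1 = 2 * rint m * G0 + 8 * (csym q s * real b) + rint m"
  and K2: "K2 = (1 + 2 * ka) * rint m * cL"
  and K3: "K3 = 2 * (csym q s * (real b * c0) * (2 + real b * K1 + real b * K2)) + c0"
  and th: "tht * Q ^ u >= 1" and J: "J : boundary n s (Suc w) ` ZGr n s" "bounded_vec n (Suc w) tht J"
 shows "EX Ph:ZGr n s. boundary n s (Suc w) Ph = J & (ALL W:Gr n w. deg n s Ph W <= (K1 + K2 + K3) * (tht * Q ^ n))"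
proof -
 \<comment> \<open>With x = q^u the covers cost x^2 for the conjugates, x^4 for the members through
   a w-space and x for the factor \<open>n - k\<close> from \<open>mod_cover\<close>. Codimension
   \<open>8 * u\<close> turns x^7 q^(n-k) into q^(n-u).\<close>
 define k where "k = 8 * u"
 \<comment> \<open>This is (q^w)^k x^4. The expected number of members through a space of dimension
   at most \<open>w\<close> is then at least of order x^4, well above the logarithmic error
   x.\<close>
 define N where "N = q ^ (u * (8 * w + 4))"
 \<comment> \<open>x^2 conjugates make \<open>m * cg * Lg / M\<close> of order q^n x / x^2 =
   q^(n-u).\<close>
 define M where "M = q ^ (2 * u)"
 have q2: "q >= 2" unfolding q_def by (rule card_field_ge2)
 have Qq: "Q = real q" by (simp add: Q_def q_def)
 have Q2: "Q >= 2" unfolding Qq using q2 by simp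
 have kap1: "ka >= 1" unfolding kdef by (rule one_le_power, rule kap_ge1) (use q2 in simp)
 define U where "U = u * m0"
 define XX where "XX = u * m0 * w"
 have m02: "m0 >= 2" by (simp add: m0)
 have uU: "u <= U" "m0 <= U" "1 <= U" "u * w <= XX" using u(1) m02 unfolding U_def XX_def by (auto simp: Suc_le_eq)
 \<comment> \<open>The exponents below are expressed through \<open>U\<close>, \<open>XX\<close>,
   \<open>u\<close>, \<open>s\<close> and \<open>b\<close>; with this single bound the remaining
   size conditions are linear.\<close>
 have nbig: "16 * XX + 30 * U + 2 * s + 2 * b + 20 <= n"
 proof -
  have a: "(m0 * (16 * w + 30) + 2 * s + 2 * b + 20) * u = 16 * XX + 30 * U + (2 * s + 2 * b + 20) * u" by (simp add: U_def XX_def algebra_simps)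
  have "(2 * s + 2 * b + 20) * 1 <= (2 * s + 2 * b + 20) * u" by (rule mult_le_mono2[OF u(1)])
  then have "16 * XX + 30 * U + (2 * s + 2 * b + 20) * 1 <= 16 * XX + 30 * U + (2 * s + 2 * b + 20) * u" by (rule add_left_mono)
  also have "... <= n" using u(2) unfolding a .
  finally show ?thesis by (simp only: mult_1_right add.assoc)
 qed
 have kU: "k * m0 = 8 * U" by (simp add: k_def U_def)
 have km: "k * m0 <= n" "k >= 1" using nbig u(1) unfolding kU by (auto simp: k_def)
 have kn: "2 * s < n - k" "k <= n" "2 * s < n" "s <= n" "u <= n" "u <= n - u" using nbig uU(1) unfolding k_def by linarith+
 have bad1: "2 * N * ((Suc m0 * Suc (N * 1) ^ m0) * (Suc m0 * Suc 1 ^ m0)) <= q ^ (n - k * m0)"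
 proof -
  have e: "(u * (8 * w + 4) + 2 * 0) * m0 = 8 * XX + 4 * U" "u * (8 * w + 4) = 8 * (u * w) + 4 * u" by (simp_all add: U_def XX_def algebra_simps)
  have "1 + u * (8 * w + 4) + 4 * m0 + (u * (8 * w + 4) + 2 * 0) * m0 <= n - k * m0" unfolding e(1) unfolding e(2) kU using nbig uU by linarith
  from bad_bound[OF q2 this] show ?thesis unfolding N_def by simp
 qed
 have bad2: "2 * M * ((Suc m0 * Suc (M * N) ^ m0) * (Suc m0 * Suc N ^ m0)) <= q ^ (n - k * m0)"
 proof -
  have e: "(2 * u + 2 * (u * (8 * w + 4))) * m0 = 16 * XX + 10 * U" by (simp add: U_def XX_def algebra_simps)
  have "1 + 2 * u + 4 * m0 + (2 * u + 2 * (u * (8 * w + 4))) * m0 <= n - k * m0" unfolding e kU using nbig uU by linarith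
  from bad_bound[OF q2 this] show ?thesis unfolding N_def M_def .
 qed
 have sz1: "q ^ (2 * s) * q ^ (2 * b) * q ^ (k * m0) < q ^ n" unfolding power_add[symmetric] kU using q2 nbig by (intro power_strict_increasing) auto
 have sz2: "2 * q ^ s * q ^ (k * m0) <= q ^ n"
 proof -
  have "2 * q ^ s * q ^ (k * m0) <= q * q ^ s * q ^ (k * m0)" by (intro mult_le_mono1 q2)
  also have "... = q ^ (1 + s + 8 * U)" unfolding kU power_add power_one_right ..
  also have "... <= q ^ n" using q2 nbig by (intro power_increasing) auto
  finally show ?thesis .
 qed
 define x where "x = Q ^ u"
 define y where "y = Q ^ (n - u)"
 have x1: "x >= 1" unfolding x_def using Q2 by (intro one_le_power) simp
 have y1: "y >= 1" unfolding y_def using Q2 by (intro one_le_power) simp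
 have xy: "x <= y" unfolding x_def y_def using Q2 kn(6) by (intro power_increasing) auto
 have Qn: "Q ^ n = x * y" unfolding x_def y_def using kn(5) by (simp add: power_add[symmetric])
 have lnq: "ln Q <= Q" "ln Q >= 0" using ln_le_minus_one[of Q] Q2 by auto
 have lnb: "ln (2 * exp 1 * z) <= x" if z: "0 < z" "z <= real (Suc w) * Q ^ (n * w)" for z
 proof -
  have p: "real (Suc w) * Q ^ (n * w) > 0" using Q2 by simp
  have "ln (2 * exp 1 * z) = ln 2 + 1 + ln z" using z(1) by (simp add: ln_mult)
  also have "... <= 1 + 1 + (real w + real n * real w * Q)"
  proof (intro add_mono order_refl)
  show "ln 2 <= (1::real)" using ln_le_minus_one[of 2] by simp
  have "ln z <= ln (real (Suc w) * Q ^ (n * w))" using z by (subst ln_le_cancel_iff) auto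
  also have "... = ln (real (Suc w)) + real (n * w) * ln Q" using Q2 by (simp add: ln_mult ln_realpow)
  also have "... <= real w + real n * real w * Q"
  proof (rule add_mono)
  show "ln (real (Suc w)) <= real w" using ln_le_minus_one[of "real (Suc w)"] by simp
  show "real (n * w) * ln Q <= real n * real w * Q" using lnq by (simp add: mult_left_mono)
  qed
  finally show "ln z <= real w + real n * real w * Q" .
  qed
  also have "... <= x" using ln1 unfolding x_def by linarith
  finally show ?thesis .
 qed
 have grb: "real (card (Gr n z :: 'a vs set)) <= Q ^ (n * w)" if "z <= w" for z
 proof -
  have "card (Gr n z :: 'a vs set) <= q ^ (n * z)" unfolding q_def by (rule card_Gr_le)
  also have "... <= q ^ (n * w)" using q2 that by (intro power_increasing) auto
  finally show ?thesis unfolding Qq by (metis of_nat_le_iff of_nat_power)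
 qed
 have zpos: "card (Gr n z :: 'a vs set) > 0" if "z <= n" for z using nspace_Gr[OF that, where 'a='a] finite_Gr by (auto simp: card_gt_0_iff)
 have wn: "w <= n" "w <= s" using ws kn by auto
 have lnsum: "ln (2 * exp 1 * (SUM z<=w. card (Gr n z :: 'a vs set))) <= x"
 proof (rule lnb)
  have "card (Gr n w :: 'a vs set) <= (SUM z<=w. card (Gr n z :: 'a vs set))" by (rule member_le_sum) auto
  then have "(SUM z<=w. card (Gr n z :: 'a vs set)) > 0" using zpos[OF wn(1)] by linarith
  then show "0 < real (SUM z<=w. card (Gr n z :: 'a vs set))" by (simp only: of_nat_0_less_iff)
  have "real (SUM z<=w. card (Gr n z :: 'a vs set)) = (SUM z<=w. real (card (Gr n z :: 'a vs set)))" by (rule of_nat_sum)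
  also have "... <= (SUM z<=w. Q ^ (n * w))" by (rule sum_mono) (rule grb, simp)
  also have "... = real (Suc w) * Q ^ (n * w)" by simp
  finally show "real (SUM z<=w. card (Gr n z :: 'a vs set)) <= real (Suc w) * Q ^ (n * w)" .
 qed
 have lnw: "ln (2 * exp 1 * card (Gr n w :: 'a vs set)) <= x"
 proof (rule lnb)
  show "0 < real (card (Gr n w :: 'a vs set))" using zpos[OF wn(1)] by simp
  have "real (card (Gr n w :: 'a vs set)) <= 1 * Q ^ (n * w)" using grb[OF order_refl] by simp
  also have "... <= real (Suc w) * Q ^ (n * w)" using Q2 by (intro mult_right_mono) auto
  finally show "real (card (Gr n w :: 'a vs set)) <= real (Suc w) * Q ^ (n * w)" .
 qed
 have N1: "N >= 1" and M1: "M >= 1" unfolding N_def M_def using q2 by simp_all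
 obtain H0 :: "'a vs set" where H0: "tfam n k m0 H0" "card H0 <= N"
  and cnt: "!!Z. nsub Z ==> Z <= nspace n ==> card Z < q ^ Suc w ==>
  real (card {X : H0. Z <= X}) <= x + 2 * (ka * real N / real (card Z ^ k)) &
  real N / (2 * ka * real (card Z ^ k)) - x <= real (card {X : H0. Z <= X})" using family[OF km m02 N1 wn(2) kn(1) bad1[unfolded q_def] lnsum] unfolding kdef q_def by blast
 define c1 where "c1 = real N / (4 * ka)"
 define C1 where "C1 = (1 + 2 * ka) * real N"
 have N0: "real N > 0" using N1 by simp
 have x3: "x * (4 * ka) <= x ^ 4" "real m1 * (4 * ka) <= x ^ 4"
 proof -
  have "x ^ 2 <= x ^ 4" "x ^ 1 <= x ^ 4" using x1 by (intro power_increasing; simp)+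
  moreover have "x * (4 * ka) <= x * x" using k4 x1 unfolding x_def by (intro mult_left_mono) auto
  ultimately show "x * (4 * ka) <= x ^ 4" "real m1 * (4 * ka) <= x ^ 4" using m14 unfolding x_def[symmetric] by (simp_all add: power2_eq_square)
 qed
 have x4: "real N = real ((q ^ w) ^ k) * x ^ 4"
 proof -
  have "u * (8 * w + 4) = w * k + u * 4" by (simp add: k_def algebra_simps)
  then show ?thesis unfolding N_def x_def Qq by (simp add: power_add power_mult)
 qed
 have rho: "real (card {X : H0. Z <= X}) <= (1 + 2 * ka) * (real N / real (card Z ^ k)) &
  real N / real (card Z ^ k) / (4 * ka) <= real (card {X : H0. Z <= X}) & x ^ 4 <= real N / real (card Z ^ k) & real (card Z ^ k) > 0"
  if Z: "nsub Z" "Z <= nspace n" "card Z < q ^ Suc w" for Z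
 proof -
  define rh where "rh = real N / real (card Z ^ k)"
  have cZ: "card Z = q ^ nv.dim Z" unfolding q_def by (rule card_subspace[OF Z(1,2)])
  then have dw: "nv.dim Z <= w" using Z(3) card_field_power_iff(1)[of "nv.dim Z" "Suc w", where 'a='a] unfolding q_def by simp
  have zp: "real (card Z ^ k) > 0" unfolding cZ using q2 by simp
  have "card Z ^ k <= (q ^ w) ^ k" unfolding cZ using q2 dw by (intro power_mono power_increasing) auto
  then have "real (card Z ^ k) <= real ((q ^ w) ^ k)" by (simp only: of_nat_le_iff)
  then have "x ^ 4 * real (card Z ^ k) <= x ^ 4 * real ((q ^ w) ^ k)" using x1 by (intro mult_left_mono) auto
  then have r4: "x ^ 4 <= rh" unfolding rh_def pos_le_divide_eq[OF zp] x4 by (simp only: mult.commute)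
  then have xr: "x * (4 * ka) <= rh" using x3(1) by linarith
  then have xr2: "x <= rh / (4 * ka)" using kap1 by (simp add: pos_le_divide_eq)
  have xr3: "x <= rh"
  proof -
  have "x * 1 <= x * (4 * ka)" using x1 kap1 by (intro mult_left_mono) auto
  then show ?thesis using xr by simp
  qed
  note c = cnt[OF Z]
  have "ka * real N / real (card Z ^ k) = ka * rh" by (simp add: rh_def)
  then have "real (card {X : H0. Z <= X}) <= rh + 2 * (ka * rh)" using c xr3 by linarith
  then have up: "real (card {X : H0. Z <= X}) <= (1 + 2 * ka) * rh" by (simp add: distrib_right)
  have "real N / (2 * ka * real (card Z ^ k)) = 2 * (rh / (4 * ka))" using kap1 zp by (simp add: rh_def)
  then have lo: "rh / (4 * ka) <= real (card {X : H0. Z <= X})" using c xr2 by linarith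
  show ?thesis using up lo r4 zp unfolding rh_def by blast
 qed
 have big: "m1 <= card {X : H0. Z <= X}" if Z: "nsub Z" "Z <= nspace n" "card Z < q ^ Suc w" for Z
 proof -
  have k40: "4 * ka > 0" using kap1 by simp
  have "real m1 * (4 * ka) <= real N / real (card Z ^ k)" using rho[OF Z] x3(2) by linarith
  then have "real m1 <= real N / real (card Z ^ k) / (4 * ka)" unfolding pos_le_divide_eq[OF k40] .
  then have "real m1 <= real (card {X : H0. Z <= X})" using rho[OF Z] by linarith
  then show ?thesis by (simp only: of_nat_le_iff)
 qed
 interpret gadget_setup n k m0 w s H0 c1 C1 b
 proof
  show "tfam n k m0 H0" by (rule H0)
  show "Suc w <= s" by (rule ws)
  show "b = 2 ^ (CARD('a) ^ s)" using bdef unfolding q_def .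
  show "b <= m0" unfolding m0 m1 by simp
  show "2 * CARD('a) ^ s * CARD('a) ^ (k * m0) <= CARD('a) ^ n" using sz2 unfolding q_def .
  show "s <= n" by (rule kn)
  show "c1 > 0" unfolding c1_def using N0 kap1 by simp
  fix Z :: "'a vs" assume "nsub Z" "Z <= nspace n" "card Z < CARD('a) ^ Suc w"
  then have Z: "nsub Z" "Z <= nspace n" "card Z < q ^ Suc w" unfolding q_def .
  let ?c = "real (card {X : H0. Z <= X})" and ?z = "real (card Z ^ k)"
  note r = rho[OF Z]
  have zp: "?z > 0" using r by blast
  have g1: "a / z / c * z = a / c" and g2: "c * (a / z) * z = c * a" if "z > 0" for a c z :: real using that by simp_all
  have "real N / ?z / (4 * ka) * ?z <= ?c * ?z" by (rule mult_right_mono) (use r in auto)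
  moreover have "real N / ?z / (4 * ka) * ?z = c1" unfolding c1_def by (rule g1[OF zp])
  moreover have "?c * ?z <= (1 + 2 * ka) * (real N / ?z) * ?z" by (rule mult_right_mono) (use r in auto)
  moreover have "(1 + 2 * ka) * (real N / ?z) * ?z = C1" unfolding C1_def by (rule g2[OF zp])
  moreover have "2 * b <= card {X : H0. Z <= X}" using big[OF Z] unfolding m1 by linarith
  ultimately show "c1 <= real (card {X : H0. Z <= X} * card Z ^ k) & real (card {X : H0. Z <= X} * card Z ^ k) <= C1 & 2 * b <= card {X : H0. Z <= X}"
  unfolding of_nat_mult by linarith
 qed
 have nsl: "real n * real s * ln Q <= x"
 proof -
  have "real n * real s * ln Q <= real n * real s * Q" using lnq by (intro mult_left_mono) auto
  then show ?thesis using ns unfolding x_def by linarith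
 qed
 have xQ: "x <= Q ^ n" unfolding Qn using mult_left_mono[OF y1, of x] x1 by simp
 define cg where "cg = G0 * Q ^ n"
 have G01: "G0 >= 1" unfolding G0 using kap1 by simp
 have cg0: "cg > 0" unfolding cg_def using G01 Q2 by simp
 obtain S where S: "!!R. R : Gr n (Suc w) ==> S R : Gr n s & R <= S R & (ALL R':Gr n (Suc w). R' <= S R --> R' ~= R --> inK H0 R')"
  and dgS: "!!W. W : Gr n w ==> real (card {R : Gr n (Suc w). W <= S R}) <= cg"
 proof -
  have "real n * real s * ln (real CARD('a)) <= real CARD('a) ^ n" using nsl xQ unfolding Q_def by linarith
  from gadget[OF this] obtain S where S: "ALL R:Gr n (Suc w). S R : Gr n s & R <= S R & (ALL R':Gr n (Suc w). R' <= S R --> R' ~= R --> inK H0 R')"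
  and d: "ALL W:Gr n w. real (card {R : Gr n (Suc w). W <= S R})
  <= (2 * (real b * real ((CARD('a) ^ w) ^ w) * (2 * C1 / c1) ^ card QI * 2 ^ (s - Suc w)) + 1) * real CARD('a) ^ n" by blast
  have rat: "2 * C1 / c1 = 8 * ka * (1 + 2 * ka)" unfolding C1_def c1_def using N0 kap1 by simp
  have r1: "8 * ka * (1 + 2 * ka) >= 1" using mult_mono[of 1 "8 * ka" 1 "1 + 2 * ka"] kap1 by simp
  have "2 * (real b * real ((CARD('a) ^ w) ^ w) * (2 * C1 / c1) ^ card QI * 2 ^ (s - Suc w)) + 1 <= G0" unfolding rat G0 q_def[symmetric]
  by (intro add_mono order_refl mult_left_mono mult_mono power_increasing card_QI(1) r1) (use r1 in auto)
  then have "(2 * (real b * real ((CARD('a) ^ w) ^ w) * (2 * C1 / c1) ^ card QI * 2 ^ (s - Suc w)) + 1) * real CARD('a) ^ n <= cg"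
  unfolding cg_def Q_def by (rule mult_right_mono) simp
  then show thesis using S d by (intro that[of S]) (blast, meson order_trans)
 qed
 have d: "2 * s < n - k" by (rule kn)
 obtain B :: "'a vs set" where B: "mcover (n - k) s w m (cL * real (n - k) * Q ^ (n - k)) B" using mc[OF d] by blast
 define cc where "cc = cL * real (n - k) * Q ^ (n - k)"
 have cc0: "cc >= 0" unfolding cc_def using cL Q2 by simp
 define cH where "cH = nat \<lfloor>(1 + 2 * ka) * x ^ 4\<rfloor>"
 have kx: "(1 + 2 * ka) * x ^ 4 >= 0" using kap1 x1 by simp
 have cH: "card {X : H0. W <= X} <= cH" if W: "W : Gr n w" for W
 proof -
  have cW: "card W = q ^ w" using GrD(5)[OF W] unfolding q_def .
  have "card W < q ^ Suc w" unfolding cW using q2 by (intro power_strict_increasing) auto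
  note r = rho[OF GrD(1,2)[OF W] this]
  have "real N / real (card W ^ k) = x ^ 4" unfolding x4 cW using q2 by simp
  then have "real (card {X : H0. W <= X}) <= (1 + 2 * ka) * x ^ 4" using r by simp
  then have "int (card {X : H0. W <= X}) <= \<lfloor>(1 + 2 * ka) * x ^ 4\<rfloor>" by (simp add: le_floor_iff)
  then show ?thesis unfolding cH_def by linarith
 qed
 have cHr: "real cH <= (1 + 2 * ka) * x ^ 4" unfolding cH_def using kx by simp
 define D where "D = 2 * (tht * Q ^ n)"
 define t where "t = tht * Q ^ n"
 have ty: "y <= t"
 proof -
  have "1 * y <= tht * x * y" using th y1 unfolding x_def by (intro mult_right_mono) auto
  then show ?thesis unfolding t_def Qn by (simp only: mult_1_left mult.assoc)
 qed
 have t0: "t >= 1" using ty y1 by linarith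
 have DD: "deg n (Suc w) J W <= D" if W: "W : Gr n w" for W using bounded_vec_deg[OF J(2), of W] W unfolding D_def Q_def by simp
 have D0: "D >= 0" "D = 2 * t" using t0 unfolding D_def t_def by auto
 have mr: "rint m >= 1" using m by simp
 have cs0: "csym q s >= 0" unfolding csym_def using kap_ge1[of q s] q2 by simp
 define D1 where "D1 = 2 * (rint m * cg * x / M + 2 * (csym CARD('a) s * 2 ^ (CARD('a) ^ s) * D)) + rint m * x"
 define D2 where "D2 = real (M * cH) * (rint m * cc)"
 define D3 where "D3 = 2 * (csym CARD('a) s * (2 ^ (CARD('a) ^ s) * c0) * (D + real b * D1 + real b * D2)) + c0 * (real n * real s * ln (real CARD('a)))"
 have br: "(2::real) ^ (CARD('a) ^ s) = real b" using bdef unfolding q_def by simp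
 have Mr: "real M = x * x" unfolding M_def x_def Qq by (simp add: power_add[symmetric] mult_2)
 have cgx: "cg * x / M = G0 * y" unfolding cg_def Qn Mr using x1 by simp
 have cgm: "rint m * cg * x / M = rint m * (G0 * y)" unfolding cgx[symmetric] by (simp only: times_divide_eq_right mult.assoc)
 have le1: "2 * (a + z) + c <= 2 * (a' + z) + c'" if "a <= a'" "c <= c'" for a z c a' c' :: real using that by simp
 have le2: "2 * a + c <= 2 * a' + c'" if "a <= a'" "c <= c'" for a c a' c' :: real using that by simp
 have D1e: "D1 = 2 * (rint m * (G0 * y) + 2 * (csym q s * real b * (2 * t))) + rint m * x" unfolding D1_def unfolding br unfolding D0(2) cgm unfolding q_def[symmetric] ..
 have D10: "D1 >= 0" unfolding D1e using mr G01 y1 t0 x1 cs0 by (intro add_nonneg_nonneg mult_nonneg_nonneg) auto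
 have D1t: "D1 <= K1 * t"
 proof -
  have a: "rint m * (G0 * y) <= rint m * (G0 * t)" using mr G01 ty by (intro mult_left_mono) auto
  have c: "rint m * x <= rint m * t" using mr xy ty by (intro mult_left_mono) auto
  have e: "K1 * t = 2 * (rint m * (G0 * t) + 2 * (csym q s * real b * (2 * t))) + rint m * t" unfolding K1 by (rule constants_alg(1))
  show ?thesis unfolding D1e e by (rule le1[OF a c])
 qed
 have D20: "D2 >= 0" unfolding D2_def using mr cc0 by simp
 have D2t: "D2 <= K2 * t"
 proof -
  have Qd: "x ^ 7 * Q ^ (n - k) = y"
  proof -
  have "n - u = u * 7 + (n - k)" using kn(2) unfolding k_def by simp
  then show ?thesis unfolding x_def y_def by (simp add: power_add power_mult)
  qed
  have "real (M * cH) <= x * x * ((1 + 2 * ka) * x ^ 4)" unfolding of_nat_mult Mr using cHr x1 by (intro mult_left_mono) auto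
  then have "D2 <= x * x * ((1 + 2 * ka) * x ^ 4) * (rint m * cc)" unfolding D2_def using mr cc0 by (intro mult_right_mono) auto
  also have "... <= x * x * ((1 + 2 * ka) * x ^ 4) * (rint m * (cL * x * Q ^ (n - k)))"
  proof -
  have "real (n - k) <= x" using nu unfolding x_def by linarith
  then have "cc <= cL * x * Q ^ (n - k)" unfolding cc_def using cL Q2 by (intro mult_right_mono mult_left_mono) auto
  then show ?thesis using mr x1 kap1 by (intro mult_left_mono) auto
  qed
  also have "... = K2 * (x ^ 7 * Q ^ (n - k))" unfolding K2 by (rule constants_alg(3))
  also have "... <= K2 * t" unfolding Qd K2 using ty mr cL kap1 by (intro mult_left_mono) auto
  finally show ?thesis .
 qed
 have D3t: "D3 <= K3 * t"
 proof -
  have "D + real b * D1 + real b * D2 <= 2 * t + real b * (K1 * t) + real b * (K2 * t)" unfolding D0(2) by (intro add_mono mult_left_mono D1t D2t) auto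
  then have a: "csym q s * (real b * c0) * (D + real b * D1 + real b * D2) <= csym q s * (real b * c0) * (2 * t + real b * (K1 * t) + real b * (K2 * t))"
  using cs0 c0 by (intro mult_left_mono) auto
  have "real n * real s * ln Q <= t" using nsl xy ty by linarith
  then have c: "c0 * (real n * real s * ln Q) <= c0 * t" using c0 by (intro mult_left_mono) auto
  have D3e: "D3 = 2 * (csym q s * (real b * c0) * (D + real b * D1 + real b * D2)) + c0 * (real n * real s * ln Q)" unfolding D3_def unfolding br unfolding q_def[symmetric] Qq ..
  have e: "K3 * t = 2 * (csym q s * (real b * c0) * (2 * t + real b * (K1 * t) + real b * (K2 * t))) + c0 * t" unfolding K3 by (rule constants_alg(2))
  show ?thesis unfolding D3e e by (rule le2[OF a c])
 qed
 have "EX Ph:ZGr n s. boundary n s (Suc w) Ph = J & (ALL W:Gr n w. deg n s Ph W <= D1 + D2 + D3)"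
 proof (rule solve[where S = S and cg = cg and Lg = x and cH = cH and D = D and B = B and cc = cc and ?c0.0 = c0 and m = m and b = b and ?m1.0 = m1, OF H0 km m02 kn(3) M1 bad2[unfolded q_def] ws])
  show "S R : Gr n s" "R <= S R" if "R : Gr n (Suc w)" for R using S[OF that] by blast+
  show "inK H0 R'" if "R : Gr n (Suc w)" "R' : Gr n (Suc w)" "R' <= S R" "R' ~= R" for R R' using S[OF that(1)] that by blast
  show "real (card {R : Gr n (Suc w). W <= S R}) <= cg" if "W : Gr n w" for W by (rule dgS[OF that])
  show "cg > 0" by (rule cg0)
  show "ln (2 * exp 1 * card (Gr n w :: 'a vs set)) <= x" by (rule lnw)
  show "m >= 1" by (rule m)
  show "EX D : ZGr n s. boundary n s (Suc w) D = (%V. m * unit_vec R V) & (SUM S:Gr n s. \<bar>rint (D S)\<bar>) <= c0" if "R : Gr n (Suc w)" for R :: "'a vs" by (rule dec[OF that])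
  show "c0 > 0" by (rule c0)
  show "mcover (n - k) s w m cc B" unfolding cc_def by (rule B)
  show "cc >= 0" by (rule cc0)
  show "b = 2 ^ (CARD('a) ^ s)" using bdef unfolding q_def .
  show "m1 <= card {X : H0. Z <= X}" if "nsub Z" "Z <= nspace n" "card Z < CARD('a) ^ Suc w" for Z using big[OF that(1,2)] that(3) unfolding q_def .
  show "card {X : H0. W <= X} <= cH" if "W : Gr n w" for W by (rule cH[OF that])
  show "(2 ^ b * b) ^ s * (2 ^ (2 * b) * 2) <= m1" "1 + b * (2 ^ (2 * b) * 2) <= m1" "m1 <= m0" unfolding m0 m1 by linarith+
  show "CARD('a) ^ (2 * s) * CARD('a) ^ (2 * b) * CARD('a) ^ (k * m0) < CARD('a) ^ n" using sz1 unfolding q_def .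
  show "J : boundary n s (Suc w) ` ZGr n s" by (rule J)
  show "deg n (Suc w) J W <= D" if "W : Gr n w" for W by (rule DD[OF that])
  show "D >= 0" by (rule D0)
  show "D1 >= 0" by (rule D10)
 qed (rule D1_def D2_def D3_def)+
 then obtain Ph where P: "Ph : ZGr n s" "boundary n s (Suc w) Ph = J" "ALL W:Gr n w. deg n s Ph W <= D1 + D2 + D3" by blast
 have "D1 + D2 + D3 <= (K1 + K2 + K3) * (tht * Q ^ n)" unfolding t_def[symmetric] distrib_right by (intro add_mono D1t D2t D3t)
 then show ?thesis using P by (intro bexI[of _ Ph] conjI ballI) (auto intro: order_trans)
qed

text \<open>The scale is u = n div \<open>DD\<close>, with \<open>DD\<close> large enough for the
  exponents in \<open>main_estimate\<close>. The other conditions there bound a polynomial in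
  \<open>n\<close> by q^u and hold for large \<open>n\<close>.\<close>

lemma main_fixed_dimension:
 fixes s w :: nat
 assumes ws: "Suc w <= s"
 shows "EX C c :: real. C > 0 & c > 0 & (\<forall>\<^sub>F n in sequentially. ALL (tht::real) (J :: 'a::{field,finite} vs => int).
  tht >= real CARD('a) powr (- c * real n) & J : boundary n s (Suc w) ` ZGr n s & bounded_vec n (Suc w) tht J -->
  (EX Ph:ZGr n s. boundary n s (Suc w) Ph = J &
  bounded_vec n (Suc w) (C * tht) (boundary n s (Suc w) (pos_part Ph)) &
  bounded_vec n (Suc w) (C * tht) (boundary n s (Suc w) (neg_part Ph))))"
proof -
 let ?q = "CARD('a)" and ?Q = "real CARD('a)"
 have Q2: "?Q >= 2"
 proof -
  have "real 2 <= ?Q" using card_field_ge2[where 'a='a] by (simp only: of_nat_le_iff)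
  then show ?thesis by simp
 qed
 obtain m :: int and c0 :: real where m: "m >= 1" and c0: "c0 > 0"
  and dec: "!!n (R :: 'a vs). Suc w + s <= n ==> R : Gr n (Suc w) ==>
  EX D : ZGr n s. boundary n s (Suc w) D = (%V. m * unit_vec R V) & (SUM S:Gr n s. \<bar>rint (D S)\<bar>) <= c0" using decode[OF ws, where 'a='a] by blast
 have mp: "m > 0" using m by simp
 obtain cL :: real where cL: "cL > 0" and mc: "!!d. 2 * s < d ==> EX B :: 'a vs set. mcover d s w m (cL * real d * ?Q ^ d) B"
  by (rule mod_cover[OF mp ws, where 'a='a]) (unfold mcover_def, blast)
 define b where "b = (2::nat) ^ (?q ^ s)"
 define m1 where "m1 = (2 ^ b * b) ^ s * (2 ^ (2 * b) * 2) + (1 + b * (2 ^ (2 * b) * 2)) + 2 * b"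
 define m0 where "m0 = m1 + 2"
 define ka where "ka = kap ?q s ^ s"
 define G0 where "G0 = 2 * (real b * real ((?q ^ w) ^ w) * (8 * ka * (1 + 2 * ka)) ^ b * 2 ^ s) + 1"
 define K1 where "K1 = 2 * rint m * G0 + 8 * (csym ?q s * real b) + rint m"
 define K2 where "K2 = (1 + 2 * ka) * rint m * cL"
 define K3 where "K3 = 2 * (csym ?q s * (real b * c0) * (2 + real b * K1 + real b * K2)) + c0"
 define DD where "DD = m0 * (16 * w + 30) + 2 * s + 2 * b + 20"
 have kap1: "ka >= 1" unfolding ka_def by (rule one_le_power, rule kap_ge1) (use card_field_ge2[where 'a='a] in simp)
 have b1: "real b >= 1" unfolding b_def by simp
 have cs0: "csym ?q s >= 0" unfolding csym_def using kap_ge1[of ?q s] card_field_ge2[where 'a='a] by simp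
 have mr: "rint m >= 1" using m by simp
 have G01: "G0 >= 1" unfolding G0_def using kap1 by simp
 have K10: "K1 > 0" unfolding K1_def using mr G01 cs0 by (intro add_nonneg_pos add_nonneg_nonneg mult_nonneg_nonneg) auto
 have K20: "K2 > 0" unfolding K2_def using mr cL kap1 by (intro mult_pos_pos) auto
 have K30: "K3 > 0" unfolding K3_def using cs0 c0 K10 K20 by (intro add_nonneg_pos mult_nonneg_nonneg add_nonneg_nonneg) auto
 \<comment> \<open>The factor \<open>b\<close> is lost on the way back from degrees to
   boundedness.\<close>
 define C where "C = real b * (K1 + K2 + K3)"
 \<comment> \<open>For u = n div \<open>DD\<close> >= 1 one has n <= \<open>DD\<close> (u + 1) <= 2
   \<open>DD\<close> u, so c n <= u and theta >= q^(-cn) gives theta q^u >= 1.\<close>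
 define c where "c = 1 / (2 * real DD)"
 have DD0: "DD > 0" unfolding DD_def by simp
 have C0: "C > 0" unfolding C_def using b1 K10 K20 K30 by (intro mult_pos_pos) auto
 have c00: "c > 0" unfolding c_def using DD0 by simp
 \<comment> \<open>Conditions on \<open>n\<close> are stated in terms of \<open>u\<close> through n
   <= \<open>DD\<close> (u + 1), and with 2^u in place of the larger q^u.\<close>
 have "eventually (%u. u >= 1 & 2 + real w + real DD * real w * ?Q * real (Suc u) <= 2 ^ u & 4 * ka + 0 * real (Suc u) <= 2 ^ u &
  real m1 * (4 * ka) + 0 * real (Suc u) <= 2 ^ u & 0 + real DD * real (Suc u) <= 2 ^ u & 0 + real DD * real s * ?Q * real (Suc u) <= 2 ^ u) sequentially"
  by (intro eventually_conj eventually_ge_at_top eventually_poly_exp)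
 then obtain u0 where u0: "!!u. u >= u0 ==> u >= 1 & 2 + real w + real DD * real w * ?Q * real (Suc u) <= 2 ^ u & 4 * ka + 0 * real (Suc u) <= 2 ^ u &
  real m1 * (4 * ka) + 0 * real (Suc u) <= 2 ^ u & 0 + real DD * real (Suc u) <= 2 ^ u & 0 + real DD * real s * ?Q * real (Suc u) <= 2 ^ u"
  unfolding eventually_sequentially by blast
 have "\<forall>\<^sub>F n in sequentially. ALL (tht::real) (J :: 'a vs => int).
  tht >= ?Q powr (- c * real n) & J : boundary n s (Suc w) ` ZGr n s & bounded_vec n (Suc w) tht J -->
  (EX Ph:ZGr n s. boundary n s (Suc w) Ph = J &
  bounded_vec n (Suc w) (C * tht) (boundary n s (Suc w) (pos_part Ph)) &
  bounded_vec n (Suc w) (C * tht) (boundary n s (Suc w) (neg_part Ph)))" unfolding eventually_sequentially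
 proof (intro exI[of _ "DD * u0"] allI impI, elim conjE)
  fix n and tht :: real and J :: "'a vs => int"
  assume n: "DD * u0 <= n" and th: "tht >= ?Q powr (- c * real n)" and J: "J : boundary n s (Suc w) ` ZGr n s" "bounded_vec n (Suc w) tht J"
  define u where "u = n div DD"
  have uu0: "u >= u0" unfolding u_def using n DD0 by (simp add: less_eq_div_iff_mult_less_eq mult.commute)
  note E = u0[OF uu0]
  have u1: "u >= 1" using E by blast
  have un: "DD * u <= n" unfolding u_def by simp
  have nu: "n <= DD * Suc u"
  proof -
  have "n = DD * u + n mod DD" unfolding u_def by simp
  moreover have "n mod DD < DD" using DD0 by simp
  ultimately show ?thesis by simp
  qed
  have nur: "real n <= real DD * real (Suc u)" using nu by (metis of_nat_le_iff of_nat_mult)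
  have pw: "2 ^ u <= ?Q ^ u" by (rule power_mono[OF Q2]) simp
  have thu: "tht * ?Q ^ u >= 1"
  proof -
  have "Suc u <= 2 * u" using u1 by simp
  then have "n <= DD * (2 * u)" using nu mult_le_mono2[of "Suc u" "2 * u" DD] by linarith
  then have "real n <= real (DD * (2 * u))" by (simp only: of_nat_le_iff)
  also have "real (DD * (2 * u)) = real u * (2 * real DD)" by simp
  finally have nn: "real n <= real u * (2 * real DD)" .
  have dd: "0 < 2 * real DD" using DD0 by simp
  have "real n / (2 * real DD) <= real u" unfolding pos_divide_le_eq[OF dd] by (rule nn)
  then have "c * real n <= real u" unfolding c_def by simp
  then have "- real u <= - c * real n" by (simp only: minus_mult_left[symmetric] neg_le_iff_le)
  moreover have "1 <= ?Q" using Q2 by linarith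
  ultimately have "?Q powr (- real u) <= ?Q powr (- c * real n)" by (rule powr_mono)
  then have "?Q powr (- real u) <= tht" using th by linarith
  then have "?Q powr (- real u) * ?Q ^ u <= tht * ?Q ^ u" using Q2 by (intro mult_right_mono) auto
  moreover have "?Q powr (- real u) * ?Q ^ u = 1" using Q2 by (simp add: powr_minus powr_realpow)
  ultimately show ?thesis by simp
  qed
  have sn: "Suc w + s <= n"
  proof -
  have "2 * s <= DD" unfolding DD_def by simp
  then have "Suc w + s <= DD * 1" using ws by simp
  also have "... <= DD * u" by (rule mult_le_mono2[OF u1])
  also have "... <= n" by (rule un)
  finally show ?thesis .
  qed
  have Qp: "?Q >= 0" by simp
  have e1: "2 + real w + real n * real w * ?Q <= ?Q ^ u"
  proof -
  have "real n * (real w * ?Q) <= real DD * real (Suc u) * (real w * ?Q)" by (rule mult_right_mono[OF nur]) simp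
  moreover have "real DD * real (Suc u) * (real w * ?Q) = real DD * real w * ?Q * real (Suc u)" by (simp only: mult_ac)
  moreover have "real n * (real w * ?Q) = real n * real w * ?Q" by (simp only: mult.assoc)
  ultimately show ?thesis using E pw by linarith
  qed
  have e2: "real n * real s * ?Q <= ?Q ^ u"
  proof -
  have "real n * (real s * ?Q) <= real DD * real (Suc u) * (real s * ?Q)" by (rule mult_right_mono[OF nur]) simp
  moreover have "real DD * real (Suc u) * (real s * ?Q) = real DD * real s * ?Q * real (Suc u)" by (simp only: mult_ac)
  moreover have "real n * (real s * ?Q) = real n * real s * ?Q" by (simp only: mult.assoc)
  ultimately show ?thesis using E pw by linarith
  qed
  have e3: "4 * ka <= ?Q ^ u" "real m1 * (4 * ka) <= ?Q ^ u" "real n <= ?Q ^ u" using E pw nur by linarith+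
  have "EX Ph:ZGr n s. boundary n s (Suc w) Ph = J & (ALL W:Gr n w. deg n s Ph W <= (K1 + K2 + K3) * (tht * ?Q ^ n))"
  by (rule main_estimate[OF ws b_def m1_def m0_def ka_def u1 un[unfolded DD_def] e1 e3(1,2,3) e2 m c0 dec[OF sn] cL mc G0_def K1_def K2_def K3_def thu J])
  then obtain Ph where P: "Ph : ZGr n s" "boundary n s (Suc w) Ph = J" "!!W. W : Gr n w ==> deg n s Ph W <= (K1 + K2 + K3) * (tht * ?Q ^ n)" by blast
  have th0: "tht >= 0"
  proof -
  have "?Q powr (- c * real n) >= 0" by simp
  then show ?thesis using th by linarith
  qed
  have Dn: "(K1 + K2 + K3) * (tht * ?Q ^ n) >= 0" using K10 K20 K30 th0 by simp
  have fin: "2 ^ (?q ^ s) * ((K1 + K2 + K3) * (tht * ?Q ^ n)) <= C * tht * ?Q ^ n"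
  proof -
  have "(2::real) ^ (?q ^ s) = real b" unfolding b_def by simp
  then show ?thesis unfolding C_def by (simp only: mult.assoc order_refl)
  qed
  have bv: "bounded_vec n (Suc w) (C * tht) (boundary n s (Suc w) g)" if "!!S. \<bar>g S\<bar> <= \<bar>Ph S\<bar>" for g
  by (rule bounded_vec_of_deg[OF that _ Dn fin]) (use P(3) in simp)
  have "bounded_vec n (Suc w) (C * tht) (boundary n s (Suc w) (pos_part Ph))" by (rule bv) (simp add: pos_part_def)
  moreover have "bounded_vec n (Suc w) (C * tht) (boundary n s (Suc w) (neg_part Ph))" by (rule bv) (simp add: neg_part_def)
  ultimately show "EX Ph:ZGr n s. boundary n s (Suc w) Ph = J &
  bounded_vec n (Suc w) (C * tht) (boundary n s (Suc w) (pos_part Ph)) &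
  bounded_vec n (Suc w) (C * tht) (boundary n s (Suc w) (neg_part Ph))" using P(1,2) by blast
 qed
 then show ?thesis using C0 c00 by (intro exI[of _ C] exI[of _ c] conjI)
qed

text \<open>For fixed q and s only finitely many r occur, so a maximum of the \<open>C\<close> and a
  minimum of the \<open>c\<close> make both constants independent of r.\<close>

theorem theorem5p2:
  fixes q s :: nat
  assumes "primepow q"
    and "CARD('a::{field,finite}) = q"
  shows "\<exists>C c :: real. C > 0 \<and> c > 0 \<and>
    (\<forall>r. 1 \<le> r \<and> r < s \<longrightarrow>
      (\<forall>\<^sub>F n in sequentially.
        \<forall>(\<theta>::real) (J :: (nat \<Rightarrow> 'a) set \<Rightarrow> int).
          \<theta> \<ge> real q powr (- c * real n) \<and>
          J \<in> boundary n s r ` ZGr n s \<and>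
          bounded_vec n r \<theta> J \<longrightarrow>
          (\<exists>\<Phi> \<in> ZGr n s.
             boundary n s r \<Phi> = J \<and>
             bounded_vec n r (C * \<theta>) (boundary n s r (pos_part \<Phi>)) \<and>
             bounded_vec n r (C * \<theta>) (boundary n s r (neg_part \<Phi>)))))"
proof -
 let ?Q = "real CARD('a)"
 define good where "good r C c n \<longleftrightarrow> (ALL (tht::real) (J :: 'a vs => int).
  tht >= ?Q powr (- c * real n) & J : boundary n s r ` ZGr n s & bounded_vec n r tht J -->
  (EX Ph:ZGr n s. boundary n s r Ph = J & bounded_vec n r (C * tht) (boundary n s r (pos_part Ph)) &
  bounded_vec n r (C * tht) (boundary n s r (neg_part Ph))))" for r n and C c :: real
 have "ALL w:{..<s}. EX p :: real \<times> real. fst p > 0 & snd p > 0 & (\<forall>\<^sub>F n in sequentially. good (Suc w) (fst p) (snd p) n)"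
 proof
  fix w assume "w : {..<s}"
  then have "Suc w <= s" by simp
  from main_fixed_dimension[OF this, where 'a='a] obtain C c :: real
  where "C > 0 & c > 0 & (\<forall>\<^sub>F n in sequentially. good (Suc w) C c n)" unfolding good_def by blast
  then show "EX p :: real \<times> real. fst p > 0 & snd p > 0 & (\<forall>\<^sub>F n in sequentially. good (Suc w) (fst p) (snd p) n)" by (intro exI[of _ "(C, c)"]) simp
 qed
 from bchoice[OF this] obtain p where p: "ALL w:{..<s}. fst (p w) > (0::real) & snd (p w) > (0::real) & (\<forall>\<^sub>F n in sequentially. good (Suc w) (fst (p w)) (snd (p w)) n)" ..
 \<comment> \<open>The inserted 1 keeps both sets nonempty when \<open>s = 0\<close>.\<close>
 define C where "C = Max (insert 1 ((%w. fst (p w)) ` {..<s}))"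
 define c where "c = Min (insert 1 ((%w. snd (p w)) ` {..<s}))"
 have Cw: "fst (p w) <= C" and cw: "c <= snd (p w)" if "w < s" for w unfolding C_def c_def using that by (auto intro!: Max_ge Min_le)
 have "1 <= C" unfolding C_def by (rule Max_ge) auto
 then have C0: "C > 0" by linarith
 have c0: "c > 0" unfolding c_def using p by (subst Min_gr_iff) auto
 have Q1: "?Q > 1" using card_field_ge2[where 'a='a] by linarith
 have "\<forall>\<^sub>F n in sequentially. good r C c n" if r: "1 <= r" "r < s" for r
 proof -
  obtain w where w: "r = Suc w" using r(1) by (cases r) auto
  have ws: "w < s" using r(2) w by simp
  then have "\<forall>\<^sub>F n in sequentially. good (Suc w) (fst (p w)) (snd (p w)) n" using p by blast
  then show ?thesis
  proof (rule eventually_mono)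
  fix n assume g: "good (Suc w) (fst (p w)) (snd (p w)) n"
  show "good r C c n" unfolding good_def w
  proof (intro allI impI, elim conjE)
  fix tht :: real and J :: "'a vs => int"
  assume th: "tht >= ?Q powr (- c * real n)" and J: "J : boundary n s (Suc w) ` ZGr n s" "bounded_vec n (Suc w) tht J"
  have "c * real n <= snd (p w) * real n" by (rule mult_right_mono[OF cw[OF ws]]) simp
  then have "?Q powr (- snd (p w) * real n) <= ?Q powr (- c * real n)" using Q1 by (intro powr_mono) auto
  then have th': "tht >= ?Q powr (- snd (p w) * real n)" using th by linarith
  have "?Q powr (- c * real n) >= 0" by simp
  then have "tht >= 0" using th by linarith
  then have le: "fst (p w) * tht <= C * tht" by (rule mult_right_mono[OF Cw[OF ws]])
  obtain Ph where "Ph : ZGr n s" "boundary n s (Suc w) Ph = J"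
  "bounded_vec n (Suc w) (fst (p w) * tht) (boundary n s (Suc w) (pos_part Ph))"
  "bounded_vec n (Suc w) (fst (p w) * tht) (boundary n s (Suc w) (neg_part Ph))" using g th' J unfolding good_def by blast
  then show "EX Ph:ZGr n s. boundary n s (Suc w) Ph = J & bounded_vec n (Suc w) (C * tht) (boundary n s (Suc w) (pos_part Ph)) &
  bounded_vec n (Suc w) (C * tht) (boundary n s (Suc w) (neg_part Ph))" using bounded_vec_mono[OF _ le] by blast
  qed
  qed
 qed
 then show ?thesis using C0 c0 unfolding good_def assms(2) by (intro exI[of _ C] exI[of _ c] conjI allI impI) auto
qed

end
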